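(* Let $\gamma\ge 0$ and let $u_\varepsilon\in L^p(\Omega\times\varepsilon\mathbb Z^d)$ (a sequence indexed by $\varepsilon\to0$) satisfy $$\limsup_{\varepsilon\to0}\Big\langle\int_{\varepsilon\mathbb Z^d}|u_\varepsilon(\omega,x)|^p+\varepsilon^{\gamma p}|\nabla^\varepsilon u_\varepsilon(\omega,x)|^p\,dm_\varepsilon(x)\Big\rangle<\infty .$$ (i) If $\gamma=0$, there exist $U\in L^p_{\mathsf{inv}}(\Omega)\otimes W^{1,p}(\mathbb R^d)$ and $\chi\in\mathbf L^p_{\mathsf{pot}}(\Omega)\otimes L^p(\mathbb R^d)$ such that, up to a subsequence, $u_\varepsilon\overset{2}{\rightharpoonup}U$ in $L^p(\Omega\times\mathbb R^d)$ and $\nabla^\varepsilon u_\varepsilon\overset{2}{\rightharpoonup}\nabla U+\chi$ in $L^p(\Omega\times\mathbb R^d)^d$. (ii) If $\gamma\in(0,1)$, there exist $U\in L^p_{\mathsf{inv}}(\Omega)\otimes L^p(\mathbb R^d)$ and $\chi\in\mathbf L^p_{\mathsf{pot}}(\Omega)\otimes L^p(\mathbb R^d)$ such that, up to a subsequence, $u_\varepsilon\overset{2}{\rightharpoonup}U$ in $L^p(\Omega\times\mathbb R^d)$ and $\varepsilon^\gamma\nabla^\varepsilon u_\varepsilon\overset{2}{\rightharpoonup}\chi$ in $L^p(\Omega\times\mathbb R^d)^d$. (iii) If $\gamma=1$, there exists $U\in L^p(\Omega\times\mathbb R^d)$ such that, up to a subsequence, $u_\varepsilon\overset{2}{\rightharpoonup}U$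 in $L^p(\Omega\times\mathbb R^d)$ and $\varepsilon\nabla^\varepsilon u_\varepsilon\overset{2}{\rightharpoonup}DU$ in $L^p(\Omega\times\mathbb R^d)^d$. (iv) If $\gamma>1$, there exists $U\in L^p(\Omega\times\mathbb R^d)$ such that, up to a subsequence, $u_\varepsilon\overset{2}{\rightharpoonup}U$ in $L^p(\Omega\times\mathbb R^d)$ and $\varepsilon^\gamma\nabla^\varepsilon u_\varepsilon\overset{2}{\rightharpoonup}0$ in $L^p(\Omega\times\mathbb R^d)^d$.
   Context: Probability setting: $p,q\in(1,\infty)$ with $\frac1p+\frac1q=1$. $(\Omega,\mathcal F,P)$ is a probability space which is a separable measure space (so $L^p(\Omega)$ is separable), $\langle\cdot\rangle$ denotes expectation, and $(T_x)_{x\in\mathbb Z^d}$ is a measure preserving dynamical system: each $T_x:\Omega\to\Omega$ is measurable, $T_0=\mathrm{Id}$, $T_{x+y}=T_x\circ T_y$, and $P(T_xA)=P(A)$ for all $A\in\mathcal F$, $x,y\in\mathbb Z^d$. $e_1,\dots,e_d$ is the standard basis of $\mathbb R^d$. For $\varphi:\Omega\to\mathbb R$, $D_i\varphi(\omega)=\varphi(T_{e_i}\omega)-\varphi(\omega)$ and $D\varphi=(D_1\varphi,\dots,D_d\varphi)$ (acting in the $\omega$-variable on random fields). $L^p_{\mathsf{inv}}(\Omega)=\{\varphi\in L^p(\Omega):\varphi(T_x\omega)=\varphi(\omega)\ \forall x\in\mathbb Z^d,\text{ a.e. }\omega\}$; $\mathbf L^p_{\mathsf{pot}}(\Omega)$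 is the closure of $\{D\varphi:\varphi\in L^p(\Omega)\}$ in $L^p(\Omega)^d$. Discrete setting: for $\varepsilon>0$, $m_\varepsilon=\varepsilon^d\sum_{x\in\varepsilon\mathbb Z^d}\delta_x$, so $\int_{\varepsilon\mathbb Z^d}u\,dm_\varepsilon=\varepsilon^d\sum_{x\in\varepsilon\mathbb Z^d}u(x)$; $L^p(\varepsilon\mathbb Z^d)$ and $L^p(\Omega\times\varepsilon\mathbb Z^d)$ are the $L^p$-spaces for $m_\varepsilon$ and $P\otimes m_\varepsilon$. $\nabla^\varepsilon u=(\nabla^\varepsilon_1u,\dots,\nabla^\varepsilon_du)$ with $\nabla^\varepsilon_iu(x)=\frac{u(x+\varepsilon e_i)-u(x)}{\varepsilon}$ (acting in $x$). Tensor products: for linear subspaces $X$ of $L^p(\Omega)$ (or $L^p(\Omega)^d$) and $Y$ of $L^p(\mathbb R^d)$ (resp. $L^p(\varepsilon\mathbb Z^d)$), $X\otimes Y$ is the closure of the linear span of $\{\varphi\eta:\varphi\in X,\eta\in Y\}$ in $L^p(\Omega\times\mathbb R^d)$ (resp. $L^p(\Omega\times\varepsilon\mathbb Z^d)$), or its $d$-vector version; if $Y\subset W^{1,p}(\mathbb R^d)$ is a Sobolev space the closure is taken in $L^p(\Omega,W^{1,p}(\mathbb R^d))$. $\nabla U$ is the weak gradient in $x$. Unfolding: with $\Box=[-\frac12,\frac12)^d$, $\overline u(x)=u(\lfloor x\rfloor_\varepsilon)$ is the piecewise-constant interpolation of $u:\varepsilon\mathbb Z^d\to\mathbb R$, where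 $\lfloor x\rfloor_\varepsilon\in\varepsilon\mathbb Z^d$ is defined by $x-\lfloor x\rfloor_\varepsilon\in\varepsilon\Box$. $(\widetilde{\mathcal T}_\varepsilon u)(\omega,x)=u(T_{-x/\varepsilon}\omega,x)$ for $x\in\varepsilon\mathbb Z^d$, and $\mathcal T_\varepsilon u=\overline{\widetilde{\mathcal T}_\varepsilon u}$ (interpolation in $x$), a linear isometry $L^p(\Omega\times\varepsilon\mathbb Z^d)\to L^p(\Omega\times\mathbb R^d)$. $u_\varepsilon\overset{2}{\rightharpoonup}U$ (resp. $u_\varepsilon\overset{2}{\to}U$) in $L^p(\Omega\times\mathbb R^d)$ means $\mathcal T_\varepsilon u_\varepsilon\to U$ weakly (resp. strongly) in $L^p(\Omega\times\mathbb R^d)$ as $\varepsilon\to0$, componentwise for vector-valued functions. *)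

theory Defs
  imports "HOL-Probability.Probability"
begin

text \<open>
  Throughout, \<open>real ^ 'd\<close> is the Euclidean space and \<open>int ^ 'd\<close> the group acting on the
  probability space. Elements of Lebesgue and Sobolev spaces are represented by measurable
  functions; all notions below are invariant under changes on null sets. Random fields are
  functions of pairs \<open>(\<omega>, x)\<close>.
\<close>

section \<open>Lebesgue spaces\<close>

definition Lp :: "real \<Rightarrow> 'a measure \<Rightarrow> ('a \<Rightarrow> 'b::euclidean_space) set" where
  "Lp p M = {f \<in> borel_measurable M. integrable M (\<lambda>x. norm (f x) powr p)}"

definition Lp_norm :: "real \<Rightarrow> 'a measure \<Rightarrow> ('a \<Rightarrow> 'b::euclidean_space) \<Rightarrow> real" where
  "Lp_norm p M f = (LINT x|M. norm (f x) powr p) powr (1 / p)"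

definition Lp_closure ::
    "real \<Rightarrow> 'a measure \<Rightarrow> ('a \<Rightarrow> 'b::euclidean_space) set \<Rightarrow> ('a \<Rightarrow> 'b) set" where
  "Lp_closure p M S = {f \<in> Lp p M. \<forall>e>0. \<exists>g\<in>S \<inter> Lp p M. Lp_norm p M (\<lambda>x. f x - g x) < e}"

text \<open>
  Bounded linear functionals. The values of \<open>\<Lambda>\<close> outside \<open>Lp p M\<close> are irrelevant, and the bound
  forces \<open>\<Lambda>\<close> to agree on functions that coincide almost everywhere.
\<close>

definition Lp_dual :: "real \<Rightarrow> 'a measure \<Rightarrow> (('a \<Rightarrow> real) \<Rightarrow> real) set" where
  "Lp_dual p M = {\<Lambda>.
     (\<forall>f\<in>Lp p M. \<forall>g\<in>Lp p M. \<forall>a b. \<Lambda> (\<lambda>x. a * f x + b * g x) = a * \<Lambda> f + b * \<Lambda> g) \<and>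
     (\<exists>C. \<forall>f\<in>Lp p M. \<bar>\<Lambda> f\<bar> \<le> C * Lp_norm p M f)}"

definition Lp_weak_conv ::
    "real \<Rightarrow> 'a measure \<Rightarrow> (nat \<Rightarrow> 'a \<Rightarrow> real) \<Rightarrow> ('a \<Rightarrow> real) \<Rightarrow> bool" where
  "Lp_weak_conv p M f g \<longleftrightarrow>
     (\<forall>n. f n \<in> Lp p M) \<and> g \<in> Lp p M \<and> (\<forall>\<Lambda>\<in>Lp_dual p M. (\<lambda>n. \<Lambda> (f n)) \<longlonglongrightarrow> \<Lambda> g)"


section \<open>Weak gradients and Sobolev spaces\<close>

primrec C_k :: "nat \<Rightarrow> (real ^ 'd \<Rightarrow> real) \<Rightarrow> bool" where
  "C_k 0 f \<longleftrightarrow> continuous_on UNIV f"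
| "C_k (Suc k) f \<longleftrightarrow>
     (\<forall>x. f differentiable (at x)) \<and> (\<forall>i. C_k k (\<lambda>x. frechet_derivative f (at x) (axis i 1)))"

definition test_function :: "(real ^ 'd \<Rightarrow> real) \<Rightarrow> bool" where
  "test_function \<psi> \<longleftrightarrow> (\<forall>k. C_k k \<psi>) \<and> compact (closure {x. \<psi> x \<noteq> 0})"

definition loc_integrable :: "(real ^ 'd \<Rightarrow> 'b::euclidean_space) \<Rightarrow> bool" where
  "loc_integrable f \<longleftrightarrow> (\<forall>K. compact K \<longrightarrow> set_integrable lborel K f)"

definition weak_gradient :: "(real ^ 'd \<Rightarrow> real) \<Rightarrow> (real ^ 'd \<Rightarrow> real ^ 'd) \<Rightarrow> bool" where
  "weak_gradient f g \<longleftrightarrow> loc_integrable f \<and> loc_integrable g \<and>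
     (\<forall>\<psi> i. test_function \<psi> \<longrightarrow>
        (LINT x|lborel. f x * frechet_derivative \<psi> (at x) (axis i 1)) =
        - (LINT x|lborel. (g x $ i) * \<psi> x))"

definition W1p :: "real \<Rightarrow> (real ^ 'd \<Rightarrow> real) set" where
  "W1p p = {f \<in> Lp p lborel. \<exists>g\<in>Lp p lborel. weak_gradient f g}"

text \<open>
  \<open>weak_gradient_x p P U G\<close>: \<open>G\<close> is a jointly measurable, \<open>p\<close>-integrable version of the weak
  gradient of \<open>U\<close> in the spatial variable. It is determined by \<open>U\<close> up to null sets, and
  the Bochner space of \<open>p\<close>-integrable maps into \<open>W1p p\<close> consists of the \<open>p\<close>-integrable
  fields \<open>U\<close> that admit such a \<open>G\<close>.
\<close>

definition weak_gradient_x ::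
    "real \<Rightarrow> 'w measure \<Rightarrow> ('w \<times> (real ^ 'd) \<Rightarrow> real) \<Rightarrow> ('w \<times> (real ^ 'd) \<Rightarrow> real ^ 'd) \<Rightarrow> bool" where
  "weak_gradient_x p P U G \<longleftrightarrow> G \<in> Lp p (P \<Otimes>\<^sub>M lborel) \<and>
     (AE \<omega> in P. weak_gradient (\<lambda>x. U (\<omega>, x)) (\<lambda>x. G (\<omega>, x)))"

definition Lp_W1p :: "real \<Rightarrow> 'w measure \<Rightarrow> ('w \<times> (real ^ 'd) \<Rightarrow> real) set" where
  "Lp_W1p p P = {U \<in> Lp p (P \<Otimes>\<^sub>M lborel). \<exists>G. weak_gradient_x p P U G}"

definition Lp_W1p_closure ::
    "real \<Rightarrow> 'w measure \<Rightarrow> ('w \<times> (real ^ 'd) \<Rightarrow> real) set \<Rightarrow> ('w \<times> (real ^ 'd) \<Rightarrow> real) set" where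
  "Lp_W1p_closure p P S = {U \<in> Lp_W1p p P. \<forall>e>0. \<exists>V\<in>S \<inter> Lp_W1p p P. \<exists>G.
     weak_gradient_x p P (\<lambda>z. U z - V z) G \<and>
     Lp_norm p (P \<Otimes>\<^sub>M lborel) (\<lambda>z. U z - V z) + Lp_norm p (P \<Otimes>\<^sub>M lborel) G < e}"


section \<open>Tensor products\<close>

definition tensor_span ::
    "('w \<Rightarrow> 'b::euclidean_space) set \<Rightarrow> ('x \<Rightarrow> real) set \<Rightarrow> ('w \<times> 'x \<Rightarrow> 'b) set" where
  "tensor_span X Y = {f. \<exists>(n::nat) c \<phi> \<eta>. (\<forall>k<n. \<phi> k \<in> X \<and> \<eta> k \<in> Y) \<and>
     f = (\<lambda>(\<omega>, x). \<Sum>k<n. c k *\<^sub>R (\<eta> k x *\<^sub>R \<phi> k \<omega>))}"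

definition tensor_Lp ::
    "real \<Rightarrow> 'w measure \<Rightarrow> ('w \<Rightarrow> 'b::euclidean_space) set \<Rightarrow> (real ^ 'd \<Rightarrow> real) set
      \<Rightarrow> ('w \<times> (real ^ 'd) \<Rightarrow> 'b) set" where
  "tensor_Lp p P X Y = Lp_closure p (P \<Otimes>\<^sub>M lborel) (tensor_span X Y)"

definition tensor_W1p ::
    "real \<Rightarrow> 'w measure \<Rightarrow> ('w \<Rightarrow> real) set \<Rightarrow> (real ^ 'd \<Rightarrow> real) set
      \<Rightarrow> ('w \<times> (real ^ 'd) \<Rightarrow> real) set" where
  "tensor_W1p p P X Y = Lp_W1p_closure p P (tensor_span X Y)"


section \<open>Measure preserving dynamical systems\<close>

definition separable_measure :: "'w measure \<Rightarrow> bool" where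
  "separable_measure P \<longleftrightarrow> (\<exists>\<C>. countable \<C> \<and> \<C> \<subseteq> sets P \<and>
     (\<forall>A\<in>sets P. \<forall>e>0. \<exists>B\<in>\<C>. measure P ((A - B) \<union> (B - A)) < e))"

locale dynamical_system = prob_space P
  for P :: "'w measure" and T :: "int ^ 'd \<Rightarrow> 'w \<Rightarrow> 'w" +
  assumes separable: "separable_measure P"
    and T_measurable: "T x \<in> measurable P P"
    and T_zero: "\<omega> \<in> space P \<Longrightarrow> T 0 \<omega> = \<omega>"
    and T_add: "\<omega> \<in> space P \<Longrightarrow> T (x + y) \<omega> = T x (T y \<omega>)"
    and T_preserving: "A \<in> sets P \<Longrightarrow> emeasure P (T x ` A) = emeasure P A"

definition hdiff :: "(int ^ 'd \<Rightarrow> 'w \<Rightarrow> 'w) \<Rightarrow> ('w \<Rightarrow> real) \<Rightarrow> 'w \<Rightarrow> real ^ 'd" where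
  "hdiff T \<phi> \<omega> = (\<chi> i. \<phi> (T (axis i 1) \<omega>) - \<phi> \<omega>)"

definition hdiff_field ::
    "(int ^ 'd \<Rightarrow> 'w \<Rightarrow> 'w) \<Rightarrow> ('w \<times> (real ^ 'd) \<Rightarrow> real) \<Rightarrow> 'w \<times> (real ^ 'd) \<Rightarrow> real ^ 'd" where
  "hdiff_field T U = (\<lambda>(\<omega>, x). hdiff T (\<lambda>\<omega>'. U (\<omega>', x)) \<omega>)"

definition Lp_inv :: "real \<Rightarrow> 'w measure \<Rightarrow> (int ^ 'd \<Rightarrow> 'w \<Rightarrow> 'w) \<Rightarrow> ('w \<Rightarrow> real) set" where
  "Lp_inv p P T = {\<phi> \<in> Lp p P. \<forall>x. AE \<omega> in P. \<phi> (T x \<omega>) = \<phi> \<omega>}"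

definition Lp_pot :: "real \<Rightarrow> 'w measure \<Rightarrow> (int ^ 'd \<Rightarrow> 'w \<Rightarrow> 'w) \<Rightarrow> ('w \<Rightarrow> real ^ 'd) set" where
  "Lp_pot p P T = Lp_closure p P (hdiff T ` Lp p P)"


section \<open>The scaled lattice\<close>

definition lattice_point :: "real \<Rightarrow> int ^ 'd \<Rightarrow> real ^ 'd" where
  "lattice_point \<epsilon> k = (\<chi> i. \<epsilon> * of_int (k $ i))"

definition eps_lattice :: "real \<Rightarrow> (real ^ 'd) set" where
  "eps_lattice \<epsilon> = range (lattice_point \<epsilon>)"

definition lattice_measure :: "real \<Rightarrow> (real ^ 'd) measure" where
  "lattice_measure \<epsilon> = scale_measure (ennreal (\<epsilon> ^ CARD('d))) (count_space (eps_lattice \<epsilon>))"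

definition discrete_gradient ::
    "real \<Rightarrow> ('w \<times> (real ^ 'd) \<Rightarrow> real) \<Rightarrow> 'w \<times> (real ^ 'd) \<Rightarrow> real ^ 'd" where
  "discrete_gradient \<epsilon> u = (\<lambda>(\<omega>, x). \<chi> i. (u (\<omega>, x + \<epsilon> *\<^sub>R axis i 1) - u (\<omega>, x)) / \<epsilon>)"

text \<open>
  Since \<open>round t = \<lfloor>t + 1/2\<rfloor>\<close>, \<open>lattice_index \<epsilon> x\<close> is the index of the lattice cell containing
  \<open>x\<close> (see \<open>lattice_floor_unique\<close>), and \<open>x / \<epsilon>\<close> if \<open>x\<close> is itself a lattice point
  (see \<open>lattice_index_lattice_point\<close>).
\<close>

definition lattice_index :: "real \<Rightarrow> real ^ 'd \<Rightarrow> int ^ 'd" where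
  "lattice_index \<epsilon> x = (\<chi> i. round (x $ i / \<epsilon>))"

definition lattice_floor :: "real \<Rightarrow> real ^ 'd \<Rightarrow> real ^ 'd" where
  "lattice_floor \<epsilon> x = lattice_point \<epsilon> (lattice_index \<epsilon> x)"

definition unit_box :: "(real ^ 'd) set" where
  "unit_box = {x. \<forall>i. - 1 / 2 \<le> x $ i \<and> x $ i < 1 / 2}"

lemma lattice_index_lattice_point:
  "0 < \<epsilon> \<Longrightarrow> lattice_index \<epsilon> (lattice_point \<epsilon> k) = k"
  by (simp add: lattice_index_def lattice_point_def vec_eq_iff)

lemma lattice_floor_unique:
  assumes "0 < \<epsilon>"
  shows "y \<in> eps_lattice \<epsilon> \<and> x - y \<in> (\<lambda>z. \<epsilon> *\<^sub>R z) ` unit_box \<longleftrightarrow> y = lattice_floor \<epsilon> x"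
proof -
  have box: "x - y \<in> (\<lambda>z. \<epsilon> *\<^sub>R z) ` unit_box \<longleftrightarrow>
      (\<forall>i. - 1 / 2 \<le> (x $ i - y $ i) / \<epsilon> \<and> (x $ i - y $ i) / \<epsilon> < 1 / 2)" for y
  proof
    assume "x - y \<in> (\<lambda>z. \<epsilon> *\<^sub>R z) ` unit_box"
    then obtain z where z: "x - y = \<epsilon> *\<^sub>R z" "z \<in> unit_box" by auto
    have "(x $ i - y $ i) / \<epsilon> = z $ i" for i
      using assms arg_cong[OF z(1), of "\<lambda>v. v $ i"] by simp
    then show "\<forall>i. - 1 / 2 \<le> (x $ i - y $ i) / \<epsilon> \<and> (x $ i - y $ i) / \<epsilon> < 1 / 2"
      using z(2) by (simp add: unit_box_def)
  next
    assume *: "\<forall>i. - 1 / 2 \<le> (x $ i - y $ i) / \<epsilon> \<and> (x $ i - y $ i) / \<epsilon> < 1 / 2"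
    have "x - y = \<epsilon> *\<^sub>R (\<chi> i. (x $ i - y $ i) / \<epsilon>)"
      using assms by (simp add: vec_eq_iff)
    moreover have "(\<chi> i. (x $ i - y $ i) / \<epsilon>) \<in> unit_box"
      using * by (simp add: unit_box_def)
    ultimately show "x - y \<in> (\<lambda>z. \<epsilon> *\<^sub>R z) ` unit_box" by blast
  qed
  have pt: "(x $ i - lattice_point \<epsilon> k $ i) / \<epsilon> = x $ i / \<epsilon> - of_int (k $ i)" for k i
    using assms by (simp add: lattice_point_def diff_divide_distrib)
  have rnd: "- 1 / 2 \<le> t - of_int m \<and> t - of_int m < 1 / 2 \<longleftrightarrow> m = round t" for t :: real and m
    unfolding round_def by linarith
  show ?thesis
  proof
    assume "y \<in> eps_lattice \<epsilon> \<and> x - y \<in> (\<lambda>z. \<epsilon> *\<^sub>R z) ` unit_box"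
    then obtain k where k: "y = lattice_point \<epsilon> k" "x - y \<in> (\<lambda>z. \<epsilon> *\<^sub>R z) ` unit_box"
      by (auto simp: eps_lattice_def)
    then have "k = lattice_index \<epsilon> x"
      unfolding box k(1) pt rnd by (simp add: lattice_index_def vec_eq_iff)
    then show "y = lattice_floor \<epsilon> x" using k(1) by (simp add: lattice_floor_def)
  next
    assume y: "y = lattice_floor \<epsilon> x"
    show "y \<in> eps_lattice \<epsilon> \<and> x - y \<in> (\<lambda>z. \<epsilon> *\<^sub>R z) ` unit_box"
      unfolding box unfolding y lattice_floor_def pt rnd
      by (simp add: lattice_index_def eps_lattice_def)
  qed
qed


section \<open>Unfolding and stochastic two-scale convergence\<close>

definition discrete_unfolding ::
    "(int ^ 'd \<Rightarrow> 'w \<Rightarrow> 'w) \<Rightarrow> real \<Rightarrow> ('w \<times> (real ^ 'd) \<Rightarrow> 'b) \<Rightarrow> 'w \<times> (real ^ 'd) \<Rightarrow> 'b" where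
  "discrete_unfolding T \<epsilon> u = (\<lambda>(\<omega>, x). u (T (- lattice_index \<epsilon> x) \<omega>, x))"

definition interpolation ::
    "real \<Rightarrow> ('w \<times> (real ^ 'd) \<Rightarrow> 'b) \<Rightarrow> 'w \<times> (real ^ 'd) \<Rightarrow> 'b" where
  "interpolation \<epsilon> v = (\<lambda>(\<omega>, x). v (\<omega>, lattice_floor \<epsilon> x))"

definition unfolding_op ::
    "(int ^ 'd \<Rightarrow> 'w \<Rightarrow> 'w) \<Rightarrow> real \<Rightarrow> ('w \<times> (real ^ 'd) \<Rightarrow> 'b) \<Rightarrow> 'w \<times> (real ^ 'd) \<Rightarrow> 'b" where
  "unfolding_op T \<epsilon> u = interpolation \<epsilon> (discrete_unfolding T \<epsilon> u)"

definition two_scale_weak ::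
    "real \<Rightarrow> 'w measure \<Rightarrow> (int ^ 'd \<Rightarrow> 'w \<Rightarrow> 'w) \<Rightarrow> (nat \<Rightarrow> real)
      \<Rightarrow> (nat \<Rightarrow> 'w \<times> (real ^ 'd) \<Rightarrow> real) \<Rightarrow> ('w \<times> (real ^ 'd) \<Rightarrow> real) \<Rightarrow> bool" where
  "two_scale_weak p P T \<epsilon> u U \<longleftrightarrow>
     Lp_weak_conv p (P \<Otimes>\<^sub>M lborel) (\<lambda>n. unfolding_op T (\<epsilon> n) (u n)) U"

definition two_scale_weak_vec ::
    "real \<Rightarrow> 'w measure \<Rightarrow> (int ^ 'd \<Rightarrow> 'w \<Rightarrow> 'w) \<Rightarrow> (nat \<Rightarrow> real)
      \<Rightarrow> (nat \<Rightarrow> 'w \<times> (real ^ 'd) \<Rightarrow> real ^ 'd) \<Rightarrow> ('w \<times> (real ^ 'd) \<Rightarrow> real ^ 'd) \<Rightarrow> bool" where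
  "two_scale_weak_vec p P T \<epsilon> v V \<longleftrightarrow>
     (\<forall>i. two_scale_weak p P T \<epsilon> (\<lambda>n z. v n z $ i) (\<lambda>z. V z $ i))"

end

theory Submission
  imports Defs "HOL-Complex_Analysis.Great_Picard"
begin

text \<open>
  Unfolding turns \<open>u \<epsilon>\<close> into an \<open>L\<^sup>p\<close>-bounded sequence \<open>V\<close> on the fixed space
  \<open>\<Omega> \<times> \<real>\<^sup>d\<close>, and its discrete gradient into the quotient
  \<open>(V (T e\<^sub>i \<omega>, x + \<epsilon> e\<^sub>i) - V (\<omega>, x)) / \<epsilon>\<close>; weak compactness of bounded sets provides limits
  of both along a subsequence. Mollifying in \<open>x\<close> splits the quotient into a part where the
  spatial increment falls onto the kernel, which converges to the mollified gradient of \<open>U\<close>, and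
  the horizontal derivative of a mollified function, which is a potential field. After
  multiplication by \<open>\<epsilon>\<^sup>\<gamma>\<close> the first part vanishes if \<open>\<gamma> > 0\<close>, and since
  norm-closed subspaces are weakly closed, the remaining limit is a potential field. If \<open>\<gamma> < 1\<close>,
  multiplying the quotient by \<open>\<epsilon>\<close> shows that \<open>U\<close> is invariant.

  If \<open>\<gamma> = 0\<close>, mollifying the limit of the quotients and subtracting the gradient \<open>y\<close> of the
  mollified \<open>U\<close> leaves a potential field, whereas \<open>y\<close> is invariant. The duality map of an
  invariant field annihilates the potential fields, so the norm of an invariant field does not
  exceed that of its sum with a potential one. Hence the \<open>y\<close> form a Cauchy sequence as the
  mollification is removed, which yields the weak gradient of \<open>U\<close>.
\<close>


section \<open>Lebesgue spaces\<close>

text \<open>The unfolded functions are piecewise constant in x, and the horizontal increment alone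
  carries the factor \<open>1 / \<epsilon>\<close>, so the hypothesis does not bound the two
  increments of the quotient separately. After mollification the spatial part converges, and the
  horizontal part converges weakly as the remainder; its possibly diverging factor is harmless
  because potential fields form a linear space. The limit \<epsilon> to 0 is taken at a fixed
  mollification. Removing the mollification is the obstacle for \<gamma> = 0, since nothing bounds
  the mollified gradients of U in advance.

  The functional analysis rests on one tool: uniform convexity provides points of least norm in
  closed convex sets, and the duality map of such a point yields both separation from closed
  subspaces and the Riesz representation. Weak compactness, weak closedness and density of tensors
  follow.

  Sizes are measured by \<open>Lp_int\<close>, the p-th power of the norm, which is additive under
  Fubini; its triangle inequality with the factor \<open>2 powr p\<close> is enough for limits equal
  to zero. Where the constant 1 matters, Fatou's lemma or Young's inequality is used
  instead.\<close>

definition Lp_int :: "real \<Rightarrow> 'a measure \<Rightarrow> ('a \<Rightarrow> 'b::euclidean_space) \<Rightarrow> real" where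
  "Lp_int p M f = (LINT x|M. norm (f x) powr p)"

definition lin_sub :: "('a \<Rightarrow> 'b::real_vector) set \<Rightarrow> bool" where
  "lin_sub S \<longleftrightarrow> (\<lambda>x. 0) \<in> S \<and> (\<forall>f\<in>S. \<forall>g\<in>S. \<forall>a b. (\<lambda>x. a *\<^sub>R f x + b *\<^sub>R g x) \<in> S)"

text \<open>The gradient of \<open>norm w powr p / p\<close>, that is, the vector at which Young's
  inequality with w becomes an equality. For \<open>p < 2\<close> the singular factor at
  \<open>w = 0\<close> does no harm, since w itself vanishes there.\<close>

definition dual_map :: "real \<Rightarrow> 'b::real_normed_vector \<Rightarrow> 'b" where
  "dual_map p w = norm w powr (p - 2) *\<^sub>R w"

definition conj_exp :: "real \<Rightarrow> real \<Rightarrow> bool" where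
  "conj_exp p q \<longleftrightarrow> 1 < p \<and> 1 < q \<and> 1 / p + 1 / q = 1"

lemma conj_expD:
  assumes "conj_exp p q"
  shows "1 < p" "1 < q" "1 / p + 1 / q = 1" "(p - 1) * q = p" "p / q = p - 1" "conj_exp q p"
proof -
  show *: "1 < p" "1 < q" "1 / p + 1 / q = 1" using assms by (auto simp: conj_exp_def)
  then have "p + q = p * q" by (simp add: field_simps)
  then show "(p - 1) * q = p" by (simp add: algebra_simps)
  then show "p / q = p - 1" using * by (simp add: field_simps)
  show "conj_exp q p" using * by (auto simp: conj_exp_def)
qed

lemma conj_exp_exists:
  assumes "1 < p"
  obtains q where "conj_exp p q"
proof
  show "conj_exp p (p / (p - 1))" using assms by (auto simp: conj_exp_def field_simps)
qed

text \<open>The crude bound \<open>a + b \<le> 2 * max a b\<close> avoids convexity. The factor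
  \<open>2 powr p\<close> is harmless, as the estimate serves only for boundedness and for
  convergence to zero.\<close>

lemma powr_add_le:
  fixes a b p :: real
  assumes "0 \<le> a" "0 \<le> b" "0 \<le> p"
  shows "(a + b) powr p \<le> 2 powr p * (a powr p + b powr p)"
proof -
  have "(a + b) powr p \<le> (2 * max a b) powr p" using assms by (intro powr_mono2) auto
  also have "\<dots> = 2 powr p * (max a b) powr p" using assms by (intro powr_mult)
  also have "(max a b) powr p \<le> a powr p + b powr p" using assms by (auto simp: max_def)
  finally show ?thesis by simp
qed

lemma norm_add_powr_le:
  fixes a b :: "'b::real_normed_vector"
  assumes "0 \<le> p"
  shows "norm (a + b) powr p \<le> 2 powr p * (norm a powr p + norm b powr p)"
proof -
  have "norm (a + b) powr p \<le> (norm a + norm b) powr p"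
    using assms by (intro powr_mono2 norm_triangle_ineq) auto
  also have "\<dots> \<le> 2 powr p * (norm a powr p + norm b powr p)"
    using assms by (intro powr_add_le) auto
  finally show ?thesis .
qed

lemma norm_diff_powr_le:
  fixes a b :: "'b::real_normed_vector"
  assumes "0 \<le> p"
  shows "norm (a - b) powr p \<le> 2 powr p * (norm a powr p + norm b powr p)"
  using norm_add_powr_le[OF assms, of a "- b"] by simp

lemma Lp_measurable[measurable_dest]: "f \<in> Lp p M \<Longrightarrow> f \<in> borel_measurable M"
  by (simp add: Lp_def)

lemma Lp_integrable: "f \<in> Lp p M \<Longrightarrow> integrable M (\<lambda>x. norm (f x) powr p)"
  by (simp add: Lp_def)

lemma LpI:
  assumes [measurable]: "f \<in> borel_measurable M" and "integrable M g"
    and "AE x in M. norm (f x) powr p \<le> g x"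
  shows "f \<in> Lp p M"
proof -
  have "integrable M (\<lambda>x. norm (f x) powr p)"
    by (rule Bochner_Integration.integrable_bound[OF assms(2)])
       (use assms(3) in \<open>auto elim!: eventually_mono\<close>)
  then show ?thesis by (simp add: Lp_def)
qed

lemma Lp_int_nonneg[simp]: "0 \<le> Lp_int p M f"
  by (simp add: Lp_int_def)

lemma Lp_int_nn: "f \<in> Lp p M \<Longrightarrow> (\<integral>\<^sup>+x. ennreal (norm (f x) powr p) \<partial>M) = ennreal (Lp_int p M f)"
  unfolding Lp_int_def by (rule nn_integral_eq_integral) (auto simp: Lp_def)

lemma Lp_iff_nn:
  assumes [measurable]: "f \<in> borel_measurable M"
  shows "f \<in> Lp p M \<longleftrightarrow> (\<integral>\<^sup>+x. ennreal (norm (f x) powr p) \<partial>M) < \<infinity>"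
  by (simp add: Lp_def integrable_iff_bounded)

text \<open>The bridge from Tonelli arguments: estimates are carried out with nonnegative integrals,
  where no integrability has to be known, and membership in L^p comes out together with the
  bound.\<close>

lemma Lp_int_le_nn:
  assumes [measurable]: "f \<in> borel_measurable M"
    and "(\<integral>\<^sup>+x. ennreal (norm (f x) powr p) \<partial>M) \<le> ennreal c" "0 \<le> c"
  shows "f \<in> Lp p M" "Lp_int p M f \<le> c"
proof -
  show f: "f \<in> Lp p M" using assms(2) by (auto simp: Lp_iff_nn intro: le_less_trans[OF _ ennreal_less_top])
  show "Lp_int p M f \<le> c" using assms(2,3) unfolding Lp_int_nn[OF f] by simp
qed

lemma Lp_zero[simp]: "(\<lambda>x. 0) \<in> Lp p M" by (simp add: Lp_def)

lemma Lp_int_zero[simp]: "Lp_int p M (\<lambda>x. 0) = 0" by (simp add: Lp_int_def)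

lemma Lp_add:
  assumes "f \<in> Lp p M" "g \<in> Lp p M" "0 < p"
  shows "(\<lambda>x. f x + g x) \<in> Lp p M"
    and "Lp_int p M (\<lambda>x. f x + g x) \<le> 2 powr p * (Lp_int p M f + Lp_int p M g)"
proof -
  note [measurable] = assms(1,2)[THEN Lp_measurable]
  have i: "integrable M (\<lambda>x. 2 powr p * (norm (f x) powr p + norm (g x) powr p))"
    using assms by (auto intro!: Lp_integrable)
  show *: "(\<lambda>x. f x + g x) \<in> Lp p M"
    by (rule LpI[OF _ i]) (use norm_add_powr_le[OF less_imp_le[OF assms(3)]] in auto)
  have "Lp_int p M (\<lambda>x. f x + g x) \<le> (LINT x|M. 2 powr p * (norm (f x) powr p + norm (g x) powr p))"
    unfolding Lp_int_def
    by (intro integral_mono i Lp_integrable[OF *] norm_add_powr_le less_imp_le[OF assms(3)])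
  also have "\<dots> = 2 powr p * (Lp_int p M f + Lp_int p M g)"
    using assms by (simp add: Lp_int_def Lp_integrable)
  finally show "Lp_int p M (\<lambda>x. f x + g x) \<le> 2 powr p * (Lp_int p M f + Lp_int p M g)" .
qed

lemma Lp_scaleR:
  assumes "f \<in> Lp p M"
  shows "(\<lambda>x. c *\<^sub>R f x) \<in> Lp p M" "Lp_int p M (\<lambda>x. c *\<^sub>R f x) = \<bar>c\<bar> powr p * Lp_int p M f"
  using assms by (auto simp: Lp_def Lp_int_def powr_mult)

lemma Lp_mult:
  fixes f :: "'a \<Rightarrow> real"
  assumes "f \<in> Lp p M"
  shows "(\<lambda>x. c * f x) \<in> Lp p M" "Lp_int p M (\<lambda>x. c * f x) = \<bar>c\<bar> powr p * Lp_int p M f"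
  using Lp_scaleR[OF assms] by auto

lemma Lp_minus:
  assumes "f \<in> Lp p M"
  shows "(\<lambda>x. - f x) \<in> Lp p M" "Lp_int p M (\<lambda>x. - f x) = Lp_int p M f"
  using assms by (auto simp: Lp_def Lp_int_def)

lemma Lp_diff:
  assumes "f \<in> Lp p M" "g \<in> Lp p M" "0 < p"
  shows "(\<lambda>x. f x - g x) \<in> Lp p M"
    and "Lp_int p M (\<lambda>x. f x - g x) \<le> 2 powr p * (Lp_int p M f + Lp_int p M g)"
  using Lp_add[OF assms(1) Lp_minus(1)[OF assms(2)] assms(3)] Lp_minus(2)[OF assms(2)] by auto

lemma Lp_int_diff_commute: "Lp_int p M (\<lambda>x. f x - g x) = Lp_int p M (\<lambda>x. g x - f x)"
  by (simp add: Lp_int_def norm_minus_commute)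

lemma Lp_lincomb:
  assumes "f \<in> Lp p M" "g \<in> Lp p M" "0 < p"
  shows "(\<lambda>x. a *\<^sub>R f x + b *\<^sub>R g x) \<in> Lp p M"
  using assms by (intro Lp_add Lp_scaleR)

lemma Lp_sum:
  assumes "\<And>i. i \<in> I \<Longrightarrow> f i \<in> Lp p M" "0 < p"
  shows "(\<lambda>x. \<Sum>i\<in>I. f i x) \<in> Lp p M"
  using assms(1)
proof (induction I rule: infinite_finite_induct)
  case (insert i I)
  then show ?case using Lp_add(1)[OF _ _ assms(2), of "f i" M "\<lambda>x. \<Sum>i\<in>I. f i x"] by simp
qed auto

lemma Lp_cong_AE:
  assumes "f \<in> Lp p M" "g \<in> borel_measurable M" "AE x in M. f x = g x"
  shows "g \<in> Lp p M" "Lp_int p M g = Lp_int p M f"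
proof -
  note [measurable] = Lp_measurable[OF assms(1)] assms(2)
  show "Lp_int p M g = Lp_int p M f"
    unfolding Lp_int_def by (rule integral_cong_AE) (use assms in \<open>auto elim!: eventually_mono\<close>)
  show "g \<in> Lp p M"
    by (rule LpI[OF assms(2) Lp_integrable[OF assms(1)]])
       (use assms(3) in \<open>auto elim!: eventually_mono\<close>)
qed

lemma Lp_int_cong_AE:
  assumes "f \<in> borel_measurable M" "g \<in> borel_measurable M" "AE x in M. f x = g x"
  shows "Lp_int p M f = Lp_int p M g"
  unfolding Lp_int_def using assms by (intro integral_cong_AE) (auto elim!: eventually_mono)

lemma Lp_int_eq_0:
  assumes "f \<in> Lp p M"
  shows "Lp_int p M f = 0 \<longleftrightarrow> (AE x in M. f x = 0)"
  unfolding Lp_int_def using assms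
  by (subst integral_nonneg_eq_0_iff_AE) (auto simp: Lp_def)

lemma Lp_mono:
  assumes "f \<in> Lp p M" "g \<in> borel_measurable M" "AE x in M. norm (g x) \<le> norm (f x)" "0 \<le> p"
  shows "g \<in> Lp p M" "Lp_int p M g \<le> Lp_int p M f"
proof -
  have le: "AE x in M. norm (g x) powr p \<le> norm (f x) powr p"
    using assms(3) by eventually_elim (use assms(4) in \<open>auto intro: powr_mono2\<close>)
  show g: "g \<in> Lp p M" by (rule LpI[OF assms(2) Lp_integrable[OF assms(1)] le])
  show "Lp_int p M g \<le> Lp_int p M f"
    unfolding Lp_int_def using le assms g by (intro integral_mono_AE) (auto intro: Lp_integrable)
qed

section \<open>Closures in Lebesgue spaces\<close>

lemma Lp_norm_less_iff:
  assumes "0 < p" "0 < e"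
  shows "Lp_norm p M f < e \<longleftrightarrow> Lp_int p M f < e powr p"
proof
  assume "Lp_norm p M f < e"
  then have "(Lp_int p M f powr (1/p)) powr p < e powr p"
    using assms unfolding Lp_norm_def Lp_int_def[symmetric] by (intro powr_less_mono2) auto
  then show "Lp_int p M f < e powr p" using assms by (simp add: powr_powr)
next
  assume "Lp_int p M f < e powr p"
  then have "Lp_int p M f powr (1/p) < (e powr p) powr (1/p)"
    using assms by (intro powr_less_mono2) auto
  then show "Lp_norm p M f < e"
    using assms by (simp add: powr_powr Lp_norm_def Lp_int_def)
qed

lemma Lp_norm_int: "Lp_norm p M f = Lp_int p M f powr (1 / p)"
  by (simp add: Lp_norm_def Lp_int_def)

text \<open>\<open>Lp_closure\<close> is phrased with norms, the proof works with p-th powers. A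
  tolerance e for the norm corresponds to the tolerance \<open>e powr p\<close> for
  \<open>Lp_int\<close>, so both notions of approximability agree.\<close>

lemma Lp_closure_iff:
  assumes "0 < p"
  shows "f \<in> Lp_closure p M S \<longleftrightarrow>
    f \<in> Lp p M \<and> (\<forall>e>0. \<exists>g\<in>S \<inter> Lp p M. Lp_int p M (\<lambda>x. f x - g x) < e)"
proof -
  have "(\<forall>e>0. \<exists>g\<in>S \<inter> Lp p M. Lp_norm p M (\<lambda>x. f x - g x) < e) \<longleftrightarrow>
    (\<forall>e>0. \<exists>g\<in>S \<inter> Lp p M. Lp_int p M (\<lambda>x. f x - g x) < e)" (is "?A \<longleftrightarrow> ?B")
  proof
    assume A: ?A
    show ?B
    proof (intro allI impI)
      fix e :: real assume "e > 0"
      then obtain g where "g \<in> S \<inter> Lp p M" "Lp_norm p M (\<lambda>x. f x - g x) < e powr (1/p)"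
        using A by (metis powr_gt_zero less_irrefl)
      then show "\<exists>g\<in>S \<inter> Lp p M. Lp_int p M (\<lambda>x. f x - g x) < e"
        using \<open>e > 0\<close> assms by (intro bexI[of _ g]) (auto simp: Lp_norm_less_iff powr_powr)
    qed
  next
    assume B: ?B
    show ?A
    proof (intro allI impI)
      fix e :: real assume "e > 0"
      then obtain g where "g \<in> S \<inter> Lp p M" "Lp_int p M (\<lambda>x. f x - g x) < e powr p"
        using B by (metis powr_gt_zero less_irrefl)
      then show "\<exists>g\<in>S \<inter> Lp p M. Lp_norm p M (\<lambda>x. f x - g x) < e"
        using \<open>e > 0\<close> assms by (intro bexI[of _ g]) (auto simp: Lp_norm_less_iff)
    qed
  qed
  then show ?thesis by (auto simp: Lp_closure_def)
qed

lemma Lp_closure_seq: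
  assumes "0 < p" "f \<in> Lp_closure p M S"
  obtains s where "\<And>n. s n \<in> S" "\<And>n. s n \<in> Lp p M" "(\<lambda>n. Lp_int p M (\<lambda>x. s n x - f x)) \<longlonglongrightarrow> 0"
proof -
  have "\<forall>n. \<exists>g\<in>S \<inter> Lp p M. Lp_int p M (\<lambda>x. f x - g x) < inverse (real (Suc n))"
    using assms by (auto simp: Lp_closure_iff)
  then obtain s where s: "\<And>n. s n \<in> S \<inter> Lp p M" "\<And>n. Lp_int p M (\<lambda>x. f x - s n x) < inverse (real (Suc n))"
    by metis
  have "(\<lambda>n. Lp_int p M (\<lambda>x. f x - s n x)) \<longlonglongrightarrow> 0"
    by (rule tendsto_sandwich[OF _ _ tendsto_const LIMSEQ_inverse_real_of_nat])
       (use s(2) in \<open>auto intro!: always_eventually less_imp_le\<close>)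
  then show thesis using s by (intro that[of s]) (auto simp: Lp_int_diff_commute[of p M _ f])
qed

lemma Lp_closureI:
  assumes "0 < p" "f \<in> Lp p M" "\<And>n. s n \<in> S" "\<And>n. s n \<in> Lp p M"
    "(\<lambda>n. Lp_int p M (\<lambda>x. s n x - f x)) \<longlonglongrightarrow> 0"
  shows "f \<in> Lp_closure p M S"
  unfolding Lp_closure_iff[OF assms(1)]
proof (intro conjI allI impI)
  fix e :: real assume "e > 0"
  then have "\<forall>\<^sub>F n in sequentially. Lp_int p M (\<lambda>x. s n x - f x) < e"
    using order_tendstoD(2)[OF assms(5)] by auto
  then obtain n where "Lp_int p M (\<lambda>x. s n x - f x) < e"
    by (auto simp: eventually_sequentially)
  then show "\<exists>g\<in>S \<inter> Lp p M. Lp_int p M (\<lambda>x. f x - g x) < e"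
    using assms by (intro bexI[of _ "s n"]) (auto simp: Lp_int_diff_commute[of p M f])
qed fact

lemma Lp_closure_subset: "Lp_closure p M S \<subseteq> Lp p M"
  by (auto simp: Lp_closure_def)

lemma Lp_closure_base:
  assumes "0 < p" "f \<in> S" "f \<in> Lp p M"
  shows "f \<in> Lp_closure p M S"
  using assms by (intro Lp_closureI[of p f M "\<lambda>_. f"]) auto

lemma Lp_int_diff_trans_le:
  assumes "f \<in> Lp p M" "g \<in> Lp p M" "h \<in> Lp p M" "0 < p"
  shows "Lp_int p M (\<lambda>x. f x - h x) \<le>
    2 powr p * (Lp_int p M (\<lambda>x. f x - g x) + Lp_int p M (\<lambda>x. g x - h x))"
  using Lp_add(2)[OF Lp_diff(1)[OF assms(1,2,4)] Lp_diff(1)[OF assms(2,3,4)] assms(4)] by simp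

lemma Lp_tendsto_add:
  assumes "0 < p" "\<And>n. s n \<in> Lp p M" "\<And>n. t n \<in> Lp p M" "f \<in> Lp p M" "g \<in> Lp p M"
    "((\<lambda>n. Lp_int p M (\<lambda>x. s n x - f x)) \<longlongrightarrow> 0) F" "((\<lambda>n. Lp_int p M (\<lambda>x. t n x - g x)) \<longlongrightarrow> 0) F"
  shows "((\<lambda>n. Lp_int p M (\<lambda>x. (s n x + t n x) - (f x + g x))) \<longlongrightarrow> 0) F"
proof (rule tendsto_sandwich[OF _ _ tendsto_const])
  show "\<forall>\<^sub>F n in F. Lp_int p M (\<lambda>x. (s n x + t n x) - (f x + g x))
      \<le> 2 powr p * (Lp_int p M (\<lambda>x. s n x - f x) + Lp_int p M (\<lambda>x. t n x - g x))"
  proof (intro always_eventually allI)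
    fix n
    have "(\<lambda>x. (s n x + t n x) - (f x + g x)) = (\<lambda>x. (s n x - f x) + (t n x - g x))" by auto
    then show "Lp_int p M (\<lambda>x. (s n x + t n x) - (f x + g x))
      \<le> 2 powr p * (Lp_int p M (\<lambda>x. s n x - f x) + Lp_int p M (\<lambda>x. t n x - g x))"
      using Lp_add(2)[OF Lp_diff(1)[OF assms(2,4,1)] Lp_diff(1)[OF assms(3,5,1)] assms(1)] by simp
  qed
  show "((\<lambda>n. 2 powr p * (Lp_int p M (\<lambda>x. s n x - f x) + Lp_int p M (\<lambda>x. t n x - g x))) \<longlongrightarrow> 0) F"
    using tendsto_mult[OF tendsto_const tendsto_add[OF assms(6,7)]] by simp
qed auto

lemma Lp_tendsto_scaleR:
  assumes "\<And>n. s n \<in> Lp p M" "f \<in> Lp p M" "0 < p"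
    "((\<lambda>n. Lp_int p M (\<lambda>x. s n x - f x)) \<longlongrightarrow> 0) F"
  shows "((\<lambda>n. Lp_int p M (\<lambda>x. c *\<^sub>R s n x - c *\<^sub>R f x)) \<longlongrightarrow> 0) F"
proof -
  have "Lp_int p M (\<lambda>x. c *\<^sub>R s n x - c *\<^sub>R f x) = \<bar>c\<bar> powr p * Lp_int p M (\<lambda>x. s n x - f x)" for n
    using Lp_scaleR(2)[OF Lp_diff(1)[OF assms(1,2,3)], of c n] by (simp add: scaleR_diff_right)
  then show ?thesis using tendsto_mult[OF tendsto_const[of "\<bar>c\<bar> powr p"] assms(4)] by simp
qed

lemma lin_sub_Lp_closure:
  assumes "0 < p" "lin_sub S"
  shows "lin_sub (Lp_closure p M S)"
  unfolding lin_sub_def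
proof (intro conjI ballI allI)
  show "(\<lambda>x. 0) \<in> Lp_closure p M S"
    using assms by (intro Lp_closure_base) (auto simp: lin_sub_def)
  fix f g a b assume f: "f \<in> Lp_closure p M S" and g: "g \<in> Lp_closure p M S"
  obtain s where s: "\<And>n. s n \<in> S" "\<And>n. s n \<in> Lp p M" "(\<lambda>n. Lp_int p M (\<lambda>x. s n x - f x)) \<longlonglongrightarrow> 0"
    using Lp_closure_seq[OF assms(1) f] by blast
  obtain t where t: "\<And>n. t n \<in> S" "\<And>n. t n \<in> Lp p M" "(\<lambda>n. Lp_int p M (\<lambda>x. t n x - g x)) \<longlonglongrightarrow> 0"
    using Lp_closure_seq[OF assms(1) g] by blast
  have fg: "f \<in> Lp p M" "g \<in> Lp p M" using f g by (auto simp: Lp_closure_def)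
  show "(\<lambda>x. a *\<^sub>R f x + b *\<^sub>R g x) \<in> Lp_closure p M S"
    using assms fg s t
    by (intro Lp_closureI[of p _ M "\<lambda>n x. a *\<^sub>R s n x + b *\<^sub>R t n x"] Lp_tendsto_add Lp_tendsto_scaleR
        Lp_add Lp_scaleR) (auto simp: lin_sub_def)
qed

lemma Lp_closure_closed:
  assumes "0 < p" "f \<in> Lp p M" "\<And>n. s n \<in> Lp_closure p M S"
    "(\<lambda>n. Lp_int p M (\<lambda>x. s n x - f x)) \<longlonglongrightarrow> 0"
  shows "f \<in> Lp_closure p M S"
  unfolding Lp_closure_iff[OF assms(1)]
proof (intro conjI allI impI)
  fix e :: real assume "e > 0"
  \<comment> \<open>Two errors below \<open>e'\<close>, enlarged by the factor
    \<open>2 powr p\<close> of the triangle inequality, add up to e.\<close>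
  define e' where "e' = e / 2 powr p / 2"
  have "e' > 0" using \<open>e > 0\<close> by (simp add: e'_def)
  then have "\<forall>\<^sub>F n in sequentially. Lp_int p M (\<lambda>x. s n x - f x) < e'"
    using order_tendstoD(2)[OF assms(4)] by auto
  then obtain n where n: "Lp_int p M (\<lambda>x. s n x - f x) < e'"
    by (auto simp: eventually_sequentially)
  obtain g where g: "g \<in> S \<inter> Lp p M" "Lp_int p M (\<lambda>x. s n x - g x) < e'"
    using assms(3)[of n] \<open>e' > 0\<close> by (auto simp: Lp_closure_iff[OF assms(1)])
  have sn: "s n \<in> Lp p M" using assms(3) Lp_closure_subset by blast
  have "Lp_int p M (\<lambda>x. f x - g x)
      \<le> 2 powr p * (Lp_int p M (\<lambda>x. f x - s n x) + Lp_int p M (\<lambda>x. s n x - g x))"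
    using Lp_int_diff_trans_le[OF assms(2) sn, of g] g assms(1) by auto
  also have "\<dots> < 2 powr p * (e' + e')"
    using n g by (intro mult_strict_left_mono add_strict_mono) (auto simp: Lp_int_diff_commute[of p M f])
  also have "\<dots> = e" by (simp add: e'_def)
  finally show "\<exists>g\<in>S \<inter> Lp p M. Lp_int p M (\<lambda>x. f x - g x) < e" using g by blast
qed fact

lemma powr_null:
  assumes "(f \<longlongrightarrow> 0) F" "0 < r" "\<And>x. 0 \<le> f x"
  shows "((\<lambda>x. f x powr r :: real) \<longlongrightarrow> 0) F"
  using tendsto_powr'[OF assms(1) tendsto_const[of r]] assms(2,3) by auto

section \<open>Pairing of conjugate Lebesgue spaces\<close>

lemma Young_powr:
  fixes a b :: real
  assumes "conj_exp p q" "0 \<le> a" "0 \<le> b"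
  shows "a * b \<le> a powr p / p + b powr q / q"
  using Youngs_inequality[of p q a b] conj_expD[OF assms(1)] assms by auto

lemma inner_Young:
  fixes f h :: "'b::euclidean_space"
  assumes "conj_exp p q"
  shows "\<bar>h \<bullet> f\<bar> \<le> norm f powr p / p + norm h powr q / q"
proof -
  have "\<bar>h \<bullet> f\<bar> \<le> norm f * norm h" using Cauchy_Schwarz_ineq2[of h f] by (simp add: mult.commute)
  also have "\<dots> \<le> norm f powr p / p + norm h powr q / q" using Young_powr[OF assms] by simp
  finally show ?thesis .
qed

text \<open>Young's inequality integrates to the additive bound; applied to f divided by its norm,
  it becomes proportional to \<open>Lp_norm p M f\<close>. The constant
  \<open>1 + Lp_int q M h\<close> is cruder than Hoelder's, but it suffices to make the pairing a
  bounded functional.\<close>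

lemma Lp_pairing:
  assumes pq: "conj_exp p q" and f: "f \<in> Lp p M" and h: "h \<in> Lp q M"
  shows "integrable M (\<lambda>x. h x \<bullet> f x)"
    and "\<bar>LINT x|M. h x \<bullet> f x\<bar> \<le> Lp_int p M f / p + Lp_int q M h / q"
    and "\<bar>LINT x|M. h x \<bullet> f x\<bar> \<le> (1 + Lp_int q M h) * Lp_norm p M f"
proof -
  note [measurable] = Lp_measurable[OF f] Lp_measurable[OF h]
  note pq' = conj_expD[OF pq]
  have gen: "integrable M (\<lambda>x. h x \<bullet> f x) \<and> \<bar>LINT x|M. h x \<bullet> f x\<bar> \<le> Lp_int p M f / p + Lp_int q M h / q"
    if f: "f \<in> Lp p M" for f
  proof
    note [measurable] = Lp_measurable[OF f]
    have i: "integrable M (\<lambda>x. norm (f x) powr p / p + norm (h x) powr q / q)"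
      using f h by (auto intro!: Lp_integrable)
    show *: "integrable M (\<lambda>x. h x \<bullet> f x)"
      by (rule Bochner_Integration.integrable_bound[OF i])
         (use inner_Young[OF pq] in \<open>auto intro!: AE_I2 order_trans[OF _ abs_ge_self]\<close>)
    have "\<bar>LINT x|M. h x \<bullet> f x\<bar> \<le> (LINT x|M. \<bar>h x \<bullet> f x\<bar>)"
      by (rule integral_abs_bound)
    also have "\<dots> \<le> (LINT x|M. norm (f x) powr p / p + norm (h x) powr q / q)"
      using i * inner_Young[OF pq] by (intro integral_mono) auto
    also have "\<dots> = Lp_int p M f / p + Lp_int q M h / q"
      using f h by (simp add: Lp_int_def Lp_integrable)
    finally show "\<bar>LINT x|M. h x \<bullet> f x\<bar> \<le> Lp_int p M f / p + Lp_int q M h / q" .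
  qed
  show "integrable M (\<lambda>x. h x \<bullet> f x)" "\<bar>LINT x|M. h x \<bullet> f x\<bar> \<le> Lp_int p M f / p + Lp_int q M h / q"
    using gen[OF f] by auto
  show "\<bar>LINT x|M. h x \<bullet> f x\<bar> \<le> (1 + Lp_int q M h) * Lp_norm p M f"
  proof (cases "Lp_int p M f = 0")
    case True
    then have "AE x in M. f x = 0" using Lp_int_eq_0[OF f] by simp
    then have "(LINT x|M. h x \<bullet> f x) = (LINT x|M. 0)"
      by (intro integral_cong_AE) (auto elim!: eventually_mono)
    then show ?thesis using True by (simp add: Lp_norm_int)
  next
    case False
    define N where "N = Lp_norm p M f"
    have N: "N > 0" "N powr p = Lp_int p M f"
      using False pq' Lp_int_nonneg[of p M f] by (auto simp: N_def Lp_norm_int powr_powr)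
    have I: "Lp_int p M (\<lambda>x. (1/N) *\<^sub>R f x) = 1"
      using Lp_scaleR(2)[OF f, of "1/N"] N False by (simp add: powr_divide)
    have "(LINT x|M. h x \<bullet> ((1/N) *\<^sub>R f x)) = (LINT x|M. h x \<bullet> f x) / N"
      by simp
    then have "\<bar>LINT x|M. h x \<bullet> f x\<bar> / N \<le> 1 / p + Lp_int q M h / q"
      using conjunct2[OF gen[OF Lp_scaleR(1)[OF f], of "1/N"]] N(1) unfolding I by simp
    also have "\<dots> \<le> 1 + Lp_int q M h"
    proof (intro add_mono)
      show "1 / p \<le> 1" using pq'(1) by simp
      show "Lp_int q M h / q \<le> Lp_int q M h"
        using pq'(2) mult_left_mono[of 1 q "Lp_int q M h"] by (simp add: divide_le_eq)
    qed
    finally show ?thesis using N(1) by (simp add: N_def[symmetric] field_simps)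
  qed
qed

lemma Lp_pairing_tendsto:
  assumes pq: "conj_exp p q" and h: "h \<in> Lp q M" and s: "\<And>n. s n \<in> Lp p M" and f: "f \<in> Lp p M"
    and lim: "((\<lambda>n. Lp_int p M (\<lambda>x. s n x - f x)) \<longlongrightarrow> 0) F"
  shows "((\<lambda>n. LINT x|M. h x \<bullet> s n x) \<longlongrightarrow> (LINT x|M. h x \<bullet> f x)) F"
proof -
  note pq' = conj_expD[OF pq]
  have d: "(\<lambda>x. s n x - f x) \<in> Lp p M" for n using s f pq' by (intro Lp_diff) auto
  have "((\<lambda>n. (1 + Lp_int q M h) * Lp_int p M (\<lambda>x. s n x - f x) powr (1/p)) \<longlongrightarrow> 0) F"
    using tendsto_mult_right_zero[OF powr_null[OF lim, of "1/p"]] pq' by simp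
  then have "((\<lambda>n. (LINT x|M. h x \<bullet> s n x) - (LINT x|M. h x \<bullet> f x)) \<longlongrightarrow> 0) F"
  proof (rule Lim_null_comparison[rotated], intro always_eventually allI)
    fix n
    have "(LINT x|M. h x \<bullet> s n x) - (LINT x|M. h x \<bullet> f x) = (LINT x|M. h x \<bullet> (s n x - f x))"
      using Lp_pairing(1)[OF pq s[of n] h] Lp_pairing(1)[OF pq f h] by (simp add: inner_diff_right)
    then show "norm ((LINT x|M. h x \<bullet> s n x) - (LINT x|M. h x \<bullet> f x))
        \<le> (1 + Lp_int q M h) * Lp_int p M (\<lambda>x. s n x - f x) powr (1/p)"
      using Lp_pairing(3)[OF pq d[of n] h] by (simp add: Lp_norm_int)
  qed
  then show ?thesis by (simp add: LIM_zero_iff)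
qed

lemma Lp_pairing_dual:
  assumes "conj_exp p q" "h \<in> Lp q M"
  shows "(\<lambda>f. LINT x|M. h x * f x :: real) \<in> Lp_dual p M"
  unfolding Lp_dual_def mem_Collect_eq
proof (intro conjI ballI allI exI)
  fix f :: "'a \<Rightarrow> real" assume f: "f \<in> Lp p M"
  show "\<bar>LINT x|M. h x * f x\<bar> \<le> (1 + Lp_int q M h) * Lp_norm p M f"
    using Lp_pairing(3)[OF assms(1) f assms(2)] by simp
  fix g :: "'a \<Rightarrow> real" and a b assume g: "g \<in> Lp p M"
  have "integrable M (\<lambda>x. h x * f x)" "integrable M (\<lambda>x. h x * g x)"
    using Lp_pairing(1)[OF assms(1) f assms(2)] Lp_pairing(1)[OF assms(1) g assms(2)] by auto
  moreover have "h x * (a * f x + b * g x) = a * (h x * f x) + b * (h x * g x)" for x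
    by (simp add: algebra_simps)
  ultimately show "(LINT x|M. h x * (a * f x + b * g x)) = a * (LINT x|M. h x * f x) + b * (LINT x|M. h x * g x)"
    by simp
qed

section \<open>Almost everywhere limits and completeness\<close>

lemma Lp_AE_subseq:
  assumes "0 < p" "\<And>n. s n \<in> Lp p M" "f \<in> Lp p M" "(\<lambda>n. Lp_int p M (\<lambda>x. s n x - f x)) \<longlonglongrightarrow> 0"
  obtains r where "strict_mono (r::nat\<Rightarrow>nat)" "AE x in M. (\<lambda>n. s (r n) x) \<longlonglongrightarrow> f x"
proof -
  have d: "(\<lambda>x. s n x - f x) \<in> Lp p M" for n using assms by (intro Lp_diff) auto
  obtain r where r: "strict_mono (r::nat\<Rightarrow>nat)"
    "AE x in M. (\<lambda>n. norm (s (r n) x - f x) powr p) \<longlonglongrightarrow> 0"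
    using tendsto_L1_AE_subseq[of M "\<lambda>n x. norm (s n x - f x) powr p"] Lp_integrable[OF d] assms(4)
    by (auto simp: Lp_int_def)
  from r(2) have "AE x in M. (\<lambda>n. s (r n) x) \<longlonglongrightarrow> f x"
  proof eventually_elim
    case (elim x)
    then have "(\<lambda>n. (norm (s (r n) x - f x) powr p) powr (1/p)) \<longlonglongrightarrow> 0 powr (1/p)"
      using assms(1) by (intro tendsto_powr'[OF _ tendsto_const]) auto
    then have "(\<lambda>n. norm (s (r n) x - f x)) \<longlonglongrightarrow> 0" using assms(1) by (simp add: powr_powr)
    then show ?case by (simp add: tendsto_norm_zero_iff LIM_zero_iff)
  qed
  with r(1) show thesis by (rule that)
qed

lemma Lp_Fatou:
  assumes "0 < p" "\<And>n. s n \<in> Lp p M" "f \<in> borel_measurable M" "AE x in M. (\<lambda>n. s n x) \<longlonglongrightarrow> f x"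
    "\<forall>\<^sub>F n in sequentially. Lp_int p M (s n) \<le> c"
  shows "f \<in> Lp p M" "Lp_int p M f \<le> c"
proof -
  note [measurable] = Lp_measurable[OF assms(2)] assms(3)
  have c: "0 \<le> c" using eventually_happens'[OF sequentially_bot assms(5)] Lp_int_nonneg[of p M] by (meson order_trans)
  have "(\<integral>\<^sup>+x. ennreal (norm (f x) powr p) \<partial>M) = (\<integral>\<^sup>+x. liminf (\<lambda>n. ennreal (norm (s n x) powr p)) \<partial>M)"
  proof (rule nn_integral_cong_AE, use assms(4) in eventually_elim)
    case (elim x)
    then have "(\<lambda>n. ennreal (norm (s n x) powr p)) \<longlonglongrightarrow> ennreal (norm (f x) powr p)"
      using assms(1) by (intro tendsto_ennrealI tendsto_powr' tendsto_norm tendsto_const) auto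
    then show ?case by (intro lim_imp_Liminf[symmetric] trivial_limit_sequentially)
  qed
  also have "\<dots> \<le> liminf (\<lambda>n. \<integral>\<^sup>+x. ennreal (norm (s n x) powr p) \<partial>M)"
    by (rule nn_integral_liminf) measurable
  also have "\<dots> \<le> ennreal c"
  proof (rule Liminf_le)
    show "\<forall>\<^sub>F n in sequentially. (\<integral>\<^sup>+x. ennreal (norm (s n x) powr p) \<partial>M) \<le> ennreal c"
      using assms(5) by eventually_elim (simp add: Lp_int_nn[OF assms(2)] c)
  qed simp
  finally show "f \<in> Lp p M" "Lp_int p M f \<le> c" using Lp_int_le_nn[OF assms(3) _ c] by auto
qed

lemma Lp_complete:
  fixes s :: "nat \<Rightarrow> 'a \<Rightarrow> 'b::euclidean_space"
  assumes p: "0 < p" and s: "\<And>n. s n \<in> Lp p M"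
    and cauchy: "\<And>e. e > 0 \<Longrightarrow> \<exists>N. \<forall>m\<ge>N. \<forall>n\<ge>N. Lp_int p M (\<lambda>x. s m x - s n x) < e"
  obtains f where "f \<in> Lp p M" "(\<lambda>n. Lp_int p M (\<lambda>x. s n x - f x)) \<longlonglongrightarrow> 0"
proof -
  note [measurable] = Lp_measurable[OF s]
  have d: "(\<lambda>x. s m x - s n x) \<in> Lp p M" for m n using s p by (intro Lp_diff) auto
  \<comment> \<open>The increments along \<open>r\<close> will have p-th power integrals below
    \<open>c ^ k\<close>. As \<open>2 powr p * c = (1/2) powr p < 1\<close>, even with the weights
    \<open>(2 powr p) ^ k\<close> their sum has a finite integral, which forces
    \<open>norm (D k x) \<le> (1/2) ^ k\<close> for large k at almost every x: a summable
    bound.\<close>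
  define c where "c = 1 / 4 powr p"
  have c: "0 < c" by (simp add: c_def)
  have "\<exists>N. \<forall>m\<ge>N. \<forall>n\<ge>N. Lp_int p M (\<lambda>x. s m x - s n x) < c ^ k" for k
    using cauchy[of "c ^ k"] c by auto
  then obtain N where N: "\<And>k m n. m \<ge> N k \<Longrightarrow> n \<ge> N k \<Longrightarrow> Lp_int p M (\<lambda>x. s m x - s n x) < c ^ k"
    by metis
  define r where "r = rec_nat (N 0) (\<lambda>k rk. max (Suc rk) (N (Suc k)))"
  have r_Suc: "r (Suc k) = max (Suc (r k)) (N (Suc k))" for k by (simp add: r_def)
  have rmono: "strict_mono r" by (rule strict_monoI_Suc) (simp add: r_Suc)
  have rN: "r k \<ge> N k" for k by (cases k) (auto simp: r_Suc, simp add: r_def)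
  define D where "D k x = s (r (Suc k)) x - s (r k) x" for k x
  have [measurable]: "D k \<in> borel_measurable M" for k unfolding D_def by measurable
  have DI: "Lp_int p M (D k) < c ^ k" for k
    unfolding D_def using rN[of k] rmono by (intro N) (auto intro: order_trans[OF _ less_imp_le[OF strict_monoD]])
  define t where "t = (1/2) powr p"
  have t: "0 < t" "t < 1" using p using powr_less_mono2[of p "1/2" 1] by (auto simp: t_def)
  have "(2::real) powr p * c = t"
  proof -
    have "(4::real) powr p = 2 powr p * 2 powr p" by (simp flip: powr_mult)
    then show ?thesis by (simp add: c_def t_def powr_divide)
  qed
  have "(\<integral>\<^sup>+x. (\<Sum>k. ennreal ((2 powr p) ^ k * norm (D k x) powr p)) \<partial>M)
      = (\<Sum>k. \<integral>\<^sup>+x. ennreal ((2 powr p) ^ k * norm (D k x) powr p) \<partial>M)"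
    by (rule nn_integral_suminf) measurable
  also have "\<dots> \<le> (\<Sum>k. ennreal (t ^ k))"
  proof (intro suminf_le allI summableI)
    fix k
    have "(\<integral>\<^sup>+x. ennreal ((2 powr p) ^ k * norm (D k x) powr p) \<partial>M)
        = ennreal ((2 powr p) ^ k) * (\<integral>\<^sup>+x. ennreal (norm (D k x) powr p) \<partial>M)"
      by (simp add: ennreal_mult nn_integral_cmult)
    also have "\<dots> = ennreal ((2 powr p) ^ k * Lp_int p M (D k))"
      using Lp_int_nn[OF d[of "r (Suc k)" "r k"]] by (simp add: D_def[abs_def] ennreal_mult)
    also have "\<dots> \<le> ennreal ((2 powr p) ^ k * c ^ k)"
      using DI[of k] by (intro ennreal_leI mult_left_mono) auto
    finally show "(\<integral>\<^sup>+x. ennreal ((2 powr p) ^ k * norm (D k x) powr p) \<partial>M) \<le> ennreal (t ^ k)"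
      using \<open>2 powr p * c = t\<close> by (simp flip: power_mult_distrib)
  qed
  also have "\<dots> < \<infinity>" using t by (subst suminf_ennreal2) (auto intro: summable_geometric)
  finally have "AE x in M. (\<Sum>k. ennreal ((2 powr p) ^ k * norm (D k x) powr p)) \<noteq> \<infinity>"
    by (intro nn_integral_PInf_AE) auto
  then have conv: "AE x in M. convergent (\<lambda>k. s (r k) x)"
  proof eventually_elim
    case (elim x)
    then have "summable (\<lambda>k. (2 powr p) ^ k * norm (D k x) powr p)"
      by (intro summable_suminf_not_top) auto
    then have "(\<lambda>k. (2 powr p) ^ k * norm (D k x) powr p) \<longlonglongrightarrow> 0" by (rule summable_LIMSEQ_zero)
    then have "\<forall>\<^sub>F k in sequentially. (2 powr p) ^ k * norm (D k x) powr p < 1"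
      by (rule order_tendstoD) simp
    then have ev: "\<forall>\<^sub>F k in sequentially. norm (D k x) \<le> (1/2) ^ k"
    proof eventually_elim
      case (elim k)
      have eq: "(2 powr p) ^ k * norm (D k x) powr p = (2 ^ k * norm (D k x)) powr p"
        by (simp add: powr_mult powr_power flip: powr_realpow)
           (simp add: powr_powr mult.commute)
      have "\<not> 1 < 2 ^ k * norm (D k x)"
        using elim eq powr_less_mono2[of p 1 "2 ^ k * norm (D k x)"] p unfolding eq powr_one_eq_one by linarith
      then show ?case by (simp add: field_simps)
    qed
    have "summable (\<lambda>k. D k x)"
      by (rule summable_comparison_test_ev[OF ev]) (simp add: summable_geometric)
    then have "convergent (\<lambda>n. \<Sum>k<n. D k x)" by (simp add: summable_iff_convergent)
    moreover have "(\<Sum>k<n. D k x) = s (r n) x - s (r 0) x" for n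
      unfolding D_def by (rule sum_lessThan_telescope)
    ultimately have "convergent (\<lambda>n. (s (r n) x - s (r 0) x) + s (r 0) x)"
      using convergent_add[OF _ convergent_const] by fastforce
    then show ?case by simp
  qed
  define f where "f x = lim (\<lambda>k. s (r k) x)" for x
  have [measurable]: "f \<in> borel_measurable M" unfolding f_def by measurable
  have lim: "AE x in M. (\<lambda>k. s (r k) x) \<longlonglongrightarrow> f x"
    using conv by eventually_elim (simp add: f_def convergent_LIMSEQ_iff)
  \<comment> \<open>Fatou's lemma along the subsequence turns the Cauchy bound between
    \<open>s n\<close> and \<open>s (r k)\<close> into a bound for \<open>s n - f\<close>. Used with
    \<open>e = 1\<close> it also shows that f lies in L^p.\<close>
  have key: "(\<lambda>x. s n x - f x) \<in> Lp p M \<and> Lp_int p M (\<lambda>x. s n x - f x) \<le> e"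
    if e: "e > 0" and n: "\<And>m. m \<ge> K \<Longrightarrow> Lp_int p M (\<lambda>x. s n x - s m x) < e" for n e K
  proof -
    have "AE x in M. (\<lambda>k. s n x - s (r k) x) \<longlonglongrightarrow> s n x - f x"
      using lim by eventually_elim (intro tendsto_intros)
    moreover have "\<forall>\<^sub>F k in sequentially. Lp_int p M (\<lambda>x. s n x - s (r k) x) \<le> e"
      using filterlim_subseq[OF rmono] eventually_ge_at_top[of K]
      unfolding filterlim_at_top by (auto elim!: allE[of _ K] eventually_mono intro!: less_imp_le n)
    ultimately show ?thesis
      using Lp_Fatou[OF p, of "\<lambda>k x. s n x - s (r k) x" M "\<lambda>x. s n x - f x" e] d by auto
  qed
  obtain K where K: "\<And>m n. m \<ge> K \<Longrightarrow> n \<ge> K \<Longrightarrow> Lp_int p M (\<lambda>x. s m x - s n x) < 1"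
    using cauchy[of 1] by (metis zero_less_one)
  have "(\<lambda>x. s K x - f x) \<in> Lp p M" using key[of 1 K K] K by auto
  from Lp_diff(1)[OF s[of K] this p] have f: "f \<in> Lp p M" by simp
  have "(\<lambda>n. Lp_int p M (\<lambda>x. s n x - f x)) \<longlonglongrightarrow> 0"
  proof (rule LIMSEQ_I)
    fix e :: real assume "e > 0"
    then obtain K where K: "\<And>m n. m \<ge> K \<Longrightarrow> n \<ge> K \<Longrightarrow> Lp_int p M (\<lambda>x. s m x - s n x) < e/2"
      using cauchy[of "e/2"] by (metis half_gt_zero)
    have "norm (Lp_int p M (\<lambda>x. s n x - f x) - 0) < e" if "n \<ge> K" for n
      using key[of "e/2" K n] K that \<open>e > 0\<close> by auto
    then show "\<exists>no. \<forall>n\<ge>no. norm (Lp_int p M (\<lambda>x. s n x - f x) - 0) < e"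
      by blast
  qed
  with f show thesis by (rule that)
qed


section \<open>Duality map, uniform convexity and the dual space\<close>

lemma dual_map_0[simp]: "dual_map p 0 = 0" by (simp add: dual_map_def)

lemma norm_dual_map: "norm (dual_map p w) = norm w powr (p - 1)"
proof (cases "w = 0")
  case False
  have "norm w powr (p - 2) * norm w = norm w powr (p - 1)"
    using powr_mult_base[of "norm w" "p - 2"] by (simp add: mult.commute)
  then show ?thesis by (simp add: dual_map_def)
qed simp

lemma dual_map_inner: "dual_map p w \<bullet> w = norm w powr p"
proof (cases "w = 0")
  case False
  have "dual_map p w \<bullet> w = norm w powr (p - 2) * (norm w)\<^sup>2"
    by (simp add: dual_map_def power2_norm_eq_inner)
  also have "\<dots> = norm w powr (p - 1) * norm w"
    using powr_mult_base[of "norm w" "p - 2"] by (simp add: mult.commute power2_eq_square mult.left_commute)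
  also have "\<dots> = norm w powr p"
    using powr_mult_base[of "norm w" "p - 1"] by (simp add: mult.commute)
  finally show ?thesis .
qed simp

lemma continuous_dual_map:
  assumes "1 < p"
  shows "continuous_on UNIV (dual_map p :: 'b::real_normed_vector \<Rightarrow> 'b)"
proof -
  have "isCont (dual_map p :: 'b \<Rightarrow> 'b) w" for w
  proof (cases "w = 0")
    \<comment> \<open>For \<open>p < 2\<close> the factor \<open>norm w powr (p - 2)\<close> is
      singular at 0. Continuity there comes from
      \<open>norm (dual_map p v) = norm v powr (p - 1)\<close>, whose exponent is positive.\<close>
    case True
    have "((\<lambda>v::'b. norm v powr (p - 1)) \<longlongrightarrow> norm (0::'b) powr (p - 1)) (at 0)"
      using assms by (intro tendsto_powr' tendsto_norm tendsto_const tendsto_ident_at) auto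
    then have "((\<lambda>v::'b. norm (dual_map p v)) \<longlongrightarrow> 0) (at 0)" using assms by (simp add: norm_dual_map)
    then show ?thesis using True by (simp add: isCont_def tendsto_norm_zero_iff)
  next
    case False
    then show ?thesis unfolding dual_map_def[abs_def] by (intro continuous_intros) auto
  qed
  then show ?thesis by (simp add: continuous_on_eq_continuous_at)
qed

lemma measurable_dual_map[measurable]:
  fixes f :: "'a \<Rightarrow> 'b::euclidean_space"
  assumes [measurable]: "f \<in> borel_measurable M"
  shows "(\<lambda>x. dual_map p (f x)) \<in> borel_measurable M"
  unfolding dual_map_def by measurable

lemma norm_dual_map_powr:
  assumes "conj_exp p q"
  shows "norm (dual_map p w) powr q = norm w powr p"
  using conj_expD[OF assms] by (simp add: norm_dual_map powr_powr)

lemma Lp_dual_map: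
  assumes "conj_exp p q" "f \<in> Lp p M"
  shows "(\<lambda>x. dual_map p (f x)) \<in> Lp q M" "Lp_int q M (\<lambda>x. dual_map p (f x)) = Lp_int p M f"
  using assms by (auto simp: Lp_def Lp_int_def norm_dual_map_powr)

text \<open>Convexity of the p-th power of the norm, obtained without differentiation: it is Young's
  inequality for \<open>dual_map p a\<close> and b, because
  \<open>norm (dual_map p a) powr q = norm a powr p\<close> and
  \<open>p / q = p - 1\<close>.\<close>

lemma norm_powr_tangent:
  fixes a b :: "'b::euclidean_space"
  assumes "1 < p"
  shows "norm a powr p + p * (dual_map p a \<bullet> (b - a)) \<le> norm b powr p"
proof -
  obtain q where pq: "conj_exp p q" using conj_exp_exists[OF assms] by blast
  note pq' = conj_expD[OF pq]
  have "dual_map p a \<bullet> b \<le> norm b powr p / p + norm a powr p / q"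
    using inner_Young[OF pq, of "dual_map p a" b] by (simp add: norm_dual_map_powr[OF pq])
  then have "p * (dual_map p a \<bullet> b) \<le> p * (norm b powr p / p + norm a powr p / q)"
    using pq' by (intro mult_left_mono) auto
  also have "\<dots> = norm b powr p + (p / q) * norm a powr p" using pq'(1) by (simp add: distrib_left)
  finally show ?thesis using pq' by (simp add: inner_diff_right dual_map_inner algebra_simps)
qed

section \<open>Uniform convexity\<close>

lemma powr_midpoint_less:
  fixes s t p :: real
  assumes "1 < p" "0 \<le> s" "s < t"
  shows "((s + t) / 2) powr p < (s powr p + t powr p) / 2"
proof -
  \<comment> \<open>The two halves of the interval have equal length, so the mean value theorem on
    each of them reduces the claim to the strict growth of the derivative.\<close>
  define m where "m = (s + t) / 2"
  have m: "s < m" "m < t" "m - s = t - m" using assms by (auto simp: m_def field_simps)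
  have cont: "continuous_on {a..b} (\<lambda>x. x powr p)" if "0 \<le> a" for a b
    using that assms by (intro continuous_on_powr' continuous_intros) auto
  have der: "((\<lambda>x. x powr p) has_real_derivative p * x powr (p - 1)) (at x)" if "0 < x" for x
    using that by (auto intro!: derivative_eq_intros)
  then have diff: "(\<lambda>x. x powr p) differentiable (at x)" if "0 < x" for x
    using that real_differentiable_def by blast
  obtain l z where z: "s < z" "z < m" "DERIV (\<lambda>x. x powr p) z :> l" "m powr p - s powr p = (m - s) * l"
    using MVT[OF m(1) cont[OF assms(2)] diff] assms(2) by force
  obtain l' z' where z': "m < z'" "z' < t" "DERIV (\<lambda>x. x powr p) z' :> l'" "t powr p - m powr p = (t - m) * l'"
    using MVT[OF m(2) cont diff] assms(2) m(1) by force
  have "l = p * z powr (p - 1)" using DERIV_unique[OF z(3) der] z assms(2) by auto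
  moreover have "l' = p * z' powr (p - 1)" using DERIV_unique[OF z'(3) der] z' m(1) assms(2) by auto
  moreover have "z powr (p - 1) < z' powr (p - 1)" using z z' assms m by (intro powr_less_mono2) auto
  ultimately have "l < l'" using assms by simp
  then have "(m - s) * l < (t - m) * l'" unfolding m(3) using m(2) by (intro mult_strict_left_mono) auto
  then show ?thesis using z(4) z'(4) unfolding m_def[symmetric] by simp
qed

text \<open>Strictness has two sources: for equal norms the parallelogram law, that is, the
  roundness of the Euclidean ball; for different norms the strict convexity of
  \<open>t powr p\<close> on the nonnegative reals.\<close>

lemma norm_powr_midpoint_less:
  fixes a b :: "'b::euclidean_space"
  assumes "1 < p" "a \<noteq> b"
  shows "norm ((1/2) *\<^sub>R (a + b)) powr p < (norm a powr p + norm b powr p) / 2"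
proof (cases "norm a = norm b")
  case True
  have "(norm (a + b))\<^sup>2 + (norm (a - b))\<^sup>2 = 2 * (norm a)\<^sup>2 + 2 * (norm b)\<^sup>2"
    by (simp add: power2_norm_eq_inner inner_add inner_diff inner_commute)
  moreover have "0 < (norm (a - b))\<^sup>2" using assms by simp
  ultimately have "(norm (a + b))\<^sup>2 < 2 * (norm a)\<^sup>2 + 2 * (norm b)\<^sup>2" by linarith
  then have "(norm (a + b))\<^sup>2 < (2 * norm a)\<^sup>2" using True by (simp add: power_mult_distrib)
  then have "norm (a + b) < 2 * norm a" by (rule power_less_imp_less_base) simp
  then have "norm ((1/2) *\<^sub>R (a + b)) powr p < norm a powr p"
    using assms by (intro powr_less_mono2) auto
  then show ?thesis using True by simp
next
  case False
  have "norm ((1/2) *\<^sub>R (a + b)) powr p \<le> ((norm a + norm b) / 2) powr p"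
    using assms norm_triangle_ineq[of a b] by (intro powr_mono2) auto
  also have "\<dots> < (norm a powr p + norm b powr p) / 2"
    using False powr_midpoint_less[OF assms(1), of "norm a" "norm b"]
      powr_midpoint_less[OF assms(1), of "norm b" "norm a"]
    by (cases "norm a < norm b") (auto simp: add.commute)
  finally show ?thesis .
qed

text \<open>
  Strict convexity becomes quantitative by compactness of the set of normalized pairs; homogeneity
  then gives the inequality for all pairs.
\<close>

lemma norm_powr_uniform_convexity:
  fixes p \<delta> :: real
  assumes "1 < p" "0 < \<delta>"
  obtains C where "0 \<le> C" "\<And>a b :: 'b::euclidean_space. norm (a - b) powr p \<le> \<delta> * (norm a powr p + norm b powr p)
     + C * ((norm a powr p + norm b powr p) / 2 - norm ((1/2) *\<^sub>R (a + b)) powr p)"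
proof -
  define g :: "'b \<times> 'b \<Rightarrow> real" where
    "g z = (norm (fst z) powr p + norm (snd z) powr p) / 2 - norm ((1/2) *\<^sub>R (fst z + snd z)) powr p" for z
  \<comment> \<open>Normalized pairs whose distance is not yet covered by the \<delta> term. They
    stay off the diagonal, so the convexity defect \<open>g\<close> has a positive lower bound m on
    this compact set.\<close>
  define K :: "('b \<times> 'b) set" where
    "K = {z. norm (fst z) powr p + norm (snd z) powr p = 1 \<and> \<delta> \<le> norm (fst z - snd z) powr p}"
  have cg: "continuous_on UNIV g" unfolding g_def using assms
    by (intro continuous_intros continuous_on_powr') auto
  have "closed K"
  proof -
    have "continuous_on UNIV (\<lambda>z::'b\<times>'b. norm (fst z) powr p + norm (snd z) powr p)"
      "continuous_on UNIV (\<lambda>z::'b\<times>'b. norm (fst z - snd z) powr p)"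
      using assms by (intro continuous_intros continuous_on_powr'; auto)+
    then show ?thesis unfolding K_def
      by (intro closed_Collect_conj closed_Collect_eq closed_Collect_le continuous_on_const)
  qed
  moreover have "bounded K"
  proof -
    have "norm z \<le> 2" if "z \<in> K" for z
    proof -
      have *: "norm (fst z) powr p + norm (snd z) powr p = 1" using that by (simp add: K_def)
      have le: "x \<le> 1" if "x powr p \<le> 1" "0 \<le> x" for x :: real
        using that assms powr_less_mono2[of p 1 x] by fastforce
      have "norm (fst z) \<le> 1" "norm (snd z) \<le> 1"
        using * le[of "norm (fst z)"] le[of "norm (snd z)"]
          powr_ge_zero[of "norm (fst z)" p] powr_ge_zero[of "norm (snd z)" p]
        by (simp_all del: powr_ge_zero)
      then show ?thesis using norm_Pair_le[of "fst z" "snd z"] by simp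
    qed
    then show ?thesis unfolding bounded_iff by blast
  qed
  ultimately have "compact K" by (simp add: compact_eq_bounded_closed)
  have "\<exists>m>0. \<forall>z\<in>K. m \<le> g z"
  proof (cases "K = {}")
    case False
    obtain z0 where z0: "z0 \<in> K" "\<And>z. z \<in> K \<Longrightarrow> g z0 \<le> g z"
      using continuous_attains_inf[OF \<open>compact K\<close> False continuous_on_subset[OF cg]] by blast
    have "fst z0 \<noteq> snd z0" using z0(1) assms by (auto simp: K_def)
    then have "0 < g z0" using norm_powr_midpoint_less[OF assms(1)] by (simp add: g_def)
    then show ?thesis using z0 by blast
  qed (auto intro: exI[of _ 1])
  then obtain m where m: "m > 0" "\<And>z. z \<in> K \<Longrightarrow> m \<le> g z" by blast
  \<comment> \<open>On \<open>K\<close> the defect is at least m, so \<open>C * g\<close> dominates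
    \<open>2 powr p\<close>, which bounds \<open>norm (a - b) powr p\<close> for all normalized
    pairs.\<close>
  define C where "C = 2 powr p / m"
  have "0 \<le> C" using m by (simp add: C_def)
  have g0: "0 \<le> g z" for z
    using norm_powr_midpoint_less[OF assms(1), of "fst z" "snd z"]
    by (cases "fst z = snd z") (auto simp: g_def simp flip: scaleR_2)
  have normalized: "norm (a - b) powr p \<le> \<delta> + C * g (a, b)" if "norm a powr p + norm b powr p = 1" for a b :: 'b
  proof (cases "\<delta> \<le> norm (a - b) powr p")
    case True
    then have "m \<le> g (a, b)" using that by (intro m) (auto simp: K_def)
    then have "2 powr p \<le> C * g (a, b)" using m by (simp add: C_def field_simps)
    moreover have "norm (a - b) powr p \<le> 2 powr p"
      using norm_diff_powr_le[of p a b] that assms by simp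
    ultimately show ?thesis using assms by linarith
  next
    case False
    then show ?thesis using g0 \<open>0 \<le> C\<close> by (smt (verit) mult_nonneg_nonneg)
  qed
  have main: "norm (a - b) powr p \<le> \<delta> * (norm a powr p + norm b powr p) + C * g (a, b)" for a b :: 'b
  proof (cases "norm a powr p + norm b powr p = 0")
    case True
    then have "norm a powr p = 0" "norm b powr p = 0"
      by (smt (verit) powr_ge_zero)+
    then show ?thesis using True g0 \<open>0 \<le> C\<close> by simp
  next
    case False
    define N where "N = norm a powr p + norm b powr p"
    have N: "N > 0" using False unfolding N_def by (smt (verit) powr_ge_zero)
    \<comment> \<open>The scaling that normalizes the pair. Both sides of the inequality are
      homogeneous of degree p, so each is divided by N.\<close>
    define l where "l = N powr (- 1 / p)"
    have l: "l > 0" "l powr p = 1 / N" using N assms by (auto simp: l_def powr_powr powr_neg_one)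
    have sc: "norm (l *\<^sub>R v) powr p = norm v powr p / N" for v :: 'b
      using l by (simp add: powr_mult)
    have "norm (l *\<^sub>R (a - b)) powr p \<le> \<delta> + C * g (l *\<^sub>R a, l *\<^sub>R b)"
      using N unfolding scaleR_diff_right by (intro normalized) (simp only: sc N_def flip: add_divide_distrib, simp)
    also have "g (l *\<^sub>R a, l *\<^sub>R b) = g (a, b) / N"
    proof -
      have "norm ((1/2) *\<^sub>R (l *\<^sub>R a + l *\<^sub>R b)) powr p = norm (l *\<^sub>R ((1/2) *\<^sub>R (a + b))) powr p"
        by (simp add: scaleR_add_right)
      then show ?thesis by (simp only: g_def fst_conv snd_conv sc) (simp add: diff_divide_distrib add_divide_distrib)
    qed
    finally have "norm (a - b) powr p / N \<le> \<delta> + C * g (a, b) / N" by (simp only: sc) simp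
    then show ?thesis using N by (simp add: N_def[symmetric] field_simps)
  qed
  show thesis using that[OF \<open>0 \<le> C\<close>] main by (simp add: g_def)
qed

text \<open>The pointwise inequality integrates term by term. The constant C is the same for all f
  and g, so along a minimizing sequence, where the last bracket tends to zero, the mutual distances
  become small.\<close>

lemma Lp_uniform_convexity:
  fixes p \<delta> :: real
  assumes "1 < p" "0 < \<delta>"
  obtains C where "0 \<le> C" "\<And>f g :: 'a \<Rightarrow> 'b::euclidean_space. f \<in> Lp p M \<Longrightarrow> g \<in> Lp p M \<Longrightarrow>
    Lp_int p M (\<lambda>x. f x - g x) \<le> \<delta> * (Lp_int p M f + Lp_int p M g)
     + C * ((Lp_int p M f + Lp_int p M g) / 2 - Lp_int p M (\<lambda>x. (1/2) *\<^sub>R (f x + g x)))"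
proof -
  obtain C where C: "0 \<le> C" "\<And>a b :: 'b. norm (a - b) powr p \<le> \<delta> * (norm a powr p + norm b powr p)
     + C * ((norm a powr p + norm b powr p) / 2 - norm ((1/2) *\<^sub>R (a + b)) powr p)"
    using norm_powr_uniform_convexity[OF assms] by metis
  show thesis
  proof (rule that[OF C(1)])
    fix f g :: "'a \<Rightarrow> 'b" assume fg: "f \<in> Lp p M" "g \<in> Lp p M"
    have p: "0 < p" using assms by simp
    have h: "(\<lambda>x. (1/2) *\<^sub>R (f x + g x)) \<in> Lp p M" by (intro Lp_scaleR Lp_add fg p)
    note i = Lp_integrable[OF fg(1)] Lp_integrable[OF fg(2)] Lp_integrable[OF h]
    have "Lp_int p M (\<lambda>x. f x - g x) \<le> (LINT x|M. \<delta> * (norm (f x) powr p + norm (g x) powr p)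
        + C * ((norm (f x) powr p + norm (g x) powr p) / 2 - norm ((1/2) *\<^sub>R (f x + g x)) powr p))"
      unfolding Lp_int_def
      by (intro integral_mono Lp_integrable Lp_diff fg p C Bochner_Integration.integrable_add
          Bochner_Integration.integrable_diff Bochner_Integration.integrable_mult_right
          Bochner_Integration.integrable_divide h)
    also have "\<dots> = \<delta> * (Lp_int p M f + Lp_int p M g)
     + C * ((Lp_int p M f + Lp_int p M g) / 2 - Lp_int p M (\<lambda>x. (1/2) *\<^sub>R (f x + g x)))"
      using i by (simp add: Lp_int_def del: norm_scaleR)
    finally show "Lp_int p M (\<lambda>x. f x - g x) \<le> \<delta> * (Lp_int p M f + Lp_int p M g)
     + C * ((Lp_int p M f + Lp_int p M g) / 2 - Lp_int p M (\<lambda>x. (1/2) *\<^sub>R (f x + g x)))" .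
  qed
qed

section \<open>Points of least norm and separation\<close>

lemma Lp_int_lsc:
  assumes "0 < p" "\<And>n. s n \<in> Lp p M" "f \<in> Lp p M" "(\<lambda>n. Lp_int p M (\<lambda>x. s n x - f x)) \<longlonglongrightarrow> 0"
    "(\<lambda>n. Lp_int p M (s n)) \<longlonglongrightarrow> c"
  shows "Lp_int p M f \<le> c"
proof -
  \<comment> \<open>Fatou's lemma along an almost everywhere convergent subsequence keeps the
    constant 1, which the triangle inequality for \<open>Lp_int\<close> would spoil by
    \<open>2 powr p\<close>.\<close>
  obtain r where r: "strict_mono (r::nat\<Rightarrow>nat)" "AE x in M. (\<lambda>n. s (r n) x) \<longlonglongrightarrow> f x"
    using Lp_AE_subseq[OF assms(1-4)] by blast
  have lim: "(\<lambda>n. Lp_int p M (s (r n))) \<longlonglongrightarrow> c"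
    using LIMSEQ_subseq_LIMSEQ[OF assms(5) r(1)] by (simp add: o_def)
  show ?thesis
  proof (rule field_le_epsilon)
    fix e :: real assume "e > 0"
    then have "\<forall>\<^sub>F n in sequentially. Lp_int p M (s (r n)) < c + e"
      using order_tendstoD(2)[OF lim] by simp
    then have ev: "\<forall>\<^sub>F n in sequentially. Lp_int p M (s (r n)) \<le> c + e"
      by (rule eventually_mono) simp
    show "Lp_int p M f \<le> c + e"
      using Lp_Fatou(2)[OF assms(1) assms(2) Lp_measurable[OF assms(3)] r(2) ev] .
  qed
qed

text \<open>A minimizing sequence is Cauchy: midpoints stay in K, so their \<open>Lp_int\<close> is
  at least the infimum m, which makes the convexity defect of two late members small. The limit lies
  in K by closedness and is a minimizer by lower semicontinuity.\<close>

lemma Lp_min_norm: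
  fixes K :: "('a \<Rightarrow> 'b::euclidean_space) set"
  assumes p: "1 < p" and K: "K \<subseteq> Lp p M" "K \<noteq> {}"
    and mid: "\<forall>f\<in>K. \<forall>g\<in>K. (\<lambda>x. (1/2) *\<^sub>R (f x + g x)) \<in> K"
    and closed: "\<forall>s f. (\<forall>n. s n \<in> K) \<longrightarrow> f \<in> Lp p M \<longrightarrow> (\<lambda>n. Lp_int p M (\<lambda>x. s n x - f x)) \<longlonglongrightarrow> 0 \<longrightarrow> f \<in> K"
  obtains w where "w \<in> K" "\<And>k. k \<in> K \<Longrightarrow> Lp_int p M w \<le> Lp_int p M k"
proof -
  have p0: "0 < p" using p by simp
  define m where "m = Inf (Lp_int p M ` K)"
  have bdd: "bdd_below (Lp_int p M ` K)" by (rule bdd_belowI2[of _ 0]) simp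
  have le: "m \<le> Lp_int p M k" if "k \<in> K" for k
    unfolding m_def using that by (intro cINF_lower bdd)
  have m0: "0 \<le> m" unfolding m_def using K by (intro cINF_greatest) auto
  have "\<exists>k\<in>K. Lp_int p M k < m + inverse (real (Suc n))" for n
    using cINF_less_iff[OF K(2) bdd, of "m + inverse (real (Suc n))"] by (auto simp: m_def)
  then obtain s where s: "\<And>n. s n \<in> K" "\<And>n. Lp_int p M (s n) < m + inverse (real (Suc n))"
    by metis
  have sL: "s n \<in> Lp p M" for n using s K by auto
  have "\<exists>N. \<forall>i\<ge>N. \<forall>j\<ge>N. Lp_int p M (\<lambda>x. s i x - s j x) < e" if e: "e > 0" for e
  proof -
    \<comment> \<open>All members of the sequence have \<open>Lp_int\<close> at most
      \<open>m + 1\<close>, so the \<delta> term of uniform convexity contributes at most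
      \<open>e / 2\<close>; the index N takes care of the other half.\<close>
    define d where "d = e / (4 * (m + 1))"
    have "d > 0" using e m0 by (simp add: d_def)
    obtain C where C: "0 \<le> C" "\<And>f g :: 'a \<Rightarrow> 'b. f \<in> Lp p M \<Longrightarrow> g \<in> Lp p M \<Longrightarrow>
      Lp_int p M (\<lambda>x. f x - g x) \<le> d * (Lp_int p M f + Lp_int p M g)
       + C * ((Lp_int p M f + Lp_int p M g) / 2 - Lp_int p M (\<lambda>x. (1/2) *\<^sub>R (f x + g x)))"
      by (rule Lp_uniform_convexity[OF p \<open>d > 0\<close>, where M = M]) (rule that; assumption)
    obtain N where N: "inverse (real (Suc N)) < e / (2 * (C + 1))"
      using reals_Archimedean[of "e / (2 * (C + 1))"] e C(1) by auto
    have "Lp_int p M (\<lambda>x. s i x - s j x) < e" if ij: "i \<ge> N" "j \<ge> N" for i j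
    proof -
      have inv: "inverse (real (Suc i)) \<le> inverse (real (Suc N))" "inverse (real (Suc j)) \<le> inverse (real (Suc N))"
        "inverse (real (Suc i)) \<le> 1" "inverse (real (Suc j)) \<le> 1"
        using ij by (auto simp: field_simps)
      have "Lp_int p M (\<lambda>x. s i x - s j x) \<le> d * (Lp_int p M (s i) + Lp_int p M (s j))
         + C * ((Lp_int p M (s i) + Lp_int p M (s j)) / 2 - Lp_int p M (\<lambda>x. (1/2) *\<^sub>R (s i x + s j x)))"
        by (intro C sL)
      also have "\<dots> \<le> d * ((m + 1) + (m + 1)) + C * inverse (real (Suc N))"
      proof (intro add_mono mult_left_mono)
        show "(Lp_int p M (s i) + Lp_int p M (s j)) / 2 - Lp_int p M (\<lambda>x. (1/2) *\<^sub>R (s i x + s j x)) \<le> inverse (real (Suc N))"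
          using s(2)[of i] s(2)[of j] le[OF mid[rule_format, OF s(1)[of i] s(1)[of j]]] inv by argo
      qed (use s(2)[of i] s(2)[of j] inv \<open>d > 0\<close> C(1) in auto)
      also have "d * ((m + 1) + (m + 1)) = e / 2" using m0 by (simp add: d_def field_simps)
      also have "C * inverse (real (Suc N)) < e / 2"
      proof -
        have "C * inverse (real (Suc N)) \<le> (C + 1) * inverse (real (Suc N))" by (intro mult_right_mono) auto
        also have "\<dots> < (C + 1) * (e / (2 * (C + 1)))" using N C(1) by (intro mult_strict_left_mono) auto
        also have "\<dots> = e / 2" using C(1) by (simp add: field_simps)
        finally show ?thesis .
      qed
      finally show ?thesis by simp
    qed
    then show ?thesis by blast
  qed
  then obtain w where w: "w \<in> Lp p M" "(\<lambda>n. Lp_int p M (\<lambda>x. s n x - w x)) \<longlonglongrightarrow> 0"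
    by (rule Lp_complete[OF p0 sL]) (assumption, rule that, assumption+)
  have "(\<lambda>n. Lp_int p M (s n)) \<longlonglongrightarrow> m"
  proof (rule tendsto_sandwich[OF _ _ tendsto_const])
    show "(\<lambda>n. m + inverse (real (Suc n))) \<longlonglongrightarrow> m"
      using tendsto_add[OF tendsto_const LIMSEQ_inverse_real_of_nat] by force
  qed (use le s in \<open>auto intro!: always_eventually less_imp_le\<close>)
  then have "Lp_int p M w \<le> m" using Lp_int_lsc[OF _ sL w] p by simp
  moreover have "w \<in> K" using closed s(1) w by blast
  ultimately show thesis using le by (intro that[of w]) (auto intro: order_trans)
qed

text \<open>A one-sided Euler-Lagrange condition. The tangent of the p-th power is taken at the
  perturbed point \<open>w + t z\<close>, so minimality gives the sign for each \<open>t > 0\<close>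
  without differentiating an integral; dominated convergence then lets t tend to 0.\<close>

lemma Lp_min_orthogonal_aux:
  fixes w z :: "'a \<Rightarrow> 'b::euclidean_space"
  assumes p: "1 < p" and w: "w \<in> Lp p M" and z: "z \<in> Lp p M"
    and min: "\<And>t. Lp_int p M w \<le> Lp_int p M (\<lambda>x. w x + t *\<^sub>R z x)"
  shows "0 \<le> (LINT x|M. dual_map p (w x) \<bullet> z x)"
proof -
  obtain q where pq: "conj_exp p q" using conj_exp_exists[OF p] by blast
  note [measurable] = Lp_measurable[OF w] Lp_measurable[OF z]
  have p0: "0 < p" using p by simp
  have wz: "(\<lambda>x. w x + t *\<^sub>R z x) \<in> Lp p M" for t by (intro Lp_add Lp_scaleR w z p0)
  have int: "integrable M (\<lambda>x. dual_map p (w x + t *\<^sub>R z x) \<bullet> z x)" for t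
    by (rule Lp_pairing(1)[OF pq z Lp_dual_map(1)[OF pq wz]])
  have pos: "0 \<le> (LINT x|M. dual_map p (w x + t *\<^sub>R z x) \<bullet> z x)" if "t > 0" for t
  proof -
    have tangent: "norm (w x + t *\<^sub>R z x) powr p - p * t * (dual_map p (w x + t *\<^sub>R z x) \<bullet> z x) \<le> norm (w x) powr p" for x
      using norm_powr_tangent[OF p, of "w x + t *\<^sub>R z x" "w x"] by simp
    have "(LINT x|M. norm (w x + t *\<^sub>R z x) powr p - p * t * (dual_map p (w x + t *\<^sub>R z x) \<bullet> z x)) \<le> Lp_int p M w"
      unfolding Lp_int_def using int[of t] Lp_integrable[OF wz[of t]] Lp_integrable[OF w] tangent
      by (intro integral_mono) auto
    then have "Lp_int p M (\<lambda>x. w x + t *\<^sub>R z x) - p * t * (LINT x|M. dual_map p (w x + t *\<^sub>R z x) \<bullet> z x) \<le> Lp_int p M w"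
      using int[of t] Lp_integrable[OF wz[of t]] by (simp add: Lp_int_def)
    then have "0 \<le> p * t * (LINT x|M. dual_map p (w x + t *\<^sub>R z x) \<bullet> z x)" using min[of t] by linarith
    then show ?thesis using mult_pos_pos[of p t] p that by (simp add: zero_le_mult_iff not_le[symmetric] del: not_le)
  qed
  have "(\<lambda>n. LINT x|M. dual_map p (w x + inverse (real (Suc n)) *\<^sub>R z x) \<bullet> z x) \<longlonglongrightarrow> (LINT x|M. dual_map p (w x) \<bullet> z x)"
  proof (rule integral_dominated_convergence[where w = "\<lambda>x. 2 powr p * (norm (w x) powr p + norm (z x) powr p)"])
    show "integrable M (\<lambda>x. 2 powr p * (norm (w x) powr p + norm (z x) powr p))"
      using Lp_integrable[OF w] Lp_integrable[OF z] by auto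
    have "(\<lambda>n. dual_map p (w x + inverse (real (Suc n)) *\<^sub>R z x)) \<longlonglongrightarrow> dual_map p (w x)" for x
    proof -
      have "(\<lambda>n. w x + inverse (real (Suc n)) *\<^sub>R z x) \<longlonglongrightarrow> w x + 0 *\<^sub>R z x"
        by (intro tendsto_intros LIMSEQ_inverse_real_of_nat)
      then show ?thesis
        using continuous_on_tendsto_compose[OF continuous_dual_map[OF p], of _ "w x"] by simp
    qed
    then show "AE x in M. (\<lambda>n. dual_map p (w x + inverse (real (Suc n)) *\<^sub>R z x) \<bullet> z x) \<longlonglongrightarrow> dual_map p (w x) \<bullet> z x"
      by (intro AE_I2 tendsto_intros)
    fix n
    show "AE x in M. norm (dual_map p (w x + inverse (real (Suc n)) *\<^sub>R z x) \<bullet> z x) \<le> 2 powr p * (norm (w x) powr p + norm (z x) powr p)"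
    proof (rule AE_I2)
      fix x
      define t where "t = inverse (real (Suc n))"
      have t: "0 \<le> t" "t \<le> 1" by (auto simp: t_def field_simps)
      \<comment> \<open>Both factors of the inner product are controlled by c, the duality map by
        \<open>c powr (p - 1)\<close> and z by c itself; the product \<open>c powr p\<close> has an
        integrable bound independent of n.\<close>
      define c where "c = norm (w x) + norm (z x)"
      have c0: "0 \<le> c" by (simp add: c_def)
      have "norm (w x + t *\<^sub>R z x) \<le> c"
        using norm_triangle_ineq[of "w x" "t *\<^sub>R z x"] t mult_left_le_one_le[of "norm (z x)" t] by (auto simp: c_def)
      then have "norm (dual_map p (w x + t *\<^sub>R z x)) \<le> c powr (p - 1)"
        unfolding norm_dual_map using p by (intro powr_mono2) auto
      moreover have "norm (z x) \<le> c" by (simp add: c_def)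
      ultimately have "norm (dual_map p (w x + t *\<^sub>R z x) \<bullet> z x) \<le> c powr (p - 1) * c"
        by (intro order_trans[OF Cauchy_Schwarz_ineq2[unfolded real_norm_def[symmetric]]] mult_mono) (auto simp: c_def)
      also have "c powr (p - 1) * c = c powr p"
      proof (cases "c = 0")
        case False
        show ?thesis using powr_mult_base[OF c0, of "p - 1"] by (simp add: mult.commute)
      qed (use p in simp)
      also have "c powr p \<le> 2 powr p * (norm (w x) powr p + norm (z x) powr p)"
        unfolding c_def using p by (intro powr_add_le) auto
      finally show "norm (dual_map p (w x + inverse (real (Suc n)) *\<^sub>R z x) \<bullet> z x) \<le> 2 powr p * (norm (w x) powr p + norm (z x) powr p)"
        by (simp add: t_def)
    qed
  qed (use p in measurable)
  then show ?thesis using pos by (intro LIMSEQ_le_const) auto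
qed

lemma Lp_min_orthogonal:
  fixes w z :: "'a \<Rightarrow> 'b::euclidean_space"
  assumes p: "1 < p" and w: "w \<in> Lp p M" and z: "z \<in> Lp p M"
    and min: "\<And>t. Lp_int p M w \<le> Lp_int p M (\<lambda>x. w x + t *\<^sub>R z x)"
  shows "(LINT x|M. dual_map p (w x) \<bullet> z x) = 0"
proof -
  have "Lp_int p M w \<le> Lp_int p M (\<lambda>x. w x + t *\<^sub>R (- z x))" for t
    using min[of "- t"] by simp
  then have "0 \<le> (LINT x|M. dual_map p (w x) \<bullet> (- z x))"
    by (intro Lp_min_orthogonal_aux p w Lp_minus z)
  then show ?thesis using Lp_min_orthogonal_aux[OF p w z min] by simp
qed

text \<open>The separating functional is the duality map of the nearest-point residual.\<close>

lemma Lp_separation: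
  fixes f :: "'a \<Rightarrow> 'b::euclidean_space"
  assumes p: "1 < p" and S: "lin_sub S" and f: "f \<in> Lp p M" "f \<notin> Lp_closure p M S"
  obtains w z where "z \<in> Lp_closure p M S" "w \<in> Lp p M" "\<And>x. w x = f x - z x" "0 < Lp_int p M w"
    "\<And>s. s \<in> Lp_closure p M S \<Longrightarrow> (LINT x|M. dual_map p (w x) \<bullet> s x) = 0"
    "(LINT x|M. dual_map p (w x) \<bullet> f x) = Lp_int p M w"
proof -
  have p0: "0 < p" using p by simp
  let ?Z = "Lp_closure p M S"
  have Z: "lin_sub ?Z" by (rule lin_sub_Lp_closure[OF p0 S])
  have ZL: "z \<in> Lp p M" if "z \<in> ?Z" for z using that Lp_closure_subset by blast
  \<comment> \<open>The residuals of f against the closure. A minimizer is \<open>f - z\<close> for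
    a nearest point z, and adding multiples of elements of the closure does not leave
    \<open>K\<close>, which is what the orthogonality argument requires.\<close>
  define K where "K = (\<lambda>z x. f x - z x) ` ?Z"
  have Zlin: "(\<lambda>x. a *\<^sub>R g x + b *\<^sub>R h x) \<in> ?Z" if "g \<in> ?Z" "h \<in> ?Z" for g h a b
    using Z that by (auto simp: lin_sub_def)
  have "K \<subseteq> Lp p M" using ZL Lp_diff(1)[OF f(1) _ p0] by (auto simp: K_def)
  moreover have "K \<noteq> {}" using Z by (auto simp: K_def lin_sub_def)
  moreover have "\<forall>g\<in>K. \<forall>h\<in>K. (\<lambda>x. (1/2) *\<^sub>R (g x + h x)) \<in> K"
  proof (intro ballI)
    fix g h assume gh: "g \<in> K" "h \<in> K"
    obtain y z where yz: "y \<in> ?Z" "z \<in> ?Z" and eq: "g = (\<lambda>x. f x - y x)" "h = (\<lambda>x. f x - z x)"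
      using gh by (auto simp: K_def)
    have "(\<lambda>x. (1/2) *\<^sub>R (g x + h x)) = (\<lambda>x. f x - ((1/2) *\<^sub>R y x + (1/2) *\<^sub>R z x))"
    proof
      fix x
      have "f x = (1/2) *\<^sub>R f x + (1/2) *\<^sub>R f x" by (simp flip: scaleR_left.add)
      then show "(1/2) *\<^sub>R (g x + h x) = f x - ((1/2) *\<^sub>R y x + (1/2) *\<^sub>R z x)"
        unfolding eq by (simp add: algebra_simps)
    qed
    then show "(\<lambda>x. (1/2) *\<^sub>R (g x + h x)) \<in> K"
      using Zlin[OF yz, of "1/2" "1/2"] by (auto simp: K_def)
  qed
  moreover have "\<forall>s g. (\<forall>n. s n \<in> K) \<longrightarrow> g \<in> Lp p M \<longrightarrow> (\<lambda>n. Lp_int p M (\<lambda>x. s n x - g x)) \<longlonglongrightarrow> 0 \<longrightarrow> g \<in> K"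
  proof (intro allI impI)
    fix s :: "nat \<Rightarrow> 'a \<Rightarrow> 'b" and g
    assume s: "\<forall>n. s n \<in> K" and g: "g \<in> Lp p M" "(\<lambda>n. Lp_int p M (\<lambda>x. s n x - g x)) \<longlonglongrightarrow> 0"
    have "\<forall>n. \<exists>z\<in>?Z. s n = (\<lambda>x. f x - z x)" using s by (auto simp: K_def)
    then obtain z where z: "\<And>n. z n \<in> ?Z" "\<And>n. s n = (\<lambda>x. f x - z n x)" by metis
    have "(\<lambda>x. f x - g x) \<in> ?Z"
    proof (rule Lp_closure_closed[OF p0 _ z(1)])
      show "(\<lambda>x. f x - g x) \<in> Lp p M" by (intro Lp_diff f g p0)
      have "Lp_int p M (\<lambda>x. z n x - (f x - g x)) = Lp_int p M (\<lambda>x. s n x - g x)" for n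
        unfolding z(2) by (subst Lp_int_diff_commute) (simp add: algebra_simps)
      then show "(\<lambda>n. Lp_int p M (\<lambda>x. z n x - (f x - g x))) \<longlonglongrightarrow> 0" using g(2) by simp
    qed
    then show "g \<in> K" unfolding K_def by (rule rev_image_eqI) simp
  qed
  ultimately obtain w where w: "w \<in> K" "\<And>k. k \<in> K \<Longrightarrow> Lp_int p M w \<le> Lp_int p M k"
    by (rule Lp_min_norm[OF p]) (rule that; assumption)
  obtain z where z: "z \<in> ?Z" "w = (\<lambda>x. f x - z x)" using w(1) by (auto simp: K_def)
  have wL: "w \<in> Lp p M" using w(1) \<open>K \<subseteq> Lp p M\<close> by auto
  have orth: "(LINT x|M. dual_map p (w x) \<bullet> s x) = 0" if s: "s \<in> ?Z" for s
  proof (rule Lp_min_orthogonal[OF p wL ZL[OF s]])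
    fix t
    have "(\<lambda>x. w x + t *\<^sub>R s x) = (\<lambda>x. f x - (1 *\<^sub>R z x + (- t) *\<^sub>R s x))" by (auto simp: z(2))
    also have "\<dots> \<in> K" unfolding K_def by (intro imageI Zlin z s)
    finally show "Lp_int p M w \<le> Lp_int p M (\<lambda>x. w x + t *\<^sub>R s x)" by (rule w(2))
  qed
  obtain q where pq: "conj_exp p q" using conj_exp_exists[OF p] by blast
  note int = Lp_pairing(1)[OF pq _ Lp_dual_map(1)[OF pq wL]]
  show thesis
  proof (rule that[OF z(1) wL _ _ orth])
    show "w x = f x - z x" for x by (simp add: z(2))
    show "0 < Lp_int p M w"
    proof (rule ccontr)
      assume "\<not> 0 < Lp_int p M w"
      then have "Lp_int p M w = 0" using Lp_int_nonneg[of p M w] by linarith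
      then have "(\<lambda>n::nat. Lp_int p M (\<lambda>x. z x - f x)) \<longlonglongrightarrow> 0"
        by (subst Lp_int_diff_commute) (simp add: z(2))
      then show False using Lp_closure_closed[OF p0 f(1), of "\<lambda>_. z"] z(1) f(2) by simp
    qed
    have "(LINT x|M. dual_map p (w x) \<bullet> f x) = (LINT x|M. dual_map p (w x) \<bullet> w x + dual_map p (w x) \<bullet> z x)"
      by (simp add: z(2) flip: inner_add_right)
    also have "\<dots> = (LINT x|M. dual_map p (w x) \<bullet> w x) + (LINT x|M. dual_map p (w x) \<bullet> z x)"
      by (intro Bochner_Integration.integral_add int wL ZL z)
    also have "\<dots> = Lp_int p M w" by (simp add: orth[OF z(1)] dual_map_inner Lp_int_def)
    finally show "(LINT x|M. dual_map p (w x) \<bullet> f x) = Lp_int p M w" .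
  qed
qed

section \<open>Bounded functionals and their representation\<close>

lemma Lp_dual_bound:
  assumes "\<Lambda> \<in> Lp_dual p M"
  obtains C where "0 \<le> C" "\<And>f. f \<in> Lp p M \<Longrightarrow> \<bar>\<Lambda> f\<bar> \<le> C * Lp_norm p M f"
proof -
  have "\<exists>C. \<forall>f\<in>Lp p M. \<bar>\<Lambda> f\<bar> \<le> C * Lp_norm p M f"
    using assms by (auto simp: Lp_dual_def)
  then obtain C where C: "\<And>f. f \<in> Lp p M \<Longrightarrow> \<bar>\<Lambda> f\<bar> \<le> C * Lp_norm p M f"
    by blast
  have "\<bar>\<Lambda> f\<bar> \<le> \<bar>C\<bar> * Lp_norm p M f" if "f \<in> Lp p M" for f
  proof -
    have "C * Lp_norm p M f \<le> \<bar>C\<bar> * Lp_norm p M f"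
      by (intro mult_right_mono) (auto simp: Lp_norm_int)
    then show ?thesis using C[OF that] by simp
  qed
  then show thesis by (intro that[of "\<bar>C\<bar>"]) auto
qed

lemma Lp_dual_linear:
  assumes "\<Lambda> \<in> Lp_dual p M" "f \<in> Lp p M" "g \<in> Lp p M"
  shows "\<Lambda> (\<lambda>x. a * f x + b * g x) = a * \<Lambda> f + b * \<Lambda> g"
    and "\<Lambda> (\<lambda>x. f x + g x) = \<Lambda> f + \<Lambda> g" and "\<Lambda> (\<lambda>x. f x - g x) = \<Lambda> f - \<Lambda> g"
    and "\<Lambda> (\<lambda>x. a * f x) = a * \<Lambda> f"
proof -
  have *: "\<Lambda> (\<lambda>x. a * f x + b * g x) = a * \<Lambda> f + b * \<Lambda> g" for a b
    using assms by (auto simp: Lp_dual_def)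
  show "\<Lambda> (\<lambda>x. a * f x + b * g x) = a * \<Lambda> f + b * \<Lambda> g" by (rule *)
  show "\<Lambda> (\<lambda>x. f x + g x) = \<Lambda> f + \<Lambda> g" "\<Lambda> (\<lambda>x. f x - g x) = \<Lambda> f - \<Lambda> g" "\<Lambda> (\<lambda>x. a * f x) = a * \<Lambda> f"
    using *[of 1 1] *[of 1 "-1"] *[of a 0] by auto
qed

lemma Lp_dual_tendsto:
  assumes "0 < p" "\<Lambda> \<in> Lp_dual p M" "\<And>n. s n \<in> Lp p M" "f \<in> Lp p M"
    "((\<lambda>n. Lp_int p M (\<lambda>x. s n x - f x)) \<longlongrightarrow> 0) F"
  shows "((\<lambda>n. \<Lambda> (s n)) \<longlongrightarrow> \<Lambda> f) F"
proof -
  obtain C where C: "\<And>f. f \<in> Lp p M \<Longrightarrow> \<bar>\<Lambda> f\<bar> \<le> C * Lp_norm p M f"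
    using Lp_dual_bound[OF assms(2)] by metis
  have "((\<lambda>n. C * Lp_int p M (\<lambda>x. s n x - f x) powr (1/p)) \<longlongrightarrow> 0) F"
    using tendsto_mult_right_zero[OF powr_null[OF assms(5), of "1/p"]] assms(1) by simp
  then have "((\<lambda>n. \<Lambda> (s n) - \<Lambda> f) \<longlongrightarrow> 0) F"
  proof (rule Lim_null_comparison[rotated], intro always_eventually allI)
    fix n
    show "norm (\<Lambda> (s n) - \<Lambda> f) \<le> C * Lp_int p M (\<lambda>x. s n x - f x) powr (1/p)"
      using C[OF Lp_diff(1)[OF assms(3,4,1)], of n] Lp_dual_linear(3)[OF assms(2,3,4)]
      by (simp add: Lp_norm_int)
  qed
  then show ?thesis by (simp add: LIM_zero_iff)
qed

lemma Lp_dual_cong_AE: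
  assumes "0 < p" "\<Lambda> \<in> Lp_dual p M" "f \<in> Lp p M" "g \<in> borel_measurable M" "AE x in M. f x = g x"
  shows "\<Lambda> g = \<Lambda> f"
proof -
  have g: "g \<in> Lp p M" by (rule Lp_cong_AE(1)[OF assms(3-5)])
  have "Lp_int p M (\<lambda>x. f x - g x) = 0"
    using Lp_int_eq_0[OF Lp_diff(1)[OF assms(3) g assms(1)]] assms(5) by auto
  then have "((\<lambda>n::nat. \<Lambda> f) \<longlonglongrightarrow> \<Lambda> g)"
    by (intro Lp_dual_tendsto[OF assms(1,2) assms(3) g]) simp
  then show ?thesis by (simp add: LIMSEQ_const_iff)
qed

text \<open>The minimizer w of \<open>Lp_int\<close> on the hyperplane where \<Lambda> equals 1 is
  orthogonal, through its duality map, to the kernel of \<Lambda>. As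
  \<open>f - \<Lambda> f * w\<close> lies in that kernel, \<Lambda> is the pairing with
  \<open>dual_map p w\<close>, divided by \<open>Lp_int p M w\<close>.\<close>

lemma Lp_Riesz:
  fixes \<Lambda> :: "('a \<Rightarrow> real) \<Rightarrow> real" and M :: "'a measure"
  assumes pq: "conj_exp p q" and \<Lambda>: "\<Lambda> \<in> Lp_dual p M"
  obtains h where "h \<in> Lp q M" "\<And>f. f \<in> Lp p M \<Longrightarrow> \<Lambda> f = (LINT x|M. h x * f x)"
proof (cases "\<forall>f\<in>Lp p M. \<Lambda> f = 0")
  case True
  then show thesis by (intro that[of "\<lambda>_. 0"]) auto
next
  case False
  note p = conj_expD(1)[OF pq]
  have p0: "0 < p" using p by simp
  obtain C where C: "0 \<le> C" "\<And>f. f \<in> Lp p M \<Longrightarrow> \<bar>\<Lambda> f\<bar> \<le> C * Lp_norm p M f"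
    using Lp_dual_bound[OF \<Lambda>] by metis
  obtain f0 where f0: "f0 \<in> Lp p M" "\<Lambda> f0 \<noteq> 0" using False by auto
  define K :: "('a \<Rightarrow> real) set" where "K = {f \<in> Lp p M. \<Lambda> f = 1}"
  have "K \<subseteq> Lp p M" by (auto simp: K_def)
  moreover have "(\<lambda>x. (1 / \<Lambda> f0) * f0 x) \<in> K"
    using f0 Lp_mult(1)[OF f0(1), of "1 / \<Lambda> f0"] Lp_dual_linear(4)[OF \<Lambda> f0(1) f0(1), of "1 / \<Lambda> f0"]
    by (simp add: K_def)
  then have "K \<noteq> {}" by blast
  moreover have "\<forall>f\<in>K. \<forall>g\<in>K. (\<lambda>x. (1/2) *\<^sub>R (f x + g x)) \<in> K"
  proof (intro ballI)
    fix f g assume "f \<in> K" "g \<in> K"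
    then show "(\<lambda>x. (1/2) *\<^sub>R (f x + g x)) \<in> K"
      using Lp_lincomb[of f p M g "1/2" "1/2"] Lp_dual_linear(1)[OF \<Lambda>, of f g "1/2" "1/2"] p0
      by (simp add: K_def add_divide_distrib)
  qed
  moreover have "\<forall>s f. (\<forall>n. s n \<in> K) \<longrightarrow> f \<in> Lp p M \<longrightarrow> (\<lambda>n. Lp_int p M (\<lambda>x. s n x - f x)) \<longlonglongrightarrow> 0 \<longrightarrow> f \<in> K"
  proof (intro allI impI)
    fix s f assume "\<forall>n. s n \<in> K" "f \<in> Lp p M" "(\<lambda>n. Lp_int p M (\<lambda>x. s n x - f x)) \<longlonglongrightarrow> 0"
    then have "(\<lambda>n. \<Lambda> (s n)) \<longlonglongrightarrow> \<Lambda> f" by (intro Lp_dual_tendsto[OF p0 \<Lambda>]) (auto simp: K_def)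
    then show "f \<in> K" using \<open>\<forall>n. s n \<in> K\<close> \<open>f \<in> Lp p M\<close> by (simp add: K_def LIMSEQ_const_iff)
  qed
  ultimately obtain w where w: "w \<in> K" "\<And>k. k \<in> K \<Longrightarrow> Lp_int p M w \<le> Lp_int p M k"
    by (rule Lp_min_norm[OF p]) (rule that; assumption)
  have wL: "w \<in> Lp p M" "\<Lambda> w = 1" using w(1) by (auto simp: K_def)
  \<comment> \<open>A vanishing norm would force \<Lambda> to vanish at w by boundedness, whereas
    its value there is 1.\<close>
  have I: "Lp_int p M w \<noteq> 0" using C(2)[OF wL(1)] wL(2) by (auto simp: Lp_norm_int)
  have Jw: "(\<lambda>x. dual_map p (w x)) \<in> Lp q M" by (rule Lp_dual_map(1)[OF pq wL(1)])
  show thesis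
  proof (rule that[of "\<lambda>x. (1 / Lp_int p M w) * dual_map p (w x)"])
    show "(\<lambda>x. (1 / Lp_int p M w) * dual_map p (w x)) \<in> Lp q M" by (rule Lp_mult(1)[OF Jw])
    fix f :: "'a \<Rightarrow> real" assume f: "f \<in> Lp p M"
    define z where "z x = f x - \<Lambda> f * w x" for x
    have zL: "z \<in> Lp p M" unfolding z_def by (intro Lp_diff Lp_mult f wL p0)
    have "\<Lambda> z = 0"
      using Lp_dual_linear(1)[OF \<Lambda> f wL(1), of 1 "- \<Lambda> f"] wL by (simp add: z_def[abs_def])
    have "(LINT x|M. dual_map p (w x) \<bullet> z x) = 0"
    proof (rule Lp_min_orthogonal[OF p wL(1) zL])
      fix t
      have "(\<lambda>x. w x + t *\<^sub>R z x) \<in> K"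
        using Lp_dual_linear(1)[OF \<Lambda> wL(1) zL, of 1 t] wL \<open>\<Lambda> z = 0\<close> Lp_lincomb[OF wL(1) zL p0, of 1 t]
        by (simp add: K_def)
      then show "Lp_int p M w \<le> Lp_int p M (\<lambda>x. w x + t *\<^sub>R z x)" by (rule w(2))
    qed
    moreover have "(LINT x|M. dual_map p (w x) \<bullet> z x)
        = (LINT x|M. dual_map p (w x) * f x - \<Lambda> f * (dual_map p (w x) \<bullet> w x))"
      by (simp add: z_def algebra_simps)
    moreover have "\<dots> = (LINT x|M. dual_map p (w x) * f x) - \<Lambda> f * (LINT x|M. dual_map p (w x) \<bullet> w x)"
      using Lp_pairing(1)[OF pq f Jw] Lp_pairing(1)[OF pq wL(1) Jw]
      by (subst Bochner_Integration.integral_diff) auto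
    moreover have "(LINT x|M. dual_map p (w x) \<bullet> w x) = Lp_int p M w"
      by (simp only: dual_map_inner Lp_int_def)
    ultimately have eq: "(LINT x|M. dual_map p (w x) * f x) = \<Lambda> f * Lp_int p M w" by simp
    have "(LINT x|M. 1 / Lp_int p M w * dual_map p (w x) * f x)
        = (1 / Lp_int p M w) * (LINT x|M. dual_map p (w x) * f x)"
      by (simp only: mult.assoc Bochner_Integration.integral_mult_right_zero)
    then show "\<Lambda> f = (LINT x|M. 1 / Lp_int p M w * dual_map p (w x) * f x)"
      using eq I by simp
  qed
qed


section \<open>Weak convergence\<close>

lemma Lp_weak_conv_subseq:
  assumes "Lp_weak_conv p M f g" "strict_mono r"
  shows "Lp_weak_conv p M (\<lambda>n. f (r n)) g"
  using assms LIMSEQ_subseq_LIMSEQ[of "\<lambda>n. \<Lambda> (f n)" "\<Lambda> g" r for \<Lambda>]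
  by (auto simp: Lp_weak_conv_def o_def)

lemma Lp_weak_conv_add:
  assumes "Lp_weak_conv p M f g" "Lp_weak_conv p M f' g'" "0 < p"
  shows "Lp_weak_conv p M (\<lambda>n x. f n x + f' n x) (\<lambda>x. g x + g' x)"
  unfolding Lp_weak_conv_def
proof (intro conjI allI ballI)
  fix \<Lambda> assume \<Lambda>: "\<Lambda> \<in> Lp_dual p M"
  have "\<Lambda> (\<lambda>x. f n x + f' n x) = \<Lambda> (f n) + \<Lambda> (f' n)" "\<Lambda> (\<lambda>x. g x + g' x) = \<Lambda> g + \<Lambda> g'" for n
    using assms by (auto intro!: Lp_dual_linear(2)[OF \<Lambda>] simp: Lp_weak_conv_def)
  then show "(\<lambda>n. \<Lambda> (\<lambda>x. f n x + f' n x)) \<longlonglongrightarrow> \<Lambda> (\<lambda>x. g x + g' x)"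
    using assms \<Lambda> by (auto intro!: tendsto_add simp: Lp_weak_conv_def)
qed (use assms in \<open>auto intro!: Lp_add simp: Lp_weak_conv_def\<close>)

lemma Lp_weak_conv_uminus:
  assumes "Lp_weak_conv p M f g"
  shows "Lp_weak_conv p M (\<lambda>n x. - f n x) (\<lambda>x. - g x)"
  unfolding Lp_weak_conv_def
proof (intro conjI allI ballI)
  fix \<Lambda> assume \<Lambda>: "\<Lambda> \<in> Lp_dual p M"
  have "\<Lambda> (\<lambda>x. - f n x) = - \<Lambda> (f n)" "\<Lambda> (\<lambda>x. - g x) = - \<Lambda> g" for n
    using assms Lp_dual_linear(4)[OF \<Lambda>, of "f n" "f n" "-1"] Lp_dual_linear(4)[OF \<Lambda>, of g g "-1"]
    by (auto simp: Lp_weak_conv_def)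
  then show "(\<lambda>n. \<Lambda> (\<lambda>x. - f n x)) \<longlonglongrightarrow> \<Lambda> (\<lambda>x. - g x)"
    using assms \<Lambda> by (auto intro!: tendsto_minus simp: Lp_weak_conv_def)
qed (use assms in \<open>auto intro!: Lp_minus simp: Lp_weak_conv_def\<close>)

lemma Lp_weak_conv_diff:
  assumes "Lp_weak_conv p M f g" "Lp_weak_conv p M f' g'" "0 < p"
  shows "Lp_weak_conv p M (\<lambda>n x. f n x - f' n x) (\<lambda>x. g x - g' x)"
  using Lp_weak_conv_add[OF assms(1) Lp_weak_conv_uminus[OF assms(2)] assms(3)] by simp

lemma Lp_strong_imp_weak:
  assumes "0 < p" "\<And>n. f n \<in> Lp p M" "g \<in> Lp p M" "(\<lambda>n. Lp_int p M (\<lambda>x. f n x - g x)) \<longlonglongrightarrow> 0"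
  shows "Lp_weak_conv p M f g"
  using assms Lp_dual_tendsto[OF assms(1) _ assms(2,3,4)] by (auto simp: Lp_weak_conv_def)

lemma Lp_weak_conv_cong_AE:
  assumes "0 < p" "Lp_weak_conv p M f g"
    "\<And>n. f' n \<in> borel_measurable M" "\<And>n. AE x in M. f n x = f' n x"
    "g' \<in> borel_measurable M" "AE x in M. g x = g' x"
  shows "Lp_weak_conv p M f' g'"
proof -
  have f: "f n \<in> Lp p M" and g: "g \<in> Lp p M" for n using assms(2) by (auto simp: Lp_weak_conv_def)
  have "(\<lambda>n. \<Lambda> (f' n)) \<longlonglongrightarrow> \<Lambda> g'" if \<Lambda>: "\<Lambda> \<in> Lp_dual p M" for \<Lambda>
    unfolding Lp_dual_cong_AE[OF assms(1) \<Lambda> f assms(3,4)] Lp_dual_cong_AE[OF assms(1) \<Lambda> g assms(5,6)]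
    using assms(2) \<Lambda> by (auto simp: Lp_weak_conv_def)
  then show ?thesis
    using Lp_cong_AE(1)[OF f assms(3,4)] Lp_cong_AE(1)[OF g assms(5,6)]
    by (auto simp: Lp_weak_conv_def)
qed

text \<open>A bounded operator preserves weak convergence, because a functional composed with it is
  a functional again. Linearity is asked almost everywhere only: mollification in x is additive just
  on the slices that are p-integrable.\<close>

lemma Lp_weak_conv_operator:
  fixes A :: "('a \<Rightarrow> real) \<Rightarrow> ('b \<Rightarrow> real)"
  assumes p: "0 < p" and f: "Lp_weak_conv p M f g"
    and A: "\<And>f. f \<in> Lp p M \<Longrightarrow> A f \<in> Lp p N"
      "\<And>f. f \<in> Lp p M \<Longrightarrow> Lp_int p N (A f) \<le> C * Lp_int p M f" "0 \<le> C"
      "\<And>f g a b. f \<in> Lp p M \<Longrightarrow> g \<in> Lp p M \<Longrightarrow>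
        AE x in N. A (\<lambda>x. a * f x + b * g x) x = a * A f x + b * A g x"
  shows "Lp_weak_conv p N (\<lambda>n. A (f n)) (A g)"
  unfolding Lp_weak_conv_def
proof (intro conjI allI ballI)
  fix \<Lambda> assume \<Lambda>: "\<Lambda> \<in> Lp_dual p N"
  obtain K where K: "0 \<le> K" "\<And>f. f \<in> Lp p N \<Longrightarrow> \<bar>\<Lambda> f\<bar> \<le> K * Lp_norm p N f"
    using Lp_dual_bound[OF \<Lambda>] by metis
  have "(\<lambda>f. \<Lambda> (A f)) \<in> Lp_dual p M"
    unfolding Lp_dual_def mem_Collect_eq
  proof (intro conjI ballI allI exI)
    fix f :: "'a \<Rightarrow> real" assume f: "f \<in> Lp p M"
    have "Lp_norm p N (A f) \<le> (C * Lp_int p M f) powr (1/p)"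
      unfolding Lp_norm_int using p A(2)[OF f] by (intro powr_mono2) auto
    also have "\<dots> = C powr (1/p) * Lp_norm p M f" using A(3) by (simp add: powr_mult Lp_norm_int)
    finally have "K * Lp_norm p N (A f) \<le> K * (C powr (1/p) * Lp_norm p M f)"
      using K(1) by (intro mult_left_mono)
    then show "\<bar>\<Lambda> (A f)\<bar> \<le> (K * C powr (1/p)) * Lp_norm p M f"
      using K(2)[OF A(1)[OF f]] by (simp add: mult.assoc)
    fix g :: "'a \<Rightarrow> real" and a b assume g: "g \<in> Lp p M"
    have fg: "(\<lambda>x. a * f x + b * g x) \<in> Lp p M" by (intro Lp_add Lp_mult f g p)
    have "\<Lambda> (A (\<lambda>x. a * f x + b * g x)) = \<Lambda> (\<lambda>x. a * A f x + b * A g x)"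
      by (rule Lp_dual_cong_AE[OF p \<Lambda>])
         (use A(4)[OF f g, of a b] in \<open>auto intro!: Lp_add Lp_mult A f g p Lp_measurable[of _ p] fg elim!: eventually_mono\<close>)
    then show "\<Lambda> (A (\<lambda>x. a * f x + b * g x)) = a * \<Lambda> (A f) + b * \<Lambda> (A g)"
      using Lp_dual_linear(1)[OF \<Lambda> A(1)[OF f] A(1)[OF g]] by simp
  qed
  then show "(\<lambda>n. \<Lambda> (A (f n))) \<longlonglongrightarrow> \<Lambda> (A g)" using f by (auto simp: Lp_weak_conv_def)
qed (use f A in \<open>auto simp: Lp_weak_conv_def\<close>)

text \<open>The test functional is the pairing with the duality map of \<open>g - h\<close>; on that
  same difference it evaluates to the \<open>Lp_int\<close> of the difference.\<close>

lemma Lp_weak_conv_unique: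
  assumes p: "1 < p" and f: "Lp_weak_conv p M f g" "Lp_weak_conv p M f h"
  shows "AE x in M. g x = h x"
proof -
  obtain q where pq: "conj_exp p q" using conj_exp_exists[OF p] by blast
  have g: "g \<in> Lp p M" "h \<in> Lp p M" using f by (auto simp: Lp_weak_conv_def)
  have p0: "0 < p" using p by simp
  have d: "(\<lambda>x. g x - h x) \<in> Lp p M" by (intro Lp_diff g p0)
  define \<Lambda> where "\<Lambda> f = (LINT x|M. dual_map p (g x - h x) * f x)" for f
  have \<Lambda>: "\<Lambda> \<in> Lp_dual p M"
    unfolding \<Lambda>_def by (rule Lp_pairing_dual[OF pq Lp_dual_map(1)[OF pq d]])
  have "\<Lambda> g = \<Lambda> h" using f \<Lambda> by (auto simp: Lp_weak_conv_def intro: LIMSEQ_unique)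
  then have "\<Lambda> (\<lambda>x. g x - h x) = 0" using Lp_dual_linear(3)[OF \<Lambda> g] by simp
  moreover have "\<Lambda> (\<lambda>x. g x - h x) = Lp_int p M (\<lambda>x. g x - h x)"
    unfolding \<Lambda>_def Lp_int_def dual_map_inner[symmetric] by simp
  ultimately show ?thesis using Lp_int_eq_0[OF d] by simp
qed

section \<open>Components of vector fields\<close>

lemma Lp_component:
  fixes f :: "'a \<Rightarrow> real ^ 'd"
  assumes "f \<in> Lp p M" "0 \<le> p"
  shows "(\<lambda>x. f x $ i) \<in> Lp p M" "Lp_int p M (\<lambda>x. f x $ i) \<le> Lp_int p M f"
proof -
  have m: "(\<lambda>x. f x $ i) \<in> borel_measurable M"
    by (intro measurable_compose[OF Lp_measurable[OF assms(1)]] borel_measurable_continuous_onI continuous_intros)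
  have le: "AE x in M. norm (f x $ i) \<le> norm (f x)" using component_le_norm_cart by auto
  show "(\<lambda>x. f x $ i) \<in> Lp p M" "Lp_int p M (\<lambda>x. f x $ i) \<le> Lp_int p M f"
    by (rule Lp_mono[OF assms(1) m le assms(2)])+
qed

lemma Lp_axis:
  fixes f :: "'a \<Rightarrow> real"
  assumes "f \<in> Lp p M"
  shows "(\<lambda>x. axis (i::'d::finite) (f x)) \<in> Lp p M" "Lp_int p M (\<lambda>x. axis (i::'d) (f x)) = Lp_int p M f"
proof -
  have eq: "axis i (f x) = f x *\<^sub>R axis i 1" for x by (simp add: vec_eq_iff axis_def)
  show "(\<lambda>x. axis (i::'d) (f x)) \<in> Lp p M" "Lp_int p M (\<lambda>x. axis (i::'d) (f x)) = Lp_int p M f"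
    unfolding eq using assms by (auto simp: Lp_def Lp_int_def norm_axis_1)
qed

lemma vec_sum_axis: "(\<chi> i. (v i :: real)) = (\<Sum>i\<in>UNIV. axis i (v i))"
  by (simp add: vec_eq_iff sum_component axis_def)

lemma Lp_vec:
  fixes f :: "'d::finite \<Rightarrow> 'a \<Rightarrow> real"
  assumes "\<And>i. f i \<in> Lp p M" "0 < p"
  shows "(\<lambda>x. \<chi> i. f i x) \<in> Lp p M"
  unfolding vec_sum_axis using assms by (intro Lp_sum Lp_axis) auto

lemma Lp_int_sum_tendsto:
  assumes p: "0 < p" and f: "\<And>i n. i \<in> I \<Longrightarrow> f i n \<in> Lp p M"
    and lim: "\<And>i. i \<in> I \<Longrightarrow> ((\<lambda>n. Lp_int p M (f i n)) \<longlongrightarrow> 0) F"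
  shows "((\<lambda>n. Lp_int p M (\<lambda>x. \<Sum>i\<in>I. f i n x)) \<longlongrightarrow> 0) F"
  using f lim
proof (induction I rule: infinite_finite_induct)
  case (insert i I)
  have "((\<lambda>n. 2 powr p * (Lp_int p M (f i n) + Lp_int p M (\<lambda>x. \<Sum>i\<in>I. f i n x))) \<longlongrightarrow> 2 powr p * (0 + 0)) F"
    using insert by (intro tendsto_intros) auto
  then have lim: "((\<lambda>n. 2 powr p * (Lp_int p M (f i n) + Lp_int p M (\<lambda>x. \<Sum>i\<in>I. f i n x))) \<longlongrightarrow> 0) F"
    by simp
  show ?case
  proof (rule tendsto_sandwich[OF _ _ tendsto_const lim])
    show "\<forall>\<^sub>F n in F. Lp_int p M (\<lambda>x. \<Sum>i\<in>insert i I. f i n x)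
        \<le> 2 powr p * (Lp_int p M (f i n) + Lp_int p M (\<lambda>x. \<Sum>i\<in>I. f i n x))"
    proof (intro always_eventually allI)
      fix n
      have "(\<lambda>x. \<Sum>i\<in>I. f i n x) \<in> Lp p M" using insert by (intro Lp_sum p) auto
      then show "Lp_int p M (\<lambda>x. \<Sum>i\<in>insert i I. f i n x)
          \<le> 2 powr p * (Lp_int p M (f i n) + Lp_int p M (\<lambda>x. \<Sum>i\<in>I. f i n x))"
        using insert Lp_add(2)[OF _ _ p, of "f i n" M "\<lambda>x. \<Sum>i\<in>I. f i n x"] by simp
    qed
  qed auto
qed auto

lemma Lp_vec_tendsto:
  fixes f :: "'d::finite \<Rightarrow> nat \<Rightarrow> 'a \<Rightarrow> real"
  assumes "\<And>i n. f i n \<in> Lp p M" "0 < p" "\<And>i. ((\<lambda>n. Lp_int p M (f i n)) \<longlongrightarrow> 0) F"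
  shows "((\<lambda>n. Lp_int p M (\<lambda>x. \<chi> i. f i n x)) \<longlongrightarrow> 0) F"
  unfolding vec_sum_axis using assms
  by (intro Lp_int_sum_tendsto Lp_axis) (simp_all only: Lp_axis(2))

text \<open>Mazur's theorem for subspaces: a separating duality map would annihilate all
  \<open>f n\<close> but not g. Weak convergence is given by components, so the pairing is first
  written as a sum over coordinates.\<close>

lemma Lp_closure_weakly_closed:
  fixes f :: "nat \<Rightarrow> 'a \<Rightarrow> real ^ 'd"
  assumes p: "1 < p" and S: "lin_sub S" and f: "\<And>n. f n \<in> Lp_closure p M S" and g: "g \<in> Lp p M"
    and lim: "\<And>i. Lp_weak_conv p M (\<lambda>n x. f n x $ i) (\<lambda>x. g x $ i)"
  shows "g \<in> Lp_closure p M S"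
proof (rule ccontr)
  assume "g \<notin> Lp_closure p M S"
  then obtain w where w: "w \<in> Lp p M" "0 < Lp_int p M w"
    "\<And>s. s \<in> Lp_closure p M S \<Longrightarrow> (LINT x|M. dual_map p (w x) \<bullet> s x) = 0"
    "(LINT x|M. dual_map p (w x) \<bullet> g x) = Lp_int p M w"
    by (rule Lp_separation[OF p S g]) (rule that; assumption)
  obtain q where pq: "conj_exp p q" using conj_exp_exists[OF p] by blast
  have p0: "0 \<le> p" and q0: "0 \<le> q" using conj_expD[OF pq] by auto
  have J: "(\<lambda>x. dual_map p (w x)) \<in> Lp q M" by (rule Lp_dual_map(1)[OF pq w(1)])
  define h where "h i x = dual_map p (w x) $ i" for i x
  have h: "h i \<in> Lp q M" for i unfolding h_def by (rule Lp_component(1)[OF J q0])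
  have split: "(LINT x|M. dual_map p (w x) \<bullet> s x) = (\<Sum>i\<in>UNIV. LINT x|M. h i x * s x $ i)"
    if "s \<in> Lp p M" for s :: "'a \<Rightarrow> real ^ 'd"
  proof -
    have "integrable M (\<lambda>x. h i x * s x $ i)" for i
      using Lp_pairing(1)[OF pq Lp_component(1)[OF that p0] h] by simp
    then show ?thesis by (simp add: inner_vec_def h_def)
  qed
  have "(\<lambda>n. \<Sum>i\<in>UNIV. LINT x|M. h i x * f n x $ i) \<longlonglongrightarrow> (\<Sum>i\<in>UNIV. LINT x|M. h i x * g x $ i)"
    using lim Lp_pairing_dual[OF pq h] unfolding Lp_weak_conv_def by (intro tendsto_sum) fast
  moreover have "(\<Sum>i\<in>UNIV. LINT x|M. h i x * f n x $ i) = 0" for n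
    using split[of "f n"] w(3)[OF f[of n]] f[of n] Lp_closure_subset by fastforce
  ultimately have "(\<Sum>i\<in>UNIV. LINT x|M. h i x * g x $ i) = 0" by (simp add: LIMSEQ_const_iff)
  then show False using split[OF g] w by simp
qed


section \<open>Tensors and weak compactness\<close>

text \<open>A countable, intersection-stable generator of the Borel sets with members of finite
  measure: countability permits a diagonal argument, stability the uniqueness argument for measures,
  finiteness puts the indicators into every L^p.\<close>

definition rat_boxes :: "'a::euclidean_space set set" where
  "rat_boxes = {box a b | a b. (\<forall>i\<in>Basis. a \<bullet> i \<in> \<rat>) \<and> (\<forall>i\<in>Basis. b \<bullet> i \<in> \<rat>)}"

lemma countable_rat_boxes: "countable (rat_boxes :: 'a::euclidean_space set set)"
proof -
  let ?R = "{a::'a. \<forall>i\<in>Basis. a \<bullet> i \<in> \<rat>}"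
  have "?R \<subseteq> (\<lambda>f. \<Sum>i\<in>Basis. f i *\<^sub>R i) ` (Basis \<rightarrow>\<^sub>E \<rat>)"
  proof
    fix a :: 'a assume "a \<in> ?R"
    moreover have "a = (\<Sum>i\<in>Basis. restrict (\<lambda>i. a \<bullet> i) Basis i *\<^sub>R i)"
      by (subst euclidean_representation[symmetric]) (auto intro!: sum.cong)
    ultimately show "a \<in> (\<lambda>f. \<Sum>i\<in>Basis. f i *\<^sub>R i) ` (Basis \<rightarrow>\<^sub>E \<rat>)"
      by (intro image_eqI[of _ _ "restrict (\<lambda>i. a \<bullet> i) Basis"]) auto
  qed
  then have "countable ?R"
    by (rule countable_subset) (auto intro!: countable_image countable_PiE countable_rat)
  then have "countable ((\<lambda>(a, b). box a b) ` (?R \<times> ?R))" by auto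
  moreover have "rat_boxes = (\<lambda>(a, b). box a b) ` (?R \<times> ?R)" by (auto simp: rat_boxes_def)
  ultimately show ?thesis by simp
qed

lemma Int_rat_boxes: "A \<in> rat_boxes \<Longrightarrow> B \<in> rat_boxes \<Longrightarrow> A \<inter> B \<in> rat_boxes"
  unfolding rat_boxes_def mem_Collect_eq
  by (elim exE conjE, simp only: box_Int_box, intro exI conjI refl ballI) (auto simp: max_def min_def)

lemma rat_boxes_borel: "B \<in> rat_boxes \<Longrightarrow> B \<in> sets borel"
  by (auto simp: rat_boxes_def)

lemma rat_boxes_finite: "B \<in> rat_boxes \<Longrightarrow> emeasure lborel B < \<infinity>"
  using emeasure_lborel_box_finite by (auto simp: rat_boxes_def)

definition nat_box :: "nat \<Rightarrow> 'a::euclidean_space set" where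
  "nat_box n = box (- real n *\<^sub>R One) (real n *\<^sub>R One)"

lemma nat_box_rat: "nat_box n \<in> rat_boxes"
  unfolding rat_boxes_def nat_box_def by (auto intro!: exI)

lemma UN_nat_box: "(\<Union>n. nat_box n) = UNIV"
  using UN_box_eq_UNIV unfolding nat_box_def by simp

lemma sets_borel_rat_boxes: "sets (borel :: 'a::euclidean_space measure) = sigma_sets UNIV rat_boxes"
proof -
  have "(borel :: 'a measure) = sigma UNIV ((\<lambda>B. B) ` rat_boxes)"
  proof (rule borel_eq_sigmaI1[OF borel_def])
    fix M :: "'a set" assume "M \<in> {S. open S}"
    then have "open M" by simp
    define a' b' where "a' f = (\<Sum>(i::'a)\<in>Basis. fst (f i :: real \<times> real) *\<^sub>R i)"
      and "b' f = (\<Sum>(i::'a)\<in>Basis. snd (f i :: real \<times> real) *\<^sub>R i)" for f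
    define I where "I = {f \<in> (Basis::'a set) \<rightarrow>\<^sub>E \<rat> \<times> \<rat>. box (a' f) (b' f) \<subseteq> M}"
    have M: "M = (\<Union>f\<in>I. box (a' f) (b' f))"
      using open_UNION_box[OF \<open>open M\<close>] unfolding I_def a'_def b'_def .
    have "countable I"
      unfolding I_def by (intro countable_Collect countable_PiE) (auto intro: countable_rat)
    moreover have "box (a' f) (b' f) \<in> sets (sigma UNIV ((\<lambda>B. B) ` rat_boxes))" if "f \<in> I" for f
    proof -
      have "f i \<in> \<rat> \<times> \<rat>" if "i \<in> Basis" for i using that \<open>f \<in> I\<close> by (auto simp: I_def)
      then have "box (a' f) (b' f) \<in> rat_boxes"
        unfolding rat_boxes_def mem_Collect_eq a'_def b'_def
        by (intro exI conjI refl ballI) (auto simp: mem_Times_iff)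
      then show ?thesis by auto
    qed
    ultimately show "M \<in> sets (sigma UNIV ((\<lambda>B. B) ` rat_boxes))"
      by (subst M, intro sets.countable_UN') auto
  qed (auto simp: rat_boxes_borel)
  then show ?thesis by (metis image_ident sets_measure_of_conv Pow_UNIV subset_UNIV)
qed

text \<open>The sets of vanishing integral form a Dynkin system, where the vanishing total integral
  takes care of complements. A function with zero integral over every measurable set is zero almost
  everywhere by uniqueness of densities.\<close>

lemma integral_zero_generator:
  fixes f :: "'a \<Rightarrow> real"
  assumes f: "integrable M f" and G: "Int_stable G" "G \<subseteq> Pow (space M)" "sets M = sigma_sets (space M) G"
    and zero: "\<And>E. E \<in> G \<Longrightarrow> (LINT x:E|M. f x) = 0" "(LINT x|M. f x) = 0"
  shows "AE x in M. f x = 0"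
proof -
  have f_set: "set_integrable M E f" if "E \<in> sets M" for E
    using integrable_mult_indicator[OF that f] unfolding set_integrable_def .
  have "(LINT x:E|M. f x) = 0" if E: "E \<in> sets M" for E
    using G(1,2) E[unfolded G(3)]
  proof (induction rule: sigma_sets_induct_disjoint)
    case (compl A)
    then have A: "A \<in> sets M" by (simp add: G(3))
    have "(LINT x:space M|M. f x) = (LINT x:A|M. f x) + (LINT x:space M - A|M. f x)"
      using A sets.sets_into_space[OF A] by (subst set_integral_Un[symmetric]) (auto intro!: f_set simp: Un_absorb1)
    then show ?case using compl zero(2) by (simp add: set_integral_space[OF f])
  next
    case (union A)
    then have A: "range A \<subseteq> sets M" by (simp add: G(3))
    have "(LINT x:(\<Union>i. A i)|M. f x) = (\<Sum>i. LINT x:A i|M. f x)"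
      using A union(1) by (intro lebesgue_integral_countable_add f_set) (auto simp: disjoint_family_on_def)
    then show ?case using union by simp
  qed (use zero in \<open>auto simp: set_lebesgue_integral_def\<close>)
  then show ?thesis using f by (intro density_unique_real[of M f "\<lambda>_. 0"]) auto
qed

lemma Lp_indicator:
  assumes "A \<in> sets M" "emeasure M A < \<infinity>"
  shows "indicat_real A \<in> Lp p M" "Lp_int p M (indicat_real A) = measure M A"
proof -
  have *: "norm (indicat_real A x) powr p = indicat_real A x" for x by (simp add: indicator_def)
  show "indicat_real A \<in> Lp p M" "Lp_int p M (indicat_real A) = measure M A"
    unfolding Lp_def Lp_int_def mem_Collect_eq * using assms by auto
qed

section \<open>Linear spans of tensors\<close>

lemma lin_subD:
  assumes "lin_sub V" "f \<in> V"
  shows "g \<in> V \<Longrightarrow> (\<lambda>x. f x + g x) \<in> V" "g \<in> V \<Longrightarrow> (\<lambda>x. f x - g x) \<in> V" "(\<lambda>x. c *\<^sub>R f x) \<in> V"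
proof -
  have *: "(\<lambda>x. a *\<^sub>R f x + b *\<^sub>R g x) \<in> V" if "g \<in> V" for a b g using assms that by (auto simp: lin_sub_def)
  show "g \<in> V \<Longrightarrow> (\<lambda>x. f x + g x) \<in> V" "g \<in> V \<Longrightarrow> (\<lambda>x. f x - g x) \<in> V" "(\<lambda>x. c *\<^sub>R f x) \<in> V"
    using *[of g 1 1] *[of g 1 "-1"] *[of f c 0] assms(2) by auto
qed

lemma lin_sub_sum:
  assumes "lin_sub V" "\<And>k. k \<in> I \<Longrightarrow> f k \<in> V"
  shows "(\<lambda>x. \<Sum>k\<in>I. f k x) \<in> V"
  using assms(2)
proof (induction I rule: infinite_finite_induct)
  case (insert i I)
  then show ?case using lin_subD(1)[OF assms(1), of "f i" "\<lambda>x. \<Sum>k\<in>I. f k x"] by simp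
qed (use assms in \<open>auto simp: lin_sub_def\<close>)

text \<open>Serves as an induction rule: to prove a property of all tensors, V is taken as the set
  of fields that have it, shown to be a subspace, and checked on pure tensors.\<close>

lemma tensor_span_least:
  assumes V: "lin_sub V" and XY: "\<And>\<phi> \<eta>. \<phi> \<in> X \<Longrightarrow> \<eta> \<in> Y \<Longrightarrow> (\<lambda>(\<omega>, x). \<eta> x *\<^sub>R \<phi> \<omega>) \<in> V"
  shows "tensor_span X Y \<subseteq> V"
proof
  fix f assume "f \<in> tensor_span X Y"
  then obtain n :: nat and c \<phi> \<eta> where *: "\<And>k. k < n \<Longrightarrow> \<phi> k \<in> X \<and> \<eta> k \<in> Y"
    "f = (\<lambda>(\<omega>, x). \<Sum>k<n. c k *\<^sub>R (\<eta> k x *\<^sub>R \<phi> k \<omega>))"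
    unfolding tensor_span_def by blast
  have "(\<lambda>z. \<Sum>k<n. (\<lambda>z. c k *\<^sub>R (case z of (\<omega>, x) \<Rightarrow> \<eta> k x *\<^sub>R \<phi> k \<omega>)) z) \<in> V"
    using * by (intro lin_sub_sum[OF V] lin_subD(3)[OF V] XY) auto
  then show "f \<in> V" unfolding *(2) by (simp add: case_prod_unfold)
qed

lemma tensor_span_elem: "\<phi> \<in> X \<Longrightarrow> \<eta> \<in> Y \<Longrightarrow> (\<lambda>(\<omega>, x). \<eta> x *\<^sub>R \<phi> \<omega>) \<in> tensor_span X Y"
  unfolding tensor_span_def mem_Collect_eq
  by (rule exI[of _ "Suc 0"], rule exI[of _ "\<lambda>_. 1"], rule exI[of _ "\<lambda>_. \<phi>"], rule exI[of _ "\<lambda>_. \<eta>"]) auto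

lemma sum_lessThan_add: "(\<Sum>k<m + n. f k) = (\<Sum>k<m. f k) + (\<Sum>k<n. f (m + k))"
  for f :: "nat \<Rightarrow> 'a::comm_monoid_add"
  by (induction n) (auto simp: add_ac)

lemma lin_sub_tensor_span: "lin_sub (tensor_span X Y)"
  unfolding lin_sub_def
proof (intro conjI ballI allI)
  show "(\<lambda>x. 0) \<in> tensor_span X Y"
    unfolding tensor_span_def mem_Collect_eq by (rule exI[of _ 0]) auto
  fix f g a b assume "f \<in> tensor_span X Y" "g \<in> tensor_span X Y"
  then obtain m c \<phi> \<eta> n c' \<phi>' \<eta>' where f: "\<forall>k<m. \<phi> k \<in> X \<and> \<eta> k \<in> Y"
      "f = (\<lambda>(\<omega>, x). \<Sum>k<(m::nat). c k *\<^sub>R (\<eta> k x *\<^sub>R \<phi> k \<omega>))"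
    and g: "\<forall>k<n. \<phi>' k \<in> X \<and> \<eta>' k \<in> Y"
      "g = (\<lambda>(\<omega>, x). \<Sum>k<(n::nat). c' k *\<^sub>R (\<eta>' k x *\<^sub>R \<phi>' k \<omega>))"
    unfolding tensor_span_def by blast
  define C where "C k = (if k < m then a * c k else b * c' (k - m))" for k
  define \<Phi> where "\<Phi> k = (if k < m then \<phi> k else \<phi>' (k - m))" for k
  define H where "H k = (if k < m then \<eta> k else \<eta>' (k - m))" for k
  have "\<forall>k<m + n. \<Phi> k \<in> X \<and> H k \<in> Y" using f(1) g(1) by (auto simp: \<Phi>_def H_def)
  moreover have "(\<lambda>x. a *\<^sub>R f x + b *\<^sub>R g x) = (\<lambda>(\<omega>, x). \<Sum>k<m + n. C k *\<^sub>R (H k x *\<^sub>R \<Phi> k \<omega>))"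
    unfolding f(2) g(2) sum_lessThan_add
    by (auto simp: C_def \<Phi>_def H_def scaleR_sum_right fun_eq_iff intro!: arg_cong2[of _ _ _ _ "(+)"] sum.cong)
  ultimately show "(\<lambda>x. a *\<^sub>R f x + b *\<^sub>R g x) \<in> tensor_span X Y"
    unfolding tensor_span_def by blast
qed

sublocale dynamical_system \<subseteq> pair: pair_sigma_finite P "lborel :: (real ^ 'd) measure"
  by (intro pair_sigma_finite.intro sigma_finite_measure_axioms sigma_finite_lborel)

section \<open>Rectangles and weak compactness on the product space\<close>

context dynamical_system
begin

abbreviation PX :: "('w \<times> (real ^ 'd)) measure" where
  "PX \<equiv> P \<Otimes>\<^sub>M lborel"

lemma emeasure_rect:
  assumes "A \<in> sets P" "B \<in> sets borel"
  shows "emeasure PX (A \<times> B) = emeasure P A * emeasure lborel B"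
  using assms by (intro pair.M2.emeasure_pair_measure_Times) auto

lemma rect_finite:
  assumes "A \<in> sets P" "B \<in> rat_boxes"
  shows "A \<times> B \<in> sets PX" "emeasure PX (A \<times> B) < \<infinity>"
proof -
  show "A \<times> B \<in> sets PX" using assms rat_boxes_borel by auto
  show "emeasure PX (A \<times> B) < \<infinity>"
    using rat_boxes_finite[OF assms(2)] rat_boxes_borel[OF assms(2)] assms(1)
    by (subst emeasure_rect) (auto simp: ennreal_mult_eq_top_iff less_top[symmetric])
qed

lemma rect_generator:
  defines "G \<equiv> {A \<times> B | A B. A \<in> sets P \<and> B \<in> (rat_boxes :: (real ^ 'd) set set)}"
  shows "Int_stable G" "G \<subseteq> Pow (space PX)" "sets PX = sigma_sets (space PX) G"
proof -
  show "Int_stable G"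
  proof (rule Int_stableI)
    fix E F assume "E \<in> G" "F \<in> G"
    then obtain A B A' B' where *: "E = A \<times> B" "A \<in> sets P" "B \<in> rat_boxes" "F = A' \<times> B'" "A' \<in> sets P" "B' \<in> rat_boxes"
      unfolding G_def by blast
    then have "E \<inter> F = (A \<inter> A') \<times> (B \<inter> B')" by auto
    with * show "E \<inter> F \<in> G" unfolding G_def using Int_rat_boxes by blast
  qed
  show *: "G \<subseteq> Pow (space PX)"
    unfolding G_def using sets.sets_into_space[of _ P] by (auto simp: space_pair_measure)
  have "sets PX = sets (sigma (space P \<times> space (lborel :: (real^'d) measure)) {a \<times> b |a b. a \<in> sets P \<and> b \<in> rat_boxes})"
  proof (rule sets_pair_eq[where Ca = "{space P}" and Cb = "range nat_box"])
    show "sets (lborel :: (real ^ 'd) measure) = sigma_sets (space lborel) rat_boxes"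
      by (simp add: sets_borel_rat_boxes)
  qed (auto simp: sets.sigma_sets_eq nat_box_rat UN_nat_box sets.space_closed)
  also have "\<dots> = sigma_sets (space PX) G"
    using * unfolding G_def by (simp add: space_pair_measure)
  finally show "sets PX = sigma_sets (space PX) G" .
qed

text \<open>An L^p function on a space of infinite measure may fail to be integrable, so h is cut
  off to the strips \<open>space P \<times> nat_box n\<close>. A rectangle intersected with a strip
  is a rectangle again, so the uniqueness argument for generators applies to each cut-off.\<close>

lemma Lp_zero_of_rect:
  fixes h :: "'w \<times> (real ^ 'd) \<Rightarrow> real"
  assumes p: "1 < p" and h: "h \<in> Lp p PX"
    and zero: "\<And>A B. A \<in> sets P \<Longrightarrow> B \<in> rat_boxes \<Longrightarrow> (LINT z|PX. indicator (A \<times> B) z * h z) = 0"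
  shows "AE z in PX. h z = 0"
proof -
  obtain q where pq: "conj_exp p q" using conj_exp_exists[OF p] by blast
  have "AE z in PX. indicator (space P \<times> nat_box n) z * h z = 0" for n
  proof (rule integral_zero_generator[OF _ rect_generator])
    let ?f = "\<lambda>z. indicator (space P \<times> nat_box n) z * h z"
    show "integrable PX ?f"
      using Lp_pairing(1)[OF pq h Lp_indicator(1)[OF rect_finite[OF sets.top nat_box_rat]]] by simp
    show "integral\<^sup>L PX ?f = 0" by (intro zero nat_box_rat) auto
    fix E assume "E \<in> {A \<times> B |A B. A \<in> sets P \<and> B \<in> (rat_boxes :: (real ^ 'd) set set)}"
    then obtain A B where E: "E = A \<times> B" "A \<in> sets P" "B \<in> rat_boxes" by blast
    have "(LINT z:E|PX. ?f z) = (LINT z|PX. indicator (A \<times> (B \<inter> nat_box n)) z * h z)"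
      unfolding set_lebesgue_integral_def E(1) using sets.sets_into_space[OF E(2)]
      by (intro Bochner_Integration.integral_cong) (auto simp: indicator_def)
    also have "\<dots> = 0" by (intro zero E Int_rat_boxes nat_box_rat)
    finally show "(LINT z:E|PX. ?f z) = 0" .
  qed
  then have "AE z in PX. \<forall>n. indicator (space P \<times> nat_box n) z * h z = 0" by (subst AE_all_countable) blast
  then show ?thesis
  proof (rule AE_mp, intro AE_I2 impI)
    fix z assume z: "z \<in> space PX" and *: "\<forall>n. indicator (space P \<times> nat_box n) z * h z = 0"
    obtain n where "snd z \<in> nat_box n" using UN_nat_box by blast
    then show "h z = 0" using *[rule_format, of n] z by (auto simp: space_pair_measure indicator_def split: if_splits)
  qed
qed

text \<open>The place where separability of P enters. Rectangles over a countable dense family of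
  events and over rational boxes approximate all rectangles in every L^q, since the error is the
  measure of a symmetric difference times that of a box. One set D serves all exponents.\<close>

lemma separable_rect_total:
  obtains D :: "('w \<times> (real ^ 'd) \<Rightarrow> real) set" where "countable D" "\<And>q. D \<subseteq> Lp q PX"
    "\<forall>p>1. \<forall>h\<in>Lp p PX. (\<forall>d\<in>D. (LINT z|PX. d z * h z) = 0) \<longrightarrow> (AE z in PX. h z = 0)"
proof -
  obtain \<C> where \<C>: "countable \<C>" "\<C> \<subseteq> sets P"
    "\<And>A e. A \<in> sets P \<Longrightarrow> e > 0 \<Longrightarrow> \<exists>B\<in>\<C>. measure P ((A - B) \<union> (B - A)) < e"
    using separable unfolding separable_measure_def by metis
  define D :: "('w \<times> (real ^ 'd) \<Rightarrow> real) set" where "D = (\<lambda>(A, B). indicator (A \<times> B)) ` (\<C> \<times> rat_boxes)"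
  show thesis
  proof (rule that[of D])
    show "countable D" unfolding D_def using \<C>(1) countable_rat_boxes by auto
    show "D \<subseteq> Lp q PX" for q
      unfolding D_def using \<C>(2) by (auto intro!: Lp_indicator(1) rect_finite)
    show "\<forall>p>1. \<forall>h\<in>Lp p PX. (\<forall>d\<in>D. (LINT z|PX. d z * h z) = 0) \<longrightarrow> (AE z in PX. h z = 0)"
    proof (intro allI impI ballI)
    fix p and h :: "'w \<times> (real ^ 'd) \<Rightarrow> real"
    assume p: "1 < p" and h: "h \<in> Lp p PX" and zero: "\<forall>d\<in>D. (LINT z|PX. d z * h z) = 0"
    obtain q where pq: "conj_exp p q" using conj_exp_exists[OF p] by blast
    show "AE z in PX. h z = 0"
    proof (rule Lp_zero_of_rect[OF p h])
      fix A :: "'w set" and B :: "(real ^ 'd) set" assume A: "A \<in> sets P" and B: "B \<in> rat_boxes"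
      have "\<forall>n. \<exists>A'\<in>\<C>. measure P ((A - A') \<union> (A' - A)) < inverse (real (Suc n))"
        using \<C>(3)[OF A] by auto
      then obtain A' where A': "\<And>n. A' n \<in> \<C>" "\<And>n. measure P ((A - A' n) \<union> (A' n - A)) < inverse (real (Suc n))"
        by metis
      have A's: "A' n \<in> sets P" for n using A' \<C>(2) by auto
      define E where "E n = (A - A' n) \<union> (A' n - A)" for n
      have E: "E n \<in> sets P" for n using A A's by (auto simp: E_def)
      have I: "Lp_int q PX (\<lambda>z. indicator (A' n \<times> B) z - indicator (A \<times> B) z :: real) = measure P (E n) * measure lborel B" for n
      proof -
        have "norm (indicator (A' n \<times> B) z - indicator (A \<times> B) z :: real) = norm (indicat_real (E n \<times> B) z)" for z
          by (cases z) (auto simp: E_def indicator_def)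
        then have "Lp_int q PX (\<lambda>z. indicator (A' n \<times> B) z - indicator (A \<times> B) z :: real) = Lp_int q PX (indicat_real (E n \<times> B))"
          by (simp add: Lp_int_def)
        also have "\<dots> = measure PX (E n \<times> B)" by (rule Lp_indicator(2)[OF rect_finite[OF E B]])
        also have "\<dots> = measure P (E n) * measure lborel B"
          unfolding measure_def using E B rat_boxes_borel by (subst emeasure_rect) (auto simp: enn2real_mult)
        finally show ?thesis .
      qed
      have "(\<lambda>n. measure P (E n) * measure lborel B) \<longlonglongrightarrow> 0 * measure lborel B"
        by (intro tendsto_mult tendsto_const tendsto_sandwich[OF _ _ tendsto_const LIMSEQ_inverse_real_of_nat])
           (use A'(2) in \<open>auto simp: E_def intro!: always_eventually less_imp_le\<close>)
      then have "(\<lambda>n. LINT z|PX. h z \<bullet> indicator (A' n \<times> B) z) \<longlonglongrightarrow> (LINT z|PX. h z \<bullet> indicator (A \<times> B) z)"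
        by (intro Lp_pairing_tendsto[OF conj_expD(6)[OF pq] h] Lp_indicator(1) rect_finite A A's B) (simp add: I)
      moreover have "(LINT z|PX. h z \<bullet> indicator (A' n \<times> B) z) = 0" for n
      proof -
        have "indicat_real (A' n \<times> B) \<in> D"
          unfolding D_def using A'(1)[of n] B by (intro image_eqI[of _ _ "(A' n, B)"]) auto
        then show ?thesis using bspec[OF zero, of "indicator (A' n \<times> B)"] by (simp add: mult.commute)
      qed
      ultimately show "(LINT z|PX. indicator (A \<times> B) z * h z) = 0"
        by (simp add: LIMSEQ_const_iff mult.commute)
    qed
    qed
  qed
qed

text \<open>A diagonal subsequence makes the pairings with a countable total set converge,
  boundedness extends the convergence to all of L^q, and the limit functional is represented by an
  element of L^p.\<close>

lemma Lp_weak_compact: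
  fixes f :: "nat \<Rightarrow> 'w \<times> (real ^ 'd) \<Rightarrow> real"
  assumes p: "1 < p" and f: "\<And>n. f n \<in> Lp p PX" and bnd: "\<And>n. Lp_int p PX (f n) \<le> C"
  obtains r g where "strict_mono (r::nat\<Rightarrow>nat)" "Lp_weak_conv p PX (\<lambda>n. f (r n)) g"
proof -
  obtain q where pq: "conj_exp p q" using conj_exp_exists[OF p] by blast
  note pq' = conj_expD[OF pq]
  have q: "1 < q" "0 < q" and p0: "0 < p" using pq' by auto
  have C0: "0 \<le> C" using bnd[of 0] Lp_int_nonneg order_trans by blast
  obtain D :: "('w \<times> (real ^ 'd) \<Rightarrow> real) set" where D: "countable D" "\<And>q. D \<subseteq> Lp q PX"
    "\<forall>p>1. \<forall>h\<in>Lp p PX. (\<forall>d\<in>D. (LINT z|PX. d z * h z) = 0) \<longrightarrow> (AE z in PX. h z = 0)"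
    by (rule separable_rect_total) (rule that; assumption)
  \<comment> \<open>A bound for all pairings of d with the sequence. Division by it brings them
    below 1 in absolute value, as the extraction of the diagonal subsequence asks for; the summand 1
    keeps the divisor positive.\<close>
  define m where "m d = C / p + Lp_int q PX d / q + 1" for d :: "'w \<times> (real ^ 'd) \<Rightarrow> real"
  have m: "0 < m d" for d unfolding m_def using C0 p0 q by (intro add_nonneg_pos add_nonneg_nonneg) auto
  define F where "F n d = (LINT z|PX. d z * f n z) / m d" for n d
  have "norm (F n d) \<le> 1" if "d \<in> D" for n d
  proof -
    have "\<bar>LINT z|PX. d z * f n z\<bar> \<le> Lp_int p PX (f n) / p + Lp_int q PX d / q"
      using Lp_pairing(2)[OF pq f[of n], of d] D(2) that by auto
    also have "\<dots> \<le> m d" unfolding m_def using divide_right_mono[OF bnd[of n], of p] p0 by simp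
    finally show ?thesis using m[of d] by (simp add: F_def)
  qed
  then obtain r where r: "strict_mono (r::nat\<Rightarrow>nat)" "\<And>d. d \<in> D \<Longrightarrow> \<exists>l. (\<lambda>n. F (r n) d) \<longlonglongrightarrow> l"
    using function_convergent_subsequence[OF D(1), of F 1] by blast
  define L where "L n h = (LINT z|PX. h z * f (r n) z)" for n h
  \<comment> \<open>The test functions along which the subsequence converges: a subspace that
    contains \<open>D\<close> and is closed by the uniform bound \<open>L_bnd\<close>. Separation
    from an element outside would produce a nonzero function orthogonal to \<open>D\<close>, so
    \<open>Z\<close> is all of L^q.\<close>
  define Z where "Z = {h \<in> Lp q PX. convergent (\<lambda>n. L n h)}"
  have L_dual: "L n \<in> Lp_dual q PX" for n
    unfolding L_def using Lp_pairing_dual[OF conj_expD(6)[OF pq] f[of "r n"]] by (simp add: mult.commute)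
  have L_bnd: "\<bar>L n h\<bar> \<le> (1 + C) * Lp_norm q PX h" if "h \<in> Lp q PX" for n h
  proof -
    have "\<bar>L n h\<bar> \<le> (1 + Lp_int p PX (f (r n))) * Lp_norm q PX h"
      using Lp_pairing(3)[OF conj_expD(6)[OF pq] that f[of "r n"]] by (simp add: L_def mult.commute)
    also have "\<dots> \<le> (1 + C) * Lp_norm q PX h"
      using bnd[of "r n"] by (intro mult_right_mono) (auto simp: Lp_norm_int)
    finally show ?thesis .
  qed
  have DZ: "d \<in> Z" if d: "d \<in> D" for d
  proof -
    obtain l where l: "(\<lambda>n. F (r n) d) \<longlonglongrightarrow> l" using r(2)[OF d] by blast
    have "(\<lambda>n. F (r n) d * m d) \<longlonglongrightarrow> l * m d" by (intro tendsto_mult l tendsto_const)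
    moreover have "F (r n) d * m d = L n d" for n using m[of d] by (simp add: F_def L_def)
    ultimately have "convergent (\<lambda>n. L n d)" by (auto simp: convergent_def)
    then show ?thesis using D(2) d by (auto simp: Z_def)
  qed
  have Z_lin: "lin_sub Z"
    unfolding lin_sub_def
  proof (intro conjI ballI allI)
    show "(\<lambda>x. 0) \<in> Z" by (simp add: Z_def L_def convergent_const)
    fix g h a b assume gh: "g \<in> Z" "h \<in> Z"
    then have gh': "g \<in> Lp q PX" "h \<in> Lp q PX" by (auto simp: Z_def)
    have "L n (\<lambda>x. a *\<^sub>R g x + b *\<^sub>R h x) = a * L n g + b * L n h" for n
      using Lp_dual_linear(1)[OF L_dual gh'] by simp
    moreover have "convergent (\<lambda>n. a * L n g + b * L n h)"
      using gh by (intro convergent_add convergent_mult convergent_const) (auto simp: Z_def)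
    ultimately show "(\<lambda>x. a *\<^sub>R g x + b *\<^sub>R h x) \<in> Z"
      using Lp_lincomb[OF gh' q(2)] by (simp add: Z_def)
  qed
  have closed: "h \<in> Z" if h: "h \<in> Lp_closure q PX Z" for h
  proof -
    have hL: "h \<in> Lp q PX" using h Lp_closure_subset by blast
    have "Cauchy (\<lambda>n. L n h)"
    proof (rule metric_CauchyI)
      fix e :: real assume e: "0 < e"
      define e' where "e' = e / (4 * (1 + C))"
      have "e' > 0" using e C0 by (simp add: e'_def)
      then obtain g where g: "g \<in> Z" "Lp_norm q PX (\<lambda>x. h x - g x) < e'"
        using h by (auto simp: Lp_closure_def)
      have gL: "g \<in> Lp q PX" using g by (simp add: Z_def)
      have close: "\<bar>L n h - L n g\<bar> \<le> e / 4" for n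
      proof -
        have "\<bar>L n h - L n g\<bar> \<le> (1 + C) * Lp_norm q PX (\<lambda>x. h x - g x)"
          using L_bnd[OF Lp_diff(1)[OF hL gL q(2)]] Lp_dual_linear(3)[OF L_dual hL gL] by simp
        also have "\<dots> \<le> (1 + C) * e'" using g(2) C0 by (intro mult_left_mono) auto
        also have "\<dots> = e / 4" using C0 by (simp add: e'_def field_simps)
        finally show ?thesis .
      qed
      have "Cauchy (\<lambda>n. L n g)" using g(1) by (simp add: Z_def Cauchy_convergent_iff)
      then obtain N where N: "\<And>m n. m \<ge> N \<Longrightarrow> n \<ge> N \<Longrightarrow> dist (L m g) (L n g) < e / 4"
        using e metric_CauchyD[of "\<lambda>n. L n g" "e/4"] by auto
      have "dist (L m h) (L n h) < e" if "m \<ge> N" "n \<ge> N" for m n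
        using close[of m] close[of n] N[OF that] e unfolding dist_real_def by linarith
      then show "\<exists>N. \<forall>m\<ge>N. \<forall>n\<ge>N. dist (L m h) (L n h) < e" by blast
    qed
    then show ?thesis using hL by (simp add: Z_def Cauchy_convergent_iff)
  qed
  have all: "h \<in> Z" if h: "h \<in> Lp q PX" for h
  proof (rule ccontr)
    assume "h \<notin> Z"
    then have "h \<notin> Lp_closure q PX Z" using closed by blast
    then obtain w where w: "w \<in> Lp q PX" "0 < Lp_int q PX w"
      "\<And>s. s \<in> Lp_closure q PX Z \<Longrightarrow> (LINT x|PX. dual_map q (w x) \<bullet> s x) = 0"
      by (rule Lp_separation[OF q(1) Z_lin h]) (rule that; assumption)
    have "AE z in PX. dual_map q (w z) = 0"
    proof (rule D(3)[rule_format, OF p])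
      show "(\<lambda>z. dual_map q (w z)) \<in> Lp p PX" by (rule Lp_dual_map(1)[OF conj_expD(6)[OF pq] w(1)])
      fix d assume d: "d \<in> D"
      then show "(LINT z|PX. d z * dual_map q (w z)) = 0"
        using w(3)[OF Lp_closure_base[OF q(2) DZ[OF d]]] D(2) by (auto simp: mult.commute)
    qed
    then have "AE z in PX. w z = 0"
    proof eventually_elim
      case (elim z)
      then show ?case using dual_map_inner[of q "w z"] by simp
    qed
    then show False using Lp_int_eq_0[OF w(1)] w(2) by simp
  qed
  define \<Lambda> where "\<Lambda> h = lim (\<lambda>n. L n h)" for h
  have L\<Lambda>: "(\<lambda>n. L n h) \<longlonglongrightarrow> \<Lambda> h" if "h \<in> Lp q PX" for h
    using all[OF that] by (simp add: Z_def \<Lambda>_def convergent_LIMSEQ_iff)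
  have "\<Lambda> \<in> Lp_dual q PX"
    unfolding Lp_dual_def mem_Collect_eq
  proof (intro conjI ballI allI exI)
    fix h :: "'w \<times> (real ^ 'd) \<Rightarrow> real" assume h: "h \<in> Lp q PX"
    show "\<bar>\<Lambda> h\<bar> \<le> (1 + C) * Lp_norm q PX h"
      using L_bnd[OF h] by (intro tendsto_upperbound[OF tendsto_rabs[OF L\<Lambda>[OF h]]]) auto
    fix g :: "'w \<times> (real ^ 'd) \<Rightarrow> real" and a b assume g: "g \<in> Lp q PX"
    have "(\<lambda>n. L n (\<lambda>x. a * h x + b * g x)) \<longlonglongrightarrow> \<Lambda> (\<lambda>x. a * h x + b * g x)"
      by (intro L\<Lambda> Lp_add Lp_mult h g q)
    moreover have "(\<lambda>n. a * L n h + b * L n g) \<longlonglongrightarrow> a * \<Lambda> h + b * \<Lambda> g"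
      by (intro tendsto_intros L\<Lambda> h g)
    ultimately show "\<Lambda> (\<lambda>x. a * h x + b * g x) = a * \<Lambda> h + b * \<Lambda> g"
      using Lp_dual_linear(1)[OF L_dual h g] by (auto intro: LIMSEQ_unique)
  qed
  then obtain g where g: "g \<in> Lp p PX" "\<And>h. h \<in> Lp q PX \<Longrightarrow> \<Lambda> h = (LINT z|PX. g z * h z)"
    by (rule Lp_Riesz[OF conj_expD(6)[OF pq]]) (rule that; assumption)
  have "Lp_weak_conv p PX (\<lambda>n. f (r n)) g"
    unfolding Lp_weak_conv_def
  proof (intro conjI allI ballI f g)
    fix \<Lambda>' assume "\<Lambda>' \<in> Lp_dual p PX"
    then obtain h where h: "h \<in> Lp q PX" "\<And>f. f \<in> Lp p PX \<Longrightarrow> \<Lambda>' f = (LINT z|PX. h z * f z)"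
      by (rule Lp_Riesz[OF pq]) (rule that; assumption)
    show "(\<lambda>n. \<Lambda>' (f (r n))) \<longlonglongrightarrow> \<Lambda>' g"
      using L\<Lambda>[OF h(1)] unfolding h(2)[OF f] h(2)[OF g(1)] g(2)[OF h(1)] L_def by (simp add: mult.commute)
  qed
  then show thesis using r(1) by (intro that)
qed

definition simple_tensors :: "('w \<times> (real ^ 'd) \<Rightarrow> real) set" where
  "simple_tensors = tensor_span ((\<lambda>A. indicator A) ` sets P) ((\<lambda>B. indicator B) ` rat_boxes)"

lemma lin_sub_simple_tensors: "lin_sub simple_tensors"
  unfolding simple_tensors_def by (rule lin_sub_tensor_span)

text \<open>Density by duality instead of approximation by simple functions: a separating functional
  would be represented by a function orthogonal to all rectangles, hence by zero.\<close>

lemma simple_tensors_dense: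
  assumes p: "1 < p" and f: "f \<in> Lp p PX"
  shows "f \<in> Lp_closure p PX simple_tensors"
proof (rule ccontr)
  assume "f \<notin> Lp_closure p PX simple_tensors"
  then obtain w where w: "w \<in> Lp p PX" "0 < Lp_int p PX w"
    "\<And>s. s \<in> Lp_closure p PX simple_tensors \<Longrightarrow> (LINT x|PX. dual_map p (w x) \<bullet> s x) = 0"
    by (rule Lp_separation[OF p lin_sub_simple_tensors f]) (rule that; assumption)
  obtain q where pq: "conj_exp p q" using conj_exp_exists[OF p] by blast
  have "AE z in PX. dual_map p (w z) = 0"
  proof (rule Lp_zero_of_rect[OF conj_expD(2)[OF pq] Lp_dual_map(1)[OF pq w(1)]])
    fix A B assume AB: "A \<in> sets P" "B \<in> (rat_boxes :: (real ^ 'd) set set)"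
    have eq: "indicat_real (A \<times> B) = (\<lambda>(\<omega>, x). indicator B x *\<^sub>R indicator A \<omega>)"
      by (auto simp: indicator_def fun_eq_iff)
    have "indicat_real (A \<times> B) \<in> simple_tensors"
      unfolding simple_tensors_def eq using AB by (intro tensor_span_elem) auto
    then have "indicat_real (A \<times> B) \<in> Lp_closure p PX simple_tensors"
      using p AB by (intro Lp_closure_base Lp_indicator rect_finite) auto
    from w(3)[OF this] show "(LINT z|PX. indicator (A \<times> B) z * dual_map p (w z)) = 0"
      by (simp add: mult.commute)
  qed
  then have "AE z in PX. w z = 0"
  proof eventually_elim
    case (elim z)
    then show ?case using dual_map_inner[of p "w z"] by simp
  qed
  then show False using Lp_int_eq_0[OF w(1)] w(2) by simp
qed

end


section \<open>Mollification\<close>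

lemma nn_integral_lborel_shift:
  fixes f :: "'a::euclidean_space \<Rightarrow> ennreal"
  assumes [measurable]: "f \<in> borel_measurable borel"
  shows "(\<integral>\<^sup>+x. f (x + v) \<partial>lborel) = (\<integral>\<^sup>+x. f x \<partial>lborel)"
  by (subst (2) lborel_distr_plus[symmetric, of v]) (simp add: nn_integral_distr add.commute)

lemma integral_lborel_shift:
  fixes f :: "'a::euclidean_space \<Rightarrow> real"
  assumes [measurable]: "f \<in> borel_measurable borel"
  shows "(LINT x|lborel. f (x + v)) = (LINT x|lborel. f x)"
  by (subst (2) lborel_distr_plus[symmetric, of v]) (simp add: integral_distr add.commute)

lemma Lp_lborel_shift:
  fixes f :: "'a::euclidean_space \<Rightarrow> 'b::euclidean_space"
  assumes "f \<in> Lp p lborel"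
  shows "(\<lambda>x. f (x + v)) \<in> Lp p lborel" "Lp_int p lborel (\<lambda>x. f (x + v)) = Lp_int p lborel f"
proof -
  have [measurable]: "f \<in> borel_measurable borel" using Lp_measurable[OF assms] by simp
  have *: "(\<integral>\<^sup>+x. ennreal (norm (f (x + v)) powr p) \<partial>lborel) = (\<integral>\<^sup>+x. ennreal (norm (f x) powr p) \<partial>lborel)"
    by (rule nn_integral_lborel_shift) measurable
  then show "(\<lambda>x. f (x + v)) \<in> Lp p lborel"
    using assms Lp_iff_nn[of f lborel p] Lp_iff_nn[of "\<lambda>x. f (x + v)" lborel p] by simp
  show "Lp_int p lborel (\<lambda>x. f (x + v)) = Lp_int p lborel f"
    unfolding Lp_int_def by (rule integral_lborel_shift) measurable
qed

text \<open>Jensen's inequality for a weight of arbitrary sign and total mass m, from the tangent of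
  the p-th power at the weighted average. The extended reals on the right cover the case in which
  the weighted p-th power is not integrable.\<close>

lemma weighted_Jensen:
  fixes \<sigma> g :: "'a \<Rightarrow> real"
  assumes p: "1 < p" and \<sigma>: "integrable N \<sigma>" and [measurable]: "g \<in> borel_measurable N"
  shows "ennreal (\<bar>LINT y|N. \<sigma> y * g y\<bar> powr p)
    \<le> ennreal ((LINT y|N. \<bar>\<sigma> y\<bar>) powr (p - 1)) * (\<integral>\<^sup>+y. ennreal (\<bar>\<sigma> y\<bar> * \<bar>g y\<bar> powr p) \<partial>N)"
proof -
  have [measurable]: "\<sigma> \<in> borel_measurable N" using \<sigma> by simp
  define m where "m = (LINT y|N. \<bar>\<sigma> y\<bar>)"
  have m0: "0 \<le> m" unfolding m_def by simp
  consider "m = 0" | "m > 0" "(\<integral>\<^sup>+y. ennreal (\<bar>\<sigma> y\<bar> * \<bar>g y\<bar> powr p) \<partial>N) = \<infinity>"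
    | "m > 0" "(\<integral>\<^sup>+y. ennreal (\<bar>\<sigma> y\<bar> * \<bar>g y\<bar> powr p) \<partial>N) < \<infinity>"
    using m0 top.not_eq_extremum by force
  then show ?thesis
  proof cases
    case 1
    then have "AE y in N. \<sigma> y = 0"
      using \<sigma> integral_nonneg_eq_0_iff_AE[of N "\<lambda>y. \<bar>\<sigma> y\<bar>"] unfolding m_def by auto
    then have "(LINT y|N. \<sigma> y * g y) = (LINT y|N. 0)"
      by (intro integral_cong_AE) (auto elim!: eventually_mono)
    then show ?thesis by simp
  next
    case 2
    then show ?thesis unfolding m_def[symmetric] by (simp add: ennreal_mult_top)
  next
    case 3
    have i1: "integrable N (\<lambda>y. \<bar>\<sigma> y\<bar> * \<bar>g y\<bar> powr p)"
      using 3 by (intro integrableI_bounded) (auto simp: abs_mult)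
    have i2: "integrable N (\<lambda>y. \<bar>\<sigma> y\<bar> * \<bar>g y\<bar>)"
    proof (rule Bochner_Integration.integrable_bound[of N "\<lambda>y. \<bar>\<sigma> y\<bar> + \<bar>\<sigma> y\<bar> * \<bar>g y\<bar> powr p"])
      show "integrable N (\<lambda>y. \<bar>\<sigma> y\<bar> + \<bar>\<sigma> y\<bar> * \<bar>g y\<bar> powr p)" using \<sigma> i1 by auto
      have le: "t \<le> 1 + t powr p" if "0 \<le> t" for t :: real
        using that p powr_mono[of 1 p t] by (cases "t \<le> 1") (auto intro: add_increasing2)
      show "AE y in N. norm (\<bar>\<sigma> y\<bar> * \<bar>g y\<bar>) \<le> norm (\<bar>\<sigma> y\<bar> + \<bar>\<sigma> y\<bar> * \<bar>g y\<bar> powr p)"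
      proof (rule AE_I2)
        fix y
        have "\<bar>\<sigma> y\<bar> * \<bar>g y\<bar> \<le> \<bar>\<sigma> y\<bar> * (1 + \<bar>g y\<bar> powr p)" by (intro mult_left_mono le) auto
        then show "norm (\<bar>\<sigma> y\<bar> * \<bar>g y\<bar>) \<le> norm (\<bar>\<sigma> y\<bar> + \<bar>\<sigma> y\<bar> * \<bar>g y\<bar> powr p)"
          by (simp add: distrib_left)
      qed
    qed measurable
    \<comment> \<open>The average of \<open>\<bar>g\<bar>\<close> against
      \<open>\<bar>\<sigma>\<bar>\<close>: with the tangent taken at this point, its linear term
      integrates to zero.\<close>
    define a where "a = (LINT y|N. \<bar>\<sigma> y\<bar> * \<bar>g y\<bar>) / m"
    have a0: "0 \<le> a" unfolding a_def using 3 by simp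
    define c where "c = p * dual_map p a"
    have tangent: "\<bar>\<sigma> y\<bar> * (a powr p) + c * (\<bar>\<sigma> y\<bar> * \<bar>g y\<bar>) - (c * a) * \<bar>\<sigma> y\<bar> \<le> \<bar>\<sigma> y\<bar> * \<bar>g y\<bar> powr p" for y
    proof -
      have "a powr p + c * (\<bar>g y\<bar> - a) \<le> \<bar>g y\<bar> powr p"
        using norm_powr_tangent[OF p, of a "\<bar>g y\<bar>"] a0 by (simp add: c_def mult.assoc)
      then have "\<bar>\<sigma> y\<bar> * (a powr p + c * (\<bar>g y\<bar> - a)) \<le> \<bar>\<sigma> y\<bar> * \<bar>g y\<bar> powr p"
        by (intro mult_left_mono) auto
      then show ?thesis by (simp add: algebra_simps)
    qed
    have "m * a powr p + c * (a * m) - (c * a) * m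
        = (LINT y|N. \<bar>\<sigma> y\<bar> * (a powr p) + c * (\<bar>\<sigma> y\<bar> * \<bar>g y\<bar>) - (c * a) * \<bar>\<sigma> y\<bar>)"
      using i2 \<sigma> 3 by (simp add: m_def a_def)
    also have "\<dots> \<le> (LINT y|N. \<bar>\<sigma> y\<bar> * \<bar>g y\<bar> powr p)"
      using i1 i2 \<sigma> tangent by (intro integral_mono) auto
    finally have key: "m * a powr p \<le> (LINT y|N. \<bar>\<sigma> y\<bar> * \<bar>g y\<bar> powr p)" by (simp add: mult_ac)
    have "\<bar>LINT y|N. \<sigma> y * g y\<bar> \<le> (LINT y|N. \<bar>\<sigma> y * g y\<bar>)" by (rule integral_abs_bound)
    also have "\<dots> = a * m" using 3 by (simp add: a_def abs_mult)
    finally have "\<bar>LINT y|N. \<sigma> y * g y\<bar> powr p \<le> (a * m) powr p" using p by (intro powr_mono2) auto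
    also have "\<dots> = a powr p * m powr p" using a0 m0 by (simp add: powr_mult)
    also have "m powr p = m powr (p - 1) * m" using powr_mult_base[OF m0, of "p - 1"] by (simp add: mult.commute)
    also have "a powr p * (m powr (p - 1) * m) = m powr (p - 1) * (m * a powr p)" by (simp add: mult_ac)
    also have "\<dots> \<le> m powr (p - 1) * (LINT y|N. \<bar>\<sigma> y\<bar> * \<bar>g y\<bar> powr p)"
      using key by (intro mult_left_mono) auto
    finally have "ennreal (\<bar>LINT y|N. \<sigma> y * g y\<bar> powr p)
        \<le> ennreal (m powr (p - 1) * (LINT y|N. \<bar>\<sigma> y\<bar> * \<bar>g y\<bar> powr p))" by (rule ennreal_leI)
    also have "\<dots> = ennreal (m powr (p - 1)) * ennreal (LINT y|N. \<bar>\<sigma> y\<bar> * \<bar>g y\<bar> powr p)"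
      by (simp add: ennreal_mult)
    also have "ennreal (LINT y|N. \<bar>\<sigma> y\<bar> * \<bar>g y\<bar> powr p) = (\<integral>\<^sup>+y. ennreal (\<bar>\<sigma> y\<bar> * \<bar>g y\<bar> powr p) \<partial>N)"
      by (rule nn_integral_eq_integral[OF i1, symmetric]) auto
    finally show ?thesis by (simp add: m_def)
  qed
qed

text \<open>Neither sign nor normalization is prescribed, because derivatives and difference
  quotients of mollifiers have to be kernels too. Boundedness with bounded support puts a kernel
  into every L^q.\<close>

definition kernel :: "('a::euclidean_space \<Rightarrow> real) \<Rightarrow> bool" where
  "kernel \<sigma> \<longleftrightarrow> \<sigma> \<in> borel_measurable borel \<and> (\<exists>B R. \<forall>y. \<bar>\<sigma> y\<bar> \<le> B * indicator (cball 0 R) y)"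

definition mass :: "('a::euclidean_space \<Rightarrow> real) \<Rightarrow> real" where
  "mass \<sigma> = (LINT y|lborel. \<bar>\<sigma> y\<bar>)"

text \<open>A correlation, with \<open>x + y\<close> in place of \<open>x - y\<close>. This is the
  origin of the minus signs below: differentiating \<open>mollify \<sigma> f\<close> puts the
  negative derivative on \<sigma>.\<close>

definition mollify :: "('a::euclidean_space \<Rightarrow> real) \<Rightarrow> ('a \<Rightarrow> real) \<Rightarrow> 'a \<Rightarrow> real" where
  "mollify \<sigma> f x = (LINT y|lborel. \<sigma> y * f (x + y))"

definition mollify_x :: "('a::euclidean_space \<Rightarrow> real) \<Rightarrow> ('w \<times> 'a \<Rightarrow> real) \<Rightarrow> 'w \<times> 'a \<Rightarrow> real" where
  "mollify_x \<sigma> f = (\<lambda>(\<omega>, x). mollify \<sigma> (\<lambda>x. f (\<omega>, x)) x)"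

lemma kernel_measurable[measurable_dest]: "kernel \<sigma> \<Longrightarrow> \<sigma> \<in> borel_measurable borel"
  by (simp add: kernel_def)

lemma mass_nonneg[simp]: "0 \<le> mass \<sigma>"
  by (simp add: mass_def)

lemma kernel_Lp:
  fixes \<sigma> :: "'a::euclidean_space \<Rightarrow> real"
  assumes "kernel \<sigma>" "0 < q"
  shows "\<sigma> \<in> Lp q lborel"
proof -
  obtain B R where BR: "\<And>y. \<bar>\<sigma> y\<bar> \<le> B * indicator (cball 0 R) y" using assms by (auto simp: kernel_def)
  have "indicat_real (cball (0::'a) R) \<in> Lp q lborel"
    using emeasure_lborel_cball_finite by (intro Lp_indicator) auto
  then have "(\<lambda>y. B * indicat_real (cball (0::'a) R) y) \<in> Lp q lborel" by (rule Lp_mult)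
  then show ?thesis
    using BR assms by (elim Lp_mono(1)) (auto simp: kernel_def intro!: AE_I2 order_trans[OF _ abs_ge_self])
qed

lemma kernel_integrable:
  assumes "kernel \<sigma>"
  shows "integrable lborel \<sigma>"
proof -
  have "integrable lborel (\<lambda>x. norm (\<sigma> x))"
    using Lp_integrable[OF kernel_Lp[OF assms, of 1]] by (simp del: real_norm_def)
  then show ?thesis by (rule integrable_norm_cancel) (use assms in \<open>simp add: kernel_def\<close>)
qed

lemma kernel_add:
  assumes "kernel \<sigma>" "kernel \<tau>"
  shows "kernel (\<lambda>y. a * \<sigma> y + b * \<tau> y)"
proof -
  obtain B R where BR: "\<And>y. \<bar>\<sigma> y\<bar> \<le> B * indicator (cball 0 R) y" using assms by (auto simp: kernel_def)
  obtain B' R' where BR': "\<And>y. \<bar>\<tau> y\<bar> \<le> B' * indicator (cball 0 R') y" using assms by (auto simp: kernel_def)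
  have "\<bar>a * \<sigma> y + b * \<tau> y\<bar> \<le> (\<bar>a\<bar> * \<bar>B\<bar> + \<bar>b\<bar> * \<bar>B'\<bar>) * indicator (cball 0 (max R R')) y" for y
  proof -
    have mono: "c * indicat_real (cball 0 r) y \<le> \<bar>c\<bar> * indicator (cball 0 (max R R')) y" if "r \<le> max R R'" for c r
      using that by (auto simp: indicator_def)
    have "\<bar>\<sigma> y\<bar> \<le> \<bar>B\<bar> * indicator (cball 0 (max R R')) y" "\<bar>\<tau> y\<bar> \<le> \<bar>B'\<bar> * indicator (cball 0 (max R R')) y"
      using order_trans[OF BR[of y] mono] order_trans[OF BR'[of y] mono] by auto
    then have "\<bar>a\<bar> * \<bar>\<sigma> y\<bar> + \<bar>b\<bar> * \<bar>\<tau> y\<bar>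
        \<le> \<bar>a\<bar> * (\<bar>B\<bar> * indicator (cball 0 (max R R')) y) + \<bar>b\<bar> * (\<bar>B'\<bar> * indicator (cball 0 (max R R')) y)"
      by (intro add_mono mult_left_mono) auto
    moreover have "\<bar>a * \<sigma> y + b * \<tau> y\<bar> \<le> \<bar>a\<bar> * \<bar>\<sigma> y\<bar> + \<bar>b\<bar> * \<bar>\<tau> y\<bar>"
      using abs_triangle_ineq[of "a * \<sigma> y" "b * \<tau> y"] by (simp add: abs_mult)
    ultimately show ?thesis by (simp add: algebra_simps)
  qed
  then show ?thesis using assms unfolding kernel_def by auto
qed

lemma kernel_shift:
  assumes "kernel \<sigma>"
  shows "kernel (\<lambda>y. \<sigma> (y + v))"
proof -
  obtain B R where BR: "\<And>y. \<bar>\<sigma> y\<bar> \<le> B * indicator (cball 0 R) y" using assms by (auto simp: kernel_def)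
  have "\<bar>\<sigma> (y + v)\<bar> \<le> \<bar>B\<bar> * indicator (cball 0 (R + norm v)) y" for y
  proof (cases "norm y \<le> R + norm v")
    case True
    have "\<bar>\<sigma> (y + v)\<bar> \<le> B * indicator (cball 0 R) (y + v)" by (rule BR)
    also have "\<dots> \<le> \<bar>B\<bar> * 1" by (auto simp: indicator_def)
    finally show ?thesis using True by (simp add: indicator_def)
  next
    case False
    then have "\<not> norm (y + v) \<le> R" using norm_triangle_ineq4[of "y + v" v] by auto
    then show ?thesis using BR[of "y + v"] by (simp add: indicator_def)
  qed
  moreover have "(\<lambda>y. \<sigma> (y + v)) \<in> borel_measurable borel" using kernel_measurable[OF assms] by measurable
  ultimately show ?thesis unfolding kernel_def by blast
qed

lemma mollify_integrable:
  assumes "kernel \<sigma>" "f \<in> Lp p lborel" "1 < p"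
  shows "integrable lborel (\<lambda>y. \<sigma> y * f (x + y))"
proof -
  obtain q where pq: "conj_exp p q" using conj_exp_exists[OF assms(3)] by blast
  have "(\<lambda>y. f (y + x)) \<in> Lp p lborel" by (rule Lp_lborel_shift(1)[OF assms(2)])
  moreover have "\<sigma> \<in> Lp q lborel" using conj_expD[OF pq] by (intro kernel_Lp assms) auto
  ultimately show ?thesis using Lp_pairing(1)[OF pq] by (force simp: add.commute)
qed

lemma mollify_linear:
  assumes "kernel \<sigma>" "f \<in> Lp p lborel" "g \<in> Lp p lborel" "1 < p"
  shows "mollify \<sigma> (\<lambda>x. a * f x + b * g x) x = a * mollify \<sigma> f x + b * mollify \<sigma> g x"
proof -
  have "mollify \<sigma> (\<lambda>x. a * f x + b * g x) x = (LINT y|lborel. a * (\<sigma> y * f (x + y)) + b * (\<sigma> y * g (x + y)))"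
    unfolding mollify_def by (simp add: algebra_simps)
  then show ?thesis
    using mollify_integrable[OF assms(1,2,4)] mollify_integrable[OF assms(1,3,4)] by (simp add: mollify_def)
qed

lemma mollify_linear_kernel:
  assumes "kernel \<sigma>" "kernel \<tau>" "f \<in> Lp p lborel" "1 < p"
  shows "mollify (\<lambda>y. a * \<sigma> y + b * \<tau> y) f x = a * mollify \<sigma> f x + b * mollify \<tau> f x"
proof -
  have "mollify (\<lambda>y. a * \<sigma> y + b * \<tau> y) f x = (LINT y|lborel. a * (\<sigma> y * f (x + y)) + b * (\<tau> y * f (x + y)))"
    unfolding mollify_def by (simp add: algebra_simps)
  then show ?thesis
    using mollify_integrable[OF assms(1,3,4)] mollify_integrable[OF assms(2,3,4)] by (simp add: mollify_def)
qed

text \<open>Translation invariance of Lebesgue measure moves an increment of the argument onto the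
  kernel, where it can be differentiated.\<close>

lemma mollify_translate:
  assumes [measurable]: "\<sigma> \<in> borel_measurable borel" "f \<in> borel_measurable borel"
  shows "mollify \<sigma> f (x + v) = mollify (\<lambda>y. \<sigma> (y - v)) f x"
proof -
  have "(LINT y|lborel. \<sigma> ((y + v) - v) * f (x + (y + v))) = (LINT y|lborel. \<sigma> (y - v) * f (x + y))"
    by (rule integral_lborel_shift) measurable
  then show ?thesis by (simp add: mollify_def algebra_simps)
qed

lemma measurable_mollify[measurable]:
  assumes [measurable]: "\<sigma> \<in> borel_measurable borel" "f \<in> borel_measurable borel"
  shows "mollify \<sigma> f \<in> borel_measurable borel"
  unfolding mollify_def[abs_def] by measurable

text \<open>Young's inequality for convolutions of L^1 with L^p: Jensen's inequality contributes
  \<open>mass \<sigma> powr (p - 1)\<close>, and Tonelli together with translation invariance of the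
  inner integral the last factor \<open>mass \<sigma>\<close>.\<close>

lemma nn_mollify_le:
  fixes \<sigma> f :: "'a::euclidean_space \<Rightarrow> real"
  assumes p: "1 < p" and \<sigma>: "kernel \<sigma>" and f[measurable]: "f \<in> borel_measurable borel"
  shows "(\<integral>\<^sup>+x. ennreal (\<bar>mollify \<sigma> f x\<bar> powr p) \<partial>lborel)
    \<le> ennreal (mass \<sigma> powr p) * (\<integral>\<^sup>+x. ennreal (\<bar>f x\<bar> powr p) \<partial>lborel)"
proof -
  note [measurable] = kernel_measurable[OF \<sigma>]
  have "(\<integral>\<^sup>+x. ennreal (\<bar>mollify \<sigma> f x\<bar> powr p) \<partial>lborel)
      \<le> (\<integral>\<^sup>+x. ennreal (mass \<sigma> powr (p - 1)) * (\<integral>\<^sup>+y. ennreal (\<bar>\<sigma> y\<bar> * \<bar>f (x + y)\<bar> powr p) \<partial>lborel) \<partial>lborel)"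
    unfolding mollify_def mass_def
    by (intro nn_integral_mono weighted_Jensen p kernel_integrable \<sigma>) measurable
  also have "\<dots> = ennreal (mass \<sigma> powr (p - 1)) * (\<integral>\<^sup>+x. (\<integral>\<^sup>+y. ennreal (\<bar>\<sigma> y\<bar> * \<bar>f (x + y)\<bar> powr p) \<partial>lborel) \<partial>lborel)"
    by (intro nn_integral_cmult) measurable
  also have "(\<integral>\<^sup>+x. (\<integral>\<^sup>+y. ennreal (\<bar>\<sigma> y\<bar> * \<bar>f (x + y)\<bar> powr p) \<partial>lborel) \<partial>lborel)
      = (\<integral>\<^sup>+y. (\<integral>\<^sup>+x. ennreal (\<bar>\<sigma> y\<bar> * \<bar>f (x + y)\<bar> powr p) \<partial>lborel) \<partial>lborel)"
    by (rule lborel_pair.Fubini') measurable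
  also have "\<dots> = (\<integral>\<^sup>+y. ennreal \<bar>\<sigma> y\<bar> * (\<integral>\<^sup>+x. ennreal (\<bar>f x\<bar> powr p) \<partial>lborel) \<partial>lborel)"
  proof (rule nn_integral_cong)
    fix y
    have "(\<integral>\<^sup>+x. ennreal (\<bar>\<sigma> y\<bar> * \<bar>f (x + y)\<bar> powr p) \<partial>lborel)
        = ennreal \<bar>\<sigma> y\<bar> * (\<integral>\<^sup>+x. ennreal (\<bar>f (x + y)\<bar> powr p) \<partial>lborel)"
      by (subst nn_integral_cmult[symmetric]) (auto simp: ennreal_mult)
    also have "(\<integral>\<^sup>+x. ennreal (\<bar>f (x + y)\<bar> powr p) \<partial>lborel) = (\<integral>\<^sup>+x. ennreal (\<bar>f x\<bar> powr p) \<partial>lborel)"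
      by (rule nn_integral_lborel_shift) measurable
    finally show "(\<integral>\<^sup>+x. ennreal (\<bar>\<sigma> y\<bar> * \<bar>f (x + y)\<bar> powr p) \<partial>lborel)
        = ennreal \<bar>\<sigma> y\<bar> * (\<integral>\<^sup>+x. ennreal (\<bar>f x\<bar> powr p) \<partial>lborel)" .
  qed
  also have "\<dots> = (\<integral>\<^sup>+y. ennreal \<bar>\<sigma> y\<bar> \<partial>lborel) * (\<integral>\<^sup>+x. ennreal (\<bar>f x\<bar> powr p) \<partial>lborel)"
    by (rule nn_integral_multc) measurable
  also have "(\<integral>\<^sup>+y. ennreal \<bar>\<sigma> y\<bar> \<partial>lborel) = ennreal (mass \<sigma>)"
    unfolding mass_def using kernel_integrable[OF \<sigma>] by (intro nn_integral_eq_integral) auto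
  also have "ennreal (mass \<sigma> powr (p - 1)) * (ennreal (mass \<sigma>) * (\<integral>\<^sup>+x. ennreal (\<bar>f x\<bar> powr p) \<partial>lborel))
      = ennreal (mass \<sigma> powr p) * (\<integral>\<^sup>+x. ennreal (\<bar>f x\<bar> powr p) \<partial>lborel)"
    using powr_mult_base[of "mass \<sigma>" "p - 1"] by (simp add: mult.assoc[symmetric] ennreal_mult[symmetric] mult.commute)
  finally show ?thesis .
qed

lemma mollify_Lp:
  fixes \<sigma> f :: "'a::euclidean_space \<Rightarrow> real"
  assumes p: "1 < p" and \<sigma>: "kernel \<sigma>" and f: "f \<in> Lp p lborel"
  shows "mollify \<sigma> f \<in> Lp p lborel" "Lp_int p lborel (mollify \<sigma> f) \<le> mass \<sigma> powr p * Lp_int p lborel f"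
proof -
  have m: "f \<in> borel_measurable borel" using Lp_measurable[OF f] by simp
  have m': "mollify \<sigma> f \<in> borel_measurable lborel" using m kernel_measurable[OF \<sigma>] by simp
  have le: "(\<integral>\<^sup>+x. ennreal (norm (mollify \<sigma> f x) powr p) \<partial>lborel) \<le> ennreal (mass \<sigma> powr p * Lp_int p lborel f)"
    using nn_mollify_le[OF p \<sigma> m] Lp_int_nn[OF f] by (simp add: ennreal_mult)
  show "mollify \<sigma> f \<in> Lp p lborel" "Lp_int p lborel (mollify \<sigma> f) \<le> mass \<sigma> powr p * Lp_int p lborel f"
    using Lp_int_le_nn[OF m' le] by simp_all
qed

text \<open>As \<sigma> has integral 1, the value \<open>f x\<close> is itself a \<sigma>-average.
  The mollification error is thus an average of increments of f, and the factor in Jensen's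
  inequality is 1.\<close>

lemma nn_mollify_diff_le:
  fixes \<sigma> f :: "'a::euclidean_space \<Rightarrow> real"
  assumes p: "1 < p" and \<sigma>: "kernel \<sigma>" "\<And>y. 0 \<le> \<sigma> y" "(LINT y|lborel. \<sigma> y) = 1" and f: "f \<in> Lp p lborel"
  shows "(\<integral>\<^sup>+x. ennreal (\<bar>mollify \<sigma> f x - f x\<bar> powr p) \<partial>lborel)
    \<le> (\<integral>\<^sup>+y. ennreal (\<sigma> y) * (\<integral>\<^sup>+x. ennreal (\<bar>f (x + y) - f x\<bar> powr p) \<partial>lborel) \<partial>lborel)"
proof -
  note [measurable] = kernel_measurable[OF \<sigma>(1)]
  have [measurable]: "f \<in> borel_measurable borel" using Lp_measurable[OF f] by simp
  have eq: "mollify \<sigma> f x - f x = (LINT y|lborel. \<sigma> y * (f (x + y) - f x))" for x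
  proof -
    have "(LINT y|lborel. \<sigma> y * (f (x + y) - f x)) = (LINT y|lborel. \<sigma> y * f (x + y) - f x * \<sigma> y)"
      by (simp add: algebra_simps)
    also have "\<dots> = mollify \<sigma> f x - f x * (LINT y|lborel. \<sigma> y)"
      unfolding mollify_def using mollify_integrable[OF \<sigma>(1) f p] kernel_integrable[OF \<sigma>(1)] by simp
    finally show ?thesis using \<sigma>(3) by simp
  qed
  have "(\<integral>\<^sup>+x. ennreal (\<bar>mollify \<sigma> f x - f x\<bar> powr p) \<partial>lborel)
      \<le> (\<integral>\<^sup>+x. (\<integral>\<^sup>+y. ennreal (\<sigma> y * \<bar>f (x + y) - f x\<bar> powr p) \<partial>lborel) \<partial>lborel)"
  proof (rule nn_integral_mono)
    fix x
    show "ennreal (\<bar>mollify \<sigma> f x - f x\<bar> powr p) \<le> (\<integral>\<^sup>+y. ennreal (\<sigma> y * \<bar>f (x + y) - f x\<bar> powr p) \<partial>lborel)"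
      using weighted_Jensen[OF p kernel_integrable[OF \<sigma>(1)], of "\<lambda>y. f (x + y) - f x"] \<sigma>(2,3) unfolding eq by simp
  qed
  also have "\<dots> = (\<integral>\<^sup>+y. (\<integral>\<^sup>+x. ennreal (\<sigma> y * \<bar>f (x + y) - f x\<bar> powr p) \<partial>lborel) \<partial>lborel)"
    by (rule lborel_pair.Fubini') measurable
  also have "\<dots> = (\<integral>\<^sup>+y. ennreal (\<sigma> y) * (\<integral>\<^sup>+x. ennreal (\<bar>f (x + y) - f x\<bar> powr p) \<partial>lborel) \<partial>lborel)"
    by (intro nn_integral_cong, subst nn_integral_cmult[symmetric]) (auto simp: ennreal_mult \<sigma>(2))
  finally show ?thesis .
qed

section \<open>Mollification of random fields\<close>

context dynamical_system
begin

lemma AE_PX_fst: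
  assumes "AE \<omega> in P. Q \<omega>"
  shows "AE z in PX. Q (fst z)"
proof -
  obtain N where N: "N \<in> null_sets P" "{\<omega> \<in> space P. \<not> Q \<omega>} \<subseteq> N"
    using assms by (auto simp: eventually_ae_filter)
  have "N \<times> UNIV \<in> null_sets PX"
    using N(1) by (auto simp: null_sets_def pair.M2.emeasure_pair_measure_Times)
  then show ?thesis
    by (rule AE_I') (use N(2) in \<open>auto simp: space_pair_measure\<close>)
qed

lemma AE_PX_snd:
  assumes "AE x in lborel. Q (x :: real ^ 'd)"
  shows "AE z in PX. Q (snd z)"
proof -
  obtain N where N: "N \<in> null_sets lborel" "{x \<in> space lborel. \<not> Q x} \<subseteq> N"
    using assms by (auto simp: eventually_ae_filter)
  have "space P \<times> N \<in> null_sets PX"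
    using N(1) by (auto simp: null_sets_def pair.M2.emeasure_pair_measure_Times)
  then show ?thesis
    by (rule AE_I') (use N(2) in \<open>auto simp: space_pair_measure\<close>)
qed

lemma slice_measurable:
  assumes "f \<in> borel_measurable PX" "\<omega> \<in> space P"
  shows "(\<lambda>x. f (\<omega>, x)) \<in> borel_measurable borel"
  using assms by measurable

lemma Lp_slice:
  fixes f :: "'w \<times> (real ^ 'd) \<Rightarrow> 'b::euclidean_space"
  assumes f: "f \<in> Lp p PX"
  shows "AE \<omega> in P. (\<lambda>x. f (\<omega>, x)) \<in> Lp p lborel"
proof -
  have "AE \<omega> in P. integrable lborel (\<lambda>x. norm (f (\<omega>, x)) powr p)"
    by (rule pair.AE_integrable_fst'[OF Lp_integrable[OF f]])
  moreover have "AE \<omega> in P. \<omega> \<in> space P" by simp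
  ultimately show ?thesis
  proof eventually_elim
    case (elim \<omega>)
    then show ?case using slice_measurable[OF Lp_measurable[OF f]] by (simp add: Lp_def)
  qed
qed

lemma Lp_int_slice:
  fixes f :: "'w \<times> (real ^ 'd) \<Rightarrow> 'b::euclidean_space"
  assumes f: "f \<in> Lp p PX"
  shows "integrable P (\<lambda>\<omega>. Lp_int p lborel (\<lambda>x. f (\<omega>, x)))"
    "(LINT \<omega>|P. Lp_int p lborel (\<lambda>x. f (\<omega>, x))) = Lp_int p PX f"
  unfolding Lp_int_def by (rule pair.integrable_fst'[OF Lp_integrable[OF f]])
    (rule pair.integral_fst'[OF Lp_integrable[OF f]])

lemma measurable_mollify_x[measurable]:
  assumes [measurable]: "\<sigma> \<in> borel_measurable borel" and f[measurable]: "f \<in> borel_measurable PX"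
  shows "mollify_x \<sigma> f \<in> borel_measurable PX"
proof -
  have "(\<lambda>z. LINT y|lborel. \<sigma> y * f (fst z, snd z + y)) \<in> borel_measurable PX"
    by measurable
  then show ?thesis by (simp add: mollify_x_def mollify_def case_prod_unfold)
qed

lemma mollify_x_Lp:
  fixes f :: "'w \<times> (real ^ 'd) \<Rightarrow> real"
  assumes p: "1 < p" and \<sigma>: "kernel \<sigma>" and f: "f \<in> Lp p PX"
  shows "mollify_x \<sigma> f \<in> Lp p PX" "Lp_int p PX (mollify_x \<sigma> f) \<le> mass \<sigma> powr p * Lp_int p PX f"
proof -
  note [measurable] = Lp_measurable[OF f] kernel_measurable[OF \<sigma>]
  have "(\<integral>\<^sup>+z. ennreal (norm (mollify_x \<sigma> f z) powr p) \<partial>PX)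
      = (\<integral>\<^sup>+\<omega>. (\<integral>\<^sup>+x. ennreal (\<bar>mollify \<sigma> (\<lambda>x. f (\<omega>, x)) x\<bar> powr p) \<partial>lborel) \<partial>P)"
    by (subst pair.M2.nn_integral_fst[symmetric], measurable) (simp add: mollify_x_def)
  also have "\<dots> \<le> (\<integral>\<^sup>+\<omega>. ennreal (mass \<sigma> powr p) * (\<integral>\<^sup>+x. ennreal (\<bar>f (\<omega>, x)\<bar> powr p) \<partial>lborel) \<partial>P)"
    using slice_measurable[OF Lp_measurable[OF f]] by (intro nn_integral_mono nn_mollify_le p \<sigma>)
  also have "\<dots> = ennreal (mass \<sigma> powr p) * (\<integral>\<^sup>+\<omega>. (\<integral>\<^sup>+x. ennreal (\<bar>f (\<omega>, x)\<bar> powr p) \<partial>lborel) \<partial>P)"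
    by (rule nn_integral_cmult) measurable
  also have "(\<integral>\<^sup>+\<omega>. (\<integral>\<^sup>+x. ennreal (\<bar>f (\<omega>, x)\<bar> powr p) \<partial>lborel) \<partial>P) = (\<integral>\<^sup>+z. ennreal (norm (f z) powr p) \<partial>PX)"
    by (subst pair.M2.nn_integral_fst[symmetric]) auto
  also have "ennreal (mass \<sigma> powr p) * \<dots> = ennreal (mass \<sigma> powr p * Lp_int p PX f)"
    by (simp add: Lp_int_nn[OF f] ennreal_mult del: real_norm_def)
  finally show "mollify_x \<sigma> f \<in> Lp p PX" "Lp_int p PX (mollify_x \<sigma> f) \<le> mass \<sigma> powr p * Lp_int p PX f"
    using Lp_int_le_nn[of "mollify_x \<sigma> f" PX p] by (auto simp del: real_norm_def)
qed

lemma mollify_x_linear: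
  fixes f :: "'w \<times> (real ^ 'd) \<Rightarrow> real"
  assumes "1 < p" "kernel \<sigma>" "f \<in> Lp p PX" "g \<in> Lp p PX"
  shows "AE z in PX. mollify_x \<sigma> (\<lambda>z. a * f z + b * g z) z = a * mollify_x \<sigma> f z + b * mollify_x \<sigma> g z"
  using AE_PX_fst[OF Lp_slice[OF assms(3)]] AE_PX_fst[OF Lp_slice[OF assms(4)]]
proof eventually_elim
  case (elim z)
  then show ?case using mollify_linear[OF assms(2) elim assms(1)] by (simp add: mollify_x_def case_prod_unfold)
qed

lemma mollify_x_linear_kernel:
  fixes f :: "'w \<times> (real ^ 'd) \<Rightarrow> real"
  assumes "1 < p" "kernel \<sigma>" "kernel \<tau>" "f \<in> Lp p PX"
  shows "AE z in PX. mollify_x (\<lambda>y. a * \<sigma> y + b * \<tau> y) f z = a * mollify_x \<sigma> f z + b * mollify_x \<tau> f z"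
  using AE_PX_fst[OF Lp_slice[OF assms(4)]]
proof eventually_elim
  case (elim z)
  then show ?case using mollify_linear_kernel[OF assms(2,3) elim assms(1)] by (simp add: mollify_x_def case_prod_unfold)
qed

lemma Lp_weak_conv_mollify_x:
  assumes "1 < p" "kernel \<sigma>" "Lp_weak_conv p PX f g"
  shows "Lp_weak_conv p PX (\<lambda>n. mollify_x \<sigma> (f n)) (mollify_x \<sigma> g)"
  by (rule Lp_weak_conv_operator[where A = "mollify_x \<sigma>" and C = "mass \<sigma> powr p", OF _ assms(3)])
     (use assms(1) in \<open>auto intro!: mollify_x_Lp[OF assms(1,2)] mollify_x_linear[OF assms(1,2)]\<close>)

lemma shift_x_Lp:
  fixes f :: "'w \<times> (real ^ 'd) \<Rightarrow> 'b::euclidean_space"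
  assumes f: "f \<in> Lp p PX"
  shows "(\<lambda>z. f (fst z, snd z + v)) \<in> Lp p PX" "Lp_int p PX (\<lambda>z. f (fst z, snd z + v)) = Lp_int p PX f"
proof -
  note [measurable] = Lp_measurable[OF f]
  have m: "(\<lambda>z. f (fst z, snd z + v)) \<in> borel_measurable PX" by measurable
  have "(\<integral>\<^sup>+z. ennreal (norm (f (fst z, snd z + v)) powr p) \<partial>PX)
      = (\<integral>\<^sup>+\<omega>. (\<integral>\<^sup>+x. ennreal (norm (f (\<omega>, x + v)) powr p) \<partial>lborel) \<partial>P)"
    by (subst pair.M2.nn_integral_fst[symmetric]) auto
  also have "\<dots> = (\<integral>\<^sup>+\<omega>. (\<integral>\<^sup>+x. ennreal (norm (f (\<omega>, x)) powr p) \<partial>lborel) \<partial>P)"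
  proof (rule nn_integral_cong)
    fix \<omega> assume "\<omega> \<in> space P"
    note [measurable] = slice_measurable[OF Lp_measurable[OF f] this]
    show "(\<integral>\<^sup>+x. ennreal (norm (f (\<omega>, x + v)) powr p) \<partial>lborel) = (\<integral>\<^sup>+x. ennreal (norm (f (\<omega>, x)) powr p) \<partial>lborel)"
      by (rule nn_integral_lborel_shift) measurable
  qed
  also have "\<dots> = (\<integral>\<^sup>+z. ennreal (norm (f z) powr p) \<partial>PX)"
    by (subst pair.M2.nn_integral_fst[symmetric]) auto
  finally have eq: "(\<integral>\<^sup>+z. ennreal (norm (f (fst z, snd z + v)) powr p) \<partial>PX) = ennreal (Lp_int p PX f)"
    by (simp add: Lp_int_nn[OF f])
  show *: "(\<lambda>z. f (fst z, snd z + v)) \<in> Lp p PX" using Lp_int_le_nn(1)[OF m eq_refl[OF eq]] by simp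
  show "Lp_int p PX (\<lambda>z. f (fst z, snd z + v)) = Lp_int p PX f"
    using eq unfolding Lp_int_nn[OF *] by simp
qed

text \<open>Off the boundary of the box, a null set, the indicator is locally constant, so the
  integrand vanishes for large n. All translates stay in one ball, which supplies the dominating
  function.\<close>

lemma translation_indicator:
  fixes Y :: "nat \<Rightarrow> real ^ 'd"
  assumes A: "A \<in> sets P" and B: "B \<in> rat_boxes" and Y: "Y \<longlonglongrightarrow> 0" and p: "0 < p"
  shows "(\<lambda>n. Lp_int p PX (\<lambda>z. indicat_real (A \<times> B) (fst z, snd z + Y n) - indicat_real (A \<times> B) z)) \<longlonglongrightarrow> 0"
proof -
  obtain a b where Bab: "B = box a b" using B by (auto simp: rat_boxes_def)
  obtain K where K: "\<And>n. norm (Y n) \<le> K" using convergent_imp_bounded[OF Y] by (auto simp: bounded_iff)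
  obtain R where R: "\<And>x. x \<in> B \<Longrightarrow> norm x \<le> R" using bounded_box[of a b] unfolding Bab bounded_iff by blast
  define C where "C = cball (0 :: real ^ 'd) (R + K)"
  have C: "emeasure lborel C < \<infinity>" "C \<in> sets borel" unfolding C_def using emeasure_lborel_cball_finite by auto
  have [measurable]: "A \<times> B \<in> sets PX" by (rule rect_finite[OF A B])
  have [measurable]: "B \<in> sets borel" by (rule rat_boxes_borel[OF B])
  let ?f = "\<lambda>n z. norm (indicat_real (A \<times> B) (fst z, snd z + Y n) - indicat_real (A \<times> B) z) powr p"
  have "(\<lambda>n. LINT z|PX. ?f n z) \<longlonglongrightarrow> (LINT z|PX. 0)"
  proof (rule integral_dominated_convergence[where w = "indicat_real (space P \<times> C)"])
    show "integrable PX (indicat_real (space P \<times> C))"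
      using C emeasure_rect[OF sets.top C(2)] by (auto simp: emeasure_space_1)
    have "AE x in lborel. x \<notin> cbox a b - box a b"
      by (rule AE_not_in) (auto simp: null_sets_def emeasure_Diff emeasure_lborel_box_eq emeasure_lborel_cbox_eq subset_box box_subset_cbox)
    then have "AE z in PX. snd z \<notin> cbox a b - box a b" by (rule AE_PX_snd)
    then show "AE z in PX. (\<lambda>n. ?f n z) \<longlonglongrightarrow> 0"
    proof eventually_elim
      case (elim z)
      have lim: "(\<lambda>n. snd z + Y n) \<longlonglongrightarrow> snd z" using tendsto_add[OF tendsto_const Y, of "snd z"] by simp
      have "\<forall>\<^sub>F n in sequentially. indicat_real (A \<times> B) (fst z, snd z + Y n) = indicat_real (A \<times> B) z"
      proof (cases "snd z \<in> box a b")
        case True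
        have "\<forall>\<^sub>F n in sequentially. snd z + Y n \<in> box a b" by (rule topological_tendstoD[OF lim open_box True])
        then show ?thesis by eventually_elim (use True in \<open>auto simp: Bab indicator_def mem_Times_iff\<close>)
      next
        case False
        then have "snd z \<in> - cbox a b" using elim by auto
        then have "\<forall>\<^sub>F n in sequentially. snd z + Y n \<in> - cbox a b"
          by (intro topological_tendstoD[OF lim]) auto
        then show ?thesis
          by eventually_elim (use False box_subset_cbox[of a b] in \<open>auto simp: Bab indicator_def mem_Times_iff\<close>)
      qed
      then have "\<forall>\<^sub>F n in sequentially. ?f n z = 0" by eventually_elim simp
      then show ?case by (rule tendsto_eventually)
    qed
    fix n
    show "AE z in PX. norm (?f n z) \<le> indicat_real (space P \<times> C) z"
    proof (rule AE_I2)
      fix z assume z: "z \<in> space PX"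
      show "norm (?f n z) \<le> indicat_real (space P \<times> C) z"
      proof (cases "snd z \<in> C")
        case True
        have "norm (indicat_real (A \<times> B) (fst z, snd z + Y n) - indicat_real (A \<times> B) z) powr p \<le> 1 powr p"
          using p by (intro powr_mono2) (auto simp: indicator_def)
        then show ?thesis using True z by (auto simp: indicator_def mem_Times_iff space_pair_measure)
      next
        case False
        have "0 \<le> K" using K[of 0] norm_ge_zero order_trans by blast
        then have "snd z \<notin> B" using R[of "snd z"] False by (auto simp: C_def)
        moreover have "snd z + Y n \<notin> B"
          using R[of "snd z + Y n"] K[of n] False norm_triangle_ineq4[of "snd z + Y n" "Y n"] by (auto simp: C_def)
        ultimately show ?thesis by (simp add: indicator_def mem_Times_iff)
      qed
    qed
  qed (measurable)
  then show ?thesis by (simp add: Lp_int_def)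
qed

text \<open>The fields with this property form a subspace that contains the rectangles. Translations
  are isometries, so the property passes to limits of simple tensors, which are all of L^p.\<close>

lemma translation_continuous_seq:
  fixes f :: "'w \<times> (real ^ 'd) \<Rightarrow> real"
  assumes p: "1 < p" and f: "f \<in> Lp p PX" and Y: "Y \<longlonglongrightarrow> 0"
  shows "(\<lambda>n. Lp_int p PX (\<lambda>z. f (fst z, snd z + Y n) - f z)) \<longlonglongrightarrow> 0"
proof -
  have p0: "0 < p" using p by simp
  define V :: "('w \<times> (real ^ 'd) \<Rightarrow> real) set"
    where "V = {f \<in> Lp p PX. (\<lambda>n. Lp_int p PX (\<lambda>z. f (fst z, snd z + Y n) - f z)) \<longlonglongrightarrow> 0}"
  have "lin_sub V"
    unfolding lin_sub_def
  proof (intro conjI ballI allI)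
    show "(\<lambda>x. 0) \<in> V" by (simp add: V_def)
    fix f g a b assume fg: "f \<in> V" "g \<in> V"
    then have fg': "f \<in> Lp p PX" "g \<in> Lp p PX" by (auto simp: V_def)
    have "(\<lambda>n. Lp_int p PX (\<lambda>z. (a *\<^sub>R f (fst z, snd z + Y n) + b *\<^sub>R g (fst z, snd z + Y n)) - (a *\<^sub>R f z + b *\<^sub>R g z))) \<longlonglongrightarrow> 0"
      using fg by (intro Lp_tendsto_add Lp_tendsto_scaleR Lp_scaleR shift_x_Lp fg' p0) (auto simp: V_def)
    then show "(\<lambda>x. a *\<^sub>R f x + b *\<^sub>R g x) \<in> V"
      using Lp_lincomb[OF fg' p0] by (simp add: V_def)
  qed
  moreover have "(\<lambda>(\<omega>, x). \<eta> x *\<^sub>R \<phi> \<omega>) \<in> V"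
    if \<phi>: "\<phi> \<in> (\<lambda>A. indicator A) ` sets P" and \<eta>: "\<eta> \<in> (\<lambda>B. indicator B) ` rat_boxes" for \<phi> \<eta>
  proof -
    obtain A B where AB: "A \<in> sets P" "B \<in> rat_boxes" "\<phi> = indicator A" "\<eta> = indicator B" using \<phi> \<eta> by blast
    have eq: "(\<lambda>(\<omega>, x). \<eta> x *\<^sub>R \<phi> \<omega>) = indicat_real (A \<times> B)"
      unfolding AB by (auto simp: indicator_def fun_eq_iff)
    show ?thesis unfolding eq V_def
      using AB(1,2) translation_indicator[OF AB(1,2) Y p0] by (auto intro: Lp_indicator(1) rect_finite)
  qed
  ultimately have "simple_tensors \<subseteq> V" unfolding simple_tensors_def by (rule tensor_span_least)
  have "f \<in> Lp_closure p PX simple_tensors" by (rule simple_tensors_dense[OF p f])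
  show ?thesis
  proof (rule LIMSEQ_I)
    fix e :: real assume e: "0 < e"
    define c where "c = 2 powr p"
    have c: "0 < c" by (simp add: c_def)
    \<comment> \<open>Two applications of the triangle inequality give the total error
      \<open>c * (e' + c * (e' + e'))\<close>, which this choice makes equal to
      \<open>e / 2\<close>.\<close>
    define e' where "e' = e / (2 * (c * (2 * c + 1)))"
    have e': "0 < e'" using e c by (simp add: e'_def)
    obtain g where g: "g \<in> simple_tensors" "g \<in> Lp p PX" "Lp_int p PX (\<lambda>z. f z - g z) < e'"
      using \<open>f \<in> Lp_closure p PX simple_tensors\<close> e' by (auto simp: Lp_closure_iff[OF p0])
    have "(\<lambda>n. Lp_int p PX (\<lambda>z. g (fst z, snd z + Y n) - g z)) \<longlonglongrightarrow> 0" using g(1) \<open>simple_tensors \<subseteq> V\<close> by (auto simp: V_def)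
    then have "\<forall>\<^sub>F n in sequentially. Lp_int p PX (\<lambda>z. g (fst z, snd z + Y n) - g z) < e'"
      using e' by (rule order_tendstoD)
    then obtain N where N: "\<And>n. n \<ge> N \<Longrightarrow> Lp_int p PX (\<lambda>z. g (fst z, snd z + Y n) - g z) < e'"
      by (auto simp: eventually_sequentially)
    have "Lp_int p PX (\<lambda>z. f (fst z, snd z + Y n) - f z) < e" if n: "n \<ge> N" for n
    proof -
      let ?s = "\<lambda>f z. f (fst z, snd z + Y n)"
      note L = f g(2) shift_x_Lp(1)[OF f] shift_x_Lp(1)[OF g(2)]
      have "Lp_int p PX (\<lambda>z. ?s f z - f z) \<le> c * (Lp_int p PX (\<lambda>z. ?s f z - ?s g z) + Lp_int p PX (\<lambda>z. ?s g z - f z))"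
        unfolding c_def by (rule Lp_int_diff_trans_le) (use L p0 in auto)
      also have "Lp_int p PX (\<lambda>z. ?s f z - ?s g z) = Lp_int p PX (\<lambda>z. f z - g z)"
        using shift_x_Lp(2)[OF Lp_diff(1)[OF f g(2) p0]] by simp
      also have "Lp_int p PX (\<lambda>z. ?s g z - f z) \<le> c * (Lp_int p PX (\<lambda>z. ?s g z - g z) + Lp_int p PX (\<lambda>z. g z - f z))"
        unfolding c_def by (rule Lp_int_diff_trans_le) (use L p0 in auto)
      also have "Lp_int p PX (\<lambda>z. g z - f z) = Lp_int p PX (\<lambda>z. f z - g z)" by (rule Lp_int_diff_commute)
      finally have "Lp_int p PX (\<lambda>z. ?s f z - f z)
          \<le> c * (Lp_int p PX (\<lambda>z. f z - g z) + c * (Lp_int p PX (\<lambda>z. ?s g z - g z) + Lp_int p PX (\<lambda>z. f z - g z)))"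
        using c by simp
      also have "\<dots> \<le> c * (e' + c * (e' + e'))"
        using g(3) N[OF n] c by (intro mult_left_mono add_mono) auto
      also have "\<dots> = e / 2"
      proof -
        have "c * (e' + c * (e' + e')) = e' * (c * (2 * c + 1))" by (simp add: algebra_simps)
        also have "\<dots> = e / 2" using mult_pos_pos[OF c, of "2 * c + 1"] c by (simp add: e'_def)
        finally show ?thesis .
      qed
      finally show ?thesis using e by simp
    qed
    then show "\<exists>no. \<forall>n\<ge>no. norm (Lp_int p PX (\<lambda>z. f (fst z, snd z + Y n) - f z) - 0) < e" by auto
  qed
qed

text \<open>Uniformity over a ball of shifts: bad shifts chosen in ever smaller balls would
  contradict the sequential version.\<close>

lemma translation_continuous:
  fixes f :: "'w \<times> (real ^ 'd) \<Rightarrow> real"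
  assumes p: "1 < p" and f: "f \<in> Lp p PX" and e: "0 < e"
  obtains d where "0 < d" "\<And>y. norm y \<le> d \<Longrightarrow> Lp_int p PX (\<lambda>z. f (fst z, snd z + y) - f z) < e"
proof -
  have "\<exists>d>0. \<forall>y. norm y \<le> d \<longrightarrow> Lp_int p PX (\<lambda>z. f (fst z, snd z + y) - f z) < e"
  proof (rule ccontr)
  assume "\<not> ?thesis"
  then have "\<exists>y. norm y \<le> d \<and> e \<le> Lp_int p PX (\<lambda>z. f (fst z, snd z + y) - f z)" if "0 < d" for d
    using that by (meson not_le)
  then have "\<forall>n. \<exists>y. norm y \<le> inverse (real (Suc n)) \<and> e \<le> Lp_int p PX (\<lambda>z. f (fst z, snd z + y) - f z)"
    by simp
  from choice[OF this] obtain Y where Y: "\<And>n. norm (Y n) \<le> inverse (real (Suc n))"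
    "\<And>n. e \<le> Lp_int p PX (\<lambda>z. f (fst z, snd z + Y n) - f z)" by blast
  have "Y \<longlonglongrightarrow> 0" by (rule Lim_null_comparison[OF _ LIMSEQ_inverse_real_of_nat]) (use Y(1) in auto)
  from translation_continuous_seq[OF p f this]
  have "\<forall>\<^sub>F n in sequentially. Lp_int p PX (\<lambda>z. f (fst z, snd z + Y n) - f z) < e"
    using e by (rule order_tendstoD)
  then obtain N where "\<And>n. n \<ge> N \<Longrightarrow> Lp_int p PX (\<lambda>z. f (fst z, snd z + Y n) - f z) < e"
    unfolding eventually_sequentially by blast
  then show False using Y(2)[of N] by (meson not_le order_refl)
  qed
  then show thesis using that by blast
qed

text \<open>The mollification error is at most the \<sigma>-average of translation errors, each at
  most e on the support of \<sigma>. The bound \<open>\<bar>e\<bar>\<close> keeps the passage to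
  nonnegative integrals free of a sign condition on e.\<close>

lemma mollify_x_diff_le:
  fixes f :: "'w \<times> (real ^ 'd) \<Rightarrow> real"
  assumes p: "1 < p" and \<sigma>: "kernel \<sigma>" "\<And>y. 0 \<le> \<sigma> y" "(LINT y|lborel. \<sigma> y) = 1"
    and supp: "\<And>y. \<sigma> y \<noteq> 0 \<Longrightarrow> norm y \<le> d" and f: "f \<in> Lp p PX"
    and e: "\<And>y. norm y \<le> d \<Longrightarrow> Lp_int p PX (\<lambda>z. f (fst z, snd z + y) - f z) \<le> e"
  shows "Lp_int p PX (\<lambda>z. mollify_x \<sigma> f z - f z) \<le> \<bar>e\<bar>"
proof -
  note [measurable] = kernel_measurable[OF \<sigma>(1)] Lp_measurable[OF f]
  have p0: "0 < p" using p by simp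
  have "(\<integral>\<^sup>+z. ennreal (norm (mollify_x \<sigma> f z - f z) powr p) \<partial>PX)
      = (\<integral>\<^sup>+\<omega>. (\<integral>\<^sup>+x. ennreal (\<bar>mollify \<sigma> (\<lambda>x. f (\<omega>, x)) x - f (\<omega>, x)\<bar> powr p) \<partial>lborel) \<partial>P)"
    by (subst pair.M2.nn_integral_fst[symmetric], measurable) (simp add: mollify_x_def)
  also have "\<dots> \<le> (\<integral>\<^sup>+\<omega>. (\<integral>\<^sup>+y. ennreal (\<sigma> y) * (\<integral>\<^sup>+x. ennreal (\<bar>f (\<omega>, x + y) - f (\<omega>, x)\<bar> powr p) \<partial>lborel) \<partial>lborel) \<partial>P)"
    using Lp_slice[OF f] by (intro nn_integral_mono_AE) (auto elim!: eventually_mono intro!: nn_mollify_diff_le p \<sigma>)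
  also have "\<dots> = (\<integral>\<^sup>+y. (\<integral>\<^sup>+\<omega>. ennreal (\<sigma> y) * (\<integral>\<^sup>+x. ennreal (\<bar>f (\<omega>, x + y) - f (\<omega>, x)\<bar> powr p) \<partial>lborel) \<partial>P) \<partial>lborel)"
    by (rule pair.Fubini'[symmetric]) measurable
  also have "\<dots> \<le> (\<integral>\<^sup>+y. ennreal (\<sigma> y) * ennreal \<bar>e\<bar> \<partial>lborel)"
  proof (rule nn_integral_mono)
    fix y :: "real ^ 'd"
    have "(\<integral>\<^sup>+\<omega>. ennreal (\<sigma> y) * (\<integral>\<^sup>+x. ennreal (\<bar>f (\<omega>, x + y) - f (\<omega>, x)\<bar> powr p) \<partial>lborel) \<partial>P)
        = ennreal (\<sigma> y) * (\<integral>\<^sup>+\<omega>. (\<integral>\<^sup>+x. ennreal (\<bar>f (\<omega>, x + y) - f (\<omega>, x)\<bar> powr p) \<partial>lborel) \<partial>P)"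
      by (rule nn_integral_cmult) measurable
    also have "(\<integral>\<^sup>+\<omega>. (\<integral>\<^sup>+x. ennreal (\<bar>f (\<omega>, x + y) - f (\<omega>, x)\<bar> powr p) \<partial>lborel) \<partial>P)
        = (\<integral>\<^sup>+z. ennreal (norm (f (fst z, snd z + y) - f z) powr p) \<partial>PX)"
      by (subst pair.M2.nn_integral_fst[symmetric]) auto
    also have "\<dots> = ennreal (Lp_int p PX (\<lambda>z. f (fst z, snd z + y) - f z))"
      by (rule Lp_int_nn[OF Lp_diff(1)[OF shift_x_Lp(1)[OF f] f p0]])
    also have "ennreal (\<sigma> y) * \<dots> \<le> ennreal (\<sigma> y) * ennreal \<bar>e\<bar>"
    proof (cases "\<sigma> y = 0")
      case False
      then have "Lp_int p PX (\<lambda>z. f (fst z, snd z + y) - f z) \<le> \<bar>e\<bar>" using e[OF supp] by (meson abs_ge_self order_trans)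
      then show ?thesis by (intro mult_left_mono ennreal_leI) auto
    qed simp
    finally show "(\<integral>\<^sup>+\<omega>. ennreal (\<sigma> y) * (\<integral>\<^sup>+x. ennreal (\<bar>f (\<omega>, x + y) - f (\<omega>, x)\<bar> powr p) \<partial>lborel) \<partial>P)
        \<le> ennreal (\<sigma> y) * ennreal \<bar>e\<bar>" .
  qed
  also have "\<dots> = (\<integral>\<^sup>+y. ennreal (\<sigma> y) \<partial>lborel) * ennreal \<bar>e\<bar>" by (rule nn_integral_multc) measurable
  also have "(\<integral>\<^sup>+y. ennreal (\<sigma> y) \<partial>lborel) = 1"
    using nn_integral_eq_integral[OF kernel_integrable[OF \<sigma>(1)]] \<sigma> by simp
  finally have "(\<integral>\<^sup>+z. ennreal (norm (mollify_x \<sigma> f z - f z) powr p) \<partial>PX) \<le> ennreal \<bar>e\<bar>" by simp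
  then show ?thesis by (intro Lp_int_le_nn(2)) auto
qed

lemma mollify_x_tendsto:
  fixes f :: "'w \<times> (real ^ 'd) \<Rightarrow> real"
  assumes p: "1 < p" and \<sigma>: "\<And>n. kernel (\<sigma> n)" "\<And>n y. 0 \<le> \<sigma> n y" "\<And>n. (LINT y|lborel. \<sigma> n y) = 1"
    and supp: "\<And>n y. \<sigma> n y \<noteq> 0 \<Longrightarrow> norm y \<le> d n" and d: "d \<longlonglongrightarrow> 0" and f: "f \<in> Lp p PX"
  shows "(\<lambda>n. Lp_int p PX (\<lambda>z. mollify_x (\<sigma> n) f z - f z)) \<longlonglongrightarrow> 0"
proof (rule LIMSEQ_I)
  fix e :: real assume e: "0 < e"
  obtain \<delta> where \<delta>: "0 < \<delta>" "\<And>y. norm y \<le> \<delta> \<Longrightarrow> Lp_int p PX (\<lambda>z. f (fst z, snd z + y) - f z) < e / 2"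
    using translation_continuous[OF p f, of "e / 2"] e by auto
  have "\<forall>\<^sub>F n in sequentially. d n < \<delta>" using d \<delta>(1) by (rule order_tendstoD)
  then obtain N where N: "\<And>n. n \<ge> N \<Longrightarrow> d n < \<delta>" by (auto simp: eventually_sequentially)
  have "norm (Lp_int p PX (\<lambda>z. mollify_x (\<sigma> n) f z - f z) - 0) < e" if "n \<ge> N" for n
  proof -
    have "Lp_int p PX (\<lambda>z. mollify_x (\<sigma> n) f z - f z) \<le> \<bar>e / 2\<bar>"
    proof (rule mollify_x_diff_le[OF p \<sigma> supp f])
      fix y :: "real ^ 'd" assume "norm y \<le> d n"
      then have "norm y \<le> \<delta>" using N[OF that] by simp
      then show "Lp_int p PX (\<lambda>z. f (fst z, snd z + y) - f z) \<le> e / 2" using \<delta>(2) less_imp_le by blast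
    qed
    then show ?thesis using e by simp
  qed
  then show "\<exists>no. \<forall>n\<ge>no. norm (Lp_int p PX (\<lambda>z. mollify_x (\<sigma> n) f z - f z) - 0) < e" by blast
qed

end

section \<open>Differentiable kernels and weak gradients\<close>

definition kernel_deriv :: "(real ^ 'd \<Rightarrow> real) \<Rightarrow> 'd \<Rightarrow> (real ^ 'd \<Rightarrow> real) \<Rightarrow> bool" where
  "kernel_deriv \<sigma> i \<sigma>' \<longleftrightarrow> kernel \<sigma> \<and> kernel \<sigma>' \<and>
     (\<forall>y. ((\<lambda>s. \<sigma> (y + s *\<^sub>R axis i 1)) has_real_derivative \<sigma>' y) (at 0))"

text \<open>What the forward quotient of a mollified function becomes on the kernel. The shift is
  backward, so the limit is the negative derivative of \<sigma>.\<close>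

definition diff_quot :: "(real ^ 'd \<Rightarrow> real) \<Rightarrow> 'd \<Rightarrow> real \<Rightarrow> real ^ 'd \<Rightarrow> real" where
  "diff_quot \<sigma> i e y = (\<sigma> (y - e *\<^sub>R axis i 1) - \<sigma> y) / e"

lemma kernel_uminus: "kernel \<sigma> \<Longrightarrow> kernel (\<lambda>y. - \<sigma> y)"
  by (simp add: kernel_def)

lemma kernel_diff_quot:
  assumes "kernel \<sigma>"
  shows "kernel (diff_quot \<sigma> i e)"
proof -
  have "kernel (\<lambda>y. (1 / e) * \<sigma> (y + (- e *\<^sub>R axis i 1)) + (- 1 / e) * \<sigma> y)"
    by (intro kernel_add kernel_shift assms)
  then show ?thesis by (simp add: diff_quot_def[abs_def] diff_divide_distrib)
qed

lemma kernel_continuous: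
  fixes \<sigma> :: "'a::euclidean_space \<Rightarrow> real"
  assumes c: "continuous_on UNIV \<sigma>" and K: "compact K" and z: "\<And>y. y \<notin> K \<Longrightarrow> \<sigma> y = 0"
  shows "kernel \<sigma>"
proof -
  have "bounded (\<sigma> ` K)"
    by (intro compact_imp_bounded compact_continuous_image continuous_on_subset[OF c] K) auto
  then obtain B where B: "\<And>y. y \<in> K \<Longrightarrow> \<bar>\<sigma> y\<bar> \<le> B" by (auto simp: bounded_iff)
  obtain R where R: "\<And>y. y \<in> K \<Longrightarrow> norm y \<le> R" using compact_imp_bounded[OF K] by (auto simp: bounded_iff)
  have "\<bar>\<sigma> y\<bar> \<le> \<bar>B\<bar> * indicator (cball 0 R) y" for y
    using B[of y] R[of y] z[of y] by (cases "y \<in> K") (auto simp: indicator_def)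
  then show ?thesis using borel_measurable_continuous_onI[OF c] by (auto simp: kernel_def)
qed

lemma kernel_deriv_at:
  assumes "kernel_deriv \<sigma> i \<sigma>'"
  shows "((\<lambda>s. \<sigma> (y + s *\<^sub>R axis i 1)) has_real_derivative \<sigma>' (y + s *\<^sub>R axis i 1)) (at s)"
proof -
  have "((\<lambda>t. \<sigma> ((y + s *\<^sub>R axis i 1) + t *\<^sub>R axis i 1)) has_real_derivative \<sigma>' (y + s *\<^sub>R axis i 1)) (at 0)"
    using assms by (auto simp: kernel_deriv_def)
  then show ?thesis
    using DERIV_shift[of "\<lambda>s. \<sigma> (y + s *\<^sub>R axis i 1)" "\<sigma>' (y + s *\<^sub>R axis i 1)" 0 s]
    by (simp add: algebra_simps)
qed

lemma diff_quot_bound: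
  assumes "kernel_deriv \<sigma> i \<sigma>'" "\<And>y. \<bar>\<sigma>' y\<bar> \<le> B" "0 < e"
  shows "\<bar>diff_quot \<sigma> i e y\<bar> \<le> B"
proof -
  obtain z where z: "- e < z" "z < 0"
    "\<sigma> (y + 0 *\<^sub>R axis i 1) - \<sigma> (y + (- e) *\<^sub>R axis i 1) = (0 - (- e)) * \<sigma>' (y + z *\<^sub>R axis i 1)"
    using MVT2[of "- e" 0 "\<lambda>s. \<sigma> (y + s *\<^sub>R axis i 1)" "\<lambda>s. \<sigma>' (y + s *\<^sub>R axis i 1)"]
      kernel_deriv_at[OF assms(1)] assms(3) by auto
  then have "diff_quot \<sigma> i e y = - \<sigma>' (y + z *\<^sub>R axis i 1)"
    using assms(3) by (simp add: diff_quot_def field_simps)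
  then show ?thesis using assms(2) by simp
qed

text \<open>Pointwise convergence is the definition of the derivative, and the mean value theorem
  bounds the quotients by the bound for \<open>\<sigma>'\<close>, so dominated convergence applies.
  The exponent \<open>r = 1\<close> measures the mass of kernels, the conjugate exponent serves in
  pairings.\<close>

lemma diff_quot_tendsto:
  fixes \<sigma> :: "real ^ 'd \<Rightarrow> real"
  assumes \<sigma>: "kernel_deriv \<sigma> i \<sigma>'" and e: "\<And>n. 0 < e n" "e \<longlonglongrightarrow> 0" and r: "0 < r"
  shows "(\<lambda>n. Lp_int r lborel (\<lambda>y. diff_quot \<sigma> i (e n) y + \<sigma>' y)) \<longlonglongrightarrow> 0"
proof -
  have k: "kernel \<sigma>" "kernel \<sigma>'" using \<sigma> by (auto simp: kernel_deriv_def)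
  obtain B R where BR: "\<And>y. \<bar>\<sigma> y\<bar> \<le> B * indicator (cball 0 R) y" using k by (auto simp: kernel_def)
  obtain B' R' where BR': "\<And>y. \<bar>\<sigma>' y\<bar> \<le> B' * indicator (cball 0 R') y" using k by (auto simp: kernel_def)
  obtain E where E: "\<And>n. e n \<le> E" using convergent_imp_bounded[OF e(2)] by (auto simp: bounded_iff intro: order_trans[OF abs_ge_self])
  have E0: "0 < E" using E[of 0] e(1)[of 0] by simp
  \<comment> \<open>Radius of a ball outside of which \<open>\<sigma>\<close>,
    \<open>\<sigma>'\<close> and every shift of \<open>\<sigma>\<close> by
    \<open>e n \<le> E\<close> vanish.\<close>
  define R1 where "R1 = max R R' + E"
  have B'1: "\<bar>\<sigma>' y\<bar> \<le> \<bar>B'\<bar>" for y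
    using BR'[of y] by (cases "norm y \<le> R'") auto
  have bound: "\<bar>diff_quot \<sigma> i (e n) y + \<sigma>' y\<bar> \<le> (2 * \<bar>B'\<bar>) * indicator (cball 0 R1) y" for n y
  proof (cases "norm y \<le> R1")
    case True
    have "\<bar>diff_quot \<sigma> i (e n) y + \<sigma>' y\<bar> \<le> \<bar>B'\<bar> + \<bar>B'\<bar>"
      using diff_quot_bound[OF \<sigma> B'1 e(1)] B'1 by (intro order_trans[OF abs_triangle_ineq add_mono])
    then show ?thesis using True by simp
  next
    case False
    have n1: "norm (e n *\<^sub>R axis i (1::real)) \<le> E" using e(1)[of n] E[of n] by (simp add: norm_axis_1)
    have "\<not> norm y \<le> R" "\<not> norm y \<le> R'" using False E0 by (auto simp: R1_def)
    moreover have "\<not> norm (y - e n *\<^sub>R axis i 1) \<le> R"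
      using norm_triangle_sub[of y "e n *\<^sub>R axis i 1"] n1 False by (auto simp: R1_def)
    ultimately have "\<sigma> y = 0" "\<sigma>' y = 0" "\<sigma> (y - e n *\<^sub>R axis i 1) = 0"
      using BR[of y] BR'[of y] BR[of "y - e n *\<^sub>R axis i 1"] by (auto simp: indicator_def)
    then show ?thesis by (simp add: diff_quot_def)
  qed
  have m: "diff_quot \<sigma> i (e n) \<in> borel_measurable borel" "\<sigma>' \<in> borel_measurable borel" for n
    using kernel_measurable[OF kernel_diff_quot[OF k(1)]] kernel_measurable[OF k(2)] by auto
  have "(\<lambda>n. LINT y|lborel. norm (diff_quot \<sigma> i (e n) y + \<sigma>' y) powr r) \<longlonglongrightarrow> (LINT y|(lborel :: (real ^ 'd) measure). 0)"
  proof (rule integral_dominated_convergence[where w = "\<lambda>y. (2 * \<bar>B'\<bar>) powr r * indicator (cball 0 R1) y"])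
    show "integrable lborel (\<lambda>y. (2 * \<bar>B'\<bar>) powr r * indicat_real (cball 0 R1 :: (real ^ 'd) set) y)"
      using emeasure_lborel_cball_finite[of "0 :: real ^ 'd" R1] by (auto intro!: integrable_real_indicator)
    show "AE y in lborel. (\<lambda>n. norm (diff_quot \<sigma> i (e n) y + \<sigma>' y) powr r) \<longlonglongrightarrow> 0"
    proof (rule AE_I2)
      fix y
      have "((\<lambda>h. (\<sigma> (y + (0 + h) *\<^sub>R axis i 1) - \<sigma> (y + 0 *\<^sub>R axis i 1)) / h) \<longlongrightarrow> \<sigma>' y) (at 0)"
        using \<sigma> unfolding kernel_deriv_def DERIV_def by blast
      moreover have "filterlim (\<lambda>n. - e n) (at 0) sequentially"
        unfolding filterlim_at using tendsto_minus[OF e(2)] e(1) by (auto intro!: always_eventually simp: less_imp_neq[symmetric])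
      ultimately have "(\<lambda>n. (\<sigma> (y + (0 + - e n) *\<^sub>R axis i 1) - \<sigma> (y + 0 *\<^sub>R axis i 1)) / (- e n)) \<longlonglongrightarrow> \<sigma>' y"
        by (rule filterlim_compose)
      then have "(\<lambda>n. - diff_quot \<sigma> i (e n) y) \<longlonglongrightarrow> \<sigma>' y" by (simp add: diff_quot_def)
      then have "(\<lambda>n. - diff_quot \<sigma> i (e n) y - \<sigma>' y) \<longlonglongrightarrow> 0" by (simp add: LIM_zero)
      then have "(\<lambda>n. norm (- diff_quot \<sigma> i (e n) y - \<sigma>' y)) \<longlonglongrightarrow> 0" by (rule tendsto_norm_zero)
      moreover have "norm (- diff_quot \<sigma> i (e n) y - \<sigma>' y) = norm (diff_quot \<sigma> i (e n) y + \<sigma>' y)" for n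
        using norm_minus_cancel[of "diff_quot \<sigma> i (e n) y + \<sigma>' y"] by simp
      ultimately have "(\<lambda>n. norm (diff_quot \<sigma> i (e n) y + \<sigma>' y)) \<longlonglongrightarrow> 0" by simp
      then show "(\<lambda>n. norm (diff_quot \<sigma> i (e n) y + \<sigma>' y) powr r) \<longlonglongrightarrow> 0" by (rule powr_null[OF _ r]) auto
    qed
    fix n
    show "AE y in lborel. norm (norm (diff_quot \<sigma> i (e n) y + \<sigma>' y) powr r) \<le> (2 * \<bar>B'\<bar>) powr r * indicator (cball 0 R1) y"
    proof (rule AE_I2)
      fix y
      show "norm (norm (diff_quot \<sigma> i (e n) y + \<sigma>' y) powr r) \<le> (2 * \<bar>B'\<bar>) powr r * indicator (cball 0 R1) y"
        using bound[of n y] powr_mono2[of r "norm (diff_quot \<sigma> i (e n) y + \<sigma>' y)" "2 * \<bar>B'\<bar>"] r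
        by (cases "norm y \<le> R1") (auto simp: indicator_def)
    qed
    show "(\<lambda>y. norm (diff_quot \<sigma> i (e n) y + \<sigma>' y) powr r) \<in> borel_measurable lborel" for n
      using m by measurable
  qed simp
  then show ?thesis by (simp add: Lp_int_def)
qed

lemma mass_Lp_int: "mass \<sigma> = Lp_int 1 lborel \<sigma>"
  by (simp add: mass_def Lp_int_def)

text \<open>Through this lemma the integrals in \<open>weak_gradient\<close> become pairings with
  L^q functions, and difference quotients of test functions converge like those of
  mollifiers.\<close>

lemma test_function_kernel:
  fixes \<psi> :: "real ^ 'd \<Rightarrow> real"
  assumes "test_function \<psi>"
  shows "kernel_deriv \<psi> i (\<lambda>x. frechet_derivative \<psi> (at x) (axis i 1))"
proof -
  let ?K = "closure {x. \<psi> x \<noteq> 0}"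
  have K: "compact ?K" and "C_k (Suc 0) \<psi>" using assms by (auto simp: test_function_def)
  then have diff: "\<psi> differentiable (at x)" and cont: "continuous_on UNIV (\<lambda>x. frechet_derivative \<psi> (at x) (axis i 1))" for x
    by auto
  have z: "\<psi> y = 0" if "y \<notin> ?K" for y using that closure_subset by force
  have z': "frechet_derivative \<psi> (at y) (axis i 1) = 0" if "y \<notin> ?K" for y
  proof -
    have "((\<lambda>_. 0::real) has_derivative (\<lambda>_. 0)) (at y)" by simp
    then have "(\<psi> has_derivative (\<lambda>_. 0)) (at y)"
    proof (rule has_derivative_transform_within_open)
      show "open (- ?K)" "y \<in> - ?K" using that by (auto intro: open_Compl)
      show "0 = \<psi> x" if "x \<in> - ?K" for x by (rule z[symmetric]) (use that in blast)
    qed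
    from fun_cong[OF frechet_derivative_at[OF this], of "axis i 1"] show ?thesis by simp
  qed
  have der: "((\<lambda>s. \<psi> (y + s *\<^sub>R axis i 1)) has_real_derivative frechet_derivative \<psi> (at y) (axis i 1)) (at 0)" for y
  proof -
    let ?D = "frechet_derivative \<psi> (at y)"
    have D: "(\<psi> has_derivative ?D) (at (y + 0 *\<^sub>R axis i 1))" using diff by (simp add: frechet_derivative_works[symmetric])
    have "((\<lambda>s::real. y + s *\<^sub>R axis i 1) has_derivative (\<lambda>s. s *\<^sub>R axis i 1)) (at 0)"
      by (auto intro!: derivative_eq_intros)
    from has_derivative_compose[OF this D]
    have "((\<lambda>s. \<psi> (y + s *\<^sub>R axis i 1)) has_derivative (\<lambda>s. ?D (s *\<^sub>R axis i 1))) (at 0)" .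
    moreover have "?D (s *\<^sub>R axis i 1) = ?D (axis i 1) * s" for s
      using linear_scale[OF has_derivative_linear[OF D]] by simp
    ultimately show ?thesis by (simp add: has_field_derivative_def)
  qed
  have "continuous_on UNIV \<psi>"
    using diff by (auto simp: continuous_on_eq_continuous_at intro!: differentiable_imp_continuous_within)
  then have "kernel \<psi>" by (rule kernel_continuous[OF _ K z])
  moreover have "kernel (\<lambda>x. frechet_derivative \<psi> (at x) (axis i 1))" by (rule kernel_continuous[OF cont K z'])
  ultimately show ?thesis unfolding kernel_deriv_def using der by blast
qed

lemma Lp_loc_integrable:
  fixes f :: "real ^ 'd \<Rightarrow> 'b::euclidean_space"
  assumes p: "1 < p" and f: "f \<in> Lp p lborel"
  shows "loc_integrable f"
  unfolding loc_integrable_def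
proof (intro allI impI)
  fix K :: "(real ^ 'd) set" assume K: "compact K"
  have [measurable]: "f \<in> borel_measurable borel" using Lp_measurable[OF f] by simp
  have Kb[measurable]: "K \<in> sets borel" by (rule borel_closed[OF compact_imp_closed[OF K]])
  have fin: "emeasure lborel K < \<infinity>" using K by (rule emeasure_compact_finite)
  show "set_integrable lborel K f"
    unfolding set_integrable_def
  proof (rule Bochner_Integration.integrable_bound[of lborel "\<lambda>x. indicat_real K x + norm (f x) powr p"])
    show "integrable lborel (\<lambda>x. indicat_real K x + norm (f x) powr p)"
      using fin Lp_integrable[OF f] by (intro Bochner_Integration.integrable_add integrable_real_indicator) auto
    have le: "t \<le> 1 + t powr p" if "0 \<le> t" for t :: real
      using that p powr_mono[of 1 p t] by (cases "t \<le> 1") (auto intro: add_increasing2)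
    show "AE x in lborel. norm (indicat_real K x *\<^sub>R f x) \<le> norm (indicat_real K x + norm (f x) powr p)"
      using le by (intro AE_I2) (auto simp: indicator_def)
  qed measurable
qed

lemma mollify_diff_quot:
  assumes "kernel \<sigma>" "f \<in> Lp p lborel" "1 < p"
  shows "(mollify \<sigma> f (x + e *\<^sub>R axis i 1) - mollify \<sigma> f x) / e = mollify (diff_quot \<sigma> i e) f x"
proof -
  have [measurable]: "f \<in> borel_measurable borel" "\<sigma> \<in> borel_measurable borel"
    using Lp_measurable[OF assms(2)] kernel_measurable[OF assms(1)] by auto
  have "mollify \<sigma> f (x + e *\<^sub>R axis i 1) = mollify (\<lambda>y. \<sigma> (y + - e *\<^sub>R axis i 1)) f x"
    by (subst mollify_translate) auto
  moreover have "mollify (\<lambda>y. (1/e) * \<sigma> (y + - e *\<^sub>R axis i 1) + (- 1/e) * \<sigma> y) f x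
      = (1/e) * mollify (\<lambda>y. \<sigma> (y + - e *\<^sub>R axis i 1)) f x + (- 1/e) * mollify \<sigma> f x"
    by (rule mollify_linear_kernel[OF kernel_shift[OF assms(1)] assms])
  moreover have "(\<lambda>y. (1/e) * \<sigma> (y + - e *\<^sub>R axis i 1) + (- 1/e) * \<sigma> y) = diff_quot \<sigma> i e"
    by (auto simp: diff_quot_def diff_divide_distrib)
  ultimately show ?thesis by (simp add: diff_divide_distrib)
qed

lemma mollify_kernel_tendsto:
  fixes \<sigma> :: "nat \<Rightarrow> 'a::euclidean_space \<Rightarrow> real" and \<tau> f :: "'a \<Rightarrow> real"
  assumes p: "1 < p" and f: "f \<in> Lp p lborel" and \<sigma>: "\<And>n. kernel (\<sigma> n)" "kernel \<tau>"
    and lim: "(\<lambda>n. mass (\<lambda>y. \<sigma> n y - \<tau> y)) \<longlonglongrightarrow> 0"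
  shows "(\<lambda>n. Lp_int p lborel (\<lambda>x. mollify (\<sigma> n) f x - mollify \<tau> f x)) \<longlonglongrightarrow> 0"
proof -
  have eq: "mollify (\<sigma> n) f x - mollify \<tau> f x = mollify (\<lambda>y. \<sigma> n y - \<tau> y) f x" for n x
    using mollify_linear_kernel[OF \<sigma> f p, where a = 1 and b = "-1"] by simp
  have k: "kernel (\<lambda>y. \<sigma> n y - \<tau> y)" for n using kernel_add[OF \<sigma>, of 1 n "-1"] by simp
  have "(\<lambda>n. mass (\<lambda>y. \<sigma> n y - \<tau> y) powr p * Lp_int p lborel f) \<longlonglongrightarrow> 0 * Lp_int p lborel f"
    using p by (intro tendsto_mult powr_null[OF lim] tendsto_const) auto
  then have lim0: "(\<lambda>n. mass (\<lambda>y. \<sigma> n y - \<tau> y) powr p * Lp_int p lborel f) \<longlonglongrightarrow> 0" by simp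
  show ?thesis
    unfolding eq
  proof (rule tendsto_sandwich[OF _ _ tendsto_const lim0])
    show "\<forall>\<^sub>F n in sequentially. Lp_int p lborel (mollify (\<lambda>y. \<sigma> n y - \<tau> y) f)
        \<le> mass (\<lambda>y. \<sigma> n y - \<tau> y) powr p * Lp_int p lborel f"
      by (intro always_eventually allI mollify_Lp(2)[OF p k f])
  qed auto
qed

text \<open>Integration by parts is carried out for difference quotients, where it is just
  translation invariance of the integral: the quotient leaves \<psi> for the mollified function and
  thereby falls onto \<rho>. Both sides then converge because the quotients of the two kernels
  do.\<close>

lemma weak_gradient_mollify:
  fixes \<rho> :: "real ^ 'd \<Rightarrow> real"
  assumes p: "1 < p" and f: "f \<in> Lp p lborel" and \<rho>: "\<And>i. kernel_deriv \<rho> i (\<rho>' i)"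
  shows "weak_gradient (mollify \<rho> f) (\<lambda>x. \<chi> i. mollify (\<lambda>y. - \<rho>' i y) f x)"
    and "(\<lambda>x. \<chi> i. mollify (\<lambda>y. - \<rho>' i y) f x) \<in> Lp p lborel"
    and "mollify \<rho> f \<in> W1p p"
proof -
  obtain q where pq: "conj_exp p q" using conj_exp_exists[OF p] by blast
  note pq' = conj_expD[OF pq]
  have k: "kernel \<rho>" "kernel (\<lambda>y. - \<rho>' i y)" for i using \<rho>[of i] kernel_uminus by (auto simp: kernel_deriv_def)
  have L: "mollify \<rho> f \<in> Lp p lborel" "mollify (\<lambda>y. - \<rho>' i y) f \<in> Lp p lborel" for i
    by (rule mollify_Lp[OF p k(1) f], rule mollify_Lp[OF p k(2) f])
  show G: "(\<lambda>x. \<chi> i. mollify (\<lambda>y. - \<rho>' i y) f x) \<in> Lp p lborel"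
    using L(2) p by (intro Lp_vec) auto
  have mf[measurable]: "mollify \<rho> f \<in> borel_measurable borel" using Lp_measurable[OF L(1)] by simp
  show *: "weak_gradient (mollify \<rho> f) (\<lambda>x. \<chi> i. mollify (\<lambda>y. - \<rho>' i y) f x)"
    unfolding weak_gradient_def
  proof (intro conjI allI impI Lp_loc_integrable[OF p] L G)
    fix \<psi> :: "real ^ 'd \<Rightarrow> real" and i assume \<psi>: "test_function \<psi>"
    define \<psi>' where "\<psi>' x = frechet_derivative \<psi> (at x) (axis i 1)" for x
    have kd: "kernel_deriv \<psi> i \<psi>'" unfolding \<psi>'_def by (rule test_function_kernel[OF \<psi>])
    have k\<psi>: "kernel \<psi>" "kernel (\<lambda>y. - \<psi>' y)" using kd kernel_uminus by (auto simp: kernel_deriv_def)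
    have [measurable]: "\<psi> \<in> borel_measurable borel" using kernel_measurable[OF k\<psi>(1)] by simp
    define e where "e n = inverse (real (Suc n))" for n
    have e: "0 < e n" "e \<longlonglongrightarrow> 0" for n unfolding e_def using LIMSEQ_inverse_real_of_nat by auto
    have q: "0 < q" using pq' by simp
    define A where "A n = (LINT x|lborel. diff_quot \<psi> i (e n) x * mollify \<rho> f x)" for n
    have "(\<lambda>n. LINT x|lborel. mollify \<rho> f x \<bullet> diff_quot \<psi> i (e n) x) \<longlonglongrightarrow> (LINT x|lborel. mollify \<rho> f x \<bullet> (- \<psi>' x))"
      using diff_quot_tendsto[OF kd e q]
      by (intro Lp_pairing_tendsto[OF pq'(6) L(1)] kernel_Lp kernel_diff_quot k\<psi> q) simp
    then have lim1: "A \<longlonglongrightarrow> - (LINT x|lborel. mollify \<rho> f x * \<psi>' x)"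
      by (simp add: A_def[abs_def] mult.commute)
    have "(\<lambda>n. mass (\<lambda>y. diff_quot \<rho> i (e n) y - - \<rho>' i y)) \<longlonglongrightarrow> 0"
      using diff_quot_tendsto[OF \<rho> e, of 1] by (simp add: mass_Lp_int)
    then have "(\<lambda>n. Lp_int p lborel (\<lambda>x. mollify (diff_quot \<rho> i (e n)) f x - mollify (\<lambda>y. - \<rho>' i y) f x)) \<longlonglongrightarrow> 0"
      by (intro mollify_kernel_tendsto p f kernel_diff_quot k)
    then have lim2: "(\<lambda>n. LINT x|lborel. \<psi> x \<bullet> mollify (diff_quot \<rho> i (e n)) f x)
        \<longlonglongrightarrow> (LINT x|lborel. \<psi> x \<bullet> mollify (\<lambda>y. - \<rho>' i y) f x)"
      by (intro Lp_pairing_tendsto[OF pq] kernel_Lp k\<psi> q mollify_Lp(1)[OF p _ f] kernel_diff_quot k)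
    have "A n = (LINT x|lborel. \<psi> x \<bullet> mollify (diff_quot \<rho> i (e n)) f x)" for n
    proof -
      let ?u = "e n *\<^sub>R axis i 1 :: real ^ 'd"
      have i1: "integrable lborel (\<lambda>x. \<psi> x * mollify \<rho> f x)"
        using Lp_pairing(1)[OF pq L(1) kernel_Lp[OF k\<psi>(1) q]] by simp
      have i2: "integrable lborel (\<lambda>x. \<psi> (x - ?u) * mollify \<rho> f x)"
        using Lp_pairing(1)[OF pq L(1) kernel_Lp[OF kernel_shift[OF k\<psi>(1)] q], of "- ?u"] by simp
      have i3: "integrable lborel (\<lambda>x. \<psi> x * mollify \<rho> f (x + ?u))"
        using Lp_pairing(1)[OF pq Lp_lborel_shift(1)[OF L(1)] kernel_Lp[OF k\<psi>(1) q], of ?u] by simp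
      have "(LINT x|lborel. \<psi> ((x + ?u) - ?u) * mollify \<rho> f (x + ?u)) = (LINT x|lborel. \<psi> (x - ?u) * mollify \<rho> f x)"
        by (rule integral_lborel_shift) measurable
      then have sh: "(LINT x|lborel. \<psi> x * mollify \<rho> f (x + ?u)) = (LINT x|lborel. \<psi> (x - ?u) * mollify \<rho> f x)"
        by simp
      have "A n = (LINT x|lborel. (1 / e n) * (\<psi> (x - ?u) * mollify \<rho> f x - \<psi> x * mollify \<rho> f x))"
        by (simp add: A_def diff_quot_def algebra_simps diff_divide_distrib)
      also have "\<dots> = (1 / e n) * ((LINT x|lborel. \<psi> (x - ?u) * mollify \<rho> f x) - (LINT x|lborel. \<psi> x * mollify \<rho> f x))"
        using i1 i2 by simp
      also have "\<dots> = (LINT x|lborel. (1 / e n) * (\<psi> x * mollify \<rho> f (x + ?u) - \<psi> x * mollify \<rho> f x))"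
        using i1 i3 by (simp add: sh)
      also have "\<dots> = (LINT x|lborel. \<psi> x \<bullet> mollify (diff_quot \<rho> i (e n)) f x)"
        unfolding mollify_diff_quot[OF k(1) f p, symmetric] by (simp add: algebra_simps diff_divide_distrib)
      finally show ?thesis .
    qed
    then have "A = (\<lambda>n. LINT x|lborel. \<psi> x \<bullet> mollify (diff_quot \<rho> i (e n)) f x)" by blast
    then have "A \<longlonglongrightarrow> (LINT x|lborel. \<psi> x \<bullet> mollify (\<lambda>y. - \<rho>' i y) f x)" using lim2 by (simp only:)
    then have "- (LINT x|lborel. mollify \<rho> f x * \<psi>' x) = (LINT x|lborel. \<psi> x \<bullet> mollify (\<lambda>y. - \<rho>' i y) f x)"
      by (rule LIMSEQ_unique[OF lim1])
    then show "(LINT x|lborel. mollify \<rho> f x * frechet_derivative \<psi> (at x) (axis i 1)) =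
        - (LINT x|lborel. (\<chi> i. mollify (\<lambda>y. - \<rho>' i y) f x) $ i * \<psi> x)"
      by (simp add: \<psi>'_def mult.commute)
  qed
  show "mollify \<rho> f \<in> W1p p" using * G L(1) by (auto simp: W1p_def)
qed

lemma weak_gradient_limit:
  fixes f :: "nat \<Rightarrow> real ^ 'd \<Rightarrow> real" and g :: "nat \<Rightarrow> real ^ 'd \<Rightarrow> real ^ 'd"
  assumes p: "1 < p" and L: "\<And>n. f n \<in> Lp p lborel" "\<And>n. g n \<in> Lp p lborel" "F \<in> Lp p lborel" "G \<in> Lp p lborel"
    and wg: "\<And>n. weak_gradient (f n) (g n)"
    and lim: "(\<lambda>n. Lp_int p lborel (\<lambda>x. f n x - F x)) \<longlonglongrightarrow> 0" "(\<lambda>n. Lp_int p lborel (\<lambda>x. g n x - G x)) \<longlonglongrightarrow> 0"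
  shows "weak_gradient F G"
  unfolding weak_gradient_def
proof (intro conjI allI impI Lp_loc_integrable[OF p] L)
  obtain q where pq: "conj_exp p q" using conj_exp_exists[OF p] by blast
  have q: "0 < q" and p0: "0 < p" using conj_expD[OF pq] by auto
  fix \<psi> :: "real ^ 'd \<Rightarrow> real" and i assume \<psi>: "test_function \<psi>"
  define \<psi>' where "\<psi>' x = frechet_derivative \<psi> (at x) (axis i 1)" for x
  have k: "kernel \<psi>" "kernel \<psi>'"
    using test_function_kernel[OF \<psi>, of i] by (auto simp: kernel_deriv_def \<psi>'_def[abs_def])
  have "(\<lambda>n. LINT x|lborel. \<psi>' x \<bullet> f n x) \<longlonglongrightarrow> (LINT x|lborel. \<psi>' x \<bullet> F x)"
    by (rule Lp_pairing_tendsto[OF pq kernel_Lp[OF k(2) q] L(1,3) lim(1)])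
  moreover have "(\<lambda>n. Lp_int p lborel (\<lambda>x. g n x $ i - G x $ i)) \<longlonglongrightarrow> 0"
  proof (rule tendsto_sandwich[OF _ _ tendsto_const lim(2)])
    show "\<forall>\<^sub>F n in sequentially. Lp_int p lborel (\<lambda>x. g n x $ i - G x $ i) \<le> Lp_int p lborel (\<lambda>x. g n x - G x)"
      using Lp_component(2)[OF Lp_diff(1)[OF L(2,4) p0] less_imp_le[OF p0]] by (auto intro!: always_eventually)
  qed auto
  then have "(\<lambda>n. LINT x|lborel. \<psi> x \<bullet> g n x $ i) \<longlonglongrightarrow> (LINT x|lborel. \<psi> x \<bullet> G x $ i)"
    using p0 by (intro Lp_pairing_tendsto[OF pq kernel_Lp[OF k(1) q]] Lp_component L) auto
  then have "(\<lambda>n. - (LINT x|lborel. \<psi> x \<bullet> g n x $ i)) \<longlonglongrightarrow> - (LINT x|lborel. \<psi> x \<bullet> G x $ i)" by (rule tendsto_minus)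
  moreover have "(LINT x|lborel. \<psi>' x \<bullet> f n x) = - (LINT x|lborel. \<psi> x \<bullet> g n x $ i)" for n
    using wg[of n] \<psi> by (auto simp: weak_gradient_def \<psi>'_def mult.commute)
  ultimately have "(LINT x|lborel. \<psi>' x \<bullet> F x) = - (LINT x|lborel. \<psi> x \<bullet> G x $ i)"
    using LIMSEQ_unique by simp
  then show "(LINT x|lborel. F x * frechet_derivative \<psi> (at x) (axis i 1)) = - (LINT x|lborel. (G x $ i) * \<psi> x)"
    by (simp add: \<psi>'_def mult.commute)
qed

lemma weak_gradient_lincomb:
  assumes p: "1 < p" and L: "f \<in> Lp p lborel" "f' \<in> Lp p lborel" "g \<in> Lp p lborel" "g' \<in> Lp p lborel"
    and wg: "weak_gradient f g" "weak_gradient f' g'"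
  shows "weak_gradient (\<lambda>x. a * f x + b * f' x) (\<lambda>x. a *\<^sub>R g x + b *\<^sub>R g' x)"
  unfolding weak_gradient_def
proof (intro conjI allI impI Lp_loc_integrable[OF p])
  obtain q where pq: "conj_exp p q" using conj_exp_exists[OF p] by blast
  have q: "0 < q" and p0: "0 < p" using conj_expD[OF pq] by auto
  show "(\<lambda>x. a * f x + b * f' x) \<in> Lp p lborel" "(\<lambda>x. a *\<^sub>R g x + b *\<^sub>R g' x) \<in> Lp p lborel"
    by (intro Lp_add Lp_mult Lp_scaleR L p0)+
  fix \<psi> :: "real ^ 'a \<Rightarrow> real" and i assume \<psi>: "test_function \<psi>"
  define \<psi>' where "\<psi>' x = frechet_derivative \<psi> (at x) (axis i 1)" for x
  have k: "kernel \<psi>" "kernel \<psi>'"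
    using test_function_kernel[OF \<psi>, of i] by (auto simp: kernel_deriv_def \<psi>'_def[abs_def])
  have i1: "integrable lborel (\<lambda>x. f x * \<psi>' x)" "integrable lborel (\<lambda>x. f' x * \<psi>' x)"
    using Lp_pairing(1)[OF pq L(1) kernel_Lp[OF k(2) q]] Lp_pairing(1)[OF pq L(2) kernel_Lp[OF k(2) q]]
    by (simp_all add: mult.commute)
  have i2: "integrable lborel (\<lambda>x. g x $ i * \<psi> x)" "integrable lborel (\<lambda>x. g' x $ i * \<psi> x)"
    using Lp_pairing(1)[OF pq Lp_component(1)[OF L(3)] kernel_Lp[OF k(1) q]]
      Lp_pairing(1)[OF pq Lp_component(1)[OF L(4)] kernel_Lp[OF k(1) q]] p0 by (simp_all add: mult.commute)
  have "(LINT x|lborel. (a * f x + b * f' x) * \<psi>' x) = a * (LINT x|lborel. f x * \<psi>' x) + b * (LINT x|lborel. f' x * \<psi>' x)"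
    using i1 by (simp add: distrib_right mult.assoc)
  moreover have "(LINT x|lborel. (a *\<^sub>R g x + b *\<^sub>R g' x) $ i * \<psi> x)
      = a * (LINT x|lborel. g x $ i * \<psi> x) + b * (LINT x|lborel. g' x $ i * \<psi> x)"
    using i2 by (simp add: distrib_right mult.assoc)
  moreover have "(LINT x|lborel. f x * \<psi>' x) = - (LINT x|lborel. g x $ i * \<psi> x)"
    "(LINT x|lborel. f' x * \<psi>' x) = - (LINT x|lborel. g' x $ i * \<psi> x)"
    using wg \<psi> by (auto simp: weak_gradient_def \<psi>'_def)
  ultimately show "(LINT x|lborel. (a * f x + b * f' x) * frechet_derivative \<psi> (at x) (axis i 1))
      = - (LINT x|lborel. (a *\<^sub>R g x + b *\<^sub>R g' x) $ i * \<psi> x)"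
    by (simp add: \<psi>'_def)
qed

text \<open>The square of a truncated paraboloid: continuously differentiable, supported in the ball
  of radius \<delta>, with an explicit gradient. One derivative is all that
  \<open>kernel_deriv\<close> asks for.\<close>

definition bump_raw :: "real \<Rightarrow> real ^ 'd \<Rightarrow> real" where
  "bump_raw \<delta> y = (max 0 (\<delta>\<^sup>2 - y \<bullet> y))\<^sup>2"

definition bump :: "real \<Rightarrow> real ^ 'd \<Rightarrow> real" where
  "bump \<delta> y = bump_raw \<delta> y / mass (bump_raw \<delta> :: real ^ 'd \<Rightarrow> real)"

definition bump' :: "real \<Rightarrow> 'd \<Rightarrow> real ^ 'd \<Rightarrow> real" where
  "bump' \<delta> i y = - 4 * y $ i * max 0 (\<delta>\<^sup>2 - y \<bullet> y) / mass (bump_raw \<delta> :: real ^ 'd \<Rightarrow> real)"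

lemma bump_support:
  assumes "0 < \<delta>" "norm y > \<delta>"
  shows "max 0 (\<delta>\<^sup>2 - y \<bullet> y) = 0"
proof -
  have "\<delta>\<^sup>2 \<le> (norm y)\<^sup>2" using assms by (intro power_mono) auto
  then show ?thesis by (simp add: power2_norm_eq_inner)
qed

lemma kernel_bump:
  fixes i :: "'d::finite"
  assumes "0 < \<delta>"
  shows "kernel (bump_raw \<delta> :: real ^ 'd \<Rightarrow> real)" "kernel (bump \<delta> :: real ^ 'd \<Rightarrow> real)" "kernel (bump' \<delta> i)"
proof -
  have z: "max 0 (\<delta>\<^sup>2 - y \<bullet> y) = 0" if "y \<notin> cball 0 \<delta>" for y :: "real ^ 'd" using that by (intro bump_support[OF assms]) auto
  note K = compact_cball[of "0 :: real ^ 'd" \<delta>]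
  show "kernel (bump_raw \<delta> :: real ^ 'd \<Rightarrow> real)"
    by (rule kernel_continuous[OF _ K]) (use z in \<open>auto simp: bump_raw_def intro!: continuous_intros\<close>)
  show "kernel (bump \<delta> :: real ^ 'd \<Rightarrow> real)"
    by (rule kernel_continuous[OF _ K]) (use z in \<open>auto simp: bump_raw_def bump_def divide_inverse intro!: continuous_intros\<close>)
  show "kernel (bump' \<delta> i)"
    by (rule kernel_continuous[OF _ K]) (use z in \<open>auto simp: bump'_def divide_inverse intro!: continuous_intros\<close>)
qed

lemma mass_bump_raw_pos:
  assumes "0 < \<delta>"
  shows "0 < mass (bump_raw \<delta> :: real ^ 'd \<Rightarrow> real)"
proof (rule ccontr)
  assume "\<not> ?thesis"
  then have "mass (bump_raw \<delta> :: real ^ 'd \<Rightarrow> real) = 0" using mass_nonneg[of "bump_raw \<delta> :: real ^ 'd \<Rightarrow> real"] by simp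
  then have "AE y in lborel. bump_raw \<delta> (y :: real ^ 'd) = 0"
    using integral_nonneg_eq_0_iff_AE[of lborel "\<lambda>y :: real ^ 'd. \<bar>bump_raw \<delta> y\<bar>"] kernel_integrable[OF kernel_bump(1)[OF assms]]
    by (auto simp: mass_def)
  moreover have "bump_raw \<delta> y \<noteq> 0" if "y \<in> ball 0 \<delta>" for y :: "real ^ 'd"
  proof -
    have "(norm y)\<^sup>2 < \<delta>\<^sup>2" using that by (intro power_strict_mono) auto
    then show ?thesis by (simp add: bump_raw_def power2_norm_eq_inner)
  qed
  ultimately have "AE y in lborel. y \<notin> ball (0 :: real ^ 'd) \<delta>" by (auto elim!: eventually_mono)
  then have "emeasure lborel (ball (0 :: real ^ 'd) \<delta>) = 0"
    by (subst (asm) AE_iff_measurable[of "ball 0 \<delta>"]) auto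
  then show False using content_ball_pos[OF assms, of "0 :: real ^ 'd"] by (simp add: measure_def)
qed

lemma bump_props:
  assumes "0 < \<delta>"
  shows "0 \<le> bump \<delta> y" "(LINT y|lborel. bump \<delta> (y :: real ^ 'd)) = 1" "bump \<delta> y \<noteq> 0 \<Longrightarrow> norm y \<le> \<delta>"
proof -
  have raw: "0 \<le> bump_raw \<delta> y" for y :: "real ^ 'd" by (simp add: bump_raw_def)
  show "0 \<le> bump \<delta> y" using mass_nonneg by (auto simp: bump_def bump_raw_def intro!: divide_nonneg_nonneg)
  show "(LINT y|lborel. bump \<delta> (y :: real ^ 'd)) = 1"
    using mass_bump_raw_pos[OF assms, where 'd = 'd] raw by (simp add: bump_def mass_def)
  show "bump \<delta> y \<noteq> 0 \<Longrightarrow> norm y \<le> \<delta>"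
    using bump_support[OF assms, of y] by (cases "norm y \<le> \<delta>") (auto simp: bump_def bump_raw_def)
qed

lemma kernel_deriv_bump:
  fixes i :: "'d::finite"
  assumes "0 < \<delta>"
  shows "kernel_deriv (bump \<delta>) i (bump' \<delta> i)"
proof -
  \<comment> \<open>The delicate point is the kink at 0, where the difference quotient of the
    squared positive part is at most \<open>\<bar>h\<bar>\<close> in absolute value.\<close>
  have sq: "((\<lambda>t::real. (max 0 t)\<^sup>2) has_real_derivative 2 * max 0 t) (at t)" for t
  proof -
    consider "t < 0" | "t = 0" | "0 < t" by linarith
    then show ?thesis
    proof cases
      case 1
      have "((\<lambda>_. 0) has_real_derivative 0) (at t)" by simp
      then have "((\<lambda>t::real. (max 0 t)\<^sup>2) has_real_derivative 0) (at t)"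
        by (rule has_field_derivative_transform_within_open[of _ _ _ "{..<0}"]) (use 1 in auto)
      then show ?thesis using 1 by simp
    next
      case 2
      have "((\<lambda>h::real. (max 0 (0 + h))\<^sup>2 / h) \<longlongrightarrow> 0) (at 0)"
      proof (rule Lim_null_comparison[of _ "\<lambda>h. \<bar>h\<bar>"])
        show "\<forall>\<^sub>F h in at 0. norm ((max 0 (0 + h))\<^sup>2 / h) \<le> \<bar>h\<bar>"
          by (intro always_eventually allI) (auto simp: max_def power2_eq_square)
        show "((\<lambda>h::real. \<bar>h\<bar>) \<longlongrightarrow> 0) (at 0)" by (intro tendsto_rabs_zero tendsto_ident_at)
      qed
      then show ?thesis using 2 by (simp add: DERIV_def)
    next
      case 3
      have "((\<lambda>t. t\<^sup>2) has_real_derivative 2 * t) (at t)" by (auto intro!: derivative_eq_intros)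
      then have "((\<lambda>t::real. (max 0 t)\<^sup>2) has_real_derivative 2 * t) (at t)"
        by (rule has_field_derivative_transform_within_open[of _ _ _ "{0<..}"]) (use 3 in auto)
      then show ?thesis using 3 by simp
    qed
  qed
  have "((\<lambda>s. bump \<delta> (y + s *\<^sub>R axis i 1)) has_real_derivative bump' \<delta> i y) (at 0)" for y :: "real ^ 'd"
  proof -
    define g where "g s = \<delta>\<^sup>2 - (y \<bullet> y + 2 * s * y $ i + s\<^sup>2)" for s :: real
    have ax: "y \<bullet> axis i 1 = y $ i" "axis i (1::real) \<bullet> y = y $ i" by (auto simp: inner_axis inner_axis')
    have g: "\<delta>\<^sup>2 - (y + s *\<^sub>R axis i 1) \<bullet> (y + s *\<^sub>R axis i 1) = g s" for s
      by (simp add: g_def inner_add inner_axis_axis ax power2_eq_square algebra_simps)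
    have "(g has_real_derivative - 2 * y $ i) (at 0)"
      unfolding g_def by (auto intro!: derivative_eq_intros)
    from DERIV_chain2[OF sq this]
    have "((\<lambda>s. (max 0 (g s))\<^sup>2) has_real_derivative 2 * max 0 (g 0) * (- 2 * y $ i)) (at 0)" .
    from DERIV_cdivide[OF this, where c = "mass (bump_raw \<delta> :: real ^ 'd \<Rightarrow> real)"]
    have "((\<lambda>s. (max 0 (g s))\<^sup>2 / mass (bump_raw \<delta> :: real ^ 'd \<Rightarrow> real)) has_real_derivative
        2 * max 0 (g 0) * (- 2 * y $ i) / mass (bump_raw \<delta> :: real ^ 'd \<Rightarrow> real)) (at 0)" .
    moreover have "bump \<delta> (y + s *\<^sub>R axis i 1) = (max 0 (g s))\<^sup>2 / mass (bump_raw \<delta> :: real ^ 'd \<Rightarrow> real)" for s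
      unfolding bump_def by (simp only: bump_raw_def g)
    moreover have "bump' \<delta> i y = 2 * max 0 (g 0) * (- 2 * y $ i) / mass (bump_raw \<delta> :: real ^ 'd \<Rightarrow> real)"
      by (simp add: bump'_def g_def)
    ultimately show ?thesis by (simp only:)
  qed
  then show ?thesis unfolding kernel_deriv_def using kernel_bump(2)[OF assms] kernel_bump(3)[OF assms, of i] by blast
qed

section \<open>Weak gradients of random fields\<close>

context dynamical_system
begin

text \<open>Convergence on the product space is convergence in L^1 of the slice integrals. A
  subsequence of these tends to zero for almost every \<omega>, and along it the weak gradients of
  the slices pass to the limit.\<close>

lemma weak_gradient_x_limit:
  assumes p: "1 < p" and L: "\<And>n. f n \<in> Lp p PX" "F \<in> Lp p PX" "G \<in> Lp p PX"
    and wg: "\<And>n. weak_gradient_x p P (f n) (g n)"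
    and lim: "(\<lambda>n. Lp_int p PX (\<lambda>x. f n x - F x)) \<longlonglongrightarrow> 0" "(\<lambda>n. Lp_int p PX (\<lambda>x. g n x - G x)) \<longlonglongrightarrow> 0"
  shows "weak_gradient_x p P F G"
proof -
  have p0: "0 < p" using p by simp
  have gL: "g n \<in> Lp p PX" for n using wg by (auto simp: weak_gradient_x_def)
  define If where "If n \<omega> = Lp_int p lborel (\<lambda>x. f n (\<omega>, x) - F (\<omega>, x))" for n \<omega>
  define Ig where "Ig n \<omega> = Lp_int p lborel (\<lambda>x. g n (\<omega>, x) - G (\<omega>, x))" for n \<omega>
  have If: "integrable P (If n)" "(LINT \<omega>|P. If n \<omega>) = Lp_int p PX (\<lambda>x. f n x - F x)" for n
    unfolding If_def using Lp_int_slice[OF Lp_diff(1)[OF L(1,2) p0]] by auto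
  have Ig: "integrable P (Ig n)" "(LINT \<omega>|P. Ig n \<omega>) = Lp_int p PX (\<lambda>x. g n x - G x)" for n
    unfolding Ig_def using Lp_int_slice[OF Lp_diff(1)[OF gL L(3) p0]] by auto
  have nonneg: "0 \<le> If n \<omega>" "0 \<le> Ig n \<omega>" for n \<omega> by (auto simp: If_def Ig_def)
  \<comment> \<open>The two slice errors are added, so that one subsequence works for the functions
    and their gradients.\<close>
  have "(\<lambda>n. LINT \<omega>|P. norm (If n \<omega> + Ig n \<omega>)) \<longlonglongrightarrow> 0"
  proof -
    have "(LINT \<omega>|P. norm (If n \<omega> + Ig n \<omega>)) = Lp_int p PX (\<lambda>x. f n x - F x) + Lp_int p PX (\<lambda>x. g n x - G x)" for n
      using If Ig nonneg by simp
    then show ?thesis using tendsto_add[OF lim] by simp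
  qed
  then obtain r where r: "strict_mono (r::nat\<Rightarrow>nat)" "AE \<omega> in P. (\<lambda>n. If (r n) \<omega> + Ig (r n) \<omega>) \<longlonglongrightarrow> 0"
    using tendsto_L1_AE_subseq[of P "\<lambda>n \<omega>. If n \<omega> + Ig n \<omega>"] If(1) Ig(1) by auto
  have "AE \<omega> in P. \<forall>n. (\<lambda>x. f n (\<omega>, x)) \<in> Lp p lborel \<and> (\<lambda>x. g n (\<omega>, x)) \<in> Lp p lborel
      \<and> weak_gradient (\<lambda>x. f n (\<omega>, x)) (\<lambda>x. g n (\<omega>, x))"
    using Lp_slice[OF L(1)] Lp_slice[OF gL] wg by (subst AE_all_countable) (auto simp: weak_gradient_x_def)
  then have "AE \<omega> in P. weak_gradient (\<lambda>x. F (\<omega>, x)) (\<lambda>x. G (\<omega>, x))"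
    using r(2) Lp_slice[OF L(2)] Lp_slice[OF L(3)]
  proof eventually_elim
    case (elim \<omega>)
    have "(\<lambda>n. If (r n) \<omega>) \<longlonglongrightarrow> 0"
    proof (rule tendsto_sandwich[OF _ _ tendsto_const elim(2)])
      show "\<forall>\<^sub>F n in sequentially. 0 \<le> If (r n) \<omega>"
        "\<forall>\<^sub>F n in sequentially. If (r n) \<omega> \<le> If (r n) \<omega> + Ig (r n) \<omega>" using nonneg by simp_all
    qed
    moreover have "(\<lambda>n. Ig (r n) \<omega>) \<longlonglongrightarrow> 0"
    proof (rule tendsto_sandwich[OF _ _ tendsto_const elim(2)])
      show "\<forall>\<^sub>F n in sequentially. 0 \<le> Ig (r n) \<omega>"
        "\<forall>\<^sub>F n in sequentially. Ig (r n) \<omega> \<le> If (r n) \<omega> + Ig (r n) \<omega>" using nonneg by simp_all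
    qed
    ultimately show ?case
      unfolding If_def Ig_def
      by (rule weak_gradient_limit[OF p _ _ elim(3,4), rotated 3]) (use elim(1) in auto)
  qed
  then show ?thesis using L(3) by (simp add: weak_gradient_x_def)
qed

lemma weak_gradient_x_lincomb:
  assumes p: "1 < p" and L: "f \<in> Lp p PX" "f' \<in> Lp p PX"
    and wg: "weak_gradient_x p P f g" "weak_gradient_x p P f' g'"
  shows "weak_gradient_x p P (\<lambda>z. a * f z + b * f' z) (\<lambda>z. a *\<^sub>R g z + b *\<^sub>R g' z)"
proof -
  have gL: "g \<in> Lp p PX" "g' \<in> Lp p PX" using wg by (auto simp: weak_gradient_x_def)
  have "AE \<omega> in P. weak_gradient (\<lambda>x. f (\<omega>, x)) (\<lambda>x. g (\<omega>, x))" "AE \<omega> in P. weak_gradient (\<lambda>x. f' (\<omega>, x)) (\<lambda>x. g' (\<omega>, x))"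
    using wg by (auto simp: weak_gradient_x_def)
  then have "AE \<omega> in P. weak_gradient (\<lambda>x. a * f (\<omega>, x) + b * f' (\<omega>, x)) (\<lambda>x. a *\<^sub>R g (\<omega>, x) + b *\<^sub>R g' (\<omega>, x))"
    using Lp_slice[OF L(1)] Lp_slice[OF L(2)] Lp_slice[OF gL(1)] Lp_slice[OF gL(2)]
    by eventually_elim (rule weak_gradient_lincomb[OF p])
  then show ?thesis
    using gL p by (auto simp: weak_gradient_x_def intro!: Lp_add Lp_scaleR)
qed

end


section \<open>Unfolding\<close>

lemma measurable_lattice_index[measurable]:
  "lattice_index \<epsilon> \<in> (borel :: (real ^ 'd) measure) \<rightarrow>\<^sub>M count_space UNIV"
proof -
  have "lattice_index \<epsilon> -` {k} = (\<Inter>i. {x :: real ^ 'd. \<lfloor>x $ i / \<epsilon> + 1 / 2\<rfloor> = k $ i})" for k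
    by (auto simp: lattice_index_def round_def vec_eq_iff)
  moreover have "{x :: real ^ 'd. \<lfloor>x $ i / \<epsilon> + 1 / 2\<rfloor> = m} \<in> sets borel" for i m
  proof -
    have [measurable]: "(\<lambda>x :: real ^ 'd. x $ i) \<in> borel_measurable borel"
      by (intro borel_measurable_continuous_onI continuous_intros)
    have "{x \<in> space borel. \<lfloor>(x :: real ^ 'd) $ i / \<epsilon> + 1 / 2\<rfloor> = m} \<in> sets borel" by measurable
    then show ?thesis by simp
  qed
  ultimately show ?thesis by (subst measurable_count_space_eq2_countable) auto
qed

text \<open>The half-open cell lies between an open and a closed box of side \<epsilon>, and these
  have the same measure.\<close>

lemma emeasure_lattice_cell:
  assumes "0 < \<epsilon>"
  shows "emeasure lborel {x :: real ^ 'd. lattice_index \<epsilon> x = k} = ennreal (\<epsilon> ^ CARD('d))"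
proof -
  define a b :: "real ^ 'd" where "a = (\<chi> i. \<epsilon> * (of_int (k $ i) - 1 / 2))" and "b = (\<chi> i. \<epsilon> * (of_int (k $ i) + 1 / 2))"
  have cell: "lattice_index \<epsilon> x = k \<longleftrightarrow> (\<forall>i. a $ i \<le> x $ i \<and> x $ i < b $ i)" for x :: "real ^ 'd"
  proof -
    have "round (x $ i / \<epsilon>) = k $ i \<longleftrightarrow> a $ i \<le> x $ i \<and> x $ i < b $ i" for i
    proof -
      have "round (x $ i / \<epsilon>) = k $ i \<longleftrightarrow> of_int (k $ i) - 1 / 2 \<le> x $ i / \<epsilon> \<and> x $ i / \<epsilon> < of_int (k $ i) + 1 / 2"
        unfolding round_def by linarith
      then show ?thesis using assms by (simp add: a_def b_def pos_le_divide_eq pos_divide_less_eq mult.commute)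
    qed
    then show ?thesis by (simp add: lattice_index_def vec_eq_iff)
  qed
  have ab: "(b - a) \<bullet> e = \<epsilon>" "a \<bullet> e \<le> b \<bullet> e" if "e \<in> Basis" for e
    using that assms by (auto simp: Basis_vec_def inner_axis a_def b_def algebra_simps)
  have "(\<Prod>e\<in>Basis. (b - a) \<bullet> e) = \<epsilon> ^ CARD('d)" using ab by simp
  then have box: "emeasure lborel (box a b) = ennreal (\<epsilon> ^ CARD('d))" "emeasure lborel (cbox a b) = ennreal (\<epsilon> ^ CARD('d))"
    using emeasure_lborel_box[of a b] emeasure_lborel_cbox[of a b] ab by auto
  have [measurable]: "{x :: real ^ 'd. lattice_index \<epsilon> x = k} \<in> sets borel"
    using measurable_sets[OF measurable_lattice_index, of "{k}" \<epsilon>] by (simp add: vimage_def)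
  show ?thesis
  proof (rule antisym)
    show "emeasure lborel {x. lattice_index \<epsilon> x = k} \<le> ennreal (\<epsilon> ^ CARD('d))"
      unfolding box(2)[symmetric] cell by (intro emeasure_mono) (auto simp: mem_box_cart less_imp_le)
    show "ennreal (\<epsilon> ^ CARD('d)) \<le> emeasure lborel {x. lattice_index \<epsilon> x = k}"
      unfolding box(1)[symmetric] by (intro emeasure_mono) (auto simp: mem_box_cart cell less_imp_le)
  qed
qed

text \<open>The source of the isometry of the interpolation: the weight in
  \<open>lattice_measure\<close> is the volume of a cell.\<close>

lemma distr_lattice_index:
  assumes "0 < \<epsilon>"
  shows "distr lborel (count_space UNIV) (lattice_index \<epsilon> :: real ^ 'd \<Rightarrow> int ^ 'd)
    = scale_measure (ennreal (\<epsilon> ^ CARD('d))) (count_space UNIV)"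
proof (rule measure_eqI_countable[of _ UNIV])
  fix k :: "int ^ 'd"
  have "emeasure (distr lborel (count_space UNIV) (lattice_index \<epsilon> :: real ^ 'd \<Rightarrow> int ^ 'd)) {k} = emeasure lborel {x :: real ^ 'd. lattice_index \<epsilon> x = k}"
    by (subst emeasure_distr) (auto simp: vimage_def)
  then show "emeasure (distr lborel (count_space UNIV) (lattice_index \<epsilon> :: real ^ 'd \<Rightarrow> int ^ 'd)) {k}
      = emeasure (scale_measure (ennreal (\<epsilon> ^ CARD('d))) (count_space UNIV)) {k}"
    using emeasure_lattice_cell[OF assms, of k] by simp
qed auto

lemma inj_lattice_point: "0 < \<epsilon> \<Longrightarrow> inj (lattice_point \<epsilon>)"
  by (rule inj_on_inverseI[of _ "lattice_index \<epsilon>"]) (simp add: lattice_index_lattice_point)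

lemma nn_integral_lattice:
  fixes g :: "real ^ 'd \<Rightarrow> ennreal"
  assumes "0 < \<epsilon>"
  shows "(\<integral>\<^sup>+y. g y \<partial>lattice_measure \<epsilon>) = ennreal (\<epsilon> ^ CARD('d)) * (\<integral>\<^sup>+k. g (lattice_point \<epsilon> k) \<partial>count_space UNIV)"
proof -
  have "bij_betw (lattice_point \<epsilon> :: int ^ 'd \<Rightarrow> _) UNIV (eps_lattice \<epsilon>)"
    unfolding eps_lattice_def using inj_lattice_point[OF assms] by (rule inj_on_imp_bij_betw)
  then show ?thesis
    unfolding lattice_measure_def by (subst nn_integral_scale_measure) (auto simp: nn_integral_bij_count_space)
qed

lemma nn_integral_lattice_index:
  fixes H :: "int ^ 'd \<Rightarrow> ennreal"
  assumes "0 < \<epsilon>"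
  shows "(\<integral>\<^sup>+x. H (lattice_index \<epsilon> x) \<partial>lborel) = ennreal (\<epsilon> ^ CARD('d)) * (\<integral>\<^sup>+k. H k \<partial>count_space UNIV)"
proof -
  have "(\<integral>\<^sup>+x. H (lattice_index \<epsilon> x) \<partial>lborel) = (\<integral>\<^sup>+k. H k \<partial>distr lborel (count_space UNIV) (lattice_index \<epsilon>))"
    by (rule nn_integral_distr[symmetric]) auto
  also have "\<dots> = ennreal (\<epsilon> ^ CARD('d)) * (\<integral>\<^sup>+k. H k \<partial>count_space UNIV)"
    unfolding distr_lattice_index[OF assms] by (rule nn_integral_scale_measure) auto
  finally show ?thesis .
qed

lemma space_lattice_measure: "space (lattice_measure \<epsilon>) = eps_lattice \<epsilon>"
  unfolding lattice_measure_def by (subst sets_eq_imp_space_eq[OF sets_scale_measure]) simp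

lemma sets_lattice_measure: "sets (lattice_measure \<epsilon>) = Pow (eps_lattice \<epsilon>)"
  by (simp add: lattice_measure_def)

lemma sigma_finite_lattice_measure:
  assumes "0 < \<epsilon>"
  shows "sigma_finite_measure (lattice_measure \<epsilon> :: (real ^ 'd) measure)"
proof
  let ?L = "eps_lattice \<epsilon> :: (real ^ 'd) set"
  have "countable ?L" unfolding eps_lattice_def by simp
  then show "\<exists>A. countable A \<and> A \<subseteq> sets (lattice_measure \<epsilon> :: (real ^ 'd) measure) \<and> \<Union>A = space (lattice_measure \<epsilon> :: (real ^ 'd) measure)
      \<and> (\<forall>a\<in>A. emeasure (lattice_measure \<epsilon> :: (real ^ 'd) measure) a \<noteq> \<infinity>)"
    by (intro exI[of _ "(\<lambda>x. {x}) ` ?L"])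
       (auto simp: space_lattice_measure sets_lattice_measure, auto simp: lattice_measure_def ennreal_mult_eq_top_iff)
qed

lemma lattice_index_add:
  assumes "0 < \<epsilon>"
  shows "lattice_index \<epsilon> (x + \<epsilon> *\<^sub>R axis i 1) = lattice_index \<epsilon> x + axis i 1"
proof -
  have "round ((x $ j + \<epsilon> * axis i 1 $ j) / \<epsilon>) = round (x $ j / \<epsilon>) + axis i 1 $ j" for j
  proof (cases "j = i")
    case True
    have "(x $ i + \<epsilon>) / \<epsilon> = x $ i / \<epsilon> + 1" using assms by (simp add: add_divide_distrib)
    then show ?thesis using True unfolding round_def by (simp add: axis_def) linarith
  qed (simp add: axis_def)
  then show ?thesis by (simp add: lattice_index_def vec_eq_iff)
qed

lemma lattice_point_add: "lattice_point \<epsilon> (k + axis i 1) = lattice_point \<epsilon> k + \<epsilon> *\<^sub>R axis i 1"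
  by (simp add: lattice_point_def vec_eq_iff axis_def distrib_left)

section \<open>Measure preservation and the isometry of unfolding\<close>

context dynamical_system
begin

lemma T_space: "\<omega> \<in> space P \<Longrightarrow> T k \<omega> \<in> space P"
  using measurable_space[OF T_measurable] by blast

lemma T_inverse: "\<omega> \<in> space P \<Longrightarrow> T (- k) (T k \<omega>) = \<omega>" "\<omega> \<in> space P \<Longrightarrow> T k (T (- k) \<omega>) = \<omega>"
  using T_add[of \<omega> "- k" k] T_add[of \<omega> k "- k"] T_zero by auto

text \<open>The locale speaks of images of events, a push-forward of preimages. As the action is
  invertible, the preimage under \<open>T k\<close> is the image under
  \<open>T (- k)\<close>.\<close>

lemma distr_T: "distr P P (T k) = P"
proof (rule measure_eqI)
  fix A assume "A \<in> sets (distr P P (T k))"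
  then have A: "A \<in> sets P" by simp
  have "T k -` A \<inter> space P = T (- k) ` A"
  proof (intro set_eqI iffI)
    fix \<omega> assume "\<omega> \<in> T k -` A \<inter> space P"
    then show "\<omega> \<in> T (- k) ` A" using T_inverse(1)[of \<omega> k] by (intro image_eqI[of _ _ "T k \<omega>"]) auto
  next
    fix \<omega> assume "\<omega> \<in> T (- k) ` A"
    then obtain \<omega>' where "\<omega>' \<in> A" "\<omega> = T (- k) \<omega>'" by blast
    then show "\<omega> \<in> T k -` A \<inter> space P"
      using T_inverse(2)[of \<omega>' k] T_space sets.sets_into_space[OF A] by auto
  qed
  then show "emeasure (distr P P (T k)) A = emeasure P A"
    using A by (simp add: emeasure_distr T_measurable T_preserving)
qed simp

lemma nn_integral_T:
  assumes "f \<in> borel_measurable P"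
  shows "(\<integral>\<^sup>+\<omega>. f (T k \<omega>) \<partial>P) = (\<integral>\<^sup>+\<omega>. f \<omega> \<partial>P)"
  by (subst (2) distr_T[symmetric, of k]) (subst nn_integral_distr, auto simp: T_measurable assms)

definition Tx :: "int ^ 'd \<Rightarrow> 'w \<times> (real ^ 'd) \<Rightarrow> 'w \<times> (real ^ 'd)" where
  "Tx k z = (T k (fst z), snd z)"

lemma measurable_Tx[measurable]: "Tx k \<in> PX \<rightarrow>\<^sub>M PX"
proof -
  note [measurable] = T_measurable
  show ?thesis unfolding Tx_def[abs_def] by measurable
qed

lemma distr_Tx: "distr PX PX (Tx k) = PX"
proof -
  have "distr P P (T k) \<Otimes>\<^sub>M distr lborel lborel (\<lambda>x. x) = distr PX PX (\<lambda>(\<omega>, x). (T k \<omega>, x))"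
    by (rule pair_measure_distr) (auto simp: T_measurable distr_id[unfolded id_def] sigma_finite_lborel)
  then show ?thesis by (simp add: distr_T distr_id[unfolded id_def] Tx_def[abs_def] case_prod_unfold)
qed

lemma Lp_Tx:
  fixes f :: "'w \<times> (real ^ 'd) \<Rightarrow> 'b::euclidean_space"
  assumes f: "f \<in> Lp p PX"
  shows "(\<lambda>z. f (Tx k z)) \<in> Lp p PX" "Lp_int p PX (\<lambda>z. f (Tx k z)) = Lp_int p PX f"
proof -
  note [measurable] = Lp_measurable[OF f]
  have "(\<integral>\<^sup>+z. ennreal (norm (f (Tx k z)) powr p) \<partial>PX) = (\<integral>\<^sup>+z. ennreal (norm (f z) powr p) \<partial>PX)"
    by (subst (2) distr_Tx[symmetric, of k]) (subst nn_integral_distr, auto)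
  then have eq: "(\<integral>\<^sup>+z. ennreal (norm (f (Tx k z)) powr p) \<partial>PX) = ennreal (Lp_int p PX f)" by (simp add: Lp_int_nn[OF f])
  have m: "(\<lambda>z. f (Tx k z)) \<in> borel_measurable PX" by measurable
  show *: "(\<lambda>z. f (Tx k z)) \<in> Lp p PX" using Lp_int_le_nn(1)[OF m eq_refl[OF eq]] by simp
  show "Lp_int p PX (\<lambda>z. f (Tx k z)) = Lp_int p PX f" using eq unfolding Lp_int_nn[OF *] by simp
qed

lemma integral_Tx:
  fixes f :: "'w \<times> (real ^ 'd) \<Rightarrow> real"
  assumes "f \<in> borel_measurable PX"
  shows "(LINT z|PX. f (Tx k z)) = (LINT z|PX. f z)"
  by (subst (2) distr_Tx[symmetric, of k]) (rule integral_distr[symmetric, OF measurable_Tx assms])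

lemma AE_T:
  assumes "AE \<omega> in P. Q \<omega>"
  shows "AE \<omega> in P. Q (T k \<omega>)"
proof -
  have "AE \<omega> in distr P P (T k). Q \<omega>" by (subst distr_T) (rule assms)
  then show ?thesis by (rule AE_distrD[OF T_measurable])
qed

lemma Lp_T:
  fixes f :: "'w \<Rightarrow> 'b::euclidean_space"
  assumes f: "f \<in> Lp p P"
  shows "(\<lambda>\<omega>. f (T k \<omega>)) \<in> Lp p P"
proof -
  note [measurable] = Lp_measurable[OF f] T_measurable
  have "(\<integral>\<^sup>+\<omega>. ennreal (norm (f (T k \<omega>)) powr p) \<partial>P) = ennreal (Lp_int p P f)"
    by (subst nn_integral_T) (auto simp: Lp_int_nn[OF f])
  then show ?thesis by (intro Lp_int_le_nn(1)) auto
qed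

lemma unfolding_op_eq:
  assumes "0 < \<epsilon>"
  shows "unfolding_op T \<epsilon> u (\<omega>, x) = u (T (- lattice_index \<epsilon> x) \<omega>, lattice_point \<epsilon> (lattice_index \<epsilon> x))"
  by (simp add: unfolding_op_def interpolation_def discrete_unfolding_def lattice_floor_def
      lattice_index_lattice_point[OF assms])

lemma unfolding_op_measurable:
  fixes u :: "'w \<times> (real ^ 'd) \<Rightarrow> real"
  assumes e: "0 < \<epsilon>" and u: "\<And>k. (\<lambda>\<omega>. u (\<omega>, lattice_point \<epsilon> k)) \<in> borel_measurable P"
  shows "unfolding_op T \<epsilon> u \<in> borel_measurable PX"
proof -
  have "(\<lambda>z. u (T (- lattice_index \<epsilon> (snd z)) (fst z), lattice_point \<epsilon> (lattice_index \<epsilon> (snd z)))) \<in> borel_measurable PX"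
  proof (rule measurable_compose_countable[where f = "\<lambda>k z. u (T (- k) (fst z), lattice_point \<epsilon> k)"])
    show "(\<lambda>z. lattice_index \<epsilon> (snd z)) \<in> PX \<rightarrow>\<^sub>M count_space UNIV" by measurable
    fix k
    have "(\<lambda>z. T (- k) (fst z)) \<in> PX \<rightarrow>\<^sub>M P" using T_measurable by measurable
    from measurable_compose[OF this u] show "(\<lambda>z. u (T (- k) (fst z), lattice_point \<epsilon> k)) \<in> borel_measurable PX" .
  qed
  moreover have "unfolding_op T \<epsilon> u = (\<lambda>z. u (T (- lattice_index \<epsilon> (snd z)) (fst z), lattice_point \<epsilon> (lattice_index \<epsilon> (snd z))))"
    using unfolding_op_eq[OF e] by (auto simp: fun_eq_iff)
  ultimately show ?thesis by simp
qed

text \<open>For fixed x the unfolding applies a single map of the action, so integrating over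
  \<omega> first removes it; what remains depends on x only through its cell and adds up to the
  lattice integral. Measurability is asked of lattice sections only, which makes the identity
  available for components of the discrete gradient.\<close>

lemma nn_integral_unfolding_op:
  fixes u :: "'w \<times> (real ^ 'd) \<Rightarrow> real"
  assumes e: "0 < \<epsilon>" and u: "\<And>k. (\<lambda>\<omega>. u (\<omega>, lattice_point \<epsilon> k)) \<in> borel_measurable P"
  shows "(\<integral>\<^sup>+z. ennreal (norm (unfolding_op T \<epsilon> u z) powr p) \<partial>PX)
    = (\<integral>\<^sup>+\<omega>. (\<integral>\<^sup>+y. ennreal (\<bar>u (\<omega>, y)\<bar> powr p) \<partial>lattice_measure \<epsilon>) \<partial>P)"
proof -
  note [measurable] = unfolding_op_measurable[OF e u]
  interpret C: pair_sigma_finite P "count_space (UNIV :: (int ^ 'd) set)"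
    by (intro pair_sigma_finite.intro sigma_finite_measure_axioms sigma_finite_measure_count_space_countable) auto
  define H where "H k = (\<integral>\<^sup>+\<omega>. ennreal (\<bar>u (\<omega>, lattice_point \<epsilon> k)\<bar> powr p) \<partial>P)" for k
  have "(\<integral>\<^sup>+z. ennreal (norm (unfolding_op T \<epsilon> u z) powr p) \<partial>PX)
      = (\<integral>\<^sup>+x. (\<integral>\<^sup>+\<omega>. ennreal (\<bar>unfolding_op T \<epsilon> u (\<omega>, x)\<bar> powr p) \<partial>P) \<partial>lborel)"
    by (subst pair.nn_integral_snd[symmetric]) auto
  also have "\<dots> = (\<integral>\<^sup>+x. H (lattice_index \<epsilon> x) \<partial>lborel)"
  proof (rule nn_integral_cong)
    fix x :: "real ^ 'd"
    let ?k = "lattice_index \<epsilon> x"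
    note [measurable] = u[of ?k]
    show "(\<integral>\<^sup>+\<omega>. ennreal (\<bar>unfolding_op T \<epsilon> u (\<omega>, x)\<bar> powr p) \<partial>P) = H ?k"
      unfolding unfolding_op_eq[OF e] H_def
      by (rule nn_integral_T[of "\<lambda>\<omega>. ennreal (\<bar>u (\<omega>, lattice_point \<epsilon> ?k)\<bar> powr p)"]) measurable
  qed
  also have "\<dots> = ennreal (\<epsilon> ^ CARD('d)) * (\<integral>\<^sup>+k. H k \<partial>count_space UNIV)"
    by (rule nn_integral_lattice_index[OF e])
  also have "(\<integral>\<^sup>+k. H k \<partial>count_space UNIV)
      = (\<integral>\<^sup>+\<omega>. (\<integral>\<^sup>+k. ennreal (\<bar>u (\<omega>, lattice_point \<epsilon> k)\<bar> powr p) \<partial>count_space UNIV) \<partial>P)"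
    unfolding H_def
  proof (rule C.Fubini')
    have [measurable]: "(\<lambda>z. u (fst z, lattice_point \<epsilon> (snd z))) \<in> borel_measurable (P \<Otimes>\<^sub>M count_space UNIV)"
    proof (rule measurable_compose_countable[where f = "\<lambda>k z. u (fst z, lattice_point \<epsilon> k)"])
      fix k show "(\<lambda>z. u (fst z, lattice_point \<epsilon> k)) \<in> borel_measurable (P \<Otimes>\<^sub>M count_space UNIV)"
        by (rule measurable_compose[OF measurable_fst u])
    qed measurable
    show "(\<lambda>(\<omega>, k). ennreal (\<bar>u (\<omega>, lattice_point \<epsilon> k)\<bar> powr p)) \<in> borel_measurable (P \<Otimes>\<^sub>M count_space UNIV)"
      unfolding case_prod_unfold by measurable
  qed
  also have "ennreal (\<epsilon> ^ CARD('d)) * \<dots>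
      = (\<integral>\<^sup>+\<omega>. ennreal (\<epsilon> ^ CARD('d)) * (\<integral>\<^sup>+k. ennreal (\<bar>u (\<omega>, lattice_point \<epsilon> k)\<bar> powr p) \<partial>count_space UNIV) \<partial>P)"
  proof (rule nn_integral_cmult[symmetric])
    have [measurable]: "(\<lambda>z. u (fst z, lattice_point \<epsilon> (snd z))) \<in> borel_measurable (P \<Otimes>\<^sub>M count_space UNIV)"
    proof (rule measurable_compose_countable[where f = "\<lambda>k z. u (fst z, lattice_point \<epsilon> k)"])
      fix k show "(\<lambda>z. u (fst z, lattice_point \<epsilon> k)) \<in> borel_measurable (P \<Otimes>\<^sub>M count_space UNIV)"
        by (rule measurable_compose[OF measurable_fst u])
    qed measurable
    have "(\<lambda>z. ennreal (\<bar>u (fst z, lattice_point \<epsilon> (snd z))\<bar> powr p)) \<in> borel_measurable (P \<Otimes>\<^sub>M count_space UNIV)"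
      by measurable
    from C.M2.borel_measurable_nn_integral_fst[OF this]
    show "(\<lambda>\<omega>. \<integral>\<^sup>+k. ennreal (\<bar>u (\<omega>, lattice_point \<epsilon> k)\<bar> powr p) \<partial>count_space UNIV) \<in> borel_measurable P" by simp
  qed
  also have "\<dots> = (\<integral>\<^sup>+\<omega>. (\<integral>\<^sup>+y. ennreal (\<bar>u (\<omega>, y)\<bar> powr p) \<partial>lattice_measure \<epsilon>) \<partial>P)"
    by (simp add: nn_integral_lattice[OF e])
  finally show ?thesis .
qed

lemma Lp_lattice_section:
  fixes u :: "'w \<times> (real ^ 'd) \<Rightarrow> real"
  assumes "u \<in> borel_measurable (P \<Otimes>\<^sub>M lattice_measure \<epsilon>)"
  shows "(\<lambda>\<omega>. u (\<omega>, lattice_point \<epsilon> k)) \<in> borel_measurable P"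
proof -
  have "lattice_point \<epsilon> k \<in> space (lattice_measure \<epsilon>)" by (simp add: space_lattice_measure eps_lattice_def)
  from measurable_compose[OF measurable_Pair2'[OF this] assms] show ?thesis by simp
qed

lemma unfolding_op_Lp:
  fixes u :: "'w \<times> (real ^ 'd) \<Rightarrow> real"
  assumes e: "0 < \<epsilon>" and u: "u \<in> Lp p (P \<Otimes>\<^sub>M lattice_measure \<epsilon>)"
  shows "unfolding_op T \<epsilon> u \<in> Lp p PX"
proof -
  note [measurable] = Lp_measurable[OF u]
  interpret L: sigma_finite_measure "lattice_measure \<epsilon> :: (real ^ 'd) measure" by (rule sigma_finite_lattice_measure[OF e])
  have s: "(\<lambda>\<omega>. u (\<omega>, lattice_point \<epsilon> k)) \<in> borel_measurable P" for k
    by (rule Lp_lattice_section[OF Lp_measurable[OF u]])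
  have "(\<integral>\<^sup>+z. ennreal (norm (unfolding_op T \<epsilon> u z) powr p) \<partial>PX) = (\<integral>\<^sup>+z. ennreal (norm (u z) powr p) \<partial>(P \<Otimes>\<^sub>M lattice_measure \<epsilon>))"
    unfolding nn_integral_unfolding_op[OF e s] by (subst L.nn_integral_fst[symmetric]) auto
  also have "\<dots> = ennreal (Lp_int p (P \<Otimes>\<^sub>M lattice_measure \<epsilon>) u)" by (rule Lp_int_nn[OF u])
  finally show ?thesis by (intro Lp_int_le_nn(1)[OF unfolding_op_measurable[OF e s] eq_refl]) auto
qed

definition shift_quot :: "real \<Rightarrow> 'd \<Rightarrow> ('w \<times> (real ^ 'd) \<Rightarrow> real) \<Rightarrow> 'w \<times> (real ^ 'd) \<Rightarrow> real" where
  "shift_quot e i f z = (f (T (axis i 1) (fst z), snd z + e *\<^sub>R axis i 1) - f z) / e"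

text \<open>The neighbouring cell is unfolded with the index \<open>k + e_i\<close> instead of k.
  Evaluating there at \<open>T e_i \<omega>\<close> cancels the additional shift, so a step on the
  lattice becomes a simultaneous step in \<omega> and in x.\<close>

lemma unfolding_op_gradient:
  assumes e: "0 < \<epsilon>" and z: "z \<in> space PX"
  shows "unfolding_op T \<epsilon> (\<lambda>z. discrete_gradient \<epsilon> u z $ i) z = shift_quot \<epsilon> i (unfolding_op T \<epsilon> u) z"
proof -
  obtain \<omega> x where zz: "z = (\<omega>, x)" "\<omega> \<in> space P" using z by (auto simp: space_pair_measure)
  let ?k = "lattice_index \<epsilon> x" and ?e = "axis i 1 :: int ^ 'd"
  have "T (- (?k + ?e)) (T ?e \<omega>) = T (- ?k) \<omega>"
    using T_add[OF zz(2), of "- (?k + ?e)" ?e] by simp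
  then show ?thesis
    unfolding zz(1) shift_quot_def fst_conv snd_conv unfolding_op_eq[OF e] lattice_index_add[OF e] lattice_point_add
    by (simp add: discrete_gradient_def)
qed

lemma shift_quot_Lp:
  assumes "f \<in> Lp p PX" "0 < p"
  shows "shift_quot e i f \<in> Lp p PX"
proof -
  have "(\<lambda>z. f (fst (Tx (axis i 1) z), snd (Tx (axis i 1) z) + e *\<^sub>R axis i 1)) \<in> Lp p PX"
    by (rule Lp_Tx(1)[OF shift_x_Lp(1)[OF assms(1)]])
  then have "(\<lambda>z. (1 / e) * (f (fst (Tx (axis i 1) z), snd (Tx (axis i 1) z) + e *\<^sub>R axis i 1) - f z)) \<in> Lp p PX"
    by (intro Lp_mult Lp_diff assms)
  then show ?thesis by (simp add: shift_quot_def[abs_def] Tx_def)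
qed

lemma unfolding_op_scale:
  fixes v :: "'w \<times> (real ^ 'd) \<Rightarrow> real"
  shows "unfolding_op T \<epsilon> (\<lambda>z. c * v z) = (\<lambda>z. c * unfolding_op T \<epsilon> v z)"
  by (simp add: unfolding_op_def interpolation_def discrete_unfolding_def case_prod_unfold)

lemma unfolding_bounds:
  fixes u :: "'w \<times> (real ^ 'd) \<Rightarrow> real"
  assumes p: "1 < p" and e: "0 < \<epsilon>" and u: "u \<in> Lp p (P \<Otimes>\<^sub>M lattice_measure \<epsilon>)" and C: "0 \<le> C"
    and bnd: "(\<integral>\<^sup>+\<omega>. \<integral>\<^sup>+x. ennreal (\<bar>u (\<omega>, x)\<bar> powr p + \<epsilon> powr (\<gamma> * p) * norm (discrete_gradient \<epsilon> u (\<omega>, x)) powr p)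
          \<partial>lattice_measure \<epsilon> \<partial>P) \<le> ennreal C"
  shows "Lp_int p PX (unfolding_op T \<epsilon> u) \<le> C"
    and "Lp_int p PX (\<lambda>z. \<epsilon> powr \<gamma> * shift_quot \<epsilon> i (unfolding_op T \<epsilon> u) z) \<le> C"
proof -
  have s: "(\<lambda>\<omega>. u (\<omega>, lattice_point \<epsilon> k)) \<in> borel_measurable P" for k
    by (rule Lp_lattice_section[OF Lp_measurable[OF u]])
  have "(\<integral>\<^sup>+z. ennreal (norm (unfolding_op T \<epsilon> u z) powr p) \<partial>PX) \<le> ennreal C"
    unfolding nn_integral_unfolding_op[where u = u, OF e s]
    by (rule order_trans[OF _ bnd]) (intro nn_integral_mono ennreal_leI, simp)
  then show "Lp_int p PX (unfolding_op T \<epsilon> u) \<le> C"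
    using C by (intro Lp_int_le_nn(2)[OF unfolding_op_measurable[where u = u, OF e s]])
  let ?g = "\<lambda>z. \<epsilon> powr \<gamma> * discrete_gradient \<epsilon> u z $ i"
  \<comment> \<open>At a lattice point the gradient involves only neighbouring lattice points, so
    its sections inherit measurability from those of u.\<close>
  have s': "(\<lambda>\<omega>. ?g (\<omega>, lattice_point \<epsilon> k)) \<in> borel_measurable P" for k
  proof -
    note [measurable] = s[of k] s[of "k + axis i 1"]
    have "?g (\<omega>, lattice_point \<epsilon> k)
        = \<epsilon> powr \<gamma> * ((u (\<omega>, lattice_point \<epsilon> (k + axis i 1)) - u (\<omega>, lattice_point \<epsilon> k)) / \<epsilon>)" for \<omega>
      unfolding lattice_point_add by (simp add: discrete_gradient_def)
    then show ?thesis by (simp only:) measurable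
  qed
  have "(\<integral>\<^sup>+z. ennreal (norm (unfolding_op T \<epsilon> ?g z) powr p) \<partial>PX) \<le> ennreal C"
    unfolding nn_integral_unfolding_op[where u = ?g, OF e s']
  proof (rule order_trans[OF _ bnd], intro nn_integral_mono ennreal_leI)
    fix \<omega> x
    have "\<bar>?g (\<omega>, x)\<bar> powr p = \<epsilon> powr (\<gamma> * p) * \<bar>discrete_gradient \<epsilon> u (\<omega>, x) $ i\<bar> powr p"
      by (simp add: abs_mult powr_mult powr_powr)
    also have "\<dots> \<le> \<epsilon> powr (\<gamma> * p) * norm (discrete_gradient \<epsilon> u (\<omega>, x)) powr p"
      using p by (intro mult_left_mono powr_mono2 component_le_norm_cart) auto
    finally show "\<bar>?g (\<omega>, x)\<bar> powr p \<le> \<bar>u (\<omega>, x)\<bar> powr p + \<epsilon> powr (\<gamma> * p) * norm (discrete_gradient \<epsilon> u (\<omega>, x)) powr p"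
      by (simp add: add_increasing)
  qed
  moreover have "(\<integral>\<^sup>+z. ennreal (norm (unfolding_op T \<epsilon> ?g z) powr p) \<partial>PX)
      = (\<integral>\<^sup>+z. ennreal (norm (\<epsilon> powr \<gamma> * shift_quot \<epsilon> i (unfolding_op T \<epsilon> u) z) powr p) \<partial>PX)"
    unfolding unfolding_op_scale by (intro nn_integral_cong) (simp only: unfolding_op_gradient[OF e])
  moreover have "(\<lambda>z. \<epsilon> powr \<gamma> * shift_quot \<epsilon> i (unfolding_op T \<epsilon> u) z) \<in> Lp p PX"
    using p by (intro Lp_mult shift_quot_Lp unfolding_op_Lp e u) auto
  ultimately show "Lp_int p PX (\<lambda>z. \<epsilon> powr \<gamma> * shift_quot \<epsilon> i (unfolding_op T \<epsilon> u) z) \<le> C"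
    using C by (intro Lp_int_le_nn(2) Lp_measurable) auto
qed

end


section \<open>Limits of the unfolded gradients\<close>

lemma Lp_weak_conv_scale:
  assumes "Lp_weak_conv p M f g" "c \<longlonglongrightarrow> a"
  shows "Lp_weak_conv p M (\<lambda>n x. c n * f n x) (\<lambda>x. a * g x)"
  unfolding Lp_weak_conv_def
proof (intro conjI allI ballI)
  have f: "f n \<in> Lp p M" and g: "g \<in> Lp p M" for n using assms(1) by (auto simp: Lp_weak_conv_def)
  show "(\<lambda>x. c n * f n x) \<in> Lp p M" "(\<lambda>x. a * g x) \<in> Lp p M" for n by (intro Lp_mult f g)+
  fix \<Lambda> assume \<Lambda>: "\<Lambda> \<in> Lp_dual p M"
  have "(\<lambda>n. c n * \<Lambda> (f n)) \<longlonglongrightarrow> a * \<Lambda> g"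
    using assms \<Lambda> by (intro tendsto_mult) (auto simp: Lp_weak_conv_def)
  then show "(\<lambda>n. \<Lambda> (\<lambda>x. c n * f n x)) \<longlonglongrightarrow> \<Lambda> (\<lambda>x. a * g x)"
    by (simp only: Lp_dual_linear(4)[OF \<Lambda> f f] Lp_dual_linear(4)[OF \<Lambda> g g])
qed

lemma Lp_weak_conv_Lp: "Lp_weak_conv p M f g \<Longrightarrow> f n \<in> Lp p M" "Lp_weak_conv p M f g \<Longrightarrow> g \<in> Lp p M"
  by (auto simp: Lp_weak_conv_def)

lemma lin_sub_kernel_pairing:
  fixes h :: "'a \<Rightarrow> 'b::euclidean_space"
  assumes pq: "conj_exp p q" and h: "h \<in> Lp q M"
  shows "lin_sub {f \<in> Lp p M. (LINT x|M. h x \<bullet> f x) = 0}"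
  unfolding lin_sub_def
proof (intro conjI ballI allI)
  have p0: "0 < p" using conj_expD[OF pq] by simp
  show "(\<lambda>x. 0) \<in> {f \<in> Lp p M. (LINT x|M. h x \<bullet> f x) = 0}" by simp
  fix f g a b assume fg: "f \<in> {f \<in> Lp p M. (LINT x|M. h x \<bullet> f x) = 0}" "g \<in> {f \<in> Lp p M. (LINT x|M. h x \<bullet> f x) = 0}"
  then have "integrable M (\<lambda>x. h x \<bullet> f x)" "integrable M (\<lambda>x. h x \<bullet> g x)"
    using Lp_pairing(1)[OF pq _ h] by auto
  then show "(\<lambda>x. a *\<^sub>R f x + b *\<^sub>R g x) \<in> {f \<in> Lp p M. (LINT x|M. h x \<bullet> f x) = 0}"
    using fg p0 by (auto simp: inner_add_right intro!: Lp_add Lp_scaleR)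
qed

lemma kernel_pairing_closed:
  fixes h :: "'a \<Rightarrow> 'b::euclidean_space"
  assumes pq: "conj_exp p q" and h: "h \<in> Lp q M"
    and S: "\<And>s. s \<in> S \<Longrightarrow> s \<in> Lp p M \<Longrightarrow> (LINT x|M. h x \<bullet> s x) = 0"
    and f: "f \<in> Lp_closure p M S"
  shows "(LINT x|M. h x \<bullet> f x) = 0"
proof -
  have p0: "0 < p" using conj_expD[OF pq] by simp
  obtain s where s: "\<And>n. s n \<in> S" "\<And>n. s n \<in> Lp p M" "(\<lambda>n. Lp_int p M (\<lambda>x. s n x - f x)) \<longlonglongrightarrow> 0"
    using Lp_closure_seq[OF p0 f] by blast
  have "f \<in> Lp p M" using f Lp_closure_subset by blast
  from Lp_pairing_tendsto[OF pq h s(2) this s(3)] show ?thesis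
    using S[OF s(1,2)] by (simp add: LIMSEQ_const_iff)
qed

context dynamical_system
begin

lemma Lp_weak_compact_finite:
  fixes f :: "'i \<Rightarrow> nat \<Rightarrow> 'w \<times> (real ^ 'd) \<Rightarrow> real"
  assumes p: "1 < p" and I: "finite I" and f: "\<And>i n. i \<in> I \<Longrightarrow> f i n \<in> Lp p PX"
    and bnd: "\<And>i n. i \<in> I \<Longrightarrow> Lp_int p PX (f i n) \<le> C"
  shows "\<exists>r g. strict_mono (r::nat\<Rightarrow>nat) \<and> (\<forall>i\<in>I. Lp_weak_conv p PX (\<lambda>n. f i (r n)) (g i))"
  using I f bnd
proof (induction I rule: finite_induct)
  case empty
  then show ?case using strict_mono_id by auto
next
  case (insert j I)
  then obtain r g where r: "strict_mono (r::nat\<Rightarrow>nat)" "\<forall>i\<in>I. Lp_weak_conv p PX (\<lambda>n. f i (r n)) (g i)"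
    by auto
  have "f j (r n) \<in> Lp p PX" "Lp_int p PX (f j (r n)) \<le> C" for n using insert.prems by auto
  then obtain r' h where r': "strict_mono (r'::nat\<Rightarrow>nat)" "Lp_weak_conv p PX (\<lambda>n. f j (r (r' n))) h"
    using Lp_weak_compact[OF p, of "\<lambda>n. f j (r n)" C] by blast
  show ?case
  proof (intro exI conjI ballI)
    show "strict_mono (\<lambda>n. r (r' n))" using strict_mono_o[OF r(1) r'(1)] by (simp add: o_def)
    fix i assume "i \<in> insert j I"
    then show "Lp_weak_conv p PX (\<lambda>n. f i (r (r' n))) ((g(j := h)) i)"
      using r'(2) r(2) Lp_weak_conv_subseq[OF _ r'(1), of p PX "\<lambda>n. f i (r n)" "g i"] by auto
  qed
qed

text \<open>By the norm bound for mollification, the mollified difference has vanishing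
  \<open>Lp_int\<close>.\<close>

lemma mollify_x_cong_AE:
  fixes f g :: "'w \<times> (real ^ 'd) \<Rightarrow> real"
  assumes p: "1 < p" and \<sigma>: "kernel \<sigma>" and f: "f \<in> Lp p PX" and g: "g \<in> Lp p PX" and eq: "AE z in PX. f z = g z"
  shows "AE z in PX. mollify_x \<sigma> f z = mollify_x \<sigma> g z"
proof -
  have d: "(\<lambda>z. f z - g z) \<in> Lp p PX" using p by (intro Lp_diff f g) auto
  have "Lp_int p PX (\<lambda>z. f z - g z) = 0" using Lp_int_eq_0[OF d] eq by auto
  then have "Lp_int p PX (mollify_x \<sigma> (\<lambda>z. f z - g z)) = 0"
    using mollify_x_Lp(2)[OF p \<sigma> d] Lp_int_nonneg[of p PX "mollify_x \<sigma> (\<lambda>z. f z - g z)"] by simp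
  then have "AE z in PX. mollify_x \<sigma> (\<lambda>z. f z - g z) z = 0"
    using Lp_int_eq_0[OF mollify_x_Lp(1)[OF p \<sigma> d]] by simp
  then show ?thesis using mollify_x_linear[OF p \<sigma> f g, of 1 "-1"] by eventually_elim simp
qed

section \<open>Splitting the unfolded gradient\<close>

definition tdiff :: "'d \<Rightarrow> ('w \<times> (real ^ 'd) \<Rightarrow> real) \<Rightarrow> 'w \<times> (real ^ 'd) \<Rightarrow> real" where
  "tdiff i f z = f (Tx (axis i 1) z) - f z"

lemma tdiff_Lp:
  assumes "f \<in> Lp p PX" "0 < p"
  shows "tdiff i f \<in> Lp p PX" "Lp_int p PX (tdiff i f) \<le> 2 powr p * (2 * Lp_int p PX f)"
  unfolding tdiff_def[abs_def]
  using Lp_diff[OF Lp_Tx(1)[OF assms(1)] assms, of "axis i 1"] Lp_Tx(2)[OF assms(1), of "axis i 1"] by auto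

lemma mollify_x_Tx: "mollify_x \<sigma> (\<lambda>z. f (Tx k z)) z = mollify_x \<sigma> f (Tx k z)"
  by (simp add: mollify_x_def Tx_def case_prod_unfold)

lemma hdiff_field_eq: "hdiff_field T f = (\<lambda>z. \<chi> i. tdiff i f z)"
  by (simp add: hdiff_field_def hdiff_def tdiff_def Tx_def fun_eq_iff)

lemma Lp_weak_conv_Tx:
  fixes f :: "nat \<Rightarrow> 'w \<times> (real ^ 'd) \<Rightarrow> real"
  assumes "0 < p" "Lp_weak_conv p PX f g"
  shows "Lp_weak_conv p PX (\<lambda>n z. f n (Tx k z)) (\<lambda>z. g (Tx k z))"
  by (rule Lp_weak_conv_operator[where A = "\<lambda>f z. f (Tx k z)" and C = 1, OF assms]) (auto simp: Lp_Tx)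

lemma Lp_weak_conv_tdiff:
  assumes "0 < p" "Lp_weak_conv p PX f g"
  shows "Lp_weak_conv p PX (\<lambda>n. tdiff i (f n)) (tdiff i g)"
  using Lp_weak_conv_diff[OF Lp_weak_conv_Tx[OF assms] assms(2,1), of "axis i 1"] by (simp add: tdiff_def[abs_def])

lemma mollify_x_tdiff:
  assumes p: "1 < p" and \<sigma>: "kernel \<sigma>" and f: "f \<in> Lp p PX"
  shows "AE z in PX. mollify_x \<sigma> (tdiff i f) z = tdiff i (mollify_x \<sigma> f) z"
  using mollify_x_linear[OF p \<sigma> Lp_Tx(1)[OF f] f, of 1 "axis i 1" "-1"]
  by eventually_elim (simp add: tdiff_def[abs_def] mollify_x_Tx)

text \<open>
  Mollification in the spatial variable separates the two increments of the unfolded gradient: the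
  spatial one falls onto the kernel, the remaining one is an exact horizontal derivative.
\<close>

lemma mollify_x_shift_quot:
  assumes p: "1 < p" and \<rho>: "kernel \<rho>" and f: "f \<in> Lp p PX"
  shows "AE z in PX. mollify_x \<rho> (shift_quot e i f) z
    = mollify_x (diff_quot \<rho> i e) (\<lambda>z. f (Tx (axis i 1) z)) z + (1 / e) * tdiff i (mollify_x \<rho> f) z"
  using AE_PX_fst[OF Lp_slice[OF f]] AE_PX_fst[OF Lp_slice[OF Lp_Tx(1)[OF f, of "axis i 1"]]]
proof eventually_elim
  case (elim z)
  obtain \<omega> x where z: "z = (\<omega>, x)" by (cases z)
  define f0 where "f0 x = f (\<omega>, x)" for x
  define f1 where "f1 x = f (T (axis i 1) \<omega>, x)" for x
  let ?u = "e *\<^sub>R axis i 1 :: real ^ 'd"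
  have L: "f0 \<in> Lp p lborel" "f1 \<in> Lp p lborel" using elim by (simp_all add: z f0_def[abs_def] f1_def[abs_def] Tx_def)
  have sh: "mollify \<rho> (\<lambda>x. f1 (x + ?u)) x = mollify \<rho> f1 (x + ?u)"
    by (simp add: mollify_def ac_simps)
  have "mollify_x \<rho> (shift_quot e i f) z = mollify \<rho> (\<lambda>x. (1 / e) * f1 (x + ?u) + (- 1 / e) * f0 x) x"
    by (simp add: z mollify_x_def shift_quot_def f0_def f1_def diff_divide_distrib)
  also have "\<dots> = (1 / e) * mollify \<rho> f1 (x + ?u) + (- 1 / e) * mollify \<rho> f0 x"
    by (simp only: mollify_linear[OF \<rho> Lp_lborel_shift(1)[OF L(2)] L(1) p] sh)
  \<comment> \<open>The value \<open>mollify \<rho> f1 x\<close> is inserted: the first quotient is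
    then a purely spatial increment of \<open>f1\<close>, the second a purely horizontal
    one.\<close>
  also have "\<dots> = (mollify \<rho> f1 (x + ?u) - mollify \<rho> f1 x) / e + (1 / e) * (mollify \<rho> f1 x - mollify \<rho> f0 x)"
    by (simp add: diff_divide_distrib)
  also have "(mollify \<rho> f1 (x + ?u) - mollify \<rho> f1 x) / e = mollify (diff_quot \<rho> i e) f1 x"
    by (rule mollify_diff_quot[OF \<rho> L(2) p])
  finally show ?case by (simp add: z mollify_x_def tdiff_def Tx_def f0_def[abs_def] f1_def[abs_def])
qed

text \<open>The kernels converge in L^1 while the fields converge only weakly. With the quotient
  written as \<open>\<tau> n\<close> minus \<open>\<rho>'\<close>, the part with
  \<open>\<tau> n\<close> tends to zero strongly by the uniform bound C, and mollification with a
  fixed kernel preserves weak convergence.\<close>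

lemma mollify_x_diff_quot_weak:
  fixes V :: "nat \<Rightarrow> 'w \<times> (real ^ 'd) \<Rightarrow> real"
  assumes p: "1 < p" and \<rho>: "kernel_deriv \<rho> i \<rho>'" and e: "\<And>n. 0 < e n" "e \<longlonglongrightarrow> 0"
    and V: "Lp_weak_conv p PX V U" and bnd: "\<And>n. Lp_int p PX (V n) \<le> C"
  shows "Lp_weak_conv p PX (\<lambda>n. mollify_x (diff_quot \<rho> i (e n)) (\<lambda>z. V n (Tx k z)))
    (mollify_x (\<lambda>y. - \<rho>' y) (\<lambda>z. U (Tx k z)))"
proof -
  have p0: "0 < p" using p by simp
  have ker: "kernel \<rho>" "kernel \<rho>'" "kernel (\<lambda>y. - \<rho>' y)" using \<rho> kernel_uminus by (auto simp: kernel_deriv_def)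
  define \<tau> where "\<tau> n y = diff_quot \<rho> i (e n) y + \<rho>' y" for n y
  have \<tau>: "kernel (\<tau> n)" for n using kernel_add[OF kernel_diff_quot[OF ker(1)] ker(2), of 1 i "e n" 1] by (simp add: \<tau>_def[abs_def])
  have W: "Lp_weak_conv p PX (\<lambda>n z. V n (Tx k z)) (\<lambda>z. U (Tx k z))" by (rule Lp_weak_conv_Tx[OF p0 V])
  note WL = Lp_weak_conv_Lp(1)[OF W]
  have "(\<lambda>n. mass (\<tau> n)) \<longlonglongrightarrow> 0"
    using diff_quot_tendsto[OF \<rho> e, of 1] by (simp add: mass_Lp_int \<tau>_def[abs_def])
  then have "(\<lambda>n. mass (\<tau> n) powr p * C) \<longlonglongrightarrow> 0 * C" using p0 by (intro tendsto_mult tendsto_const powr_null) auto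
  then have lim0: "(\<lambda>n. mass (\<tau> n) powr p * C) \<longlonglongrightarrow> 0" by simp
  have "(\<lambda>n. Lp_int p PX (\<lambda>z. mollify_x (\<tau> n) (\<lambda>z. V n (Tx k z)) z - 0)) \<longlonglongrightarrow> 0"
  proof (rule tendsto_sandwich[OF _ _ tendsto_const lim0])
    have "Lp_int p PX (mollify_x (\<tau> n) (\<lambda>z. V n (Tx k z))) \<le> mass (\<tau> n) powr p * C" for n
    proof -
      have "Lp_int p PX (mollify_x (\<tau> n) (\<lambda>z. V n (Tx k z))) \<le> mass (\<tau> n) powr p * Lp_int p PX (\<lambda>z. V n (Tx k z))"
        by (rule mollify_x_Lp(2)[OF p \<tau> WL])
      also have "\<dots> \<le> mass (\<tau> n) powr p * C"
        using bnd Lp_Tx(2)[OF Lp_weak_conv_Lp(1)[OF V]] by (intro mult_left_mono) auto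
      finally show ?thesis .
    qed
    then show "\<forall>\<^sub>F n in sequentially. Lp_int p PX (\<lambda>z. mollify_x (\<tau> n) (\<lambda>z. V n (Tx k z)) z - 0) \<le> mass (\<tau> n) powr p * C"
      by simp
  qed simp
  then have "Lp_weak_conv p PX (\<lambda>n. mollify_x (\<tau> n) (\<lambda>z. V n (Tx k z))) (\<lambda>z. 0)"
    by (intro Lp_strong_imp_weak p0 mollify_x_Lp(1)[OF p \<tau> WL]) auto
  from Lp_weak_conv_add[OF this Lp_weak_conv_mollify_x[OF p ker(3) W] p0]
  have conv: "Lp_weak_conv p PX (\<lambda>n z. mollify_x (\<tau> n) (\<lambda>z. V n (Tx k z)) z + mollify_x (\<lambda>y. - \<rho>' y) (\<lambda>z. V n (Tx k z)) z)
      (mollify_x (\<lambda>y. - \<rho>' y) (\<lambda>z. U (Tx k z)))" by simp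
  show ?thesis
  proof (rule Lp_weak_conv_cong_AE[OF p0 conv])
    fix n
    show "mollify_x (diff_quot \<rho> i (e n)) (\<lambda>z. V n (Tx k z)) \<in> borel_measurable PX"
      by (intro Lp_measurable[of _ p] mollify_x_Lp(1)[OF p kernel_diff_quot[OF ker(1)] WL])
    have "(\<lambda>y. 1 * \<tau> n y + 1 * - \<rho>' y) = diff_quot \<rho> i (e n)" by (auto simp: \<tau>_def)
    then show "AE z in PX. mollify_x (\<tau> n) (\<lambda>z. V n (Tx k z)) z + mollify_x (\<lambda>y. - \<rho>' y) (\<lambda>z. V n (Tx k z)) z
        = mollify_x (diff_quot \<rho> i (e n)) (\<lambda>z. V n (Tx k z)) z"
      using mollify_x_linear_kernel[OF p \<tau>[of n] ker(3) WL[of n], of 1 1] by (auto elim!: eventually_mono)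
    show "mollify_x (\<lambda>y. - \<rho>' y) (\<lambda>z. U (Tx k z)) \<in> borel_measurable PX"
      by (intro Lp_measurable[of _ p] mollify_x_Lp(1)[OF p ker(3)] Lp_weak_conv_Lp(2)[OF W])
  qed auto
qed

definition bumps :: "nat \<Rightarrow> real ^ 'd \<Rightarrow> real" where
  "bumps n = bump (inverse (real (Suc n)))"

definition bumps' :: "nat \<Rightarrow> 'd \<Rightarrow> real ^ 'd \<Rightarrow> real" where
  "bumps' n = bump' (inverse (real (Suc n)))"

lemma kernel_deriv_bumps: "kernel_deriv (bumps n) i (bumps' n i)"
  unfolding bumps_def bumps'_def by (rule kernel_deriv_bump) simp

lemma kernel_bumps: "kernel (bumps n)" "kernel (bumps' n i)" "kernel (\<lambda>y. - bumps' n i y)"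
  using kernel_deriv_bumps[of n i] kernel_uminus by (auto simp: kernel_deriv_def)

lemma mollify_bumps_tendsto:
  fixes f :: "'w \<times> (real ^ 'd) \<Rightarrow> real"
  assumes p: "1 < p" and f: "f \<in> Lp p PX"
  shows "(\<lambda>n. Lp_int p PX (\<lambda>z. mollify_x (bumps n) f z - f z)) \<longlonglongrightarrow> 0"
proof (rule mollify_x_tendsto[OF p _ _ _ _ LIMSEQ_inverse_real_of_nat f])
  have pos: "0 < inverse (real (Suc n))" for n by simp
  show "kernel (bumps n)" for n by (rule kernel_bumps)
  show "0 \<le> bumps n y" for n y unfolding bumps_def by (rule bump_props[OF pos])
  show "(LINT y|lborel. bumps n y) = 1" for n unfolding bumps_def by (rule bump_props[OF pos])
  show "norm y \<le> inverse (real (Suc n))" if "bumps n y \<noteq> 0" for n y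
    using bump_props(3)[OF pos] that unfolding bumps_def .
qed

text \<open>Lets identities between limits be checked after mollification: the mollified sequences
  agree and converge strongly, one to f and the other to g.\<close>

lemma AE_eq_of_mollified:
  fixes f g :: "'w \<times> (real ^ 'd) \<Rightarrow> real"
  assumes p: "1 < p" and f: "f \<in> Lp p PX" and g: "g \<in> Lp p PX"
    and eq: "\<And>n. AE z in PX. mollify_x (bumps n) f z = mollify_x (bumps n) g z"
  shows "AE z in PX. f z = g z"
proof -
  have p0: "0 < p" using p by simp
  have "Lp_weak_conv p PX (\<lambda>n. mollify_x (bumps n) f) f"
    by (rule Lp_strong_imp_weak[OF p0 mollify_x_Lp(1)[OF p kernel_bumps(1) f] f mollify_bumps_tendsto[OF p f]])
  then have 1: "Lp_weak_conv p PX (\<lambda>n. mollify_x (bumps n) g) f"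
    by (rule Lp_weak_conv_cong_AE[OF p0])
       (use eq Lp_measurable[OF f] Lp_measurable[OF mollify_x_Lp(1)[OF p kernel_bumps(1) g]] in auto)
  have "Lp_weak_conv p PX (\<lambda>n. mollify_x (bumps n) g) g"
    by (rule Lp_strong_imp_weak[OF p0 mollify_x_Lp(1)[OF p kernel_bumps(1) g] g mollify_bumps_tendsto[OF p g]])
  from Lp_weak_conv_unique[OF p 1 this] show ?thesis .
qed

text \<open>The ratio \<open>c n / e n\<close> may diverge; the product with it still converges
  weakly, being the difference of the mollified quotient and its spatial part. Applied with
  \<open>c = e\<close> in the critical case and with the powers \<open>e n powr \<gamma>\<close> for
  smaller exponents.\<close>

lemma shift_quot_weak_mollified:
  fixes V :: "nat \<Rightarrow> 'w \<times> (real ^ 'd) \<Rightarrow> real"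
  assumes p: "1 < p" and \<rho>: "kernel_deriv \<rho> i \<rho>'" and e: "\<And>n. 0 < e n" "e \<longlonglongrightarrow> 0"
    and V: "Lp_weak_conv p PX V U" and bnd: "\<And>n. Lp_int p PX (V n) \<le> C" and c: "c \<longlonglongrightarrow> a"
    and F: "Lp_weak_conv p PX (\<lambda>n z. c n * shift_quot (e n) i (V n) z) F"
  shows "Lp_weak_conv p PX (\<lambda>n z. (c n / e n) * tdiff i (mollify_x \<rho> (V n)) z)
    (\<lambda>z. mollify_x \<rho> F z - a * mollify_x (\<lambda>y. - \<rho>' y) (\<lambda>z. U (Tx (axis i 1) z)) z)"
proof -
  have p0: "0 < p" using p by simp
  have ker: "kernel \<rho>" using \<rho> by (auto simp: kernel_deriv_def)
  note VL = Lp_weak_conv_Lp(1)[OF V]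
  have 1: "Lp_weak_conv p PX (\<lambda>n z. mollify_x \<rho> (\<lambda>z. c n * shift_quot (e n) i (V n) z) z
        - c n * mollify_x (diff_quot \<rho> i (e n)) (\<lambda>z. V n (Tx (axis i 1) z)) z)
      (\<lambda>z. mollify_x \<rho> F z - a * mollify_x (\<lambda>y. - \<rho>' y) (\<lambda>z. U (Tx (axis i 1) z)) z)"
    by (intro Lp_weak_conv_diff p0 Lp_weak_conv_mollify_x[OF p ker F] Lp_weak_conv_scale[OF _ c]
        mollify_x_diff_quot_weak[OF p \<rho> e V bnd])
  show ?thesis
  proof (rule Lp_weak_conv_cong_AE[OF p0 1])
    fix n
    have sL: "shift_quot (e n) i (V n) \<in> Lp p PX" by (rule shift_quot_Lp[OF VL p0])
    show "(\<lambda>z. (c n / e n) * tdiff i (mollify_x \<rho> (V n)) z) \<in> borel_measurable PX"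
      by (intro Lp_measurable[of _ p] Lp_mult tdiff_Lp(1) mollify_x_Lp(1)[OF p ker VL] p0)
    show "AE z in PX. mollify_x \<rho> (\<lambda>z. c n * shift_quot (e n) i (V n) z) z
        - c n * mollify_x (diff_quot \<rho> i (e n)) (\<lambda>z. V n (Tx (axis i 1) z)) z
        = (c n / e n) * tdiff i (mollify_x \<rho> (V n)) z"
      using mollify_x_shift_quot[OF p ker VL[of n], of "e n" i] mollify_x_linear[OF p ker sL sL, of "c n" 0]
      by eventually_elim (simp add: algebra_simps)
    show "(\<lambda>z. mollify_x \<rho> F z - a * mollify_x (\<lambda>y. - \<rho>' y) (\<lambda>z. U (Tx (axis i 1) z)) z) \<in> borel_measurable PX"
      by (rule Lp_measurable[OF Lp_weak_conv_Lp(2)[OF 1]])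
  qed simp
qed

text \<open>With \<open>c = e\<close> the spatial part gets a factor tending to 0 and the horizontal
  one the factor 1, and the horizontal difference is weakly continuous. If F vanishes, the lemma
  says that U is invariant under \<open>axis i 1\<close>; in this form it serves the exponents below
  1.\<close>

lemma shift_quot_limit_critical:
  fixes V :: "nat \<Rightarrow> 'w \<times> (real ^ 'd) \<Rightarrow> real"
  assumes p: "1 < p" and e: "\<And>n. 0 < e n" "e \<longlonglongrightarrow> 0"
    and V: "Lp_weak_conv p PX V U" and bnd: "\<And>n. Lp_int p PX (V n) \<le> C"
    and F: "Lp_weak_conv p PX (\<lambda>n z. e n * shift_quot (e n) i (V n) z) F"
  shows "AE z in PX. F z = tdiff i U z"
proof (rule AE_eq_of_mollified[OF p Lp_weak_conv_Lp(2)[OF F]])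
  have p0: "0 < p" using p by simp
  note UL = Lp_weak_conv_Lp(2)[OF V]
  show "tdiff i U \<in> Lp p PX" by (rule tdiff_Lp(1)[OF UL p0])
  fix m
  have "e n / e n = 1" for n using e(1)[of n] by simp
  then have 1: "Lp_weak_conv p PX (\<lambda>n. tdiff i (mollify_x (bumps m) (V n))) (mollify_x (bumps m) F)"
    using shift_quot_weak_mollified[OF p kernel_deriv_bumps e V bnd e(2) F, of m] by simp
  have "Lp_weak_conv p PX (\<lambda>n. tdiff i (mollify_x (bumps m) (V n))) (tdiff i (mollify_x (bumps m) U))"
    by (rule Lp_weak_conv_tdiff[OF p0 Lp_weak_conv_mollify_x[OF p kernel_bumps(1) V]])
  from Lp_weak_conv_unique[OF p 1 this] mollify_x_tdiff[where i = i, OF p kernel_bumps(1)[of m] UL]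
  show "AE z in PX. mollify_x (bumps m) F z = mollify_x (bumps m) (tdiff i U) z" by eventually_elim simp
qed

section \<open>Potential and invariant fields\<close>

lemma Lp_tensor:
  fixes \<phi> :: "'w \<Rightarrow> 'b::euclidean_space" and \<eta> :: "real ^ 'd \<Rightarrow> real"
  assumes \<phi>: "\<phi> \<in> Lp p P" and \<eta>: "\<eta> \<in> Lp p lborel"
  shows "(\<lambda>(\<omega>, x). \<eta> x *\<^sub>R \<phi> \<omega>) \<in> Lp p PX"
    and "Lp_int p PX (\<lambda>(\<omega>, x). \<eta> x *\<^sub>R \<phi> \<omega>) = Lp_int p P \<phi> * Lp_int p lborel \<eta>"
proof -
  note [measurable] = Lp_measurable[OF \<phi>] Lp_measurable[OF \<eta>]
  let ?f = "\<lambda>(\<omega>, x). \<eta> x *\<^sub>R \<phi> \<omega>"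
  have m: "?f \<in> borel_measurable PX" by measurable
  have "(\<integral>\<^sup>+z. ennreal (norm (?f z) powr p) \<partial>PX)
      = (\<integral>\<^sup>+\<omega>. (\<integral>\<^sup>+x. ennreal (norm (\<phi> \<omega>) powr p) * ennreal (norm (\<eta> x) powr p) \<partial>lborel) \<partial>P)"
    by (subst pair.M2.nn_integral_fst[symmetric]) (auto simp: powr_mult ennreal_mult[symmetric] mult.commute)
  also have "\<dots> = (\<integral>\<^sup>+\<omega>. ennreal (norm (\<phi> \<omega>) powr p) * ennreal (Lp_int p lborel \<eta>) \<partial>P)"
    by (subst nn_integral_cmult) (auto simp: Lp_int_nn[OF \<eta>, symmetric] simp del: real_norm_def)
  also have "\<dots> = ennreal (Lp_int p P \<phi> * Lp_int p lborel \<eta>)"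
    by (subst nn_integral_multc) (auto simp: Lp_int_nn[OF \<phi>] ennreal_mult)
  finally have eq: "(\<integral>\<^sup>+z. ennreal (norm (?f z) powr p) \<partial>PX) = ennreal (Lp_int p P \<phi> * Lp_int p lborel \<eta>)" .
  show *: "?f \<in> Lp p PX" using Lp_int_le_nn(1)[OF m eq_refl[OF eq]] by simp
  show "Lp_int p PX ?f = Lp_int p P \<phi> * Lp_int p lborel \<eta>" using eq unfolding Lp_int_nn[OF *] by simp
qed

lemma hdiff_Lp:
  assumes "\<phi> \<in> Lp p P" "0 < p"
  shows "hdiff T \<phi> \<in> Lp p P"
  unfolding hdiff_def[abs_def] using assms by (intro Lp_vec Lp_diff Lp_T)

lemma hdiff_field_lincomb:
  "hdiff_field T (\<lambda>z. a *\<^sub>R f z + b *\<^sub>R g z) = (\<lambda>z. a *\<^sub>R hdiff_field T f z + b *\<^sub>R hdiff_field T g z)"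
  by (auto simp: hdiff_field_eq vec_eq_iff tdiff_def fun_eq_iff algebra_simps)

text \<open>For a tensor of indicators the horizontal derivative is a pure tensor again, with the
  exact gradient \<open>hdiff T \<phi>\<close> as its factor on \<Omega>. Density of such tensors
  and boundedness of \<open>hdiff_field\<close> give the general case.\<close>

lemma hdiff_field_pot:
  assumes p: "1 < p" and V: "V \<in> Lp p PX"
  shows "hdiff_field T V \<in> tensor_Lp p P (Lp_pot p P T) (Lp p lborel)"
proof -
  have p0: "0 < p" using p by simp
  let ?S = "tensor_span (Lp_pot p P T) (Lp p lborel) :: ('w \<times> (real ^ 'd) \<Rightarrow> real ^ 'd) set"
  define W :: "('w \<times> (real ^ 'd) \<Rightarrow> real) set" where "W = {s \<in> Lp p PX. hdiff_field T s \<in> ?S}"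
  have hL: "hdiff_field T s \<in> Lp p PX" if "s \<in> Lp p PX" for s
    unfolding hdiff_field_eq by (intro Lp_vec tdiff_Lp that p0)
  have "lin_sub W"
    unfolding lin_sub_def
  proof (intro conjI ballI allI)
    have "hdiff_field T (\<lambda>x. 0) = (\<lambda>x. 0)" by (simp add: hdiff_field_eq tdiff_def vec_eq_iff fun_eq_iff)
    then show "(\<lambda>x. 0) \<in> W" using lin_sub_tensor_span[of "Lp_pot p P T" "Lp p lborel"] by (auto simp: W_def lin_sub_def)
    fix f g a b assume "f \<in> W" "g \<in> W"
    then show "(\<lambda>x. a *\<^sub>R f x + b *\<^sub>R g x) \<in> W"
      using lin_sub_tensor_span[of "Lp_pot p P T" "Lp p lborel"] p0
      unfolding W_def mem_Collect_eq hdiff_field_lincomb by (auto simp: lin_sub_def intro!: Lp_add Lp_mult)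
  qed
  moreover have "(\<lambda>(\<omega>, x). \<eta> x *\<^sub>R \<phi> \<omega>) \<in> W"
    if \<phi>: "\<phi> \<in> (\<lambda>A. indicator A) ` sets P" and \<eta>: "\<eta> \<in> (\<lambda>B. indicator B) ` rat_boxes"
    for \<phi> :: "'w \<Rightarrow> real" and \<eta> :: "real ^ 'd \<Rightarrow> real"
  proof -
    have \<phi>L: "\<phi> \<in> Lp p P" using \<phi> by (auto intro!: Lp_indicator(1) simp: less_top[symmetric])
    have \<eta>L: "\<eta> \<in> Lp p lborel" using \<eta> rat_boxes_finite rat_boxes_borel by (auto intro!: Lp_indicator(1))
    have eq: "hdiff_field T (\<lambda>(\<omega>, x). \<eta> x *\<^sub>R \<phi> \<omega>) = (\<lambda>(\<omega>, x). \<eta> x *\<^sub>R hdiff T \<phi> \<omega>)"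
      by (auto simp: hdiff_field_def hdiff_def fun_eq_iff vec_eq_iff algebra_simps)
    have "hdiff T \<phi> \<in> Lp_pot p P T"
      unfolding Lp_pot_def using \<phi>L by (intro Lp_closure_base p0 imageI hdiff_Lp)
    then show ?thesis unfolding W_def mem_Collect_eq eq using Lp_tensor(1)[OF \<phi>L \<eta>L] tensor_span_elem[OF _ \<eta>L] by auto
  qed
  ultimately have SW: "simple_tensors \<subseteq> W" unfolding simple_tensors_def by (rule tensor_span_least)
  obtain s where s: "\<And>n. s n \<in> simple_tensors" "\<And>n. s n \<in> Lp p PX" "(\<lambda>n. Lp_int p PX (\<lambda>x. s n x - V x)) \<longlonglongrightarrow> 0"
    using Lp_closure_seq[OF p0 simple_tensors_dense[OF p V]] by blast
  show ?thesis
    unfolding tensor_Lp_def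
  proof (rule Lp_closure_closed[OF p0 hL[OF V]])
    show "hdiff_field T (s n) \<in> Lp_closure p PX ?S" for n
      using s(1)[of n] SW by (intro Lp_closure_base[OF p0 _ hL[OF s(2)]]) (auto simp: W_def)
    have sV: "(\<lambda>z. s n z - V z) \<in> Lp p PX" for n by (intro Lp_diff s V p0)
    have "(\<lambda>n. 2 powr p * (2 * Lp_int p PX (\<lambda>z. s n z - V z))) \<longlonglongrightarrow> 2 powr p * (2 * 0)"
      by (intro tendsto_mult tendsto_const s(3))
    then have lim0: "(\<lambda>n. 2 powr p * (2 * Lp_int p PX (\<lambda>z. s n z - V z))) \<longlonglongrightarrow> 0" by simp
    have "(\<lambda>n. Lp_int p PX (tdiff i (\<lambda>z. s n z - V z))) \<longlonglongrightarrow> 0" for i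
    proof (rule tendsto_sandwich[OF _ _ tendsto_const lim0])
      show "\<forall>\<^sub>F n in sequentially. Lp_int p PX (tdiff i (\<lambda>z. s n z - V z)) \<le> 2 powr p * (2 * Lp_int p PX (\<lambda>z. s n z - V z))"
        by (intro always_eventually allI tdiff_Lp(2)[OF sV p0])
    qed simp
    then have "(\<lambda>n. Lp_int p PX (\<lambda>z. \<chi> i. tdiff i (\<lambda>z. s n z - V z) z)) \<longlonglongrightarrow> 0"
      by (intro Lp_vec_tendsto[OF _ p0] tdiff_Lp(1)[OF sV p0])
    moreover have "(\<chi> i. tdiff i (\<lambda>z. s n z - V z) z) = hdiff_field T (s n) z - hdiff_field T V z" for n z
      by (simp add: hdiff_field_eq vec_eq_iff tdiff_def)
    ultimately show "(\<lambda>n. Lp_int p PX (\<lambda>z. hdiff_field T (s n) z - hdiff_field T V z)) \<longlonglongrightarrow> 0" by simp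
  qed
qed

text \<open>As \<open>Tx\<close> preserves the measure and h is invariant, h has the same pairing
  with a field and with its shift, so horizontal differences integrate to zero. The remaining steps
  extend this from exact gradients to the two closures, first on \<Omega> and then on the
  product.\<close>

lemma invariant_pot_orthogonal:
  fixes h z :: "'w \<times> (real ^ 'd) \<Rightarrow> real ^ 'd"
  assumes pq: "conj_exp p q" and h: "h \<in> Lp q PX" and inv: "\<And>i. AE z in PX. h (Tx (axis i 1) z) = h z"
    and z: "z \<in> tensor_Lp p P (Lp_pot p P T) (Lp p lborel)"
  shows "(LINT x|PX. h x \<bullet> z x) = 0"
proof -
  note pq' = conj_expD[OF pq]
  have p: "1 < p" "0 < p" "0 \<le> q" using pq' by auto
  let ?pair = "\<lambda>f. LINT x|PX. h x \<bullet> f x"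
  have A: "?pair (\<lambda>(\<omega>, x). \<eta> x *\<^sub>R hdiff T \<phi> \<omega>) = 0" if \<phi>: "\<phi> \<in> Lp p P" and \<eta>: "\<eta> \<in> Lp p lborel" for \<phi> \<eta>
  proof -
    define f where "f = (\<lambda>(\<omega>, x). \<eta> x * \<phi> \<omega>)"
    have f: "f \<in> Lp p PX" using Lp_tensor(1)[OF \<phi> \<eta>] by (simp add: f_def)
    have hi: "(\<lambda>z. h z $ i) \<in> Lp q PX" for i by (rule Lp_component(1)[OF h p(3)])
    have i1: "integrable PX (\<lambda>z. h z $ i * f z)" "integrable PX (\<lambda>z. h z $ i * f (Tx (axis i 1) z))" for i
      using Lp_pairing(1)[OF pq f hi] Lp_pairing(1)[OF pq Lp_Tx(1)[OF f] hi] by auto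
    have "(LINT z|PX. h z $ i * f (Tx (axis i 1) z)) = (LINT z|PX. h z $ i * f z)" for i
    proof -
      have "(LINT z|PX. h z $ i * f (Tx (axis i 1) z)) = (LINT z|PX. h (Tx (axis i 1) z) $ i * f (Tx (axis i 1) z))"
      proof (rule integral_cong_AE)
        show "(\<lambda>z. h (Tx (axis i 1) z) $ i * f (Tx (axis i 1) z)) \<in> borel_measurable PX"
          using measurable_compose[OF measurable_Tx borel_measurable_integrable[OF i1(1)[of i]]] by simp
        show "(\<lambda>z. h z $ i * f (Tx (axis i 1) z)) \<in> borel_measurable PX"
          by (rule borel_measurable_integrable[OF i1(2)])
        show "AE z in PX. h z $ i * f (Tx (axis i 1) z) = h (Tx (axis i 1) z) $ i * f (Tx (axis i 1) z)"
          using inv[of i] by eventually_elim simp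
      qed
      also have "\<dots> = (LINT z|PX. h z $ i * f z)"
        by (rule integral_Tx[OF borel_measurable_integrable[OF i1(1)]])
      finally show ?thesis .
    qed
    moreover have "?pair (\<lambda>(\<omega>, x). \<eta> x *\<^sub>R hdiff T \<phi> \<omega>)
        = (LINT z|PX. (\<Sum>i\<in>UNIV. h z $ i * f (Tx (axis i 1) z) - h z $ i * f z))"
      by (auto intro!: Bochner_Integration.integral_cong sum.cong simp: f_def inner_vec_def hdiff_def Tx_def algebra_simps)
    ultimately show ?thesis using i1 by simp
  qed
  \<comment> \<open>Tensors whose factor on \<Omega> is an exact gradient. A tensor with a limit of
    gradients is a limit of these, because \<open>Lp_int\<close> of a tensor is a product.\<close>
  define S0 where "S0 = {(\<lambda>(\<omega>, x). \<eta> x *\<^sub>R hdiff T \<phi> \<omega>) |\<phi> \<eta>. \<phi> \<in> Lp p P \<and> \<eta> \<in> (Lp p lborel :: (real ^ 'd \<Rightarrow> real) set)}"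
  have B: "?pair (\<lambda>(\<omega>, x). \<eta> x *\<^sub>R \<phi> \<omega>) = 0" if \<phi>: "\<phi> \<in> Lp_pot p P T" and \<eta>: "\<eta> \<in> Lp p lborel" for \<phi> \<eta>
  proof (rule kernel_pairing_closed[OF pq h])
    show "?pair s = 0" if "s \<in> S0" for s using that A by (auto simp: S0_def)
    have \<phi>L: "\<phi> \<in> Lp p P" using \<phi> Lp_closure_subset unfolding Lp_pot_def by blast
    obtain \<phi>n where \<phi>n: "\<And>n. \<phi>n n \<in> hdiff T ` Lp p P" "\<And>n. \<phi>n n \<in> Lp p P" "(\<lambda>n. Lp_int p P (\<lambda>x. \<phi>n n x - \<phi> x)) \<longlonglongrightarrow> 0"
      using Lp_closure_seq[OF p(2) \<phi>[unfolded Lp_pot_def]] by blast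
    show "(\<lambda>(\<omega>, x). \<eta> x *\<^sub>R \<phi> \<omega>) \<in> Lp_closure p PX S0"
    proof (rule Lp_closureI[OF p(2) Lp_tensor(1)[OF \<phi>L \<eta>]])
      show "(\<lambda>(\<omega>, x). \<eta> x *\<^sub>R \<phi>n n \<omega>) \<in> S0" for n
      proof -
        obtain \<psi> where \<psi>: "\<psi> \<in> Lp p P" "\<phi>n n = hdiff T \<psi>" using \<phi>n(1)[of n] by blast
        show ?thesis unfolding S0_def mem_Collect_eq \<psi>(2)
          by (rule exI[of _ \<psi>], rule exI[of _ \<eta>]) (simp add: \<psi>(1) \<eta>)
      qed
      show "(\<lambda>(\<omega>, x). \<eta> x *\<^sub>R \<phi>n n \<omega>) \<in> Lp p PX" for n by (rule Lp_tensor(1)[OF \<phi>n(2) \<eta>])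
      have "(\<lambda>x. (case x of (\<omega>, x) \<Rightarrow> \<eta> x *\<^sub>R \<phi>n n \<omega>) - (case x of (\<omega>, x) \<Rightarrow> \<eta> x *\<^sub>R \<phi> \<omega>))
          = (\<lambda>(\<omega>, x). \<eta> x *\<^sub>R (\<phi>n n \<omega> - \<phi> \<omega>))" for n by (auto simp: scaleR_diff_right)
      then have "Lp_int p PX (\<lambda>x. (case x of (\<omega>, x) \<Rightarrow> \<eta> x *\<^sub>R \<phi>n n \<omega>) - (case x of (\<omega>, x) \<Rightarrow> \<eta> x *\<^sub>R \<phi> \<omega>))
          = Lp_int p P (\<lambda>x. \<phi>n n x - \<phi> x) * Lp_int p lborel \<eta>" for n
        using Lp_tensor(2)[OF Lp_diff(1)[OF \<phi>n(2) \<phi>L p(2)] \<eta>] by simp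
      moreover have "(\<lambda>n. Lp_int p P (\<lambda>x. \<phi>n n x - \<phi> x) * Lp_int p lborel \<eta>) \<longlonglongrightarrow> 0 * Lp_int p lborel \<eta>"
        by (intro tendsto_mult \<phi>n tendsto_const)
      ultimately show "(\<lambda>n. Lp_int p PX (\<lambda>x. (case x of (\<omega>, x) \<Rightarrow> \<eta> x *\<^sub>R \<phi>n n \<omega>) - (case x of (\<omega>, x) \<Rightarrow> \<eta> x *\<^sub>R \<phi> \<omega>))) \<longlonglongrightarrow> 0"
        by simp
    qed
  qed
  have "tensor_span (Lp_pot p P T) (Lp p lborel) \<subseteq> {f \<in> Lp p PX. ?pair f = 0}"
  proof (rule tensor_span_least[OF lin_sub_kernel_pairing[OF pq h]])
    fix \<phi> \<eta> assume \<phi>\<eta>: "\<phi> \<in> Lp_pot p P T" "\<eta> \<in> (Lp p lborel :: (real ^ 'd \<Rightarrow> real) set)"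
    then have "\<phi> \<in> Lp p P" using Lp_closure_subset unfolding Lp_pot_def by blast
    then show "(\<lambda>(\<omega>, x). \<eta> x *\<^sub>R \<phi> \<omega>) \<in> {f \<in> Lp p PX. ?pair f = 0}"
      using B[OF \<phi>\<eta>] Lp_tensor(1) \<phi>\<eta>(2) by blast
  qed
  then show ?thesis using kernel_pairing_closed[OF pq h _ z[unfolded tensor_Lp_def]] by blast
qed

lemma invariant_pot_le:
  fixes y z :: "'w \<times> (real ^ 'd) \<Rightarrow> real ^ 'd"
  assumes p: "1 < p" and y: "y \<in> Lp p PX" and inv: "\<And>i. AE z in PX. y (Tx (axis i 1) z) = y z"
    and z: "z \<in> tensor_Lp p P (Lp_pot p P T) (Lp p lborel)"
  shows "Lp_int p PX y \<le> Lp_int p PX (\<lambda>x. y x + z x)"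
proof -
  obtain q where pq: "conj_exp p q" using conj_exp_exists[OF p] by blast
  note pq' = conj_expD[OF pq]
  have p0: "0 < p" using p by simp
  have zL: "z \<in> Lp p PX" using z Lp_closure_subset unfolding tensor_Lp_def by blast
  note J = Lp_dual_map[OF pq y]
  have invJ: "AE z in PX. dual_map p (y (Tx (axis i 1) z)) = dual_map p (y z)" for i
    using inv[of i] by eventually_elim simp
  have orth: "(LINT x|PX. dual_map p (y x) \<bullet> z x) = 0"
    by (rule invariant_pot_orthogonal[OF pq J(1) invJ z])
  have "Lp_int p PX y = (LINT x|PX. dual_map p (y x) \<bullet> y x)" by (simp add: dual_map_inner Lp_int_def)
  also have "\<dots> = (LINT x|PX. dual_map p (y x) \<bullet> (y x + z x))"
    using Lp_pairing(1)[OF pq y J(1)] Lp_pairing(1)[OF pq zL J(1)] orth by (simp add: inner_add_right)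
  \<comment> \<open>By Young's inequality; the term \<open>Lp_int p PX y / q\<close> then moves to
    the left, where the factor \<open>1 - 1 / q = 1 / p\<close> remains and cancels. This yields the
    comparison with the constant 1.\<close>
  also have "\<dots> \<le> Lp_int p PX (\<lambda>x. y x + z x) / p + Lp_int p PX y / q"
    using Lp_pairing(2)[OF pq Lp_add(1)[OF y zL p0] J(1)] J(2) by simp
  finally have "Lp_int p PX y * (1 - 1 / q) \<le> Lp_int p PX (\<lambda>x. y x + z x) / p" by (simp add: algebra_simps)
  moreover have "1 - 1 / q = 1 / p" using pq'(3) by simp
  ultimately show ?thesis using p0 by (simp add: divide_le_cancel)
qed

text \<open>The group elements that fix \<open>\<psi>\<close> almost everywhere form a subgroup, as
  measure preservation carries null sets along the action; the unit vectors generate the whole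
  group.\<close>

lemma invariant_generators:
  assumes gen: "\<And>i. AE \<omega> in P. \<psi> (T (axis i 1) \<omega>) = \<psi> \<omega>"
  shows "AE \<omega> in P. \<psi> (T x \<omega>) = \<psi> \<omega>"
proof -
  define H where "H x \<longleftrightarrow> (AE \<omega> in P. \<psi> (T x \<omega>) = \<psi> \<omega>)" for x
  have zero: "H 0" unfolding H_def by (rule AE_I2) (simp add: T_zero)
  have add: "H (x + y)" if "H x" "H y" for x y
  proof -
    have "AE \<omega> in P. \<psi> (T x (T y \<omega>)) = \<psi> (T y \<omega>)" using AE_T[of "\<lambda>\<omega>. \<psi> (T x \<omega>) = \<psi> \<omega>" y] that(1) by (simp add: H_def)
    then show ?thesis using that(2) AE_space[of P] unfolding H_def by eventually_elim (simp add: T_add)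
  qed
  have negH: "H (- x)" if "H x" for x
  proof -
    have "AE \<omega> in P. \<psi> (T x (T (- x) \<omega>)) = \<psi> (T (- x) \<omega>)" using AE_T[of "\<lambda>\<omega>. \<psi> (T x \<omega>) = \<psi> \<omega>" "- x"] that by (simp add: H_def)
    then show ?thesis using AE_space[of P] unfolding H_def by eventually_elim (simp add: T_inverse)
  qed
  have nat: "H (axis i (int n))" for i n
  proof (induction n)
    case (Suc n)
    have "axis i (int (Suc n)) = axis i (int n) + axis i 1" by (simp add: vec_eq_iff axis_def)
    then show ?case using add[OF Suc] gen[of i] by (simp add: H_def)
  next
    case 0
    have "axis i (int 0) = 0" by (simp add: vec_eq_iff axis_def)
    then show ?case using zero by (simp only:)
  qed
  have int: "H (axis i m)" for i m
  proof (cases m)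
    case (nonneg n)
    then show ?thesis using nat by simp
  next
    case (neg n)
    have "axis i m = - axis i (int (Suc n))" by (simp add: vec_eq_iff axis_def neg)
    then show ?thesis using negH[OF nat[of i "Suc n"]] by (simp only:)
  qed
  have "H (\<Sum>i\<in>I. axis i (x $ i))" if "finite I" for I
    using that by induction (auto intro: zero add int)
  from this[of UNIV] have "H (\<Sum>i\<in>UNIV. axis i (x $ i))" by simp
  moreover have "(\<Sum>i\<in>UNIV. axis i (x $ i)) = x" by (simp add: vec_eq_iff sum_component axis_def)
  ultimately show ?thesis by (simp add: H_def)
qed

lemma lin_sub_invariant:
  assumes "0 < p"
  shows "lin_sub {f \<in> Lp p PX. AE z in PX. tdiff i f z = 0}"
  unfolding lin_sub_def
proof (intro conjI ballI allI)
  show "(\<lambda>x. 0) \<in> {f \<in> Lp p PX. AE z in PX. tdiff i f z = 0}" by (simp add: tdiff_def)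
  fix f g a b assume fg: "f \<in> {f \<in> Lp p PX. AE z in PX. tdiff i f z = 0}" "g \<in> {f \<in> Lp p PX. AE z in PX. tdiff i f z = 0}"
  then have "AE z in PX. tdiff i f z = 0" "AE z in PX. tdiff i g z = 0" by auto
  then have "AE z in PX. tdiff i (\<lambda>x. a *\<^sub>R f x + b *\<^sub>R g x) z = 0"
    by eventually_elim (simp add: tdiff_def)
  then show "(\<lambda>x. a *\<^sub>R f x + b *\<^sub>R g x) \<in> {f \<in> Lp p PX. AE z in PX. tdiff i f z = 0}"
    using fg assms by (auto intro!: Lp_add Lp_mult)
qed

lemma invariant_closed:
  assumes p: "1 < p" and f: "f \<in> Lp_closure p PX {f \<in> Lp p PX. AE z in PX. tdiff i f z = 0}"
  shows "AE z in PX. tdiff i f z = 0"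
proof -
  have p0: "0 < p" using p by simp
  have fL: "f \<in> Lp p PX" using f Lp_closure_subset by blast
  obtain s where s: "\<And>n. AE z in PX. tdiff i (s n) z = 0" "\<And>n. s n \<in> Lp p PX" "(\<lambda>n. Lp_int p PX (\<lambda>x. s n x - f x)) \<longlonglongrightarrow> 0"
    using Lp_closure_seq[OF p0 f] by auto
  have "Lp_weak_conv p PX (\<lambda>n. tdiff i (s n)) (tdiff i f)"
    by (rule Lp_weak_conv_tdiff[OF p0 Lp_strong_imp_weak[OF p0 s(2) fL s(3)]])
  then have 1: "Lp_weak_conv p PX (\<lambda>n z. 0) (tdiff i f)"
    by (rule Lp_weak_conv_cong_AE[OF p0]) (use s(1) Lp_measurable[OF tdiff_Lp(1)[OF fL p0]] in auto)
  have 2: "Lp_weak_conv p PX (\<lambda>n z. 0) (\<lambda>z. 0)" by (rule Lp_strong_imp_weak[OF p0]) auto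
  show ?thesis using Lp_weak_conv_unique[OF p 1 2] .
qed

lemma invariant_tensor_span:
  assumes p: "1 < p" and s: "s \<in> tensor_span (Lp_inv p P T) (Lp p lborel)"
  shows "s \<in> Lp p PX" "AE z in PX. tdiff i s z = 0"
proof -
  have p0: "0 < p" using p by simp
  have "tensor_span (Lp_inv p P T) (Lp p lborel) \<subseteq> {f \<in> Lp p PX. AE z in PX. tdiff i f z = 0}"
  proof (rule tensor_span_least[OF lin_sub_invariant[OF p0]])
    fix \<phi> and \<eta> :: "real ^ 'd \<Rightarrow> real" assume \<phi>: "\<phi> \<in> Lp_inv p P T" and \<eta>: "\<eta> \<in> Lp p lborel"
    have "AE \<omega> in P. \<phi> (T (axis i 1) \<omega>) = \<phi> \<omega>" using \<phi> by (auto simp: Lp_inv_def)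
    from AE_PX_fst[OF this] have "AE z in PX. tdiff i (\<lambda>(\<omega>, x). \<eta> x *\<^sub>R \<phi> \<omega>) z = 0"
      by eventually_elim (simp add: tdiff_def Tx_def case_prod_unfold)
    moreover have "(\<lambda>(\<omega>, x). \<eta> x *\<^sub>R \<phi> \<omega>) \<in> Lp p PX"
      by (rule Lp_tensor(1)[OF _ \<eta>]) (use \<phi> in \<open>simp add: Lp_inv_def\<close>)
    ultimately show "(\<lambda>(\<omega>, x). \<eta> x *\<^sub>R \<phi> \<omega>) \<in> {f \<in> Lp p PX. AE z in PX. tdiff i f z = 0}" by blast
  qed
  then show "s \<in> Lp p PX" "AE z in PX. tdiff i s z = 0" using s by auto
qed

text \<open>
  If an invariant field were not a limit of invariant tensors, the separating functional would be
  represented by an invariant function, whose spatial averages are then admissible test functions.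
\<close>

lemma invariant_in_tensor_Lp:
  assumes p: "1 < p" and U: "U \<in> Lp p PX" and inv: "\<And>i. AE z in PX. tdiff i U z = 0"
  shows "U \<in> tensor_Lp p P (Lp_inv p P T) (Lp p lborel)"
proof (rule ccontr)
  let ?S = "tensor_span (Lp_inv p P T) (Lp p lborel) :: ('w \<times> (real ^ 'd) \<Rightarrow> real) set"
  assume "U \<notin> tensor_Lp p P (Lp_inv p P T) (Lp p lborel)"
  then have "U \<notin> Lp_closure p PX ?S" by (simp add: tensor_Lp_def)
  then obtain w z where w: "z \<in> Lp_closure p PX ?S" "w \<in> Lp p PX" "\<And>x. w x = U x - z x" "0 < Lp_int p PX w"
    "\<And>s. s \<in> Lp_closure p PX ?S \<Longrightarrow> (LINT x|PX. dual_map p (w x) \<bullet> s x) = 0"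
    by (rule Lp_separation[OF p lin_sub_tensor_span U]) (rule that; assumption)
  have p0: "0 < p" using p by simp
  obtain q where pq: "conj_exp p q" using conj_exp_exists[OF p] by blast
  note pq' = conj_expD[OF pq]
  define h where "h z = dual_map p (w z)" for z
  have h: "h \<in> Lp q PX" unfolding h_def by (rule Lp_dual_map(1)[OF pq w(2)])
  note [measurable] = Lp_measurable[OF h]
  \<comment> \<open>U is invariant by hypothesis and its nearest point z as a limit of invariant
    tensors. Hence the residual w is invariant, and so is h, which depends on w pointwise.\<close>
  have h_inv: "AE z in PX. h (Tx (axis i 1) z) = h z" for i
  proof -
    have "z \<in> Lp_closure p PX {f \<in> Lp p PX. AE z in PX. tdiff i f z = 0}"
      using w(1) invariant_tensor_span[OF p] unfolding Lp_closure_def by blast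
    from invariant_closed[OF p this] inv[of i] show ?thesis
      by eventually_elim (simp add: h_def w(3) tdiff_def)
  qed
  have "AE z in PX. h z = 0"
  proof (rule Lp_zero_of_rect[OF pq'(2) h])
    fix A :: "'w set" and B :: "(real ^ 'd) set" assume A: "A \<in> sets P" and B: "B \<in> rat_boxes"
    have [measurable]: "B \<in> sets borel" by (rule rat_boxes_borel[OF B])
    define f where "f z = indicator B (snd z) * h z" for z
    have fint: "integrable PX (\<lambda>z. indicator (C \<times> B) z * h z)" if "C \<in> sets P" for C
      using Lp_pairing(1)[OF pq Lp_indicator(1)[OF rect_finite[OF that B]] h] by (simp add: mult.commute)
    \<comment> \<open>The integral of h over the box at fixed \<omega>: by Fubini, integrating h
      over a rectangle \<open>C \<times> B\<close> is integrating \<open>hB\<close> over C.\<close>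
    define hB where "hB \<omega> = (LINT x|lborel. indicator B x * h (\<omega>, x))" for \<omega>
    have rect: "(LINT z|PX. indicator (C \<times> B) z * h z) = (LINT \<omega>|P. indicator C \<omega> * hB \<omega>)"
      "integrable P (\<lambda>\<omega>. indicator C \<omega> * hB \<omega>)" if "C \<in> sets P" for C
    proof -
      have "(LINT x|lborel. indicator (C \<times> B) (\<omega>, x) * h (\<omega>, x)) = indicator C \<omega> * hB \<omega>" for \<omega>
        by (simp add: hB_def indicator_times mult.assoc)
      then show "(LINT z|PX. indicator (C \<times> B) z * h z) = (LINT \<omega>|P. indicator C \<omega> * hB \<omega>)"
        "integrable P (\<lambda>\<omega>. indicator C \<omega> * hB \<omega>)"
        using pair.integral_fst'[OF fint[OF that]] pair.integrable_fst'[OF fint[OF that]] by simp_all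
    qed
    have hBm[measurable]: "hB \<in> borel_measurable P" unfolding hB_def by measurable
    have hB_inv: "AE \<omega> in P. hB (T k \<omega>) = hB \<omega>" for k
    proof (rule invariant_generators)
      fix i
      have "AE \<omega> in P. AE x in lborel. h (Tx (axis i 1) (\<omega>, x)) = h (\<omega>, x)" by (rule pair.AE_pair[OF h_inv])
      then show "AE \<omega> in P. hB (T (axis i 1) \<omega>) = hB \<omega>" using AE_space[of P]
      proof eventually_elim
        case (elim \<omega>)
        note [measurable] = slice_measurable[OF Lp_measurable[OF h] elim(2)]
          slice_measurable[OF Lp_measurable[OF h] T_space[OF elim(2), of "axis i 1"]]
        show ?case unfolding hB_def
          by (rule integral_cong_AE) (use elim(1) in \<open>auto simp: Tx_def elim!: eventually_mono\<close>)
      qed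
    qed
    \<comment> \<open>Level sets of the invariant function \<open>hB\<close> are invariant, and
      their indicators are bounded, so these are admissible elements of \<open>Lp_inv\<close>. The
      positive and the negative half-line as choices of R leave only \<open>hB = 0\<close>.\<close>
    have level: "(LINT \<omega>|P. indicator {\<omega> \<in> space P. hB \<omega> \<in> R} \<omega> * hB \<omega>) = 0" if R[measurable]: "R \<in> sets borel" for R
    proof -
      let ?D = "{\<omega> \<in> space P. hB \<omega> \<in> R}"
      have D: "?D \<in> sets P" by measurable
      have "AE \<omega> in P. indicat_real ?D (T k \<omega>) = indicat_real ?D \<omega>" for k
        using hB_inv[of k] AE_space[of P] by eventually_elim (simp add: indicator_def T_space)
      then have \<phi>: "indicat_real ?D \<in> Lp_inv p P T"
        using D by (auto simp: Lp_inv_def less_top[symmetric] intro!: Lp_indicator(1))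
      have \<eta>: "indicat_real B \<in> Lp p lborel" using rat_boxes_finite[OF B] by (intro Lp_indicator(1)) auto
      have "(\<lambda>(\<omega>, x). indicat_real B x *\<^sub>R indicat_real ?D \<omega>) \<in> Lp_closure p PX ?S"
        using tensor_span_elem[OF \<phi> \<eta>] invariant_tensor_span(1)[OF p] by (intro Lp_closure_base p0) auto
      from w(5)[OF this] have "(LINT z|PX. h z * (case z of (\<omega>, x) \<Rightarrow> indicat_real B x * indicat_real ?D \<omega>)) = 0"
        by (simp add: h_def)
      moreover have "h z * (case z of (\<omega>, x) \<Rightarrow> indicat_real B x * indicat_real ?D \<omega>) = indicat_real (?D \<times> B) z * h z" for z
        by (cases z) (simp add: indicator_times)
      ultimately show ?thesis using rect(1)[OF D] by simp
    qed
    have "AE \<omega> in P. indicator {\<omega> \<in> space P. hB \<omega> \<in> {0<..}} \<omega> * hB \<omega> = 0"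
    proof (subst integral_nonneg_eq_0_iff_AE[symmetric])
      show "integrable P (\<lambda>\<omega>. indicator {\<omega> \<in> space P. hB \<omega> \<in> {0<..}} \<omega> * hB \<omega>)" by (rule rect(2)) measurable
      show "AE \<omega> in P. 0 \<le> indicator {\<omega> \<in> space P. hB \<omega> \<in> {0<..}} \<omega> * hB \<omega>" by (auto simp: indicator_def)
      show "(LINT \<omega>|P. indicator {\<omega> \<in> space P. hB \<omega> \<in> {0<..}} \<omega> * hB \<omega>) = 0" by (rule level) simp
    qed
    moreover have "AE \<omega> in P. - (indicator {\<omega> \<in> space P. hB \<omega> \<in> {..<0}} \<omega> * hB \<omega>) = 0"
    proof (subst integral_nonneg_eq_0_iff_AE[symmetric])
      show "integrable P (\<lambda>\<omega>. - (indicator {\<omega> \<in> space P. hB \<omega> \<in> {..<0}} \<omega> * hB \<omega>))"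
        by (intro Bochner_Integration.integrable_minus rect(2)) measurable
      show "AE \<omega> in P. 0 \<le> - (indicator {\<omega> \<in> space P. hB \<omega> \<in> {..<0}} \<omega> * hB \<omega>)" by (auto simp: indicator_def)
      show "(LINT \<omega>|P. - (indicator {\<omega> \<in> space P. hB \<omega> \<in> {..<0}} \<omega> * hB \<omega>)) = 0"
        using level[of "{..<0}"] by simp
    qed
    ultimately have "AE \<omega> in P. hB \<omega> = 0"
      using AE_space[of P] by eventually_elim (auto simp: indicator_def split: if_splits)
    then have "(LINT \<omega>|P. indicator A \<omega> * hB \<omega>) = (LINT \<omega>|P. 0)"
      using A by (intro integral_cong_AE) (auto elim!: eventually_mono)
    then show "(LINT z|PX. indicator (A \<times> B) z * h z) = 0" using rect(1)[OF A] by simp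
  qed
  then have "AE z in PX. w z = 0"
  proof eventually_elim
    case (elim z)
    then show ?case using dual_map_inner[of p "w z"] by (simp add: h_def)
  qed
  then show False using Lp_int_eq_0[OF w(2)] w(4) by simp
qed

section \<open>Sobolev regularity of invariant limits\<close>

lemma mollify_x_tensor:
  fixes \<rho> :: "real ^ 'd \<Rightarrow> real" and \<rho>' :: "'d \<Rightarrow> real ^ 'd \<Rightarrow> real"
  assumes p: "1 < p" and \<rho>: "\<And>i. kernel_deriv \<rho> i (\<rho>' i)" and s: "s \<in> tensor_span (Lp_inv p P T) (Lp p lborel)"
  shows "mollify_x \<rho> s \<in> tensor_span (Lp_inv p P T) (W1p p)"
    and "weak_gradient_x p P (mollify_x \<rho> s) (\<lambda>z. \<chi> i. mollify_x (\<lambda>y. - \<rho>' i y) s z)"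
proof -
  have p0: "0 < p" using p by simp
  have k: "kernel \<rho>" "kernel (\<lambda>y. - \<rho>' i y)" for i using \<rho>[of i] kernel_uminus by (auto simp: kernel_deriv_def)
  let ?S = "tensor_span (Lp_inv p P T) (W1p p) :: ('w \<times> (real ^ 'd) \<Rightarrow> real) set"
  define grad where "grad s = (\<lambda>z. \<chi> i. mollify_x (\<lambda>y. - \<rho>' i y) s z)" for s :: "'w \<times> (real ^ 'd) \<Rightarrow> real"
  \<comment> \<open>The slices are required to be p-integrable for every \<omega>, so that
    mollification is linear as an identity of functions and not just almost everywhere: membership
    in \<open>tensor_span\<close> is sensitive to null sets.\<close>
  define V :: "('w \<times> (real ^ 'd) \<Rightarrow> real) set" where
    "V = {s \<in> Lp p PX. (\<forall>\<omega>. (\<lambda>x. s (\<omega>, x)) \<in> Lp p lborel) \<and> mollify_x \<rho> s \<in> ?S \<and> weak_gradient_x p P (mollify_x \<rho> s) (grad s)}"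
  have lin: "mollify_x \<sigma> (\<lambda>z. a *\<^sub>R f z + b *\<^sub>R g z) = (\<lambda>z. a *\<^sub>R mollify_x \<sigma> f z + b *\<^sub>R mollify_x \<sigma> g z)"
    if "kernel \<sigma>" "f \<in> V" "g \<in> V" for \<sigma> f g a b
    using mollify_linear[OF that(1) _ _ p] that(2,3) by (auto simp: mollify_x_def V_def fun_eq_iff)
  have "lin_sub V"
    unfolding lin_sub_def
  proof (intro conjI ballI allI)
    have m0: "mollify_x \<sigma> (\<lambda>z. 0) = (\<lambda>z. 0)" for \<sigma> :: "real ^ 'd \<Rightarrow> real"
      by (simp add: mollify_x_def mollify_def case_prod_unfold)
    have "weak_gradient (\<lambda>x::real ^ 'd. 0) (\<lambda>x. \<chi> i. 0)"
      unfolding zero_vec_def[symmetric] by (simp add: weak_gradient_def loc_integrable_def set_integrable_def)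
    then have "weak_gradient_x p P (mollify_x \<rho> (\<lambda>z. 0)) (grad (\<lambda>z. 0))"
      unfolding grad_def m0 weak_gradient_x_def by (auto intro!: Lp_vec p0)
    moreover have "(\<lambda>z. 0) \<in> ?S" using lin_sub_tensor_span by (auto simp: lin_sub_def)
    ultimately show "(\<lambda>x. 0) \<in> V" by (simp add: V_def m0)
    fix f g a b assume fg: "f \<in> V" "g \<in> V"
    have "weak_gradient_x p P (\<lambda>z. a * mollify_x \<rho> f z + b * mollify_x \<rho> g z) (\<lambda>z. a *\<^sub>R grad f z + b *\<^sub>R grad g z)"
      using fg by (intro weak_gradient_x_lincomb[OF p] mollify_x_Lp(1)[OF p k(1)]) (auto simp: V_def)
    moreover have "grad (\<lambda>z. a *\<^sub>R f z + b *\<^sub>R g z) = (\<lambda>z. a *\<^sub>R grad f z + b *\<^sub>R grad g z)"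
      unfolding grad_def lin[OF k(2) fg] by (simp add: vec_eq_iff fun_eq_iff)
    moreover have "(\<lambda>z. a *\<^sub>R mollify_x \<rho> f z + b *\<^sub>R mollify_x \<rho> g z) \<in> ?S"
      using fg lin_sub_tensor_span[of "Lp_inv p P T" "W1p p"] unfolding V_def lin_sub_def by blast
    ultimately show "(\<lambda>x. a *\<^sub>R f x + b *\<^sub>R g x) \<in> V"
      using fg lin[OF k(1) fg, of a b] by (auto simp: V_def intro!: Lp_add Lp_mult p0)
  qed
  then have "tensor_span (Lp_inv p P T) (Lp p lborel) \<subseteq> V"
  proof (rule tensor_span_least)
    fix \<phi> and \<eta> :: "real ^ 'd \<Rightarrow> real" assume \<phi>: "\<phi> \<in> Lp_inv p P T" and \<eta>: "\<eta> \<in> Lp p lborel"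
    have m: "mollify_x \<sigma> (\<lambda>(\<omega>, x). \<eta> x *\<^sub>R \<phi> \<omega>) = (\<lambda>(\<omega>, x). mollify \<sigma> \<eta> x *\<^sub>R \<phi> \<omega>)" for \<sigma>
      by (simp add: mollify_x_def mollify_def case_prod_unfold mult.assoc[symmetric])
    have L: "(\<lambda>(\<omega>, x). \<eta> x *\<^sub>R \<phi> \<omega>) \<in> Lp p PX"
      by (rule Lp_tensor(1)[OF _ \<eta>]) (use \<phi> in \<open>simp add: Lp_inv_def\<close>)
    note wg = weak_gradient_mollify[OF p \<eta> \<rho>]
    have "weak_gradient (\<lambda>x. mollify \<rho> \<eta> x *\<^sub>R \<phi> \<omega>) (\<lambda>x. \<chi> i. mollify (\<lambda>y. - \<rho>' i y) \<eta> x *\<^sub>R \<phi> \<omega>)" for \<omega>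
    proof -
      have "weak_gradient (\<lambda>x. \<phi> \<omega> * mollify \<rho> \<eta> x + 0 * mollify \<rho> \<eta> x)
          (\<lambda>x. \<phi> \<omega> *\<^sub>R (\<chi> i. mollify (\<lambda>y. - \<rho>' i y) \<eta> x) + 0 *\<^sub>R (\<chi> i. mollify (\<lambda>y. - \<rho>' i y) \<eta> x))"
        by (rule weak_gradient_lincomb[OF p mollify_Lp(1)[OF p k(1) \<eta>] mollify_Lp(1)[OF p k(1) \<eta>] wg(2) wg(2) wg(1) wg(1)])
      moreover have "\<phi> \<omega> *\<^sub>R (\<chi> i. mollify (\<lambda>y. - \<rho>' i y) \<eta> x) + 0 *\<^sub>R (\<chi> i. mollify (\<lambda>y. - \<rho>' i y) \<eta> x)
          = (\<chi> i. mollify (\<lambda>y. - \<rho>' i y) \<eta> x *\<^sub>R \<phi> \<omega>)" for x by (simp add: vec_eq_iff)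
      ultimately show ?thesis by (simp add: mult.commute)
    qed
    moreover have "grad (\<lambda>(\<omega>, x). \<eta> x *\<^sub>R \<phi> \<omega>) \<in> Lp p PX"
      unfolding grad_def by (intro Lp_vec mollify_x_Lp(1)[OF p k(2) L] p0)
    ultimately have "weak_gradient_x p P (mollify_x \<rho> (\<lambda>(\<omega>, x). \<eta> x *\<^sub>R \<phi> \<omega>)) (grad (\<lambda>(\<omega>, x). \<eta> x *\<^sub>R \<phi> \<omega>))"
      unfolding weak_gradient_x_def by (simp add: grad_def m[simplified])
    moreover have "mollify_x \<rho> (\<lambda>(\<omega>, x). \<eta> x *\<^sub>R \<phi> \<omega>) \<in> ?S"
      unfolding m using \<phi> wg(3) by (rule tensor_span_elem)
    moreover have "(\<lambda>x. \<eta> x *\<^sub>R \<phi> \<omega>) \<in> Lp p lborel" for \<omega> using Lp_mult(1)[OF \<eta>, of "\<phi> \<omega>"] by (simp add: mult.commute)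
    ultimately show "(\<lambda>(\<omega>, x). \<eta> x *\<^sub>R \<phi> \<omega>) \<in> V" using L by (simp add: V_def)
  qed
  then show "mollify_x \<rho> s \<in> ?S" "weak_gradient_x p P (mollify_x \<rho> s) (\<lambda>z. \<chi> i. mollify_x (\<lambda>y. - \<rho>' i y) s z)"
    using s by (auto simp: V_def grad_def)
qed

text \<open>The spatial gradient of \<open>mollify_x (bumps m) U\<close>, with the derivative placed
  on the kernel, so that it makes sense for fields U that are merely in L^p.\<close>

definition mollified_gradient :: "nat \<Rightarrow> ('w \<times> (real ^ 'd) \<Rightarrow> real) \<Rightarrow> 'w \<times> (real ^ 'd) \<Rightarrow> real ^ 'd" where
  "mollified_gradient m U z = (\<chi> i. mollify_x (\<lambda>y. - bumps' m i y) U z)"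

lemma mollified_gradient_Lp:
  assumes "1 < p" "U \<in> Lp p PX"
  shows "mollified_gradient m U \<in> Lp p PX"
  unfolding mollified_gradient_def[abs_def] using assms by (intro Lp_vec mollify_x_Lp(1)[OF _ kernel_bumps(3)]) auto

text \<open>For a fixed m both operations are bounded and linear on L^p, so strong convergence
  passes through them.\<close>

lemma mollified_gradient_approx:
  assumes p: "1 < p" and U: "U \<in> Lp p PX" and s: "\<And>n. s n \<in> Lp p PX" "(\<lambda>n. Lp_int p PX (\<lambda>z. s n z - U z)) \<longlonglongrightarrow> 0"
  shows "(\<lambda>n. Lp_int p PX (\<lambda>z. mollify_x (bumps m) (s n) z - mollify_x (bumps m) U z)) \<longlonglongrightarrow> 0"
    and "(\<lambda>n. Lp_int p PX (\<lambda>z. mollified_gradient m (s n) z - mollified_gradient m U z)) \<longlonglongrightarrow> 0"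
proof -
  have p0: "0 < p" using p by simp
  have gen: "(\<lambda>n. Lp_int p PX (\<lambda>z. mollify_x \<sigma> (s n) z - mollify_x \<sigma> U z)) \<longlonglongrightarrow> 0" if \<sigma>: "kernel \<sigma>" for \<sigma>
  proof -
    have d: "(\<lambda>z. s n z - U z) \<in> Lp p PX" for n by (intro Lp_diff s U p0)
    have "(\<lambda>n. mass \<sigma> powr p * Lp_int p PX (\<lambda>z. s n z - U z)) \<longlonglongrightarrow> mass \<sigma> powr p * 0"
      by (intro tendsto_mult tendsto_const s(2))
    then have lim0: "(\<lambda>n. mass \<sigma> powr p * Lp_int p PX (\<lambda>z. s n z - U z)) \<longlonglongrightarrow> 0" by simp
    show ?thesis
    proof (rule tendsto_sandwich[OF _ _ tendsto_const lim0])
      have "Lp_int p PX (\<lambda>z. mollify_x \<sigma> (s n) z - mollify_x \<sigma> U z) \<le> mass \<sigma> powr p * Lp_int p PX (\<lambda>z. s n z - U z)" for n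
      proof -
        have "Lp_int p PX (\<lambda>z. mollify_x \<sigma> (s n) z - mollify_x \<sigma> U z) = Lp_int p PX (mollify_x \<sigma> (\<lambda>z. s n z - U z))"
        proof (rule Lp_int_cong_AE)
          show "AE z in PX. mollify_x \<sigma> (s n) z - mollify_x \<sigma> U z = mollify_x \<sigma> (\<lambda>z. s n z - U z) z"
            using mollify_x_linear[OF p \<sigma> s(1)[of n] U, of 1 "-1"] by eventually_elim simp
        qed (intro Lp_measurable[of _ p] Lp_diff mollify_x_Lp(1)[OF p \<sigma>] s U p0)+
        then show ?thesis using mollify_x_Lp(2)[OF p \<sigma> d[of n]] by simp
      qed
      then show "\<forall>\<^sub>F n in sequentially. Lp_int p PX (\<lambda>z. mollify_x \<sigma> (s n) z - mollify_x \<sigma> U z)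
          \<le> mass \<sigma> powr p * Lp_int p PX (\<lambda>z. s n z - U z)" by (intro always_eventually allI)
    qed simp
  qed
  show "(\<lambda>n. Lp_int p PX (\<lambda>z. mollify_x (bumps m) (s n) z - mollify_x (bumps m) U z)) \<longlonglongrightarrow> 0"
    by (rule gen[OF kernel_bumps(1)])
  have eq: "mollified_gradient m (s n) z - mollified_gradient m U z
      = (\<chi> i. mollify_x (\<lambda>y. - bumps' m i y) (s n) z - mollify_x (\<lambda>y. - bumps' m i y) U z)" for n z
    by (simp add: mollified_gradient_def vec_eq_iff)
  show "(\<lambda>n. Lp_int p PX (\<lambda>z. mollified_gradient m (s n) z - mollified_gradient m U z)) \<longlonglongrightarrow> 0"
    unfolding eq by (intro Lp_vec_tendsto gen kernel_bumps(3) Lp_diff mollify_x_Lp(1)[OF p kernel_bumps(3)] s U p0)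
qed

text \<open>For each m a tensor \<open>s (N m)\<close> is chosen so close to U that its
  mollification follows that of U up to \<open>1 / (m + 1)\<close>, gradients included. The
  mollified tensors lie in the algebraic span with factors in \<open>W1p\<close> and converge to U
  together with their gradients.\<close>

lemma invariant_in_tensor_W1p:
  assumes p: "1 < p" and U: "U \<in> tensor_Lp p P (Lp_inv p P T) (Lp p lborel)" and G: "G \<in> Lp p PX"
    and lim: "(\<lambda>m. Lp_int p PX (\<lambda>z. mollified_gradient m U z - G z)) \<longlonglongrightarrow> 0"
  shows "U \<in> tensor_W1p p P (Lp_inv p P T) (W1p p)" "weak_gradient_x p P U G"
proof -
  have p0: "0 < p" using p by simp
  have UL: "U \<in> Lp p PX" using U Lp_closure_subset unfolding tensor_Lp_def by blast
  let ?S = "tensor_span (Lp_inv p P T) (Lp p lborel) :: ('w \<times> (real ^ 'd) \<Rightarrow> real) set"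
  obtain s where s: "\<And>n. s n \<in> ?S" "\<And>n. s n \<in> Lp p PX" "(\<lambda>n. Lp_int p PX (\<lambda>z. s n z - U z)) \<longlonglongrightarrow> 0"
    using Lp_closure_seq[OF p0 U[unfolded tensor_Lp_def]] by blast
  have ex: "\<forall>m. \<exists>n. Lp_int p PX (\<lambda>z. mollify_x (bumps m) (s n) z - mollify_x (bumps m) U z) < inverse (real (Suc m))
      \<and> Lp_int p PX (\<lambda>z. mollified_gradient m (s n) z - mollified_gradient m U z) < inverse (real (Suc m))"
  proof
    fix m
    have "0 < inverse (real (Suc m))" by simp
    then have "\<forall>\<^sub>F n in sequentially. Lp_int p PX (\<lambda>z. mollify_x (bumps m) (s n) z - mollify_x (bumps m) U z) < inverse (real (Suc m))"
      "\<forall>\<^sub>F n in sequentially. Lp_int p PX (\<lambda>z. mollified_gradient m (s n) z - mollified_gradient m U z) < inverse (real (Suc m))"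
      using order_tendstoD(2)[OF mollified_gradient_approx(1)[OF p UL s(2,3)]]
        order_tendstoD(2)[OF mollified_gradient_approx(2)[OF p UL s(2,3)]] by blast+
    then have "\<forall>\<^sub>F n in sequentially. Lp_int p PX (\<lambda>z. mollify_x (bumps m) (s n) z - mollify_x (bumps m) U z) < inverse (real (Suc m))
      \<and> Lp_int p PX (\<lambda>z. mollified_gradient m (s n) z - mollified_gradient m U z) < inverse (real (Suc m))"
      by (rule eventually_conj)
    from eventually_happens'[OF sequentially_bot this]
    show "\<exists>n. Lp_int p PX (\<lambda>z. mollify_x (bumps m) (s n) z - mollify_x (bumps m) U z) < inverse (real (Suc m))
      \<and> Lp_int p PX (\<lambda>z. mollified_gradient m (s n) z - mollified_gradient m U z) < inverse (real (Suc m))" .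
  qed
  from choice[OF ex] obtain N where N: "\<And>m. Lp_int p PX (\<lambda>z. mollify_x (bumps m) (s (N m)) z - mollify_x (bumps m) U z) < inverse (real (Suc m))"
      "\<And>m. Lp_int p PX (\<lambda>z. mollified_gradient m (s (N m)) z - mollified_gradient m U z) < inverse (real (Suc m))"
    by blast
  define f where "f m = mollify_x (bumps m) (s (N m))" for m
  define g where "g m = mollified_gradient m (s (N m))" for m
  have f: "f m \<in> tensor_span (Lp_inv p P T) (W1p p)" "weak_gradient_x p P (f m) (g m)" for m
    using mollify_x_tensor[OF p kernel_deriv_bumps s(1)] by (auto simp: f_def g_def mollified_gradient_def[abs_def])
  have fL: "f m \<in> Lp p PX" and gL: "g m \<in> Lp p PX" for m
    unfolding f_def g_def by (rule mollify_x_Lp(1)[OF p kernel_bumps(1) s(2)], rule mollified_gradient_Lp[OF p s(2)])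
  have null: "(\<lambda>m. Lp_int p PX (\<lambda>z. a m z - b m z)) \<longlonglongrightarrow> 0"
    if "\<And>m. Lp_int p PX (\<lambda>z. a m z - b m z) < inverse (real (Suc m))" for a b :: "nat \<Rightarrow> 'w \<times> (real ^ 'd) \<Rightarrow> 'c::euclidean_space"
    by (rule tendsto_sandwich[OF _ _ tendsto_const LIMSEQ_inverse_real_of_nat])
       (use that in \<open>auto intro!: always_eventually less_imp_le\<close>)
  have tri: "(\<lambda>m. Lp_int p PX (\<lambda>z. a m z - c z)) \<longlonglongrightarrow> 0"
    if L: "\<And>m. a m \<in> Lp p PX" "\<And>m. b m \<in> Lp p PX" "c \<in> Lp p PX"
      and ab: "(\<lambda>m. Lp_int p PX (\<lambda>z. a m z - b m z)) \<longlonglongrightarrow> 0" and bc: "(\<lambda>m. Lp_int p PX (\<lambda>z. b m z - c z)) \<longlonglongrightarrow> 0"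
    for a b :: "nat \<Rightarrow> 'w \<times> (real ^ 'd) \<Rightarrow> 'c::euclidean_space" and c
  proof -
    have "(\<lambda>m. 2 powr p * (Lp_int p PX (\<lambda>z. a m z - b m z) + Lp_int p PX (\<lambda>z. b m z - c z))) \<longlonglongrightarrow> 2 powr p * (0 + 0)"
      by (intro tendsto_mult tendsto_const tendsto_add ab bc)
    then have lim0: "(\<lambda>m. 2 powr p * (Lp_int p PX (\<lambda>z. a m z - b m z) + Lp_int p PX (\<lambda>z. b m z - c z))) \<longlonglongrightarrow> 0" by simp
    show ?thesis
    proof (rule tendsto_sandwich[OF _ _ tendsto_const lim0])
      show "\<forall>\<^sub>F m in sequentially. Lp_int p PX (\<lambda>z. a m z - c z)
          \<le> 2 powr p * (Lp_int p PX (\<lambda>z. a m z - b m z) + Lp_int p PX (\<lambda>z. b m z - c z))"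
        by (intro always_eventually allI Lp_int_diff_trans_le L p0)
    qed simp
  qed
  have flim: "(\<lambda>m. Lp_int p PX (\<lambda>z. f m z - U z)) \<longlonglongrightarrow> 0"
    by (rule tri[OF fL mollify_x_Lp(1)[OF p kernel_bumps(1) UL] UL null mollify_bumps_tendsto[OF p UL]])
       (use N(1) in \<open>simp add: f_def\<close>)
  have glim: "(\<lambda>m. Lp_int p PX (\<lambda>z. g m z - G z)) \<longlonglongrightarrow> 0"
    by (rule tri[OF gL mollified_gradient_Lp[OF p UL] G null lim]) (use N(2) in \<open>simp add: g_def\<close>)
  show wg: "weak_gradient_x p P U G"
    by (rule weak_gradient_x_limit[OF p fL UL G f(2) flim glim])
  have fW: "f m \<in> Lp_W1p p P" for m using f(2) fL by (auto simp: Lp_W1p_def)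
  show "U \<in> tensor_W1p p P (Lp_inv p P T) (W1p p)"
    unfolding tensor_W1p_def Lp_W1p_closure_def mem_Collect_eq
  proof (intro conjI allI impI)
    show "U \<in> Lp_W1p p P" using wg UL by (auto simp: Lp_W1p_def)
    fix e :: real assume e: "0 < e"
    then have e2: "0 < (e / 2) powr p" by simp
    have "\<forall>\<^sub>F m in sequentially. Lp_int p PX (\<lambda>z. f m z - U z) < (e / 2) powr p \<and> Lp_int p PX (\<lambda>z. g m z - G z) < (e / 2) powr p"
      using order_tendstoD(2)[OF flim e2] order_tendstoD(2)[OF glim e2] by (rule eventually_conj)
    from eventually_happens'[OF sequentially_bot this]
    obtain m where m: "Lp_int p PX (\<lambda>z. f m z - U z) < (e / 2) powr p" "Lp_int p PX (\<lambda>z. g m z - G z) < (e / 2) powr p" by blast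
    have "weak_gradient_x p P (\<lambda>z. 1 * U z + (- 1) * f m z) (\<lambda>z. 1 *\<^sub>R G z + (- 1) *\<^sub>R g m z)"
      by (rule weak_gradient_x_lincomb[OF p UL fL wg f(2)])
    then have "weak_gradient_x p P (\<lambda>z. U z - f m z) (\<lambda>z. G z - g m z)" by simp
    moreover have "Lp_norm p PX (\<lambda>z. U z - f m z) < e / 2" "Lp_norm p PX (\<lambda>z. G z - g m z) < e / 2"
      using m e p0 Lp_int_diff_commute[of p PX U "f m"] Lp_int_diff_commute[of p PX G "g m"]
        Lp_norm_less_iff[of p "e / 2" PX "\<lambda>z. U z - f m z"] Lp_norm_less_iff[of p "e / 2" PX "\<lambda>z. G z - g m z"] by simp_all
    then have "Lp_norm p PX (\<lambda>z. U z - f m z) + Lp_norm p PX (\<lambda>z. G z - g m z) < e" by simp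
    ultimately show "\<exists>V\<in>tensor_span (Lp_inv p P T) (W1p p) \<inter> Lp_W1p p P. \<exists>G. weak_gradient_x p P (\<lambda>z. U z - V z) G
        \<and> Lp_norm p PX (\<lambda>z. U z - V z) + Lp_norm p PX G < e"
      using f(1)[of m] fW[of m] by blast
  qed
qed

section \<open>The regimes of the exponent\<close>

lemma shift_quot_limit_subcritical:
  fixes V :: "nat \<Rightarrow> 'w \<times> (real ^ 'd) \<Rightarrow> real"
  assumes p: "1 < p" and e: "\<And>n. 0 < e n" "e \<longlonglongrightarrow> 0" and \<gamma>: "0 \<le> \<gamma>" "\<gamma> < 1"
    and V: "Lp_weak_conv p PX V U" and bnd: "\<And>n. Lp_int p PX (V n) \<le> C"
    and F: "\<And>i. Lp_weak_conv p PX (\<lambda>n z. e n powr \<gamma> * shift_quot (e n) i (V n) z) (F i)"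
  shows "AE z in PX. tdiff i U z = 0"
    and "(\<lambda>z. \<chi> i. mollify_x (bumps m) (F i) z - (if \<gamma> = 0 then 1 else 0) * mollify_x (\<lambda>y. - bumps' m i y) U z)
      \<in> tensor_Lp p P (Lp_pot p P T) (Lp p lborel)" (is "?R \<in> _")
proof -
  have p0: "0 < p" using p by simp
  note VL = Lp_weak_conv_Lp(1)[OF V] and UL = Lp_weak_conv_Lp(2)[OF V]
  show inv: "AE z in PX. tdiff i U z = 0" for i
  proof -
    \<comment> \<open>A further positive power of \<open>e n\<close> raises the exponent to 1 and
      makes the weak limit zero, so the critical case identifies \<open>tdiff i U\<close> with
      0.\<close>
    have "(\<lambda>n. e n powr (1 - \<gamma>)) \<longlonglongrightarrow> 0" using e \<gamma> by (intro powr_null) (auto intro: less_imp_le)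
    from Lp_weak_conv_scale[OF F[of i] this]
    have "Lp_weak_conv p PX (\<lambda>n z. e n powr (1 - \<gamma>) * (e n powr \<gamma> * shift_quot (e n) i (V n) z)) (\<lambda>z. 0)" by simp
    moreover have "e n powr (1 - \<gamma>) * (e n powr \<gamma> * t) = e n * t" for n t
      using e(1)[of n] by (simp add: mult.assoc[symmetric] powr_add[symmetric])
    ultimately have "Lp_weak_conv p PX (\<lambda>n z. e n * shift_quot (e n) i (V n) z) (\<lambda>z. 0)" by simp
    from shift_quot_limit_critical[OF p e V bnd this] show ?thesis by eventually_elim simp
  qed
  define c where "c n = e n powr \<gamma>" for n
  \<comment> \<open>The limit of \<open>e n powr \<gamma>\<close>: the spatial part survives for
    \<open>\<gamma> = 0\<close> only.\<close>
  define a :: real where "a = (if \<gamma> = 0 then 1 else 0)"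
  have c: "c \<longlonglongrightarrow> a"
  proof (cases "\<gamma> = 0")
    case True
    then have "c = (\<lambda>n. 1)" using e(1) by (auto simp: c_def fun_eq_iff less_imp_neq[THEN not_sym])
    then show ?thesis using True by (simp add: a_def)
  next
    case False
    then show ?thesis unfolding c_def a_def using e \<gamma> powr_null[of e sequentially \<gamma>] by (auto intro: less_imp_le)
  qed
  \<comment> \<open>The possibly diverging factor \<open>c n / e n\<close> is put inside the field,
    so each \<open>H n\<close> is an exact horizontal derivative of an L^p field and hence
    potential.\<close>
  define H where "H n = hdiff_field T (\<lambda>z. (c n / e n) * mollify_x (bumps m) (V n) z)" for n
  have H: "H n \<in> tensor_Lp p P (Lp_pot p P T) (Lp p lborel)" for n
    unfolding H_def by (intro hdiff_field_pot[OF p] Lp_mult mollify_x_Lp(1)[OF p kernel_bumps(1) VL])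
  have H_comp: "H n z $ i = (c n / e n) * tdiff i (mollify_x (bumps m) (V n)) z" for n z i
    by (simp add: H_def hdiff_field_eq tdiff_def right_diff_distrib)
  have lim: "Lp_weak_conv p PX (\<lambda>n z. H n z $ i) (\<lambda>z. ?R z $ i)" for i
  proof -
    have kb: "kernel (\<lambda>y. - bumps' m i y)" by (rule kernel_bumps)
    have UT: "(\<lambda>z. U (Tx (axis i 1) z)) \<in> Lp p PX" by (rule Lp_Tx(1)[OF UL])
    \<comment> \<open>The invariance of U proved above removes the shift that the splitting leaves
      on U in the spatial part.\<close>
    have "AE z in PX. mollify_x (\<lambda>y. - bumps' m i y) (\<lambda>z. U (Tx (axis i 1) z)) z = mollify_x (\<lambda>y. - bumps' m i y) U z"
      by (rule mollify_x_cong_AE[OF p kb UT UL]) (use inv[of i] in \<open>auto simp: tdiff_def elim!: eventually_mono\<close>)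
    then have ae: "AE z in PX. mollify_x (bumps m) (F i) z - a * mollify_x (\<lambda>y. - bumps' m i y) (\<lambda>z. U (Tx (axis i 1) z)) z = ?R z $ i"
      by eventually_elim (simp add: a_def)
    have meas: "(\<lambda>z. ?R z $ i) \<in> borel_measurable PX"
      using Lp_measurable[OF Lp_diff(1)[OF mollify_x_Lp(1)[OF p kernel_bumps(1)[of m] Lp_weak_conv_Lp(2)[OF F[of i]]]
        Lp_mult(1)[OF mollify_x_Lp(1)[OF p kb UL], of a] p0]] by (simp add: a_def)
    have w: "Lp_weak_conv p PX (\<lambda>n z. (c n / e n) * tdiff i (mollify_x (bumps m) (V n)) z)
      (\<lambda>z. mollify_x (bumps m) (F i) z - a * mollify_x (\<lambda>y. - bumps' m i y) (\<lambda>z. U (Tx (axis i 1) z)) z)"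
      by (rule shift_quot_weak_mollified[OF p kernel_deriv_bumps e V bnd c]) (use F[of i] in \<open>simp add: c_def\<close>)
    show ?thesis unfolding H_comp
      by (rule Lp_weak_conv_cong_AE[OF p0 w _ _ meas ae]) (use Lp_measurable[OF Lp_weak_conv_Lp(1)[OF w]] in auto)
  qed
  have R: "?R \<in> Lp p PX"
  proof -
    have "(\<lambda>z. ?R z $ i) \<in> Lp p PX" for i by (rule Lp_weak_conv_Lp(2)[OF lim])
    from Lp_vec[where f = "\<lambda>i z. ?R z $ i", OF this p0] show ?thesis by (simp only: vec_lambda_eta)
  qed
  show "?R \<in> tensor_Lp p P (Lp_pot p P T) (Lp p lborel)"
    unfolding tensor_Lp_def
    by (rule Lp_closure_weakly_closed[OF p lin_sub_tensor_span H[unfolded tensor_Lp_def] R lim])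
qed

lemma mollify_vec_tendsto:
  fixes F :: "'d \<Rightarrow> 'w \<times> (real ^ 'd) \<Rightarrow> real"
  assumes p: "1 < p" and F: "\<And>i. F i \<in> Lp p PX"
  shows "(\<lambda>m. Lp_int p PX (\<lambda>z. (\<chi> i. mollify_x (bumps m) (F i) z) - (\<chi> i. F i z))) \<longlonglongrightarrow> 0"
proof -
  have eq: "(\<chi> i. mollify_x (bumps m) (F i) z) - (\<chi> i. F i z) = (\<chi> i. mollify_x (bumps m) (F i) z - F i z)" for m z
    by (simp add: vec_eq_iff)
  show ?thesis unfolding eq using p
    by (intro Lp_vec_tendsto mollify_bumps_tendsto[OF p F] Lp_diff mollify_x_Lp(1)[OF p kernel_bumps(1) F] F) auto
qed

lemma subcritical_pot:
  fixes V :: "nat \<Rightarrow> 'w \<times> (real ^ 'd) \<Rightarrow> real"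
  assumes p: "1 < p" and e: "\<And>n. 0 < e n" "e \<longlonglongrightarrow> 0" and \<gamma>: "0 < \<gamma>" "\<gamma> < 1"
    and V: "Lp_weak_conv p PX V U" and bnd: "\<And>n. Lp_int p PX (V n) \<le> C"
    and F: "\<And>i. Lp_weak_conv p PX (\<lambda>n z. e n powr \<gamma> * shift_quot (e n) i (V n) z) (F i)"
  shows "(\<lambda>z. \<chi> i. F i z) \<in> tensor_Lp p P (Lp_pot p P T) (Lp p lborel)"
proof -
  have p0: "0 < p" using p by simp
  have 1: "(\<lambda>z. \<chi> i. mollify_x (bumps m) (F i) z) \<in> tensor_Lp p P (Lp_pot p P T) (Lp p lborel)" for m
    using shift_quot_limit_subcritical(2)[OF p e less_imp_le[OF \<gamma>(1)] \<gamma>(2) V bnd F, of m] \<gamma>(1) by simp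
  show ?thesis
    unfolding tensor_Lp_def
    by (rule Lp_closure_closed[OF p0 Lp_vec[OF Lp_weak_conv_Lp(2)[OF F] p0] 1[unfolded tensor_Lp_def]
      mollify_vec_tendsto[OF p Lp_weak_conv_Lp(2)[OF F]]])
qed

lemma gradient_limit:
  fixes V :: "nat \<Rightarrow> 'w \<times> (real ^ 'd) \<Rightarrow> real"
  assumes p: "1 < p" and e: "\<And>n. 0 < e n" "e \<longlonglongrightarrow> 0"
    and V: "Lp_weak_conv p PX V U" and bnd: "\<And>n. Lp_int p PX (V n) \<le> C"
    and F: "\<And>i. Lp_weak_conv p PX (\<lambda>n z. shift_quot (e n) i (V n) z) (F i)"
  obtains G where "weak_gradient_x p P U G" "U \<in> tensor_W1p p P (Lp_inv p P T) (W1p p)"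
    "(\<lambda>z. (\<chi> i. F i z) - G z) \<in> tensor_Lp p P (Lp_pot p P T) (Lp p lborel)"
proof -
  have p0: "0 < p" using p by simp
  let ?Z = "tensor_Lp p P (Lp_pot p P T) (Lp p lborel) :: ('w \<times> (real ^ 'd) \<Rightarrow> real ^ 'd) set"
  have Zlin: "lin_sub ?Z" unfolding tensor_Lp_def by (rule lin_sub_Lp_closure[OF p0 lin_sub_tensor_span])
  note UL = Lp_weak_conv_Lp(2)[OF V] and FL = Lp_weak_conv_Lp(2)[OF F]
  \<comment> \<open>Positivity of \<open>e n\<close> matters here: \<open>e n powr 0\<close> is 1,
    whereas \<open>0 powr 0\<close> is 0.\<close>
  have F': "Lp_weak_conv p PX (\<lambda>n z. e n powr 0 * shift_quot (e n) i (V n) z) (F i)" for i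
    using F[of i] e(1) by (simp add: less_imp_neq[symmetric])
  have z01: "(0::real) \<le> 0" "(0::real) < 1" by auto
  note sub = shift_quot_limit_subcritical[OF p e z01 V bnd F']
  define Fm where "Fm m z = (\<chi> i. mollify_x (bumps m) (F i) z)" for m z
  let ?y = "\<lambda>m. mollified_gradient m U"
  have Fm: "Fm m \<in> Lp p PX" for m unfolding Fm_def by (intro Lp_vec mollify_x_Lp(1)[OF p kernel_bumps(1) FL] p0)
  have y: "?y m \<in> Lp p PX" for m by (rule mollified_gradient_Lp[OF p UL])
  have Z: "(\<lambda>z. Fm m z - ?y m z) \<in> ?Z" for m
  proof -
    have "(\<chi> i. mollify_x (bumps m) (F i) z - 1 * mollify_x (\<lambda>y. - bumps' m i y) U z) = Fm m z - ?y m z" for z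
      by (simp add: Fm_def mollified_gradient_def vec_eq_iff)
    then show ?thesis using sub(2)[of m] by simp
  qed
  have F_lim: "(\<lambda>m. Lp_int p PX (\<lambda>z. Fm m z - (\<chi> i. F i z))) \<longlonglongrightarrow> 0"
    unfolding Fm_def by (rule mollify_vec_tendsto[OF p FL])
  have FvL: "(\<lambda>z. \<chi> i. F i z) \<in> Lp p PX" by (rule Lp_vec[OF FL p0])
  have y_inv: "AE z in PX. ?y m (Tx (axis j 1) z) = ?y m z" for m j
  proof -
    have "AE z in PX. mollify_x (\<lambda>y. - bumps' m i y) U (Tx (axis j 1) z) = mollify_x (\<lambda>y. - bumps' m i y) U z" for i
    proof -
      have "AE z in PX. mollify_x (\<lambda>y. - bumps' m i y) (\<lambda>z. U (Tx (axis j 1) z)) z = mollify_x (\<lambda>y. - bumps' m i y) U z"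
        by (rule mollify_x_cong_AE[OF p kernel_bumps(3) Lp_Tx(1)[OF UL] UL])
           (use sub(1)[of j] in \<open>auto simp: tdiff_def elim!: eventually_mono\<close>)
      then show ?thesis by (simp only: mollify_x_Tx)
    qed
    then have "AE z in PX. \<forall>i\<in>UNIV. mollify_x (\<lambda>y. - bumps' m i y) U (Tx (axis j 1) z) = mollify_x (\<lambda>y. - bumps' m i y) U z"
      by (intro AE_finite_allI) auto
    then show ?thesis by eventually_elim (simp add: mollified_gradient_def)
  qed
  \<comment> \<open>\<open>Fm m - Fm n\<close> is the invariant field \<open>?y m - ?y n\<close>
    plus a potential one. The comparison of such sums hands the Cauchy property of the mollified
    limits over to the gradients.\<close>
  have mono: "Lp_int p PX (\<lambda>z. ?y m z - ?y n z) \<le> Lp_int p PX (\<lambda>z. Fm m z - Fm n z)" for m n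
  proof -
    have "AE z in PX. ?y m (Tx (axis j 1) z) - ?y n (Tx (axis j 1) z) = ?y m z - ?y n z" for j
      using y_inv[of m j] y_inv[of n j] by eventually_elim simp
    moreover have "(\<lambda>z. (Fm m z - ?y m z) - (Fm n z - ?y n z)) \<in> ?Z" by (rule lin_subD(2)[OF Zlin Z Z])
    ultimately have "Lp_int p PX (\<lambda>z. ?y m z - ?y n z)
        \<le> Lp_int p PX (\<lambda>x. (?y m x - ?y n x) + ((Fm m x - ?y m x) - (Fm n x - ?y n x)))"
      by (intro invariant_pot_le[OF p Lp_diff(1)[OF y y p0]])
    then show ?thesis by (simp add: algebra_simps)
  qed
  have "\<exists>N. \<forall>m\<ge>N. \<forall>n\<ge>N. Lp_int p PX (\<lambda>z. ?y m z - ?y n z) < d" if d: "0 < d" for d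
  proof -
    define d' where "d' = d / 2 powr p / 2"
    have "0 < d'" using d by (simp add: d'_def)
    then have "\<forall>\<^sub>F m in sequentially. Lp_int p PX (\<lambda>z. Fm m z - (\<chi> i. F i z)) < d'" by (rule order_tendstoD(2)[OF F_lim])
    then obtain N where N: "\<And>m. m \<ge> N \<Longrightarrow> Lp_int p PX (\<lambda>z. Fm m z - (\<chi> i. F i z)) < d'" unfolding eventually_sequentially by blast
    have "Lp_int p PX (\<lambda>z. ?y m z - ?y n z) < d" if "m \<ge> N" "n \<ge> N" for m n
    proof -
      have "Lp_int p PX (\<lambda>z. Fm m z - Fm n z)
          \<le> 2 powr p * (Lp_int p PX (\<lambda>z. Fm m z - (\<chi> i. F i z)) + Lp_int p PX (\<lambda>z. (\<chi> i. F i z) - Fm n z))"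
        by (rule Lp_int_diff_trans_le[OF Fm FvL Fm p0])
      also have "\<dots> < 2 powr p * (d' + d')"
        using N[OF that(1)] N[OF that(2)] Lp_int_diff_commute[of p PX "\<lambda>z. \<chi> i. F i z" "Fm n"]
        by (intro mult_strict_left_mono add_strict_mono) auto
      also have "\<dots> = d" by (simp add: d'_def)
      finally show ?thesis using mono[of m n] by simp
    qed
    then show ?thesis by blast
  qed
  then obtain G where G: "G \<in> Lp p PX" "(\<lambda>m. Lp_int p PX (\<lambda>z. ?y m z - G z)) \<longlonglongrightarrow> 0"
    by (rule Lp_complete[OF p0 y]) (assumption, rule that, assumption+)
  have "U \<in> tensor_Lp p P (Lp_inv p P T) (Lp p lborel)" by (rule invariant_in_tensor_Lp[OF p UL sub(1)])
  note W = invariant_in_tensor_W1p[OF p this G]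
  have "(\<lambda>z. (\<chi> i. F i z) - G z) \<in> ?Z"
    unfolding tensor_Lp_def
  proof (rule Lp_closure_closed[OF p0 Lp_diff(1)[OF FvL G(1) p0] Z[unfolded tensor_Lp_def]])
    have "(\<lambda>m. Lp_int p PX (\<lambda>z. (- 1) *\<^sub>R ?y m z - (- 1) *\<^sub>R G z)) \<longlonglongrightarrow> 0"
      by (rule Lp_tendsto_scaleR[OF y G(1) p0 G(2)])
    from Lp_tendsto_add[OF p0 Fm Lp_scaleR(1)[OF y] FvL Lp_scaleR(1)[OF G(1)] F_lim this]
    show "(\<lambda>m. Lp_int p PX (\<lambda>z. Fm m z - ?y m z - ((\<chi> i. F i z) - G z))) \<longlonglongrightarrow> 0" by simp
  qed
  with W show thesis by (intro that)
qed

text \<open>Convergence is even strong: \<open>e n * shift_quot\<close> is the difference of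
  \<open>V n\<close> and an isometric image of it, hence bounded in L^p, and the remaining factor
  \<open>e n powr (\<gamma> - 1)\<close> tends to 0.\<close>

lemma shift_quot_limit_supercritical:
  fixes V :: "nat \<Rightarrow> 'w \<times> (real ^ 'd) \<Rightarrow> real"
  assumes p: "1 < p" and e: "\<And>n. 0 < e n" "e \<longlonglongrightarrow> 0" and \<gamma>: "1 < \<gamma>"
    and V: "\<And>n. V n \<in> Lp p PX" and bnd: "\<And>n. Lp_int p PX (V n) \<le> C"
  shows "Lp_weak_conv p PX (\<lambda>n z. e n powr \<gamma> * shift_quot (e n) i (V n) z) (\<lambda>z. 0)"
proof -
  have p0: "0 < p" using p by simp
  have "(\<lambda>n. (e n powr (\<gamma> - 1)) powr p * (2 powr p * (2 * C))) \<longlonglongrightarrow> 0 * (2 powr p * (2 * C))"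
    using e \<gamma> p0 by (intro tendsto_mult tendsto_const powr_null) (auto intro: less_imp_le)
  then have lim0: "(\<lambda>n. (e n powr (\<gamma> - 1)) powr p * (2 powr p * (2 * C))) \<longlonglongrightarrow> 0" by simp
  have L: "(\<lambda>z. e n powr \<gamma> * shift_quot (e n) i (V n) z) \<in> Lp p PX" for n by (intro Lp_mult shift_quot_Lp V p0)
  have le: "Lp_int p PX (\<lambda>z. e n powr \<gamma> * shift_quot (e n) i (V n) z) \<le> (e n powr (\<gamma> - 1)) powr p * (2 powr p * (2 * C))" for n
  proof -
    let ?s = "\<lambda>z. V n (fst z, snd z + e n *\<^sub>R axis i 1)"
    have s: "?s \<in> Lp p PX" "Lp_int p PX ?s = Lp_int p PX (V n)" using shift_x_Lp[OF V] by auto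
    have "e n powr \<gamma> = e n powr (\<gamma> - 1) * e n"
      using e(1)[of n] powr_mult_base[of "e n" "\<gamma> - 1"] by (simp add: mult.commute)
    then have "e n powr \<gamma> * shift_quot (e n) i (V n) z = e n powr (\<gamma> - 1) * (?s (Tx (axis i 1) z) - V n z)" for z
      using e(1)[of n] by (simp add: shift_quot_def Tx_def)
    then have "Lp_int p PX (\<lambda>z. e n powr \<gamma> * shift_quot (e n) i (V n) z)
        = (e n powr (\<gamma> - 1)) powr p * Lp_int p PX (\<lambda>z. ?s (Tx (axis i 1) z) - V n z)"
      using Lp_mult(2)[OF Lp_diff(1)[OF Lp_Tx(1)[OF s(1), of "axis i 1"] V[of n] p0], of "e n powr (\<gamma> - 1)"] by simp
    also have "\<dots> \<le> (e n powr (\<gamma> - 1)) powr p * (2 powr p * (Lp_int p PX ?s + Lp_int p PX (V n)))"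
      using Lp_diff(2)[OF Lp_Tx(1)[OF s(1), of "axis i 1"] V[of n] p0] Lp_Tx(2)[OF s(1), of "axis i 1"]
      by (intro mult_left_mono) auto
    also have "\<dots> \<le> (e n powr (\<gamma> - 1)) powr p * (2 powr p * (2 * C))"
      using bnd[of n] s(2) by (intro mult_left_mono) auto
    finally show ?thesis .
  qed
  have "(\<lambda>n. Lp_int p PX (\<lambda>z. e n powr \<gamma> * shift_quot (e n) i (V n) z - 0)) \<longlonglongrightarrow> 0"
  proof (rule tendsto_sandwich[OF _ _ tendsto_const lim0])
    show "\<forall>\<^sub>F n in sequentially. Lp_int p PX (\<lambda>z. e n powr \<gamma> * shift_quot (e n) i (V n) z - 0)
        \<le> (e n powr (\<gamma> - 1)) powr p * (2 powr p * (2 * C))" using le by simp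
  qed simp
  then show ?thesis by (intro Lp_strong_imp_weak p0 L) auto
qed

section \<open>From unfolded limits to two-scale convergence\<close>

lemma two_scale_weak_vecI:
  fixes u :: "nat \<Rightarrow> 'w \<times> (real ^ 'd) \<Rightarrow> real"
  assumes p: "1 < p" and e: "\<And>n. 0 < e n"
    and F: "\<And>i. Lp_weak_conv p PX (\<lambda>n z. k n * shift_quot (e n) i (unfolding_op T (e n) (u n)) z) (\<lambda>z. F z $ i)"
  shows "two_scale_weak_vec p P T e (\<lambda>n z. k n *\<^sub>R discrete_gradient (e n) (u n) z) F"
  unfolding two_scale_weak_vec_def two_scale_weak_def
proof
  fix i
  have p0: "0 < p" using p by simp
  have eq: "unfolding_op T (e n) (\<lambda>z. (k n *\<^sub>R discrete_gradient (e n) (u n) z) $ i) z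
      = k n * shift_quot (e n) i (unfolding_op T (e n) (u n)) z" if "z \<in> space PX" for n z
    using unfolding_op_gradient[OF e that] by (simp add: unfolding_op_scale)
  show "Lp_weak_conv p PX (\<lambda>n. unfolding_op T (e n) (\<lambda>z. (k n *\<^sub>R discrete_gradient (e n) (u n) z) $ i)) (\<lambda>z. F z $ i)"
  proof (rule Lp_weak_conv_cong_AE[OF p0 F[of i]])
    fix n
    show "unfolding_op T (e n) (\<lambda>z. (k n *\<^sub>R discrete_gradient (e n) (u n) z) $ i) \<in> borel_measurable PX"
      using Lp_measurable[OF Lp_weak_conv_Lp(1)[OF F[of i], of n]] by (subst measurable_cong[OF eq])
    show "AE z in PX. k n * shift_quot (e n) i (unfolding_op T (e n) (u n)) z
        = unfolding_op T (e n) (\<lambda>z. (k n *\<^sub>R discrete_gradient (e n) (u n) z) $ i) z"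
      by (rule AE_I2) (simp only: eq)
    show "(\<lambda>z. F z $ i) \<in> borel_measurable PX" by (rule Lp_measurable[OF Lp_weak_conv_Lp(2)[OF F]])
  qed simp
qed

text \<open>The limsup bounds a tail of the sequence only; the finitely many earlier values are
  added to the bound of the tail. One constant serves all directions and all indices, as weak
  compactness asks for.\<close>

lemma uniform_bound:
  fixes u :: "nat \<Rightarrow> 'w \<times> (real ^ 'd) \<Rightarrow> real"
  assumes p: "1 < p" and e: "\<And>n. 0 < \<epsilon> n" and u: "\<And>n. u n \<in> Lp p (P \<Otimes>\<^sub>M lattice_measure (\<epsilon> n))"
    and lim: "limsup (\<lambda>n. \<integral>\<^sup>+ \<omega>. \<integral>\<^sup>+ x. ennreal (\<bar>u n (\<omega>, x)\<bar> powr p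
              + \<epsilon> n powr (\<gamma> * p) * norm (discrete_gradient (\<epsilon> n) (u n) (\<omega>, x)) powr p)
          \<partial>lattice_measure (\<epsilon> n) \<partial>P) < \<infinity>"
  obtains C where "\<And>n. Lp_int p PX (unfolding_op T (\<epsilon> n) (u n)) \<le> C"
    "\<And>i n. Lp_int p PX (\<lambda>z. \<epsilon> n powr \<gamma> * shift_quot (\<epsilon> n) i (unfolding_op T (\<epsilon> n) (u n)) z) \<le> C"
proof -
  define A where "A n = (\<integral>\<^sup>+ \<omega>. \<integral>\<^sup>+ x. ennreal (\<bar>u n (\<omega>, x)\<bar> powr p
              + \<epsilon> n powr (\<gamma> * p) * norm (discrete_gradient (\<epsilon> n) (u n) (\<omega>, x)) powr p)
          \<partial>lattice_measure (\<epsilon> n) \<partial>P)" for n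
  obtain c where c: "limsup A < c" "c < \<infinity>" using dense[OF lim] unfolding A_def by blast
  then obtain C0 where C0: "0 \<le> C0" "c = ennreal C0" by (cases c) auto
  have "\<forall>\<^sub>F n in sequentially. A n < c" by (rule Limsup_lessD[OF c(1)])
  then obtain N where N: "\<And>n. n \<ge> N \<Longrightarrow> A n < c" unfolding eventually_sequentially by blast
  define a where "a n = Lp_int p PX (unfolding_op T (\<epsilon> n) (u n))" for n
  define b where "b i n = Lp_int p PX (\<lambda>z. \<epsilon> n powr \<gamma> * shift_quot (\<epsilon> n) i (unfolding_op T (\<epsilon> n) (u n)) z)" for i n
  have nonneg: "0 \<le> a n" "0 \<le> b i n" for i n by (auto simp: a_def b_def)
  have large: "a n \<le> C0" "b i n \<le> C0" if "n \<ge> N" for i n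
  proof -
    have "A n \<le> ennreal C0" using N[OF that] C0(2) by (simp add: less_imp_le)
    from unfolding_bounds[OF p e u C0(1) this[unfolded A_def]] show "a n \<le> C0" "b i n \<le> C0"
      by (auto simp: a_def b_def)
  qed
  define C where "C = C0 + (\<Sum>n<N. a n + (\<Sum>i\<in>UNIV. b i n))"
  have small: "a n + (\<Sum>i\<in>UNIV. b i n) \<le> (\<Sum>n<N. a n + (\<Sum>i\<in>UNIV. b i n))" if "n < N" for n
    using that nonneg by (intro member_le_sum) (auto intro!: add_nonneg_nonneg sum_nonneg)
  have sums: "0 \<le> (\<Sum>n<N. a n + (\<Sum>i\<in>UNIV. b i n))" "0 \<le> (\<Sum>i\<in>UNIV. b i n)" "b i n \<le> (\<Sum>i\<in>UNIV. b i n)" for i n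
    using nonneg by (auto intro!: add_nonneg_nonneg sum_nonneg member_le_sum)
  have "a n \<le> C \<and> b i n \<le> C" for i n
  proof (cases "n < N")
    case True
    then show ?thesis using small[OF True] sums(2)[of n] sums(3)[of i n] nonneg(1)[of n] C0(1) unfolding C_def by linarith
  next
    case False
    then show ?thesis using large(1)[of n] large(2)[of n i] sums(1) unfolding C_def by (simp add: add_increasing2)
  qed
  then show thesis by (intro that[of C]) (auto simp: a_def b_def)
qed

end

theorem proposition3p1:
  fixes P :: "'w measure"
    and T :: "int ^ 'd \<Rightarrow> 'w \<Rightarrow> 'w"
    and p \<gamma> :: real
    and \<epsilon> :: "nat \<Rightarrow> real"
    and u :: "nat \<Rightarrow> 'w \<times> (real ^ 'd) \<Rightarrow> real"
  assumes "dynamical_system P T"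
    and "1 < p"
    and "0 \<le> \<gamma>"
    and "\<And>n. 0 < \<epsilon> n"
    and "\<epsilon> \<longlonglongrightarrow> 0"
    and "\<And>n. u n \<in> Lp p (P \<Otimes>\<^sub>M lattice_measure (\<epsilon> n))"
    and "limsup (\<lambda>n. \<integral>\<^sup>+ \<omega>. \<integral>\<^sup>+ x.
            ennreal (\<bar>u n (\<omega>, x)\<bar> powr p
              + \<epsilon> n powr (\<gamma> * p) * norm (discrete_gradient (\<epsilon> n) (u n) (\<omega>, x)) powr p)
          \<partial>lattice_measure (\<epsilon> n) \<partial>P) < \<infinity>"
  shows "(\<gamma> = 0 \<longrightarrow>
           (\<exists>U\<in>tensor_W1p p P (Lp_inv p P T) (W1p p).
            \<exists>chi\<in>tensor_Lp p P (Lp_pot p P T) (Lp p lborel).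
            \<exists>G r. weak_gradient_x p P U G \<and> strict_mono r \<and>
              two_scale_weak p P T (\<epsilon> \<circ> r) (u \<circ> r) U \<and>
              two_scale_weak_vec p P T (\<epsilon> \<circ> r)
                (\<lambda>n. discrete_gradient (\<epsilon> (r n)) (u (r n))) (\<lambda>z. G z + chi z)))
       \<and> (0 < \<gamma> \<and> \<gamma> < 1 \<longrightarrow>
           (\<exists>U\<in>tensor_Lp p P (Lp_inv p P T) (Lp p lborel).
            \<exists>chi\<in>tensor_Lp p P (Lp_pot p P T) (Lp p lborel).
            \<exists>r. strict_mono r \<and>
              two_scale_weak p P T (\<epsilon> \<circ> r) (u \<circ> r) U \<and>
              two_scale_weak_vec p P T (\<epsilon> \<circ> r)
                (\<lambda>n z. \<epsilon> (r n) powr \<gamma> *\<^sub>R discrete_gradient (\<epsilon> (r n)) (u (r n)) z) chi))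
       \<and> (\<gamma> = 1 \<longrightarrow>
           (\<exists>U\<in>Lp p (P \<Otimes>\<^sub>M lborel). \<exists>r. strict_mono r \<and>
              two_scale_weak p P T (\<epsilon> \<circ> r) (u \<circ> r) U \<and>
              two_scale_weak_vec p P T (\<epsilon> \<circ> r)
                (\<lambda>n z. \<epsilon> (r n) *\<^sub>R discrete_gradient (\<epsilon> (r n)) (u (r n)) z) (hdiff_field T U)))
       \<and> (1 < \<gamma> \<longrightarrow>
           (\<exists>U\<in>Lp p (P \<Otimes>\<^sub>M lborel). \<exists>r. strict_mono r \<and>
              two_scale_weak p P T (\<epsilon> \<circ> r) (u \<circ> r) U \<and>
              two_scale_weak_vec p P T (\<epsilon> \<circ> r)
                (\<lambda>n z. \<epsilon> (r n) powr \<gamma> *\<^sub>R discrete_gradient (\<epsilon> (r n)) (u (r n)) z) (\<lambda>z. 0)))"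
proof -
  interpret dynamical_system P T by fact
  note p = assms(2) and e = assms(4) and e0 = assms(5) and u = assms(6)
  have p0: "0 < p" using p by simp
  define V where "V n = unfolding_op T (\<epsilon> n) (u n)" for n
  have VL: "V n \<in> Lp p PX" for n unfolding V_def by (rule unfolding_op_Lp[OF e u])
  obtain C where C: "\<And>n. Lp_int p PX (V n) \<le> C"
    "\<And>i n. Lp_int p PX (\<lambda>z. \<epsilon> n powr \<gamma> * shift_quot (\<epsilon> n) i (V n) z) \<le> C"
    by (rule uniform_bound[OF p e u assms(7), folded V_def]) (rule that; assumption)
  \<comment> \<open>Two successive extractions: first for the unfolded functions, then for all
    components of the scaled gradients at once. The limits U and F are common to the four cases,
    which differ in how F is identified.\<close>
  obtain r0 U where r0: "strict_mono (r0 :: nat \<Rightarrow> nat)" "Lp_weak_conv p PX (\<lambda>n. V (r0 n)) U"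
    by (rule Lp_weak_compact[OF p VL C(1)]) (rule that; assumption)
  define D where "D i n = (\<lambda>z. \<epsilon> (r0 n) powr \<gamma> * shift_quot (\<epsilon> (r0 n)) i (V (r0 n)) z)" for i n
  have "D i n \<in> Lp p PX" "Lp_int p PX (D i n) \<le> C" for i n
    unfolding D_def by (intro Lp_mult shift_quot_Lp VL p0, rule C(2))
  then obtain r1 F where r1: "strict_mono (r1 :: nat \<Rightarrow> nat)" "\<And>i. Lp_weak_conv p PX (\<lambda>n. D i (r1 n)) (F i)"
    using Lp_weak_compact_finite[OF p finite[of UNIV], of D C] by blast
  define r where "r n = r0 (r1 n)" for n
  have r: "strict_mono r" using strict_mono_o[OF r0(1) r1(1)] by (simp add: r_def[abs_def] o_def)
  define e' where "e' n = \<epsilon> (r n)" for n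
  define W where "W n = V (r n)" for n
  have e': "0 < e' n" "e' \<longlonglongrightarrow> 0" for n
    using e LIMSEQ_subseq_LIMSEQ[OF e0 r] by (simp_all add: e'_def[abs_def] o_def)
  have W: "Lp_weak_conv p PX W U"
    using Lp_weak_conv_subseq[OF r0(2) r1(1)] by (simp add: W_def[abs_def] r_def)
  have WC: "Lp_int p PX (W n) \<le> C" for n unfolding W_def by (rule C(1))
  have F: "Lp_weak_conv p PX (\<lambda>n z. e' n powr \<gamma> * shift_quot (e' n) i (W n) z) (F i)" for i
    using r1(2)[of i] by (simp add: D_def e'_def W_def r_def)
  note UL = Lp_weak_conv_Lp(2)[OF W]
  have scalar: "two_scale_weak p P T (\<epsilon> \<circ> r) (u \<circ> r) U"
    using W by (simp add: two_scale_weak_def W_def[abs_def] V_def)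
  \<comment> \<open>The factor k will be 1, \<open>\<epsilon> powr \<gamma>\<close> or \<epsilon>,
    according to the case.\<close>
  have vector: "two_scale_weak_vec p P T (\<epsilon> \<circ> r) (\<lambda>n z. k n *\<^sub>R discrete_gradient (\<epsilon> (r n)) (u (r n)) z) H"
    if "\<And>i. Lp_weak_conv p PX (\<lambda>n z. k n * shift_quot (e' n) i (W n) z) (\<lambda>z. H z $ i)" for k H
    using two_scale_weak_vecI[OF p, where e = "\<epsilon> \<circ> r" and k = k and u = "u \<circ> r" and F = H] that e
    by (simp add: e'_def W_def V_def)
  have "\<exists>U\<in>tensor_W1p p P (Lp_inv p P T) (W1p p).
            \<exists>chi\<in>tensor_Lp p P (Lp_pot p P T) (Lp p lborel).
            \<exists>G r. weak_gradient_x p P U G \<and> strict_mono r \<and>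
              two_scale_weak p P T (\<epsilon> \<circ> r) (u \<circ> r) U \<and>
              two_scale_weak_vec p P T (\<epsilon> \<circ> r)
                (\<lambda>n. discrete_gradient (\<epsilon> (r n)) (u (r n))) (\<lambda>z. G z + chi z)" if "\<gamma> = 0"
  proof -
    have F1: "Lp_weak_conv p PX (\<lambda>n z. shift_quot (e' n) i (W n) z) (F i)" for i
      using F[of i] e'(1) that by (simp add: less_imp_neq[symmetric])
    obtain G where G: "weak_gradient_x p P U G" "U \<in> tensor_W1p p P (Lp_inv p P T) (W1p p)"
      "(\<lambda>z. (\<chi> i. F i z) - G z) \<in> tensor_Lp p P (Lp_pot p P T) (Lp p lborel)"
      using gradient_limit[OF p e' W WC F1] by blast
    \<comment> \<open>The potential part is the difference of F and G, so that its sum with G is the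
      limit already found; the factor 1 only fits the gradient to the form of
      \<open>vector\<close>.\<close>
    have "two_scale_weak_vec p P T (\<epsilon> \<circ> r) (\<lambda>n z. 1 *\<^sub>R discrete_gradient (\<epsilon> (r n)) (u (r n)) z)
        (\<lambda>z. G z + ((\<chi> i. F i z) - G z))"
      by (rule vector) (use F1 in simp)
    then show ?thesis using G r scalar by (intro bexI[OF _ G(2)] bexI[OF _ G(3)] exI[of _ G] exI[of _ r]) simp
  qed
  moreover have "\<exists>U\<in>tensor_Lp p P (Lp_inv p P T) (Lp p lborel).
            \<exists>chi\<in>tensor_Lp p P (Lp_pot p P T) (Lp p lborel).
            \<exists>r. strict_mono r \<and>
              two_scale_weak p P T (\<epsilon> \<circ> r) (u \<circ> r) U \<and>
              two_scale_weak_vec p P T (\<epsilon> \<circ> r)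
                (\<lambda>n z. \<epsilon> (r n) powr \<gamma> *\<^sub>R discrete_gradient (\<epsilon> (r n)) (u (r n)) z) chi" if \<gamma>: "0 < \<gamma>" "\<gamma> < 1"
  proof -
    have 1: "U \<in> tensor_Lp p P (Lp_inv p P T) (Lp p lborel)"
      by (rule invariant_in_tensor_Lp[OF p UL shift_quot_limit_subcritical(1)[OF p e' less_imp_le[OF \<gamma>(1)] \<gamma>(2) W WC F]])
    have 2: "(\<lambda>z. \<chi> i. F i z) \<in> tensor_Lp p P (Lp_pot p P T) (Lp p lborel)"
      by (rule subcritical_pot[OF p e' \<gamma> W WC F])
    have 3: "two_scale_weak_vec p P T (\<epsilon> \<circ> r)
        (\<lambda>n z. \<epsilon> (r n) powr \<gamma> *\<^sub>R discrete_gradient (\<epsilon> (r n)) (u (r n)) z) (\<lambda>z. \<chi> i. F i z)"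
      by (rule vector) (use F in \<open>simp add: e'_def\<close>)
    show ?thesis by (intro bexI[OF _ 1] bexI[OF _ 2] exI[of _ r] conjI r scalar 3)
  qed
  moreover have "\<exists>U\<in>Lp p (P \<Otimes>\<^sub>M lborel). \<exists>r. strict_mono r \<and>
              two_scale_weak p P T (\<epsilon> \<circ> r) (u \<circ> r) U \<and>
              two_scale_weak_vec p P T (\<epsilon> \<circ> r)
                (\<lambda>n z. \<epsilon> (r n) *\<^sub>R discrete_gradient (\<epsilon> (r n)) (u (r n)) z) (hdiff_field T U)" if "\<gamma> = 1"
  proof -
    have F1: "Lp_weak_conv p PX (\<lambda>n z. e' n * shift_quot (e' n) i (W n) z) (F i)" for i
      using F[of i] e'(1) that by (simp add: less_imp_le)
    have "Lp_weak_conv p PX (\<lambda>n z. e' n * shift_quot (e' n) i (W n) z) (tdiff i U)" for i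
      by (rule Lp_weak_conv_cong_AE[OF p0 F1[of i] _ _ _ shift_quot_limit_critical[OF p e' W WC F1]])
         (use Lp_measurable[OF Lp_weak_conv_Lp(1)[OF F1[of i]]] Lp_measurable[OF tdiff_Lp(1)[OF UL p0]] in auto)
    then have 3: "two_scale_weak_vec p P T (\<epsilon> \<circ> r)
        (\<lambda>n z. \<epsilon> (r n) *\<^sub>R discrete_gradient (\<epsilon> (r n)) (u (r n)) z) (hdiff_field T U)"
      by (intro vector) (simp add: e'_def hdiff_field_eq)
    show ?thesis by (intro bexI[OF _ UL] exI[of _ r] conjI r scalar 3)
  qed
  moreover have "\<exists>U\<in>Lp p (P \<Otimes>\<^sub>M lborel). \<exists>r. strict_mono r \<and>
              two_scale_weak p P T (\<epsilon> \<circ> r) (u \<circ> r) U \<and>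
              two_scale_weak_vec p P T (\<epsilon> \<circ> r)
                (\<lambda>n z. \<epsilon> (r n) powr \<gamma> *\<^sub>R discrete_gradient (\<epsilon> (r n)) (u (r n)) z) (\<lambda>z. 0)" if \<gamma>: "1 < \<gamma>"
  proof -
    have 3: "two_scale_weak_vec p P T (\<epsilon> \<circ> r)
        (\<lambda>n z. \<epsilon> (r n) powr \<gamma> *\<^sub>R discrete_gradient (\<epsilon> (r n)) (u (r n)) z) (\<lambda>z. 0)"
      by (rule vector)
         (use shift_quot_limit_supercritical[OF p e' \<gamma> Lp_weak_conv_Lp(1)[OF W] WC] in \<open>simp add: e'_def\<close>)
    show ?thesis by (intro bexI[OF _ UL] exI[of _ r] conjI r scalar 3)
  qed
  ultimately show ?thesis by (intro conjI impI) blast+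
qed

end
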